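(* Suppose conditions (A1)--(A10), listed in full in the context, hold. Let $\mathcal M_{\mathrm{full}}$ be the full model (all $p$ coordinates) and $k_0=|\mathcal M_0|$. Then, under the same prior $\pi(\theta\mid\mathcal M)$ and $\pi(\mathcal M)$, w.p.a.1 as $n\to\infty$: (i) (Model selection convergence rate) If $\mathcal M_0\ne\mathcal M_{\mathrm{full}}$, then $$\frac{q(\mathcal M:\mathcal M\ne\mathcal M_0\mid\mathbf D)}{p(\mathcal M:\mathcal M\ne\mathcal M_0\mid\hat\theta)}\to1,\qquad q(\mathcal M:\mathcal M\ne\mathcal M_0\mid\mathbf D)\asymp p(\mathcal M:\mathcal M\ne\mathcal M_0\mid\hat\theta)\asymp n^{-\frac12}\to0.$$ If $\mathcal M_0=\mathcal M_{\mathrm{full}}$, then for some constant $C>0$, $$q(\mathcal M:\mathcal M\ne\mathcal M_0\mid\mathbf D)\le\exp(-Cn\underline\theta^2)\to0,$$ $$p(\mathcal M:\mathcal M\ne\mathcal M_0\mid\hat\theta)\le\exp(-Cn\underline\theta^2)\vee\tau_n n^{-\frac{p-k_0+1}{2}}\to0.$$ (ii) (Asymptotic posterior validity) $$\sup_{A\subseteq\Theta}\left|\int_A q(\theta\mid\mathbf D)\,d\theta-\int_A p(\theta\mid\hat\theta)\,d\theta\right|\to0,$$ the supremum being over measurable sets.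
   Context: Setting. All objects may depend on the sample size $n$; "constant" means a number not depending on $n$; limits are as $n\to\infty$. $\mathbf D=\{D_1,\dots,D_n\}$ is the sample with law $P_{\mathbf D}$, and $D$ is a generic observation with law $P_D$. $o_p$, $O_p$ and "w.p.a.1" (with probability approaching 1) refer to $P_{\mathbf D}$. The parameter is $\theta\in\Theta\subseteq\mathbb R^p$; $g(D,\theta)\in\mathbb R^m$ is the moment function; $\bar g(\mathbf D,\theta)=n^{-1}\sum_{i=1}^n g(D_i,\theta)$; $\mathbf V_n$ is an $m\times m$ matrix possibly depending on $\mathbf D$. $\epsilon_n=\sqrt{p/n}$; $B_0(\epsilon)=\{\theta\in\Theta:\|\theta-\theta_0\|<\epsilon\}$. $\|\cdot\|$ is the Euclidean norm (operator norm for matrices). $a_n\prec b_n$ means $a_n=o(b_n)$, $a_n\preceq b_n$ means $a_n=O(b_n)$, and $a_n\asymp b_n$ means same order; $a\wedge b=\min(a,b)$, $a\vee b=\max(a,b)$. Models. A model $\mathcal M$ is a subset of the $p$ coordinates, of size $|\mathcal M|$ ($2^p$ models in total); $\Theta(\mathcal M)$ is the set of $\theta\in\Theta$ whose coordinates outside $\mathcal M$ vanish. Given $\mathcal M$, write $\theta=(\theta_1^\top,\theta_2^\top)^\top$ with $\theta_1\in\mathbb R^{|\mathcal M|}$ the coordinates in $\mathcal M$ and $\theta_2$ those outside, so $\theta_2=0$ on $\Theta(\mathcal M)$. $\theta_{0,(j)}$ is the $j$th coordinate of $\theta_0$, $\mathcal M_0=\{j:\theta_{0,(j)}\ne0\}$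 is the true model, $k_0=|\mathcal M_0|$, and $\theta_{0,\mathcal M,1}$ is the subvector of $\theta_0$ with coordinates in $\mathcal M$. The prior consists of model probabilities $\pi(\mathcal M)$ and, for each $\mathcal M$, a density $\pi(\theta\mid\mathcal M)$ (also written $\pi(\theta_1\mid\mathcal M)$) on $\Theta(\mathcal M)$ with respect to $|\mathcal M|$-dimensional Lebesgue measure; integrals over subsets of $\Theta(\mathcal M)$ are with respect to $\theta_1$. Quasi-posterior. $q(\mathbf D\mid\theta)=\det(2\pi\mathbf V_n/n)^{-1/2}\exp\{-\tfrac n2\bar g(\mathbf D,\theta)^\top\mathbf V_n^{-1}\bar g(\mathbf D,\theta)\}$; $q(\mathbf D\mid\mathcal M)=\int_{\Theta(\mathcal M)}q(\mathbf D\mid\theta)\pi(\theta\mid\mathcal M)d\theta$; $q(\mathcal M\mid\mathbf D)=\pi(\mathcal M)q(\mathbf D\mid\mathcal M)/\sum_{\mathcal M'}\pi(\mathcal M')q(\mathbf D\mid\mathcal M')$; for measurable $A\subseteq\Theta$, $\int_A q(\theta\mid\mathbf D)d\theta=\sum_{\mathcal M}\pi(\mathcal M)\int_{A\cap\Theta(\mathcal M)}q(\mathbf D\mid\theta)\pi(\theta\mid\mathcal M)d\theta\big/\sum_{\mathcal M}\pi(\mathcal M)q(\mathbf D\mid\mathcal M)$. Posterior given $\hat\theta$. Let $\hat\theta$ be the minimizer of $\bar g(\mathbf D,\theta)^\top\mathbf V^{-1}\bar g(\mathbf D,\theta)$ over the full $p$-dimensional model space (the GMM estimator), and $p(\hat\theta\mid\theta)$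 its density when the true parameter is $\theta$. The posterior probabilities $p(\mathcal M\mid\hat\theta)$ and posterior measure $\int_A p(\theta\mid\hat\theta)d\theta$ are defined by the same formulas as $q(\mathcal M\mid\mathbf D)$ and $\int_A q(\theta\mid\mathbf D)d\theta$ with $q(\mathbf D\mid\theta)$ replaced by $p(\hat\theta\mid\theta)$. $q(\mathcal M:\mathcal M\ne\mathcal M_0\mid\mathbf D)=\sum_{\mathcal M\ne\mathcal M_0}q(\mathcal M\mid\mathbf D)$ and $p(\mathcal M:\mathcal M\ne\mathcal M_0\mid\hat\theta)=\sum_{\mathcal M\ne\mathcal M_0}p(\mathcal M\mid\hat\theta)$. Assumptions. (A1) $D_1,\dots,D_n$ are i.i.d.; $E\,g(D,\theta_0)=0$ for some $\theta_0\in\Theta$; $\Theta$ is compact and connected with $\sup_{\theta\in\Theta}\|\theta\|=R$ for some large constant $R>0$, and contains an open neighborhood of $\theta_0$. (A2) $p\le m$, $p\asymp m$, $p^4\ln^2n/n\to0$ and $p^{2+\alpha}\ln n/n^\alpha\to0$, with $\alpha$ from (A4). (A3) $\sqrt{\ln n}\,\epsilon_n\prec\min_{j\in\mathcal M_0}|\theta_{0,(j)}|\preceq1$. (A4) (i) For some constant $\alpha\in(0,1]$, uniformly in $\theta\in\Theta$, $\sup_{\eta\in\mathbb R^m,\|\eta\|=1}[E\{(\eta^\top(g(D,\theta)-g(D,\theta_0)))^2\}]^{1/2}\le O((\sqrt p\,\|\theta-\theta_0\|)^\alpha)$. (ii) The class $\mathcal F=\{\eta^\top(g(D,\theta)-g(D,\theta_0)):\theta\in\Theta,\eta\in\mathbb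 R^m,\|\eta\|=1\}$ has an envelope $F$ whose $L_2$ norm $\|F\|_{P_D,2}$ is $O(\sqrt p)$, and its $L_2$ uniform covering number satisfies, for any small $\epsilon>0$, $\ln N(\epsilon\|F\|_{P_D,2},\mathcal F,L_2(P_D))=O(p\ln(n/\epsilon))$. (A5) (i) $\|E\,g(D,\theta)\|\ge\delta_0\wedge(\delta_1\|\theta-\theta_0\|)$ uniformly on $\Theta$ for positive constants $\delta_0,\delta_1$. (ii) $\mathbf G:=\nabla_\theta E\,g(D,\theta_0)$ exists and the eigenvalues of $\mathbf G^\top\mathbf G$ are bounded from below and above (by positive constants). (iii) $\mathbf H(\theta):=\nabla^2_{\theta\theta^\top}E\,g(D,\theta)$ exists for $\theta\in B_0(C\epsilon_n)$ and, uniformly over $B_0(C\epsilon_n)$ for any fixed $C>0$, $\sup_{\|u\|=\|v\|=1,\,u,v\in\mathbb R^p}\|\mathbf H(\theta)(u,v)\|=O(\sqrt p)$. (A6) $\mathbf V_n$ is positive definite for all $n$ and converges (in probability) in operator norm to $\mathbf V=\mathrm{Var}\{g(D,\theta_0)\}$; w.p.a.1 the eigenvalues of $\mathbf V_n$ and $\mathbf V$ lie between positive constants $\underline\lambda$ and $\bar\lambda$. (A7) (i) $\pi(\theta\mid\mathcal M)$ is a density restricted to $\Theta$, bounded above by a constant $c_\pi$ uniformly over all $\mathcal M$. (ii) Uniformly over all $\mathcal M\supseteq\mathcal M_0$, for any given $C>0$, $|\ln\pi(\theta_1\mid\mathcal M)-\ln\pi(\theta_{0,\mathcal M,1}\mid\mathcal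 M)|=o(1)$ if $\theta=(\theta_1^\top,0^\top)^\top\in\Theta(\mathcal M)\cap B_0(C\epsilon_n)$. (iii) There are constants $c_0,c_1>0$ such that, uniformly for all $\mathcal M\supseteq\mathcal M_0$, $\pi(\theta_0\mid\mathcal M)\ge e^{-c_0|\mathcal M|}$ and $|\ln\pi(\theta_{0,\mathcal M,1}\mid\mathcal M)-\ln\pi(\theta_0\mid\mathcal M_0)|\le c_1(|\mathcal M|-|\mathcal M_0|)$. (A8) (i) $\lim_{n\to\infty}\sup_{\mathcal M\supsetneq\mathcal M_0}\frac{\pi(\mathcal M)}{\pi(\mathcal M_0)}(p/\sqrt n)^{|\mathcal M|-|\mathcal M_0|}=0$. (ii) $\sup_{\mathcal M:\,\mathcal M_0\setminus\mathcal M\ne\emptyset}\pi(\mathcal M)/\pi(\mathcal M_0)\preceq e^{r_1p\ln n}$ for some constant $r_1>0$. (A9) (i) $1\le p\le\bar p$ for some large fixed integer $\bar p$. (ii) $\min_{j\in\mathcal M_0}|\theta_{0,(j)}|\ge\underline\theta$ for some small constant $\underline\theta>0$. (iii) Let $\mathbf V(\theta)=\mathrm{Var}\{g(D,\theta)\}$ and $\mathbf G(\theta)=\nabla_\theta E\,g(D,\theta)$ (so $\mathbf V(\theta_0)=\mathbf V$, $\mathbf G(\theta_0)=\mathbf G$). The elements of $\mathbf V(\theta),\mathbf G(\theta)$ are continuous in $\theta$, and the eigenvalues of $\mathbf G(\theta)^\top\mathbf G(\theta)$ and $\mathbf V(\theta)$ are uniformly bounded below and above (by positive constants) for all $\theta\in\Theta$.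 (iv) For any two models $\mathcal M_1,\mathcal M_2$, $\pi(\mathcal M_2)/\pi(\mathcal M_1)\le r$ for some constant $r>0$. (v) $\|\hat\theta-\bar\theta\|=O_p(1/n)$, where $\bar\theta=\theta_0-(\mathbf G^\top\mathbf V^{-1}\mathbf G)^{-1}\mathbf G^\top\mathbf V^{-1}\bar g(\mathbf D,\theta_0)$. (A10) Let $\mathbf F(\theta)$ be a $p\times p$ matrix with $\mathbf F(\theta)^\top\mathbf F(\theta)=\mathbf G(\theta)^\top\mathbf V(\theta)^{-1}\mathbf G(\theta)$, $Z=\sqrt n\,\mathbf F(\theta)(\hat\theta-\theta)$, and $p_Z(z\mid\theta)$ the density of $Z$ when the true parameter is $\theta$. Then $\sup_{\theta\in\Theta}\sup_z(1+\|z\|^{p+1})|p_Z(z\mid\theta)-\phi(z;0,\mathbf I_p)|=\tau_n$, where $\tau_n=o(1)$ does not depend on $z,\theta$, and $\phi(\cdot;\mu,\boldsymbol\Sigma)$ is the normal density with mean $\mu$ and covariance $\boldsymbol\Sigma$.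
   Formalization: In (i), the order n^{-1/2} is meant in probability (constants depend on the probability level), the τ_n term of the full-model bound carries a constant factor K>0 (with K=1 it can fail), and the neighborhood of θ_0 inside Θ has a radius not depending on n. *)

theory Defs
  imports
    "HOL-Probability.Probability"
    "HOL-Library.Landau_Symbols"
    "Jordan_Normal_Form.Char_Poly"
    "Jordan_Normal_Form.Gauss_Jordan_Elimination"
begin

unbundle no vec_syntax
unbundle no inner_syntax

hide_const (open) Finite_Cartesian_Product.vec Finite_Cartesian_Product.mat
  Determinants.det Finite_Cartesian_Product.row

section \<open>Euclidean vectors and matrices of varying dimension\<close>

text \<open>
  The dimensions p and m depend on the sample size, so they cannot be types.
  Parameters are sequences vanishing from index p on; the product topology and the
  Borel sets of the function space induce the usual ones on this copy of p-space.
  Moment vectors and matrices are those of Jordan_Normal_Form; the first p entries of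
  a parameter x form the vector vec p x.
\<close>

definition euclid :: "nat \<Rightarrow> (nat \<Rightarrow> real) set" where
  "euclid p = {x. \<forall>j\<ge>p. x j = 0}"

definition zero_pad :: "real vec \<Rightarrow> nat \<Rightarrow> real" where
  "zero_pad v = (\<lambda>j. if j < dim_vec v then v $ j else 0)"

definition vnorm :: "real vec \<Rightarrow> real" where
  "vnorm v = sqrt (v \<bullet> v)"

definition edist :: "nat \<Rightarrow> (nat \<Rightarrow> real) \<Rightarrow> (nat \<Rightarrow> real) \<Rightarrow> real" where
  "edist p x y = vnorm (vec p x - vec p y)"

definition op_norm :: "real mat \<Rightarrow> real" where
  "op_norm A = (SUP u \<in> {u \<in> carrier_vec (dim_col A). vnorm u = 1}. vnorm (A *\<^sub>v u))"

definition minv :: "real mat \<Rightarrow> real mat" where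
  "minv A = the (mat_inverse A)"

definition pos_def_mat :: "real mat \<Rightarrow> bool" where
  "pos_def_mat A \<longleftrightarrow> square_mat A \<and> transpose_mat A = A \<and>
     (\<forall>u \<in> carrier_vec (dim_row A). u \<noteq> 0\<^sub>v (dim_row A) \<longrightarrow> u \<bullet> (A *\<^sub>v u) > 0)"

definition eigenvalues_in :: "real mat \<Rightarrow> real \<Rightarrow> real \<Rightarrow> bool" where
  "eigenvalues_in A l u \<longleftrightarrow> (\<forall>k. eigenvalue A k \<longrightarrow> l \<le> k \<and> k \<le> u)"

text \<open>Total (Frechet) derivative at x, relative to a set S of p-dimensional points.\<close>

definition has_jacobian ::
  "nat \<Rightarrow> (nat \<Rightarrow> real) set \<Rightarrow> ((nat \<Rightarrow> real) \<Rightarrow> real vec) \<Rightarrow> real mat \<Rightarrow> (nat \<Rightarrow> real) \<Rightarrow> bool" where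
  "has_jacobian p S f A x \<longleftrightarrow>
     A \<in> carrier_mat (dim_vec (f x)) p \<and>
     (\<forall>e>0. \<exists>d>0. \<forall>y\<in>S. edist p y x < d \<longrightarrow>
        vnorm (f y - f x - A *\<^sub>v (vec p y - vec p x)) \<le> e * edist p y x)"

definition normal_dens :: "nat \<Rightarrow> real vec \<Rightarrow> real mat \<Rightarrow> real vec \<Rightarrow> real" where
  "normal_dens k \<mu> \<Sigma> x =
     det ((2 * pi) \<cdot>\<^sub>m \<Sigma>) powr (- 1 / 2) * exp (- ((x - \<mu>) \<bullet> (minv \<Sigma> *\<^sub>v (x - \<mu>))) / 2)"

text \<open>
  Lebesgue measure in the coordinates of M, carried by the points whose other
  coordinates vanish; for empty M it is the point mass at the origin.
\<close>

definition coord_lebesgue :: "nat set \<Rightarrow> (nat \<Rightarrow> real) measure" where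
  "coord_lebesgue M =
     distr (PiM M (\<lambda>_. lborel)) borel (\<lambda>x j. if j \<in> M then x j else 0)"


section \<open>Stochastic orders\<close>

text \<open>
  Events need not be measurable: a lower bound on the probability of E is witnessed by
  a measurable subset of E, which is equivalent to the usual bound when E is measurable.
\<close>

definition prob_ge :: "'b measure \<Rightarrow> ('b \<Rightarrow> bool) \<Rightarrow> real \<Rightarrow> bool" where
  "prob_ge P E r \<longleftrightarrow> (\<exists>S\<in>sets P. (\<forall>\<omega>\<in>S. E \<omega>) \<and> r \<le> measure P S)"

definition wpa1 :: "(nat \<Rightarrow> 'b measure) \<Rightarrow> (nat \<Rightarrow> 'b \<Rightarrow> bool) \<Rightarrow> bool" where
  "wpa1 P E \<longleftrightarrow> (\<forall>\<delta>>0. \<forall>\<^sub>F n in sequentially. prob_ge (P n) (E n) (1 - \<delta>))"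

definition conv_in_prob :: "(nat \<Rightarrow> 'b measure) \<Rightarrow> (nat \<Rightarrow> 'b \<Rightarrow> real) \<Rightarrow> real \<Rightarrow> bool" where
  "conv_in_prob P Y c \<longleftrightarrow> (\<forall>e>0. wpa1 P (\<lambda>n \<omega>. \<bar>Y n \<omega> - c\<bar> < e))"

definition bigO_prob :: "(nat \<Rightarrow> 'b measure) \<Rightarrow> (nat \<Rightarrow> 'b \<Rightarrow> real) \<Rightarrow> (nat \<Rightarrow> real) \<Rightarrow> bool" where
  "bigO_prob P Y b \<longleftrightarrow>
     (\<forall>\<delta>>0. \<exists>C. \<forall>\<^sub>F n in sequentially. prob_ge (P n) (\<lambda>\<omega>. \<bar>Y n \<omega>\<bar> \<le> C * b n) (1 - \<delta>))"

text \<open>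
  Same order for random sequences: their ratio is bounded, and bounded away from zero,
  in probability.
\<close>

definition same_order_prob ::
  "(nat \<Rightarrow> 'b measure) \<Rightarrow> (nat \<Rightarrow> 'b \<Rightarrow> real) \<Rightarrow> (nat \<Rightarrow> 'b \<Rightarrow> real) \<Rightarrow> bool" where
  "same_order_prob P Y B \<longleftrightarrow>
     (\<forall>\<delta>>0. \<exists>c>0. \<exists>C. \<forall>\<^sub>F n in sequentially.
        prob_ge (P n) (\<lambda>\<omega>. c * B n \<omega> \<le> Y n \<omega> \<and> Y n \<omega> \<le> C * B n \<omega>) (1 - \<delta>))"


section \<open>Covering numbers\<close>

definition square_integrable :: "'b measure \<Rightarrow> ('b \<Rightarrow> real) set" where
  "square_integrable P = {f \<in> borel_measurable P. integrable P (\<lambda>x. (f x)\<^sup>2)}"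

definition L2_norm_of :: "'b measure \<Rightarrow> ('b \<Rightarrow> real) \<Rightarrow> real" where
  "L2_norm_of P f = sqrt (LINT x|P. (f x)\<^sup>2)"

text \<open>Centres may be any square integrable functions; the value is infinite if no finite net exists.\<close>

definition covering_number :: "'b measure \<Rightarrow> real \<Rightarrow> ('b \<Rightarrow> real) set \<Rightarrow> enat" where
  "covering_number P r \<F> =
     (INF T \<in> {T. finite T \<and> T \<subseteq> square_integrable P \<and>
                  (\<forall>f\<in>\<F>. \<exists>h\<in>T. L2_norm_of P (\<lambda>x. f x - h x) \<le> r)}. enat (card T))"


section \<open>The moment condition model at a fixed sample size\<close>

text \<open>
  obs_law \<theta> is the law of one observation when the true parameter is \<theta>, so the data are
  generated by obs_law theta0.  est_dens t \<theta> is the density at t of the estimator, and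
  Z_dens z \<theta> the density at z of its studentised version, when the true parameter is \<theta>.
  Entry j k of Hess \<theta> i is the second derivative in directions j, k of the i-th expected
  moment.  est_space is the set over which the estimator minimises; it contains Theta
  (which is compact, so that an estimator confined to it has no approximately normal law
  when the true parameter is on the boundary) and may be the whole of p-space.
\<close>

record 'd gmm =
  pdim :: nat
  mdim :: nat
  Theta :: "(nat \<Rightarrow> real) set"
  theta0 :: "nat \<Rightarrow> real"
  obs_law :: "(nat \<Rightarrow> real) \<Rightarrow> 'd measure"
  mom :: "'d \<Rightarrow> (nat \<Rightarrow> real) \<Rightarrow> real vec"
  Vn :: "(nat \<Rightarrow> 'd) \<Rightarrow> real mat"
  model_prior :: "nat set \<Rightarrow> real"
  cond_prior :: "nat set \<Rightarrow> (nat \<Rightarrow> real) \<Rightarrow> real"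
  est_space :: "(nat \<Rightarrow> real) set"
  theta_hat :: "(nat \<Rightarrow> 'd) \<Rightarrow> (nat \<Rightarrow> real)"
  est_dens :: "(nat \<Rightarrow> real) \<Rightarrow> (nat \<Rightarrow> real) \<Rightarrow> real"
  Jac :: "(nat \<Rightarrow> real) \<Rightarrow> real mat"
  Hess :: "(nat \<Rightarrow> real) \<Rightarrow> nat \<Rightarrow> real mat"
  Fmat :: "(nat \<Rightarrow> real) \<Rightarrow> real mat"
  Z_dens :: "(nat \<Rightarrow> real) \<Rightarrow> (nat \<Rightarrow> real) \<Rightarrow> real"

text \<open>The law generating the data; expectations without further specification refer to it.\<close>

definition data_law :: "'d gmm \<Rightarrow> 'd measure" where
  "data_law X = obs_law X (theta0 X)"

definition sample_law_at :: "nat \<Rightarrow> 'd gmm \<Rightarrow> (nat \<Rightarrow> real) \<Rightarrow> (nat \<Rightarrow> 'd) measure" where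
  "sample_law_at n X \<theta> = PiM {..<n} (\<lambda>_. obs_law X \<theta>)"

definition sample_law :: "nat \<Rightarrow> 'd gmm \<Rightarrow> (nat \<Rightarrow> 'd) measure" where
  "sample_law n X = sample_law_at n X (theta0 X)"

definition eps :: "nat \<Rightarrow> 'd gmm \<Rightarrow> real" where
  "eps n X = sqrt (real (pdim X) / real n)"

definition B0 :: "'d gmm \<Rightarrow> real \<Rightarrow> (nat \<Rightarrow> real) set" where
  "B0 X r = {\<theta> \<in> Theta X. edist (pdim X) \<theta> (theta0 X) < r}"

definition gbar :: "nat \<Rightarrow> 'd gmm \<Rightarrow> (nat \<Rightarrow> 'd) \<Rightarrow> (nat \<Rightarrow> real) \<Rightarrow> real vec" where
  "gbar n X D \<theta> = vec (mdim X) (\<lambda>i. (\<Sum>k<n. mom X (D k) \<theta> $ i) / real n)"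

definition mean_mom :: "'d gmm \<Rightarrow> (nat \<Rightarrow> real) \<Rightarrow> real vec" where
  "mean_mom X \<theta> = vec (mdim X) (\<lambda>i. LINT d|data_law X. mom X d \<theta> $ i)"

definition var_mom :: "'d gmm \<Rightarrow> (nat \<Rightarrow> real) \<Rightarrow> real mat" where
  "var_mom X \<theta> = mat (mdim X) (mdim X) (\<lambda>(i, j). LINT d|data_law X.
     (mom X d \<theta> $ i - mean_mom X \<theta> $ i) * (mom X d \<theta> $ j - mean_mom X \<theta> $ j))"

abbreviation V0 :: "'d gmm \<Rightarrow> real mat" where
  "V0 X \<equiv> var_mom X (theta0 X)"

abbreviation G0 :: "'d gmm \<Rightarrow> real mat" where
  "G0 X \<equiv> Jac X (theta0 X)"

subsection \<open>Models and posteriors\<close>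

definition models :: "'d gmm \<Rightarrow> nat set set" where
  "models X = Pow {..<pdim X}"

definition full_model :: "'d gmm \<Rightarrow> nat set" where
  "full_model X = {..<pdim X}"

definition true_model :: "'d gmm \<Rightarrow> nat set" where
  "true_model X = {j \<in> {..<pdim X}. theta0 X j \<noteq> 0}"

definition min_signal :: "'d gmm \<Rightarrow> real" where
  "min_signal X = Min ((\<lambda>j. \<bar>theta0 X j\<bar>) ` true_model X)"

definition Theta_of :: "'d gmm \<Rightarrow> nat set \<Rightarrow> (nat \<Rightarrow> real) set" where
  "Theta_of X M = {\<theta> \<in> Theta X. \<forall>j \<in> {..<pdim X} - M. \<theta> j = 0}"

definition q_lik :: "nat \<Rightarrow> 'd gmm \<Rightarrow> (nat \<Rightarrow> 'd) \<Rightarrow> (nat \<Rightarrow> real) \<Rightarrow> real" where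
  "q_lik n X D \<theta> =
     det ((2 * pi / real n) \<cdot>\<^sub>m Vn X D) powr (- 1 / 2) *
     exp (- (real n / 2) * (gbar n X D \<theta> \<bullet> (minv (Vn X D) *\<^sub>v gbar n X D \<theta>)))"

definition p_lik :: "'d gmm \<Rightarrow> (nat \<Rightarrow> 'd) \<Rightarrow> (nat \<Rightarrow> real) \<Rightarrow> real" where
  "p_lik X D \<theta> = est_dens X (theta_hat X D) \<theta>"

text \<open>Posterior quantities as functionals of an arbitrary (quasi-)likelihood L.\<close>

definition marg_lik_on ::
  "'d gmm \<Rightarrow> ((nat \<Rightarrow> real) \<Rightarrow> real) \<Rightarrow> nat set \<Rightarrow> (nat \<Rightarrow> real) set \<Rightarrow> real" where
  "marg_lik_on X L M A =
     (LINT \<theta>:A \<inter> Theta_of X M|coord_lebesgue M. L \<theta> * cond_prior X M \<theta>)"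

definition marg_lik :: "'d gmm \<Rightarrow> ((nat \<Rightarrow> real) \<Rightarrow> real) \<Rightarrow> nat set \<Rightarrow> real" where
  "marg_lik X L M = (LINT \<theta>:Theta_of X M|coord_lebesgue M. L \<theta> * cond_prior X M \<theta>)"

definition evidence :: "'d gmm \<Rightarrow> ((nat \<Rightarrow> real) \<Rightarrow> real) \<Rightarrow> real" where
  "evidence X L = (\<Sum>M\<in>models X. model_prior X M * marg_lik X L M)"

definition model_post :: "'d gmm \<Rightarrow> ((nat \<Rightarrow> real) \<Rightarrow> real) \<Rightarrow> nat set \<Rightarrow> real" where
  "model_post X L M = model_prior X M * marg_lik X L M / evidence X L"

definition post_measure :: "'d gmm \<Rightarrow> ((nat \<Rightarrow> real) \<Rightarrow> real) \<Rightarrow> (nat \<Rightarrow> real) set \<Rightarrow> real" where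
  "post_measure X L A =
     (\<Sum>M\<in>models X. model_prior X M * marg_lik_on X L M A) / evidence X L"

definition wrong_model_post :: "'d gmm \<Rightarrow> ((nat \<Rightarrow> real) \<Rightarrow> real) \<Rightarrow> real" where
  "wrong_model_post X L = (\<Sum>M\<in>models X - {true_model X}. model_post X L M)"

subsection \<open>The estimator\<close>

definition gmm_objective :: "nat \<Rightarrow> 'd gmm \<Rightarrow> (nat \<Rightarrow> 'd) \<Rightarrow> (nat \<Rightarrow> real) \<Rightarrow> real" where
  "gmm_objective n X D \<theta> = gbar n X D \<theta> \<bullet> (minv (V0 X) *\<^sub>v gbar n X D \<theta>)"

definition theta_bar :: "nat \<Rightarrow> 'd gmm \<Rightarrow> (nat \<Rightarrow> 'd) \<Rightarrow> real vec" where
  "theta_bar n X D = vec (pdim X) (theta0 X) -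
     minv (transpose_mat (G0 X) * minv (V0 X) * G0 X) *\<^sub>v
       (transpose_mat (G0 X) *\<^sub>v (minv (V0 X) *\<^sub>v gbar n X D (theta0 X)))"

definition Z_stat :: "nat \<Rightarrow> 'd gmm \<Rightarrow> (nat \<Rightarrow> real) \<Rightarrow> (nat \<Rightarrow> 'd) \<Rightarrow> (nat \<Rightarrow> real)" where
  "Z_stat n X \<theta> D = zero_pad (sqrt (real n) \<cdot>\<^sub>v
     (Fmat X \<theta> *\<^sub>v (vec (pdim X) (theta_hat X D) - vec (pdim X) \<theta>)))"

subsection \<open>Types, measurability and normalisation of the data of the model\<close>

definition valid_moments :: "'d gmm \<Rightarrow> bool" where
  "valid_moments X \<longleftrightarrow>
     Theta X \<subseteq> est_space X \<and> est_space X \<subseteq> euclid (pdim X) \<and> theta0 X \<in> Theta X \<and>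
     (\<forall>\<theta>\<in>Theta X. prob_space (obs_law X \<theta>) \<and> sets (obs_law X \<theta>) = sets (data_law X)) \<and>
     (\<forall>d\<in>space (data_law X). \<forall>\<theta>\<in>est_space X. mom X d \<theta> \<in> carrier_vec (mdim X)) \<and>
     (\<forall>i<mdim X. (\<lambda>(d, \<theta>). mom X d \<theta> $ i)
        \<in> borel_measurable (data_law X \<Otimes>\<^sub>M restrict_space borel (Theta X))) \<and>
     (\<forall>\<theta>\<in>Theta X. \<forall>i<mdim X. (\<lambda>d. mom X d \<theta> $ i) \<in> square_integrable (data_law X))"

definition valid_weights :: "nat \<Rightarrow> 'd gmm \<Rightarrow> bool" where
  "valid_weights n X \<longleftrightarrow>
     (\<forall>D\<in>space (sample_law n X). Vn X D \<in> carrier_mat (mdim X) (mdim X)) \<and>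
     (\<forall>i<mdim X. \<forall>j<mdim X. (\<lambda>D. Vn X D $$ (i, j)) \<in> borel_measurable (sample_law n X))"

definition valid_prior :: "'d gmm \<Rightarrow> bool" where
  "valid_prior X \<longleftrightarrow>
     (\<forall>M\<in>models X. 0 \<le> model_prior X M) \<and> (\<Sum>M\<in>models X. model_prior X M) = 1 \<and>
     (\<forall>M\<in>models X.
        cond_prior X M \<in> borel_measurable (restrict_space borel (Theta_of X M)) \<and>
        (\<forall>\<theta>\<in>Theta_of X M. 0 \<le> cond_prior X M \<theta>) \<and>
        (\<integral>\<^sup>+\<theta>\<in>Theta_of X M. ennreal (cond_prior X M \<theta>) \<partial>coord_lebesgue M) = 1)"

definition valid_estimator :: "nat \<Rightarrow> 'd gmm \<Rightarrow> bool" where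
  "valid_estimator n X \<longleftrightarrow>
     theta_hat X \<in> sample_law n X \<rightarrow>\<^sub>M borel \<and>
     (\<forall>D\<in>space (sample_law n X).
        is_arg_min (gmm_objective n X D) (\<lambda>\<theta>. \<theta> \<in> est_space X) (theta_hat X D)) \<and>
     (\<lambda>(t, \<theta>). est_dens X t \<theta>) \<in> borel_measurable (borel \<Otimes>\<^sub>M restrict_space borel (Theta X)) \<and>
     (\<forall>t. \<forall>\<theta>\<in>Theta X. 0 \<le> est_dens X t \<theta>) \<and>
     (\<forall>\<theta>\<in>Theta X. distributed (sample_law_at n X \<theta>) (coord_lebesgue {..<pdim X})
        (theta_hat X) (\<lambda>t. ennreal (est_dens X t \<theta>)))"

definition gmm_setting :: "(nat \<Rightarrow> 'd gmm) \<Rightarrow> bool" where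
  "gmm_setting X \<longleftrightarrow> (\<forall>\<^sub>F n in sequentially.
     valid_moments (X n) \<and> valid_weights n (X n) \<and> valid_prior (X n) \<and> valid_estimator n (X n))"


section \<open>The assumptions\<close>

text \<open>
  X n is the model at sample size n.  Real constants are quantified outside of n; all
  conditions concern large n only.  Independence and identical distribution are part of
  sample_law.  The neighbourhood of theta0 inside Theta has a radius not depending on n.
\<close>

definition cond_A1 :: "(nat \<Rightarrow> 'd gmm) \<Rightarrow> bool" where
  "cond_A1 X \<longleftrightarrow>
     (\<forall>\<^sub>F n in sequentially. mean_mom (X n) (theta0 (X n)) = 0\<^sub>v (mdim (X n)) \<and>
        compact (Theta (X n)) \<and> connected (Theta (X n))) \<and>
     (\<exists>R>0. \<forall>\<^sub>F n in sequentially.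
        (SUP \<theta>\<in>Theta (X n). vnorm (vec (pdim (X n)) \<theta>)) = R) \<and>
     (\<exists>r>0. \<forall>\<^sub>F n in sequentially.
        {\<theta> \<in> euclid (pdim (X n)). edist (pdim (X n)) \<theta> (theta0 (X n)) < r} \<subseteq> Theta (X n))"

definition cond_A2 :: "real \<Rightarrow> (nat \<Rightarrow> 'd gmm) \<Rightarrow> bool" where
  "cond_A2 \<alpha> X \<longleftrightarrow>
     (\<forall>\<^sub>F n in sequentially. pdim (X n) \<le> mdim (X n)) \<and>
     (\<lambda>n. real (pdim (X n))) \<in> \<Theta>(\<lambda>n. real (mdim (X n))) \<and>
     (\<lambda>n. real (pdim (X n)) ^ 4 * (ln (real n))\<^sup>2 / real n) \<longlonglongrightarrow> 0 \<and>
     (\<lambda>n. real (pdim (X n)) powr (2 + \<alpha>) * ln (real n) / real n powr \<alpha>) \<longlonglongrightarrow> 0"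

text \<open>Restricting the filter makes the condition void along those n for which theta0 vanishes.\<close>

definition cond_A3 :: "(nat \<Rightarrow> 'd gmm) \<Rightarrow> bool" where
  "cond_A3 X \<longleftrightarrow>
     (let Fl = inf sequentially (principal {n. true_model (X n) \<noteq> {}}) in
      (\<lambda>n. sqrt (ln (real n)) * eps n (X n)) \<in> o[Fl](\<lambda>n. min_signal (X n)) \<and>
      (\<lambda>n. min_signal (X n)) \<in> O[Fl](\<lambda>n. 1))"

definition moment_class :: "'d gmm \<Rightarrow> ('d \<Rightarrow> real) set" where
  "moment_class X = {\<lambda>d. \<eta> \<bullet> (mom X d \<theta> - mom X d (theta0 X)) | \<theta> \<eta>.
     \<theta> \<in> Theta X \<and> \<eta> \<in> carrier_vec (mdim X) \<and> vnorm \<eta> = 1}"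

definition cond_A4 :: "real \<Rightarrow> (nat \<Rightarrow> 'd gmm) \<Rightarrow> bool" where
  "cond_A4 \<alpha> X \<longleftrightarrow>
     0 < \<alpha> \<and> \<alpha> \<le> 1 \<and>
     (\<exists>K. \<forall>\<^sub>F n in sequentially. \<forall>\<theta>\<in>Theta (X n). \<forall>\<eta>\<in>carrier_vec (mdim (X n)). vnorm \<eta> = 1 \<longrightarrow>
        L2_norm_of (data_law (X n)) (\<lambda>d. \<eta> \<bullet> (mom (X n) d \<theta> - mom (X n) d (theta0 (X n))))
          \<le> K * (sqrt (real (pdim (X n))) * edist (pdim (X n)) \<theta> (theta0 (X n))) powr \<alpha>) \<and>
     (\<exists>env.
        (\<forall>\<^sub>F n in sequentially. env n \<in> square_integrable (data_law (X n)) \<and>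
           (\<forall>f\<in>moment_class (X n). \<forall>d\<in>space (data_law (X n)). \<bar>f d\<bar> \<le> env n d)) \<and>
        (\<lambda>n. L2_norm_of (data_law (X n)) (env n)) \<in> O(\<lambda>n. sqrt (real (pdim (X n)))) \<and>
        (\<exists>K. \<exists>e0>0. \<forall>\<^sub>F n in sequentially. \<forall>e. 0 < e \<and> e \<le> e0 \<longrightarrow>
           (\<exists>N. covering_number (data_law (X n)) (e * L2_norm_of (data_law (X n)) (env n))
                  (moment_class (X n)) = enat N \<and>
                ln (real N) \<le> K * real (pdim (X n)) * ln (real n / e))))"

definition cond_A5 :: "(nat \<Rightarrow> 'd gmm) \<Rightarrow> bool" where
  "cond_A5 X \<longleftrightarrow>
     (\<exists>\<delta>0>0. \<exists>\<delta>1>0. \<forall>\<^sub>F n in sequentially. \<forall>\<theta>\<in>Theta (X n).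
        min \<delta>0 (\<delta>1 * edist (pdim (X n)) \<theta> (theta0 (X n))) \<le> vnorm (mean_mom (X n) \<theta>)) \<and>
     (\<forall>\<^sub>F n in sequentially.
        has_jacobian (pdim (X n)) (Theta (X n)) (mean_mom (X n)) (G0 (X n)) (theta0 (X n))) \<and>
     (\<exists>l>0. \<exists>u. \<forall>\<^sub>F n in sequentially. eigenvalues_in (transpose_mat (G0 (X n)) * G0 (X n)) l u) \<and>
     (\<forall>C>0. \<exists>K. \<forall>\<^sub>F n in sequentially. \<forall>\<theta>\<in>B0 (X n) (C * eps n (X n)).
        has_jacobian (pdim (X n)) (Theta (X n)) (mean_mom (X n)) (Jac (X n) \<theta>) \<theta> \<and>
        (\<forall>i<mdim (X n). has_jacobian (pdim (X n)) (Theta (X n))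
           (\<lambda>\<theta>'. row (Jac (X n) \<theta>') i) (Hess (X n) \<theta> i) \<theta>) \<and>
        (\<forall>u\<in>carrier_vec (pdim (X n)). \<forall>v\<in>carrier_vec (pdim (X n)). vnorm u = 1 \<and> vnorm v = 1 \<longrightarrow>
           vnorm (vec (mdim (X n)) (\<lambda>i. u \<bullet> (Hess (X n) \<theta> i *\<^sub>v v)))
             \<le> K * sqrt (real (pdim (X n)))))"

definition cond_A6 :: "(nat \<Rightarrow> 'd gmm) \<Rightarrow> bool" where
  "cond_A6 X \<longleftrightarrow>
     (\<forall>\<^sub>F n in sequentially. \<forall>D\<in>space (sample_law n (X n)). pos_def_mat (Vn (X n) D)) \<and>
     conv_in_prob (\<lambda>n. sample_law n (X n)) (\<lambda>n D. op_norm (Vn (X n) D - V0 (X n))) 0 \<and>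
     (\<exists>l>0. \<exists>u. wpa1 (\<lambda>n. sample_law n (X n))
        (\<lambda>n D. eigenvalues_in (Vn (X n) D) l u \<and> eigenvalues_in (V0 (X n)) l u))"

definition cond_A7 :: "(nat \<Rightarrow> 'd gmm) \<Rightarrow> bool" where
  "cond_A7 X \<longleftrightarrow>
     (\<exists>c\<^sub>\<pi>. \<forall>\<^sub>F n in sequentially. \<forall>M\<in>models (X n). \<forall>\<theta>\<in>Theta_of (X n) M.
        cond_prior (X n) M \<theta> \<le> c\<^sub>\<pi>) \<and>
     (\<forall>C>0. \<forall>e>0. \<forall>\<^sub>F n in sequentially. \<forall>M\<in>models (X n). true_model (X n) \<subseteq> M \<longrightarrow>
        (\<forall>\<theta>\<in>Theta_of (X n) M \<inter> B0 (X n) (C * eps n (X n)).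
           0 < cond_prior (X n) M \<theta> \<and>
           \<bar>ln (cond_prior (X n) M \<theta>) - ln (cond_prior (X n) M (theta0 (X n)))\<bar> < e)) \<and>
     (\<exists>c\<^sub>0>0. \<exists>c\<^sub>1>0. \<forall>\<^sub>F n in sequentially. \<forall>M\<in>models (X n). true_model (X n) \<subseteq> M \<longrightarrow>
        exp (- c\<^sub>0 * real (card M)) \<le> cond_prior (X n) M (theta0 (X n)) \<and>
        \<bar>ln (cond_prior (X n) M (theta0 (X n))) -
           ln (cond_prior (X n) (true_model (X n)) (theta0 (X n)))\<bar>
          \<le> c\<^sub>1 * (real (card M) - real (card (true_model (X n)))))"

definition cond_A8 :: "(nat \<Rightarrow> 'd gmm) \<Rightarrow> bool" where
  "cond_A8 X \<longleftrightarrow>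
     (\<forall>e>0. \<forall>\<^sub>F n in sequentially. \<forall>M\<in>models (X n). true_model (X n) \<subset> M \<longrightarrow>
        model_prior (X n) M / model_prior (X n) (true_model (X n)) *
          (real (pdim (X n)) / sqrt (real n)) ^ (card M - card (true_model (X n))) < e) \<and>
     (\<exists>r\<^sub>1>0. \<exists>K. \<forall>\<^sub>F n in sequentially. \<forall>M\<in>models (X n). true_model (X n) - M \<noteq> {} \<longrightarrow>
        model_prior (X n) M / model_prior (X n) (true_model (X n))
          \<le> K * exp (r\<^sub>1 * real (pdim (X n)) * ln (real n)))"

text \<open>The positivity of all model probabilities is what makes the prior ratios meaningful.\<close>

definition cond_A9 :: "real \<Rightarrow> (nat \<Rightarrow> 'd gmm) \<Rightarrow> bool" where
  "cond_A9 \<theta>min X \<longleftrightarrow>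
     (\<exists>pbar. \<forall>\<^sub>F n in sequentially. 1 \<le> pdim (X n) \<and> pdim (X n) \<le> pbar) \<and>
     0 < \<theta>min \<and> (\<forall>\<^sub>F n in sequentially. \<forall>j\<in>true_model (X n). \<theta>min \<le> \<bar>theta0 (X n) j\<bar>) \<and>
     (\<forall>\<^sub>F n in sequentially.
        (\<forall>\<theta>\<in>Theta (X n). has_jacobian (pdim (X n)) (Theta (X n)) (mean_mom (X n)) (Jac (X n) \<theta>) \<theta>) \<and>
        (\<forall>i<mdim (X n). \<forall>j<mdim (X n). continuous_on (Theta (X n)) (\<lambda>\<theta>. var_mom (X n) \<theta> $$ (i, j))) \<and>
        (\<forall>i<mdim (X n). \<forall>j<pdim (X n). continuous_on (Theta (X n)) (\<lambda>\<theta>. Jac (X n) \<theta> $$ (i, j)))) \<and>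
     (\<exists>l>0. \<exists>u. \<forall>\<^sub>F n in sequentially. \<forall>\<theta>\<in>Theta (X n).
        eigenvalues_in (transpose_mat (Jac (X n) \<theta>) * Jac (X n) \<theta>) l u \<and>
        eigenvalues_in (var_mom (X n) \<theta>) l u) \<and>
     (\<exists>r>0. \<forall>\<^sub>F n in sequentially.
        (\<forall>M\<in>models (X n). 0 < model_prior (X n) M) \<and>
        (\<forall>M\<^sub>1\<in>models (X n). \<forall>M\<^sub>2\<in>models (X n). model_prior (X n) M\<^sub>2 / model_prior (X n) M\<^sub>1 \<le> r)) \<and>
     bigO_prob (\<lambda>n. sample_law n (X n))
       (\<lambda>n D. vnorm (vec (pdim (X n)) (theta_hat (X n) D) - theta_bar n (X n) D))
       (\<lambda>n. 1 / real n)"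

text \<open>
  The supremum is taken in the extended reals, so that equality with a real number entails
  finiteness.  Since \<tau> n is this exact supremum and not an order of magnitude, rates
  expressed through \<tau> hold up to a constant factor: prior ratios, prior densities and
  norm of theta0 all enter as constants.
\<close>

definition cond_A10 :: "(nat \<Rightarrow> real) \<Rightarrow> (nat \<Rightarrow> 'd gmm) \<Rightarrow> bool" where
  "cond_A10 \<tau> X \<longleftrightarrow>
     (\<forall>\<^sub>F n in sequentially. \<forall>\<theta>\<in>Theta (X n).
        Fmat (X n) \<theta> \<in> carrier_mat (pdim (X n)) (pdim (X n)) \<and>
        transpose_mat (Fmat (X n) \<theta>) * Fmat (X n) \<theta> =
          transpose_mat (Jac (X n) \<theta>) * minv (var_mom (X n) \<theta>) * Jac (X n) \<theta> \<and>
        (\<forall>z. 0 \<le> Z_dens (X n) z \<theta>) \<and>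
        distributed (sample_law_at n (X n) \<theta>) (coord_lebesgue {..<pdim (X n)})
          (Z_stat n (X n) \<theta>) (\<lambda>z. ennreal (Z_dens (X n) z \<theta>))) \<and>
     (\<forall>\<^sub>F n in sequentially.
        (SUP \<theta>\<in>Theta (X n). SUP z\<in>euclid (pdim (X n)).
           ereal ((1 + vnorm (vec (pdim (X n)) z) ^ (pdim (X n) + 1)) *
             \<bar>Z_dens (X n) z \<theta> -
               normal_dens (pdim (X n)) (0\<^sub>v (pdim (X n))) (1\<^sub>m (pdim (X n))) (vec (pdim (X n)) z)\<bar>))
          = ereal (\<tau> n)) \<and>
     \<tau> \<longlonglongrightarrow> 0"

end

theory Submission
  imports Defs "HOL-Real_Asymp.Real_Asymp"
begin

text \<open>
 Why the theorem holds.  In the local coordinate h = sqrt n (theta - theta0) both likelihoods,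
 up to factors free of theta, are close to one Gaussian function
 psi(h) = exp (- (w + G h) V^-1 (w + G h) / 2) with w = sqrt n gbar(theta0).  The posteriors
 depend only on the integrals of the likelihoods against the priors of the 2^p models, and p is
 bounded.  So it suffices to compare these integrals.

 For a model M that contains the true one, the integral of psi has exact order n^(-|M|/2), and each
 likelihood differs from psi by o(n^(-|M|/2)) in L1 of the prior.  For a model that misses a relevant
 coordinate, all parameters stay at a fixed distance from theta0, where the quasi-likelihood is
 exponentially small and the density of the estimator is of order tau n^(-(p+1)/2).  All sums over
 models are then equal up to a factor 1 + o(1) to the corresponding sums for psi
 (sum_close, posterior_distance, wrong_posterior_rate).  The wrong models of largest mass have one
 superfluous coordinate, which gives the rate n^(-1/2); if the true model is full, no such model
 exists and only the exponentially small models and the tau term remain (wrong_posterior_full).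

 Quasi-likelihood (Lq_psi_prob, Lq_missing_prob).  Only integrals over the prior matter:
 a bound in mean or in probability at each fixed parameter is integrated by Fubini and turned into a
 statement about the sample by Markov.  Locally
 the second moment of the fluctuation vanishes by the Hoelder condition.  In the tail the moments are
 truncated at the size that the envelope reaches in the sample, which makes exponential
 inequalities available.

 Estimator (Pbound_AE, Pt_psit_integral).  The density of the estimator is that of its studentised
 version up to the Jacobian, a ratio of Gaussian integrals; the Edgeworth-type condition bounds its
 error by tau / (1 + |z|^(p+1)), which is integrable over every model.  The estimator itself is
 replaced by the minimiser of the quadratic form in psi, to which it is close.  Completing the square
 in psi then shows that the two limits differ by a factor that does not involve theta.
\<close>

text \<open>Short names for constants that occur in almost every statement.\<close>

abbreviation eventually_seq :: "(nat \<Rightarrow> bool) \<Rightarrow> bool" (binder "EV " 10) where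
  "eventually_seq Q \<equiv> eventually Q sequentially"

notation mult_mat_vec (infixl "*." 70) and scalar_prod (infix ".*" 70)

abbreviation "enn \<equiv> ennreal"
abbreviation "bmb \<equiv> borel_measurable borel"
abbreviation "cvec \<equiv> carrier_vec"
abbreviation "cmat \<equiv> carrier_mat"
abbreviation "cleb \<equiv> coord_lebesgue"
abbreviation "NI \<equiv> nn_integral"

lemmas mcomp = measurable_compose
lemmas meas_coord = measurable_coordinatewise_then_product

section \<open>Linear algebra\<close>

lemma vnorm_L2: "vnorm v = L2_set (%i. v $ i) {..<dim_vec v}"
 by (simp add: vnorm_def L2_set_def scalar_prod_def lessThan_atLeast0 power2_eq_square)

lemma vnorm_nonneg [simp]: "0 <= vnorm v"
 by (simp add: vnorm_L2 L2_set_nonneg)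

lemma scalar_prod_self_nonneg [simp]: "0 <= (v :: real vec) .* v"
 by (auto simp: scalar_prod_def intro!: sum_nonneg)

lemma vnorm_sq: "(vnorm v)\<^sup>2 = v .* v"
 by (simp add: vnorm_def)

lemma abs_scalar_prod_le:
 assumes "v : cvec k" "w : cvec k"
 shows "\<bar>v .* w\<bar> <= vnorm v * vnorm w"
proof -
 have "\<bar>v .* w\<bar> <= (\<Sum>i<k. \<bar>v $ i\<bar> * \<bar>w $ i\<bar>)"
 using assms by (auto simp: scalar_prod_def lessThan_atLeast0 abs_mult[symmetric] intro!: sum_abs)
 also have "... <= vnorm v * vnorm w"
 using assms L2_set_mult_ineq[of "%i. v $ i" "%i. w $ i" "{..<k}"] by (simp add: vnorm_L2)
 finally show ?thesis .
qed

lemma vnorm_triangle: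
 assumes "v : cvec k" "w : cvec k"
 shows "vnorm (v + w) <= vnorm v + vnorm w"
 using assms L2_set_triangle_ineq[of "%i. v $ i" "%i. w $ i" "{..<k}"]
 by (simp add: vnorm_L2 L2_set_def)

lemma vnorm_smult: "vnorm (c \<cdot>\<^sub>v v) = \<bar>c\<bar> * vnorm v"
 by (simp add: vnorm_def real_sqrt_mult flip: power2_eq_square mult.assoc)

lemma vnorm_minus_commute:
 assumes "v : cvec k" "w : cvec k"
 shows "vnorm (v - w) = vnorm (w - v)"
proof -
 have "v - w = (-1) \<cdot>\<^sub>v (w - v)" using assms by auto
 then show ?thesis by (simp add: vnorm_smult)
qed

lemma vnorm_diff_le:
 assumes "v : cvec k" "w : cvec k"
 shows "vnorm v - vnorm w <= vnorm (v - w)"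
proof -
 have "v = (v - w) + w" using assms by auto
 then show ?thesis using vnorm_triangle[of "v - w" k w] assms by force
qed

lemma vnorm_diff_triangle:
 assumes "v : cvec k" "w : cvec k"
 shows "vnorm (v - w) <= vnorm v + vnorm w"
proof -
 have "v - w = v + (-1) \<cdot>\<^sub>v w" using assms by auto
 then show ?thesis using vnorm_triangle[of v k "(-1) \<cdot>\<^sub>v w"] assms by (simp add: vnorm_smult)
qed

lemma abs_component_le_vnorm: "i < dim_vec v ==> \<bar>v $ i\<bar> <= vnorm v"
 using member_le_L2_set[of "{..<dim_vec v}" i "%i. \<bar>v $ i\<bar>"] by (simp add: vnorm_L2 L2_set_def)

lemma vnorm_le_sum_abs: "vnorm v <= (\<Sum>i<dim_vec v. \<bar>v $ i\<bar>)"
 by (simp add: vnorm_L2 L2_set_le_sum_abs)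

lemma vnorm_eq_0_iff: "v : cvec k ==> vnorm v = 0 \<longleftrightarrow> v = 0\<^sub>v k"
 by (auto simp: vnorm_L2 L2_set_eq_0_iff)

lemma scalar_prod_self_eq_0: "(v :: real vec) : cvec k ==> v .* v = 0 \<longleftrightarrow> v = 0\<^sub>v k"
 using vnorm_eq_0_iff[of v k] by (simp add: vnorm_def)

lemma mult_mat_vec_zero: "A : cmat k m ==> A *. 0\<^sub>v m = (0\<^sub>v k :: real vec)"
 by (auto simp: scalar_prod_def)

lemma quadratic_form_sum:
 assumes "A : cmat k m"
 shows "vec k x .* (A *. vec m y) = (\<Sum>i<k. \<Sum>j<m. A $$ (i,j) * x i * (y j :: real))"
 using assms by (auto simp: scalar_prod_def lessThan_atLeast0 sum_distrib_left intro!: sum.cong)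

lemma scalar_prod_sym_form:
 assumes "A : cmat m m" "transpose_mat A = A" "x : cvec m" "y : cvec m"
 shows "x .* (A *. y) = (A *. x) .* (y :: real vec)"
 using transpose_vec_mult_scalar[of A m m y x] assms by (simp add: comm_scalar_prod[of _ m])

lemma quadratic_form_add_smult:
 assumes A: "A : cmat m m" "transpose_mat A = A" and x: "x : cvec m" and y: "y : cvec m"
 shows "(x + t \<cdot>\<^sub>v y) .* (A *. (x + t \<cdot>\<^sub>v y)) =
 x .* (A *. x) + 2 * t * (y .* (A *. x)) + t\<^sup>2 * (y .* (A *. (y :: real vec)))"
proof -
 have 1: "A *. (x + t \<cdot>\<^sub>v y) = A *. x + t \<cdot>\<^sub>v (A *. y)"
 using A x y by (simp add: mult_add_distrib_mat_vec mult_mat_vec)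
 have 2: "x .* (A *. y) = y .* (A *. x)"
 using scalar_prod_sym_form[OF A x y] comm_scalar_prod[of "A *. x" m y] A x y by auto
 show ?thesis unfolding 1 using A x y 2
 by (simp add: add_scalar_prod_distrib[of _ m] scalar_prod_add_distrib[of _ m] algebra_simps power2_eq_square)
qed

lemma compact_unit_sphere: "compact {x : euclid m. (\<Sum>j<m. (x j)\<^sup>2) = 1}"
proof -
 let ?B = "PiE (UNIV::nat set) (%j. if j < m then {-1..1::real} else {0})"
 have "compactin (product_topology (%_. euclideanreal) UNIV) ?B"
 by (subst compactin_PiE) auto
 then have B: "compact ?B" by (simp add: euclidean_product_topology)
 let ?S = "{x : euclid m. (\<Sum>j<m. (x j)\<^sup>2) = 1}"
 have "?S = (\<Inter>j\<in>{m..}. {x. x j = 0}) \<inter> {x. (\<Sum>j<m. (x j)\<^sup>2) = 1}"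
 by (auto simp: euclid_def)
 moreover have "closed ..."
 by (intro closed_Int closed_INT ballI closed_Collect_eq continuous_intros) auto
 ultimately have cl: "closed ?S" by simp
 have "?S <= ?B"
 proof
 fix x assume x: "x : ?S"
 have "x j : {-1..1}" if "j < m" for j
 proof -
 have "(x j)\<^sup>2 <= (\<Sum>j<m. (x j)\<^sup>2)" using that by (intro member_le_sum) auto
 then have "(x j)\<^sup>2 <= 1" using x by simp
 then show ?thesis using abs_square_le_1[of "x j"] by auto
 qed
 then show "x : ?B" using x by (auto simp: euclid_def)
 qed
 then have "?S = ?B \<inter> ?S" by auto
 then show ?thesis using compact_Int_closed[OF B cl] by simp
qed

text \<open>The quadratic form attains its minimum on the unit sphere, and a minimiser is an eigenvector:
 otherwise moving along the residual A y - k y would lower the form.\<close>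

lemma symmetric_min_eigenvalue:
 assumes A: "A : cmat m m" "transpose_mat A = (A :: real mat)" and m: "m > 0"
 obtains mu where "eigenvalue A mu" "\<And>y. y : cvec m ==> mu * (y .* y) <= y .* (A *. y)"
proof -
 let ?S = "{x : euclid m. (\<Sum>j<m. (x j)\<^sup>2) = 1}"
 have ne: "(%j. if j = 0 then 1 else 0) : ?S"
 using m by (auto simp: euclid_def if_distrib[of "%x. x\<^sup>2"] cong: if_cong)
 have "\<exists>x\<in>?S. ALL y:?S. (\<Sum>i<m. \<Sum>j<m. A $$ (i,j) * x i * x j) <= (\<Sum>i<m. \<Sum>j<m. A $$ (i,j) * y i * y j)"
 using ne by (intro continuous_attains_inf compact_unit_sphere)
 (auto intro!: continuous_intros continuous_on_subset[OF continuous_on_product_coordinates])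
 then obtain x0 where x0: "x0 : ?S"
 and min: "\<And>y. y : ?S ==> vec m x0 .* (A *. vec m x0) <= vec m y .* (A *. vec m y)"
 unfolding quadratic_form_sum[OF A(1)] by blast
 define x where "x = vec m x0"
 define mu where "mu = x .* (A *. x)"
 have x: "x : cvec m" by (simp add: x_def)
 have xx: "x .* x = 1"
 using x0 by (simp add: x_def scalar_prod_def lessThan_atLeast0 power2_eq_square)
 have le: "mu * (y .* y) <= y .* (A *. y)" if y: "y : cvec m" for y
 proof (cases "y = 0\<^sub>v m")
 case True then show ?thesis using A by simp
 next
 case False
 define c where "c = vnorm y"
 have c: "c > 0" "c\<^sup>2 = y .* y"
 using False y by (auto simp: c_def vnorm_sq vnorm_eq_0_iff less_le)
 have eq: "vec m (zero_pad ((1/c) \<cdot>\<^sub>v y)) = (1/c) \<cdot>\<^sub>v y"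
 using y by (auto simp: zero_pad_def)
 have "(\<Sum>j<m. (zero_pad ((1/c) \<cdot>\<^sub>v y) j)\<^sup>2) = ((1/c) \<cdot>\<^sub>v y) .* ((1/c) \<cdot>\<^sub>v y)"
 using y by (simp add: zero_pad_def scalar_prod_def lessThan_atLeast0 power2_eq_square)
 also have "... = (y .* y) / c\<^sup>2" using y by (simp add: power2_eq_square)
 also have "... = 1" using c by (simp flip: c(2))
 finally have "zero_pad ((1/c) \<cdot>\<^sub>v y) : ?S"
 using y by (auto simp: zero_pad_def euclid_def)
 from min[OF this] have "mu <= ((1/c) \<cdot>\<^sub>v y) .* (A *. ((1/c) \<cdot>\<^sub>v y))"
 unfolding eq mu_def x_def .
 also have "... = (y .* (A *. y)) / c\<^sup>2"
 using y A by (simp add: mult_mat_vec power2_eq_square)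
 finally have "mu <= (y .* (A *. y)) / c\<^sup>2" .
 moreover have "0 < c\<^sup>2" using c(1) by simp
 ultimately have "mu * c\<^sup>2 <= y .* (A *. y)" by (simp only: pos_le_divide_eq)
 then show ?thesis by (simp only: c(2))
 qed
 define v where "v = A *. x - mu \<cdot>\<^sub>v x"
 have v: "v : cvec m" using A x by (simp add: v_def)
 have "mu * (x .* x + 2 * t * (v .* x) + t\<^sup>2 * (v .* v)) <= mu + 2 * t * (v .* (A *. x)) + t\<^sup>2 * (v .* (A *. v))" for t
 proof -
 have "(x + t \<cdot>\<^sub>v v) .* (x + t \<cdot>\<^sub>v v) = x .* x + 2 * t * (v .* x) + t\<^sup>2 * (v .* v)"
 using quadratic_form_add_smult[of "1\<^sub>m m" m x v t] x v by simp
 then show ?thesis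
 using le[of "x + t \<cdot>\<^sub>v v"] x v quadratic_form_add_smult[OF A x v, of t] by (simp add: mu_def)
 qed
 moreover have "v .* (A *. x) = v .* v + mu * (v .* x)"
 proof -
 have "A *. x = v + mu \<cdot>\<^sub>v x" using A x by (auto simp: v_def)
 then show ?thesis using v x by (simp add: scalar_prod_add_distrib[of _ m])
 qed
 ultimately have q: "0 <= 2 * t * (v .* v) + t\<^sup>2 * (v .* (A *. v) - mu * (v .* v))" for t
 using xx by (simp add: algebra_simps)
 define c d where "c = v .* v" and "d = v .* (A *. v) - mu * (v .* v)"
 have d: "d >= 0" using le[OF v] by (simp add: d_def)
 have c0: "c >= 0" by (simp add: c_def)
 have "c = 0"
 proof (rule ccontr)
 assume "c ~= 0"
 then have c: "c > 0" using c0 by simp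
 have "0 <= 2 * (-c/(d+1)) * c + (-c/(d+1))\<^sup>2 * d" using q[of "-c/(d+1)"] by (simp add: c_def d_def)
 also have "... = c\<^sup>2/(d+1)\<^sup>2 * (d - 2 * (d+1))"
 proof -
 have "2 * (-c/e) * c + (-c/e)\<^sup>2 * d = c\<^sup>2/e\<^sup>2 * (d - 2 * e)" if "e > 0" for e :: real
 using that by (simp add: field_simps power2_eq_square)
 then show ?thesis using d by simp
 qed
 also have "... < 0" using c d by (intro mult_pos_neg) auto
 finally show False by simp
 qed
 then have "v = 0\<^sub>v m" using scalar_prod_self_eq_0[OF v] by (simp add: c_def)
 then have "A *. x = mu \<cdot>\<^sub>v x"
 proof -
 assume v0: "v = 0\<^sub>v m"
 have "A *. x = v + mu \<cdot>\<^sub>v x" using A x by (auto simp: v_def)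
 then show ?thesis using v0 x by simp
 qed
 moreover have "x ~= 0\<^sub>v m" using xx by auto
 ultimately have "eigenvalue A mu" using A x by (auto simp: eigenvalue_def eigenvector_def)
 then show thesis using that le by blast
qed

text \<open>Converts the spectral bounds of the conditions into bounds on quadratic forms, the only form in
 which they are used.\<close>

lemma eigenvalues_in_form_bounds:
 assumes A: "A : cmat m m" "transpose_mat A = A" and e: "eigenvalues_in A l u"
 and y: "y : cvec m"
 shows "l * (y .* y) <= y .* (A *. y)" "y .* (A *. y) <= u * (y .* y)"
proof -
 have "l * (y .* y) <= y .* (A *. y) & y .* (A *. y) <= u * (y .* y)"
 proof (cases "m = 0")
 case True then show ?thesis using A y by (simp add: scalar_prod_def)
 next
 case False
 then have m: "m > 0" by simp
 obtain mu where mu: "eigenvalue A mu" "mu * (y .* y) <= y .* (A *. y)"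
 using symmetric_min_eigenvalue[OF A m] y by metis
 have mA: "- A : cmat m m" "transpose_mat (- A) = - A" using A by (auto simp: transpose_uminus)
 obtain \<nu> where \<nu>: "eigenvalue (- A) \<nu>" "\<nu> * (y .* y) <= y .* (- A *. y)"
 using symmetric_min_eigenvalue[OF mA m] y by metis
 from \<nu>(1) obtain z where z: "z : cvec m" "z ~= 0\<^sub>v m" "- A *. z = \<nu> \<cdot>\<^sub>v z"
 using A by (auto simp: eigenvalue_def eigenvector_def)
 have "A *. z = (- \<nu>) \<cdot>\<^sub>v z"
 proof -
 have "- (A *. z) = \<nu> \<cdot>\<^sub>v z" using A z by simp
 then have "- (- (A *. z)) = - (\<nu> \<cdot>\<^sub>v z)" by simp
 then show ?thesis by (auto intro!: eq_vecI)
 qed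
 then have "eigenvalue A (- \<nu>)" using A z by (auto simp: eigenvalue_def eigenvector_def)
 then have "- \<nu> <= u" "l <= mu" using e mu(1) by (auto simp: eigenvalues_in_def)
 moreover have "y .* (- A *. y) = - (y .* (A *. y))"
 proof -
 have "- A *. y = - (A *. y)"
 using A y by (intro eq_vecI) (auto simp: scalar_prod_def sum_negf)
 then show ?thesis using A y by simp
 qed
 ultimately show ?thesis using mu(2) \<nu>(2) mult_right_mono[of l mu "y .* y"]
 mult_right_mono[of "-\<nu>" u "y .* y"] by auto
 qed
 then show "l * (y .* y) <= y .* (A *. y)" "y .* (A *. y) <= u * (y .* y)" by auto
qed

lemma symmetric_form_bound_imp_norm_bound:
 assumes A: "A : cmat m m" "transpose_mat A = A"
 and b: "\<And>y. y : cvec m ==> \<bar>y .* (A *. y)\<bar> <= u * (y .* y)" and y: "y : cvec m"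
 shows "vnorm (A *. y) <= u * vnorm (y :: real vec)"
proof (cases "vnorm (A *. y) = 0 | vnorm y = 0")
 case True
 have "0 <= u * vnorm y"
 proof (cases "vnorm y = 0")
 case False
 have "0 <= u * (vnorm y)\<^sup>2" using b[OF y] by (simp add: vnorm_sq)
 then show ?thesis using False by (simp add: zero_le_mult_iff less_le)
 qed simp
 moreover have "vnorm y = 0 ==> vnorm (A *. y) = 0"
 using vnorm_eq_0_iff[OF y] A(1) vnorm_eq_0_iff[of "0\<^sub>v m" m] mult_mat_vec_zero[OF A(1)] by auto
 ultimately show ?thesis using True by auto
next
 case False
 define z where "z = A *. y"
 define s where "s = vnorm y / vnorm z"
 have s: "s > 0" using False by (simp add: s_def z_def less_le)
 have z: "z : cvec m" using A y by (simp add: z_def)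
 have e: "(y + t \<cdot>\<^sub>v z) .* (A *. (y + t \<cdot>\<^sub>v z)) = y .* z + 2 * t * (z .* z) + t\<^sup>2 * (z .* (A *. z))" for t
 using quadratic_form_add_smult[OF A y z, of t] by (simp add: z_def)
 have f: "(y + t \<cdot>\<^sub>v z) .* (y + t \<cdot>\<^sub>v z) = y .* y + 2 * t * (z .* y) + t\<^sup>2 * (z .* z)" for t
 using quadratic_form_add_smult[of "1\<^sub>m m" m y z t] y z by simp
 have "4 * s * (z .* z) = (y + s \<cdot>\<^sub>v z) .* (A *. (y + s \<cdot>\<^sub>v z)) - (y + (-s) \<cdot>\<^sub>v z) .* (A *. (y + (-s) \<cdot>\<^sub>v z))"
 unfolding e by simp
 also have "... <= u * ((y + s \<cdot>\<^sub>v z) .* (y + s \<cdot>\<^sub>v z)) + u * ((y + (-s) \<cdot>\<^sub>v z) .* (y + (-s) \<cdot>\<^sub>v z))"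
 using b[of "y + s \<cdot>\<^sub>v z"] b[of "y + (-s) \<cdot>\<^sub>v z"] y z by auto
 also have "... = 2 * u * (y .* y + s\<^sup>2 * (z .* z))" unfolding f by (simp add: algebra_simps)
 also have "... = 4 * u * (vnorm y)\<^sup>2"
 using False by (simp add: s_def z_def power_divide flip: vnorm_sq)
 finally have "4 * (vnorm y * vnorm z) <= 4 * (u * vnorm y * vnorm y)"
 using False by (simp add: s_def z_def power2_eq_square flip: vnorm_sq)
 then have "vnorm y * vnorm z <= vnorm y * (u * vnorm y)" by (simp add: ac_simps)
 then show ?thesis using False unfolding z_def by (simp add: less_le)
qed

lemma minv_inverse:
 assumes A: "A : cmat m m" and inj: "\<And>y. y : cvec m ==> A *. y = 0\<^sub>v m ==> y = 0\<^sub>v m"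
 shows "minv A : cmat m m" "A * minv A = 1\<^sub>m m" "minv A * A = 1\<^sub>m m"
proof -
 have "det A ~= 0" using det_0_iff_vec_prod_zero[OF A] inj by auto
 from det_non_zero_imp_unit[OF A this, of "()"] have "mat_inverse A ~= None"
 using mat_inverse(1)[OF A, of "()"] by auto
 then obtain B where "mat_inverse A = Some B" by auto
 from mat_inverse(2)[OF A this] this
 show "minv A : cmat m m" "A * minv A = 1\<^sub>m m" "minv A * A = 1\<^sub>m m"
 by (auto simp: minv_def)
qed

definition coercive :: "nat => real => real => real mat => bool" where
 "coercive m l u A \<longleftrightarrow> A : cmat m m & transpose_mat A = A & 0 < l &
 (ALL y:cvec m. l * (y .* y) <= y .* (A *. y) & y .* (A *. y) <= u * (y .* y))"

lemma eigenvalues_in_coercive: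
 "A : cmat m m ==> transpose_mat A = A ==> eigenvalues_in A l u ==> 0 < l ==> coercive m l u A"
 using eigenvalues_in_form_bounds by (auto simp: coercive_def)

lemma coercive_norm_le:
 assumes "coercive m l u A" "y : cvec m"
 shows "vnorm (A *. y) <= u * vnorm y"
proof -
 have "\<bar>y .* (A *. y)\<bar> <= u * (y .* y)" if "y : cvec m" for y
 proof -
 have "0 <= l * (y .* y)" using assms by (simp add: coercive_def)
 moreover have "l * (y .* y) <= y .* (A *. y)" "y .* (A *. y) <= u * (y .* y)"
 using assms that by (auto simp: coercive_def)
 ultimately show ?thesis by linarith
 qed
 then show ?thesis using assms symmetric_form_bound_imp_norm_bound by (auto simp: coercive_def)
qed

lemma coercive_minv:
 assumes "coercive m l u A"
 shows "minv A : cmat m m" "A * minv A = 1\<^sub>m m" "minv A * A = 1\<^sub>m m"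
proof -
 have A: "A : cmat m m" using assms by (simp add: coercive_def)
 have "y = 0\<^sub>v m" if "y : cvec m" "A *. y = 0\<^sub>v m" for y
 proof -
 have "l * (y .* y) <= 0" using assms that by (force simp: coercive_def)
 then have "y .* y = 0" using assms scalar_prod_self_nonneg[of y]
 by (auto simp: coercive_def mult_le_0_iff)
 then show ?thesis using scalar_prod_self_eq_0 that by auto
 qed
 from minv_inverse[OF A this]
 show "minv A : cmat m m" "A * minv A = 1\<^sub>m m" "minv A * A = 1\<^sub>m m" by auto
qed

lemma coercive_minv_vec:
 assumes "coercive m l u A" "x : cvec m"
 shows "minv A *. x : cvec m" "A *. (minv A *. x) = x" "minv A *. (A *. x) = x"
proof -
 note i = coercive_minv[OF assms(1)]
 have A: "A : cmat m m" using assms by (simp add: coercive_def)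
 show "minv A *. x : cvec m" "A *. (minv A *. x) = x" "minv A *. (A *. x) = x"
 using i A assms(2) assoc_mult_mat_vec[OF A i(1) assms(2)] assoc_mult_mat_vec[OF i(1) A assms(2)]
 by auto
qed

lemma coercive_minv_sym:
 assumes c: "coercive m l u A" and x: "x : cvec m" and y: "y : cvec m"
 shows "x .* (minv A *. y) = (minv A *. x) .* y"
proof -
 note v = coercive_minv_vec[OF c]
 have "x .* (minv A *. y) = (A *. (minv A *. x)) .* (minv A *. y)" using v x by simp
 also have "... = (minv A *. x) .* (A *. (minv A *. y))"
 using scalar_prod_sym_form[of A m "minv A *. x" "minv A *. y"] c v x y by (auto simp: coercive_def)
 finally show ?thesis using v y by simp
qed

lemma coercive_vnorm_ge:
 assumes c: "coercive m l u A" and y: "y : cvec m"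
 shows "l * vnorm y <= vnorm (A *. y)"
proof (cases "vnorm y = 0")
 case False
 have "l * vnorm y * vnorm y <= y .* (A *. y)"
 using c y by (auto simp: coercive_def power2_eq_square simp flip: vnorm_sq)
 also have "... <= vnorm y * vnorm (A *. y)"
 using abs_scalar_prod_le[of y m "A *. y"] c y by (auto simp: coercive_def)
 finally show ?thesis using False by (simp add: ac_simps less_le)
qed simp

lemma coercive_minv_vnorm:
 assumes c: "coercive m l u A" and x: "x : cvec m"
 shows "vnorm (minv A *. x) <= vnorm x / l"
 using coercive_vnorm_ge[OF c, of "minv A *. x"] coercive_minv_vec[OF c x] c
 by (auto simp: field_simps coercive_def)

lemma coercive_minv_form_ge:
 assumes c: "coercive m l u A" and x: "x : cvec m" and u: "0 < u"
 shows "l / u\<^sup>2 * (x .* x) <= x .* (minv A *. x)"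
proof -
 define y where "y = minv A *. x"
 have y: "y : cvec m" "A *. y = x" using coercive_minv_vec[OF c x] by (auto simp: y_def)
 have l: "0 < l" using c by (simp add: coercive_def)
 have "vnorm x <= u * vnorm y" using coercive_norm_le[OF c y(1)] y by simp
 then have "(vnorm x)\<^sup>2 <= (u * vnorm y)\<^sup>2" by (rule power_mono) simp
 then have "x .* x <= u\<^sup>2 * (y .* y)" by (simp add: power_mult_distrib vnorm_sq)
 then have "l / u\<^sup>2 * (x .* x) <= l * (y .* y)"
 using u l by (simp add: field_simps)
 also have "... <= y .* (A *. y)" using c y by (auto simp: coercive_def)
 also have "... = x .* y" using y x by (simp add: comm_scalar_prod[of _ m])
 finally show ?thesis by (simp add: y_def)
qed

lemma coercive_minv_form_le:
 assumes c: "coercive m l u A" and x: "x : cvec m"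
 shows "x .* (minv A *. x) <= (x .* x) / l" "\<bar>x .* (minv A *. x)\<bar> <= (x .* x) / l"
proof -
 have l: "0 < l" using c by (simp add: coercive_def)
 have "\<bar>x .* (minv A *. x)\<bar> <= vnorm x * vnorm (minv A *. x)"
 using abs_scalar_prod_le[of x m "minv A *. x"] coercive_minv_vec[OF c x] x by auto
 also have "... <= vnorm x * (vnorm x / l)"
 by (intro mult_left_mono coercive_minv_vnorm[OF c x]) simp
 finally show "\<bar>x .* (minv A *. x)\<bar> <= (x .* x) / l" by (simp add: power2_eq_square flip: vnorm_sq)
 then show "x .* (minv A *. x) <= (x .* x) / l" by auto
qed

text \<open>From the resolvent identity: the difference of two inverses is an inverse times the difference
 times an inverse.\<close>

lemma coercive_minv_diff:
 assumes cA: "coercive m l u A" and cB: "coercive m l u B"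
 and d: "\<And>v. v : cvec m ==> vnorm ((A - B) *. v) <= dl * vnorm v" and d0: "0 <= dl"
 and x: "x : cvec m" and y: "y : cvec m"
 shows "\<bar>x .* (minv A *. y) - x .* (minv B *. y)\<bar> <= dl / l\<^sup>2 * (vnorm x * vnorm y)"
proof -
 define a b where "a = minv A *. y" and "b = minv B *. x"
 have A: "A : cmat m m" "B : cmat m m" and l: "0 < l" using cA cB by (auto simp: coercive_def)
 have a: "a : cvec m" "A *. a = y" using coercive_minv_vec[OF cA y] by (auto simp: a_def)
 have b: "b : cvec m" "B *. b = x" using coercive_minv_vec[OF cB x] by (auto simp: b_def)
 have 1: "x .* (minv A *. y) = b .* (B *. a)"
 using scalar_prod_sym_form[of B m b a] cB a b by (simp add: coercive_def a_def)
 have 2: "x .* (minv B *. y) = b .* (A *. a)"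
 using coercive_minv_sym[OF cB x y] a by (simp add: b_def)
 have "b .* (A *. a) - b .* (B *. a) = b .* ((A - B) *. a)"
 using A a(1) b(1) scalar_prod_minus_distrib[of b m "A *. a" "B *. a"]
 by (simp add: minus_mult_distrib_mat_vec)
 then have "\<bar>x .* (minv A *. y) - x .* (minv B *. y)\<bar> = \<bar>b .* ((A - B) *. a)\<bar>"
 unfolding 1 2 by linarith
 also have "... <= vnorm b * vnorm ((A - B) *. a)"
 using A a(1) b(1) by (intro abs_scalar_prod_le[of _ m] mult_mat_vec_carrier[of _ m m]) auto
 also have "... <= (vnorm x / l) * (dl * (vnorm y / l))"
 using coercive_minv_vnorm[OF cB x] coercive_minv_vnorm[OF cA y] d[OF a(1)] d0 l
 by (intro mult_mono order_trans[OF d[OF a(1)] mult_left_mono]) (auto simp: a_def b_def)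
 finally show ?thesis by (simp add: power2_eq_square field_simps)
qed

lemma vnorm_mult_mat_vec_le_entries:
 assumes A: "A : cmat k m" and e: "\<And>i j. i < k ==> j < m ==> \<bar>A $$ (i,j)\<bar> <= dl"
 and x: "x : cvec m"
 shows "vnorm (A *. x) <= real k * real m * dl * vnorm x"
proof -
 have "vnorm (A *. x) <= (\<Sum>i<k. \<bar>(A *. x) $ i\<bar>)" using vnorm_le_sum_abs[of "A *. x"] A by simp
 also have "... <= (\<Sum>i<k. \<Sum>j<m. dl * vnorm x)"
 proof (rule sum_mono)
 fix i assume i: "i : {..<k}"
 have "\<bar>(A *. x) $ i\<bar> <= (\<Sum>j<m. \<bar>A $$ (i,j)\<bar> * \<bar>x $ j\<bar>)"
 using A x i by (auto simp: scalar_prod_def lessThan_atLeast0 abs_mult[symmetric] intro!: sum_abs)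
 also have "... <= (\<Sum>j<m. dl * vnorm x)"
 proof (rule sum_mono)
 fix j assume j: "j : {..<m}"
 have "0 <= dl" using order_trans[OF abs_ge_zero e[of i j]] i j by simp
 then show "\<bar>A $$ (i,j)\<bar> * \<bar>x $ j\<bar> <= dl * vnorm x"
 using e[of i j] i j x abs_component_le_vnorm[of j x] by (intro mult_mono) auto
 qed
 finally show "\<bar>(A *. x) $ i\<bar> <= (\<Sum>j<m. dl * vnorm x)" .
 qed
 finally show ?thesis by (simp add: ac_simps)
qed

lemma vnorm_mult_mat_vec_le_op_norm:
 assumes A: "A : cmat k m" and x: "x : cvec m"
 shows "vnorm (A *. x) <= op_norm A * vnorm x"
proof (cases "vnorm x = 0")
 case True
 then have "x = 0\<^sub>v m" using vnorm_eq_0_iff[OF x] by simp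
 then show ?thesis using A vnorm_eq_0_iff[of "0\<^sub>v k" k] mult_mat_vec_zero[OF A] True by simp
next
 case False
 define dl where "dl = (\<Sum>i<k. \<Sum>j<m. \<bar>A $$ (i,j)\<bar>)"
 have e: "\<bar>A $$ (i,j)\<bar> <= dl" if "i < k" "j < m" for i j
 proof -
 have "\<bar>A $$ (i,j)\<bar> <= (\<Sum>j<m. \<bar>A $$ (i,j)\<bar>)" using that by (intro member_le_sum) auto
 also have "... <= dl" unfolding dl_def using that
 by (intro member_le_sum[where f="%i. \<Sum>j<m. \<bar>A $$ (i,j)\<bar>"]) (auto intro: sum_nonneg)
 finally show ?thesis .
 qed
 define x' where "x' = (1 / vnorm x) \<cdot>\<^sub>v x"
 have x': "x' : cvec m" "vnorm x' = 1" using x False by (auto simp: x'_def vnorm_smult)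
 have "vnorm (A *. x') <= op_norm A"
 unfolding op_norm_def
 proof (rule cSUP_upper)
 show "x' : {u : cvec (dim_col A). vnorm u = 1}" using x' A by simp
 show "bdd_above ((%u. vnorm (A *. u)) ` {u : cvec (dim_col A). vnorm u = 1})"
 using vnorm_mult_mat_vec_le_entries[OF A e] A
 by (intro bdd_aboveI[of _ "real k * real m * dl"]) force
 qed
 moreover have "A *. x' = (1 / vnorm x) \<cdot>\<^sub>v (A *. x)" using A x by (simp add: x'_def mult_mat_vec)
 ultimately show ?thesis using False by (simp add: vnorm_smult field_simps less_le)
qed

lemma entry_eq_unit_form:
 assumes "A : cmat k m" "i < k" "j < m"
 shows "A $$ (i,j) = unit_vec k i .* (A *. (unit_vec m j :: real vec))"
 using assms by simp

lemma vnorm_unit_vec: "i < k ==> vnorm (unit_vec k i) = 1"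
 by (simp add: vnorm_def)

lemma coercive_entry_le:
 assumes c: "coercive m l u A" and "i < m" "j < m"
 shows "\<bar>A $$ (i,j)\<bar> <= u"
proof -
 have A: "A : cmat m m" using c by (simp add: coercive_def)
 have "\<bar>A $$ (i,j)\<bar> <= vnorm (unit_vec m i) * vnorm (A *. unit_vec m j)"
 unfolding entry_eq_unit_form[OF A assms(2,3)] using A by (intro abs_scalar_prod_le[of _ m]) auto
 also have "... <= u" using coercive_norm_le[OF c, of "unit_vec m j"] assms by (simp add: vnorm_unit_vec)
 finally show ?thesis .
qed

section \<open>Lebesgue measure on coordinate subspaces\<close>

definition coord_embed :: "nat set => (nat => real) => nat => real" where
 "coord_embed M x = (%j. if j : M then x j else 0)"

lemma coord_lebesgue_eq: "cleb M = distr (PiM M (%_. lborel)) borel (coord_embed M)"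
 by (simp add: coord_lebesgue_def coord_embed_def[abs_def])

lemma measurable_coord_embed [measurable]:
 "coord_embed M : PiM M (%_. lborel) \<rightarrow>\<^sub>M borel"
proof (rule meas_coord)
 fix j
 show "(%x. coord_embed M x j) : borel_measurable (PiM M (%_. lborel))"
 proof (cases "j : M")
 case True
 then have "(%x. x j) : PiM M (%_. lborel) \<rightarrow>\<^sub>M (lborel :: real measure)"
 by (rule measurable_component_singleton)
 then show ?thesis using True by (simp add: coord_embed_def)
 qed (simp add: coord_embed_def)
qed

lemma space_coord_lebesgue [simp]: "space (cleb M) = UNIV"
 and sets_coord_lebesgue [simp, measurable_cong]: "sets (cleb M) = sets borel"
 by (simp_all add: coord_lebesgue_eq)

lemma nn_integral_coord_lebesgue:
 "f : bmb ==>
 (NI (cleb M) (%x. f x)) = (NI (PiM M (%_. lborel)) (%x. f (coord_embed M x)))"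
 unfolding coord_lebesgue_eq by (rule nn_integral_distr[OF measurable_coord_embed]) auto

lemma AE_coord_lebesgue_support: "AE x in cleb M. ALL j. j \<notin> M --> x j = 0"
 unfolding coord_lebesgue_eq
proof (subst AE_distr_iff)
 show "{x : space borel. ALL j. j \<notin> M --> x j = (0::real)} : sets borel" by measurable
qed (auto simp: coord_embed_def)

lemma emeasure_coord_cube:
 assumes "finite M" "0 <= c"
 shows "emeasure (cleb M) {x. ALL j:M. \<bar>x j\<bar> <= c} = enn ((2 * c) ^ card M)"
proof -
 interpret product_sigma_finite "%_::nat. lborel :: real measure" by standard
 have m: "{x. ALL j:M. \<bar>x j\<bar> <= c} : sets (borel :: (nat => real) measure)"
 using assms by measurable
 have "coord_embed M -` {x. ALL j:M. \<bar>x j\<bar> <= c} \<inter> space (PiM M (%_. lborel :: real measure))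
 = PiE M (%_. {-c..c})"
 by (auto simp: coord_embed_def space_PiM PiE_def Pi_def abs_le_iff)
 then show ?thesis unfolding coord_lebesgue_eq using assms m
 by (subst emeasure_distr) (auto simp: emeasure_PiM ennreal_power)
qed

lemma sigma_finite_coord_lebesgue: "finite M ==> sigma_finite_measure (cleb M)"
proof
 assume M: "finite M"
 let ?A = "%k::nat. {x. ALL j:M. \<bar>x j\<bar> <= real k}"
 have "x : (\<Union>k. ?A k)" for x
 proof -
 obtain k :: nat where k: "(\<Sum>j\<in>M. \<bar>x j\<bar>) <= real k" using real_arch_simple by blast
 have "\<bar>x j\<bar> <= real k" if "j : M" for j
 using member_le_sum[of j M "%j. \<bar>x j\<bar>"] that M k by auto
 then show ?thesis by auto
 qed
 moreover have "?A k : sets borel" for k using M by measurable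
 ultimately show "\<exists>A. countable A & A <= sets (cleb M) & \<Union> A = space (cleb M) &
 (ALL a:A. emeasure (cleb M) a ~= \<infinity>)"
 using M by (intro exI[of _ "range ?A"]) (auto simp: emeasure_coord_cube)
qed

lemma emeasure_lborel_affine_vimage:
 assumes s: "s > 0" and A: "A : sets borel"
 shows "emeasure lborel A = enn s * emeasure lborel ((%x. s * (x - a)) -` A :: real set)"
proof -
 have m: "(%x. s * (x - a)) -` A : sets lborel"
 using measurable_sets[of "%x. s * (x - a)" borel borel A] A by simp
 have "emeasure lborel A = (NI lborel (%x. indicator A x))" using A by simp
 also have "... = enn \<bar>s\<bar> * (NI lborel (%x. indicator A ((- s * a) + s * x)))"
 using s A by (intro nn_integral_real_affine) auto
 also have "(NI lborel (%x. indicator A ((- s * a) + s * x))) =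
 (NI lborel (%x. indicator ((%x. s * (x - a)) -` A) x))"
 by (intro nn_integral_cong) (auto simp: indicator_def algebra_simps)
 finally show ?thesis using s m by simp
qed

lemma PiM_lborel_affine:
 fixes M :: "nat set"
 assumes M: "finite M" and s: "s > 0"
 shows "distr (PiM M (%_. lborel)) (PiM M (%_. lborel)) (%x. \<lambda>j\<in>M. s * (x j - a j)) =
 scale_measure (enn (1 / s ^ card M)) (PiM M (%_. lborel :: real measure))"
 (is "?D = _")
proof -
 interpret product_sigma_finite "%_::nat. lborel :: real measure" by standard
 let ?T = "%x. \<lambda>j\<in>M. s * (x j - a j)"
 have T: "?T : PiM M (%_. lborel) \<rightarrow>\<^sub>M PiM M (%_. lborel)"
 by (rule measurable_restrict) measurable
 have em: "emeasure (scale_measure (enn (s ^ card M)) ?D) (PiE M A) = (\<Prod>i\<in>M. emeasure lborel (A i))"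
 if A: "\<And>i. i : M ==> A i : sets (lborel :: real measure)" for A
 proof -
 have "?T -` PiE M A \<inter> space (PiM M (%_. lborel :: real measure)) = PiE M (%i. (%x. s * (x - a i)) -` A i)"
 by (auto simp: space_PiM PiE_def Pi_def)
 moreover have "(%x. s * (x - a i)) -` A i : sets lborel" if "i : M" for i
 using measurable_sets[of "%x. s * (x - a i)" borel borel "A i"] A[OF that] by simp
 ultimately have "emeasure ?D (PiE M A) = (\<Prod>i\<in>M. emeasure lborel ((%x. s * (x - a i)) -` A i))"
 using A M by (subst emeasure_distr[OF T]) (auto intro!: sets_PiM_I_finite simp: emeasure_PiM)
 then have "emeasure (scale_measure (enn (s ^ card M)) ?D) (PiE M A) =
 (\<Prod>i\<in>M. enn s) * (\<Prod>i\<in>M. emeasure lborel ((%x. s * (x - a i)) -` A i))"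
 using s by (simp add: ennreal_power)
 also have "... = (\<Prod>i\<in>M. emeasure lborel (A i))"
 unfolding prod.distrib[symmetric] using A s
 by (intro prod.cong refl) (simp add: emeasure_lborel_affine_vimage[symmetric])
 finally show ?thesis .
 qed
 have "scale_measure (enn (s ^ card M)) ?D = PiM M (%_. lborel)"
 using PiM_eqI[OF M _ em] by simp
 then have "scale_measure (enn (1 / s ^ card M)) (scale_measure (enn (s ^ card M)) ?D) =
 scale_measure (enn (1 / s ^ card M)) (PiM M (%_. lborel))" by simp
 moreover have "enn (1 / s ^ card M) * enn (s ^ card M) = 1"
 using s by (simp flip: ennreal_mult)
 ultimately show ?thesis by simp
qed

text \<open>The substitution behind the local coordinate: each of the coordinates in M contributes one factor
 s.\<close>

lemma nn_integral_coord_affine: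
 assumes M: "finite M" and s: "s > 0" and f: "f : bmb"
 and a: "\<And>j. j \<notin> M ==> a j = 0"
 shows "(NI (cleb M) (%x. f (%j. s * (x j - a j)))) =
 enn (1 / s ^ card M) * (NI (cleb M) (%x. f x))"
proof -
 let ?P = "PiM M (%_. lborel :: real measure)" and ?T = "%x. \<lambda>j\<in>M. s * (x j - a j)"
 have T: "?T : ?P \<rightarrow>\<^sub>M ?P" by (rule measurable_restrict) measurable
 have m: "(%x j. s * (x j - a j)) : borel_measurable (borel :: (nat => real) measure)"
 by (rule meas_coord) measurable
 have "(NI (cleb M) (%x. f (%j. s * (x j - a j)))) =
 (NI ?P (%x. f (%j. s * (coord_embed M x j - a j))))"
 by (rule nn_integral_coord_lebesgue) (rule mcomp[OF m f])
 also have "... = (NI ?P (%x. f (coord_embed M (?T x))))"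
 using a by (intro nn_integral_cong arg_cong[where f=f]) (auto simp: coord_embed_def)
 also have "... = (NI (distr ?P ?P ?T) (%y. f (coord_embed M y)))"
 using f by (subst nn_integral_distr[OF T]) (auto intro: mcomp[OF measurable_coord_embed])
 also have "... = enn (1 / s ^ card M) * (NI ?P (%y. f (coord_embed M y)))"
 unfolding PiM_lborel_affine[OF M s]
 by (rule nn_integral_scale_measure) (rule mcomp[OF measurable_coord_embed f])
 finally show ?thesis using nn_integral_coord_lebesgue[OF f] by simp
qed

definition nrm :: "nat => (nat => real) => real" where
 "nrm p x = vnorm (vec p x)"

lemma nrm_eq: "nrm p x = sqrt (\<Sum>j<p. (x j)\<^sup>2)"
 by (simp add: nrm_def vnorm_L2 L2_set_def)

lemma nrm_nonneg [simp]: "0 <= nrm p x"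
 by (simp add: nrm_def)

lemma measurable_nrm [measurable]: "nrm p : bmb"
 unfolding nrm_eq[abs_def] by measurable

lemma abs_le_nrm: "j < p ==> \<bar>x j\<bar> <= nrm p x"
 using abs_component_le_vnorm[of j "vec p x"] by (simp add: nrm_def)

text \<open>Dyadic shells reduce the integral of an inverse power to the volumes of cubes.\<close>

lemma inverse_power_le_dyadic:
 fixes r :: real assumes "r >= 0"
 obtains j where "r <= 2 ^ j" "1 / (1 + r ^ q) <= 2 ^ q * (1 / 2 ^ j) ^ q"
proof -
 obtain j0 where "r <= 2 ^ j0"
 using real_arch_pow[of 2 r] by (auto intro: less_imp_le)
 define j where "j = (LEAST j. r <= 2 ^ j)"
 have j: "r <= 2 ^ j" unfolding j_def by (rule LeastI) fact
 have "1 / (1 + r ^ q) <= 2 ^ q * (1 / 2 ^ j) ^ q"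
 proof (cases j)
 case 0
 have "1 / (1 + r ^ q) <= 1" using assms by (simp add: divide_simps)
 also have "1 <= (2::real) ^ q" by simp
 finally show ?thesis using 0 by simp
 next
 case (Suc i)
 have "\<not> r <= 2 ^ i" using not_less_Least[of i "%j. r <= 2 ^ j"] Suc by (auto simp: j_def)
 then have "(2 ^ i) ^ q <= r ^ q" by (intro power_mono) auto
 then have "1 / (1 + r ^ q) <= 1 / (2 ^ i) ^ q"
 using assms by (intro divide_left_mono mult_pos_pos add_pos_nonneg) auto
 also have "... = 2 ^ q * (1 / 2 ^ j) ^ q" using Suc by (simp add: power_mult_distrib power_divide)
 finally show ?thesis .
 qed
 with j that show thesis by blast
qed

lemma nn_integral_inverse_power_le:
 assumes M: "M <= {..<p}" and q: "card M < q"
 shows "(NI (cleb M) (%x. enn (1 / (1 + nrm p x ^ q)))) <= enn (2 ^ (q + card M + 1))"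
proof -
 have fin: "finite M" using M finite_subset by blast
 let ?B = "%j::nat. {x::nat => real. ALL i:M. \<bar>x i\<bar> <= 2 ^ j}"
 have [measurable]: "?B j : sets borel" for j using fin by measurable
 let ?g = "%j x. enn (2 ^ q * (1 / 2 ^ j) ^ q) * indicator (?B j) x :: ennreal"
 have "(NI (cleb M) (%x. enn (1 / (1 + nrm p x ^ q)))) <= (NI (cleb M) (%x. (\<Sum>j. ?g j x)))"
 proof (rule nn_integral_mono)
 fix x
 obtain j where j: "nrm p x <= 2 ^ j" "1 / (1 + nrm p x ^ q) <= 2 ^ q * (1 / 2 ^ j) ^ q"
 using inverse_power_le_dyadic[of "nrm p x" q] by auto
 have "x : ?B j"
 proof (clarify)
 fix i assume "i : M"
 then have "\<bar>x i\<bar> <= nrm p x" using M by (intro abs_le_nrm) auto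
 then show "\<bar>x i\<bar> <= 2 ^ j" using j by linarith
 qed
 then have "enn (1 / (1 + nrm p x ^ q)) <= ?g j x" using j by (simp add: ennreal_leI)
 also have "... <= (\<Sum>j. ?g j x)"
 using sum_le_suminf[of "%j. ?g j x" "{j}"]
 by (simp only: sum.insert sum.empty finite.emptyI finite_insert summableI zero_le
 add_0_right simp_thms empty_iff)
 finally show "enn (1 / (1 + nrm p x ^ q)) <= (\<Sum>j. ?g j x)" .
 qed
 also have "... = (\<Sum>j. \<integral>\<^sup>+x. ?g j x \<partial>cleb M)"
 by (intro nn_integral_suminf) measurable
 also have "... <= (\<Sum>j. enn (2 ^ (q + card M) * (1 / 2) ^ j))"
 proof (intro suminf_le summableI)
 fix j :: nat
 have "(NI (cleb M) (%x. ?g j x)) = enn (2 ^ q * (1 / 2 ^ j) ^ q) * enn ((2 * 2 ^ j) ^ card M)"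
 using fin by (simp add: nn_integral_cmult emeasure_coord_cube)
 also have "... = enn (2 ^ q * (1 / 2 ^ j) ^ q * (2 * 2 ^ j) ^ card M)"
 by (simp add: ennreal_mult)
 also have "... <= enn (2 ^ (q + card M) * (1 / 2) ^ j)"
 proof (rule ennreal_leI)
 have "(1 / 2 ^ j) ^ q * (2 ^ j) ^ card M = (1 / 2 ^ j) ^ (q - card M) * ((1::real) / 2 ^ j * 2 ^ j) ^ card M"
 using q by (subst power_mult_distrib) (simp add: power_add[symmetric] mult.assoc[symmetric])
 also have "... <= (1 / 2 ^ j) ^ 1" using q power_decreasing[of 1 "q - card M" "(1::real) / 2 ^ j"]
 by (simp add: divide_simps)
 finally have "(1 / 2 ^ j) ^ q * (2 ^ j) ^ card M <= ((1::real) / 2 ^ j) ^ 1" .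
 then have "2 ^ (q + card M) * ((1 / 2 ^ j) ^ q * (2 ^ j) ^ card M) <= 2 ^ (q + card M) * (((1::real) / 2 ^ j) ^ 1)"
 by (rule mult_left_mono) simp
 moreover have "2 ^ q * (1 / 2 ^ j) ^ q * (2 * 2 ^ j) ^ card M =
 2 ^ (q + card M) * (((1::real) / 2 ^ j) ^ q * (2 ^ j) ^ card M)"
 by (simp only: power_mult_distrib power_add mult_ac)
 moreover have "((1::real) / 2 ^ j) ^ 1 = (1 / 2) ^ j" by (simp add: power_one_over)
 ultimately show "2 ^ q * (1 / 2 ^ j) ^ q * (2 * 2 ^ j) ^ card M <= (2::real) ^ (q + card M) * (1 / 2) ^ j"
 by (simp only:)
 qed
 finally show "(NI (cleb M) (%x. ?g j x)) <= enn (2 ^ (q + card M) * (1 / 2) ^ j)" .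
 qed
 also have "... = enn (2 ^ (q + card M) * 2)"
 by (intro suminf_ennreal_eq sums_mult) (auto intro: geometric_sums[of "1/2::real", simplified])
 finally show ?thesis by (simp add: mult.commute)
qed

lemma vec_linear_image_add:
 assumes F: "F : cmat p p"
 shows "zero_pad (F *. vec p (%j. x j + y j)) = (%j. zero_pad (F *. vec p x) j + zero_pad (F *. vec p y) j)"
proof -
 have "vec p (%j. x j + y j) = vec p x + vec p y" by auto
 then show ?thesis using F by (auto simp: zero_pad_def mult_add_distrib_mat_vec)
qed

lemma measurable_zero_pad_linear [measurable]:
 "(%x. zero_pad (F *. vec p x)) : bmb"
proof (rule meas_coord)
 fix i
 show "(%x. zero_pad (F *. vec p x) i) : bmb"
 by (cases "i < dim_row F") (auto simp: zero_pad_def scalar_prod_def)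
qed

lemma nn_integral_coord_translate:
 assumes f: "f : bmb" and a: "a : euclid p"
 shows "(NI (cleb {..<p}) (%x. f (%j. x j + a j))) = (NI (cleb {..<p}) (%x. f x))"
 using nn_integral_coord_affine[of "{..<p}" 1 f "%j. - a j"] f a by (auto simp: euclid_def)

text \<open>Lebesgue measure is determined up to a factor by translation invariance. Evaluating a double
 integral of f (x + L y) g in both orders shows this without a determinant, and a Gaussian g then
 identifies the factor as a ratio of Gaussian integrals.\<close>

lemma nn_integral_linear_exchange:
 assumes F: "F : cmat p p" and Fi: "Fi : cmat p p" "F * Fi = 1\<^sub>m p"
 and f[measurable]: "f : bmb" and g[measurable]: "g : bmb"
 defines "L == %x. zero_pad (F *. vec p x)"
 shows "(NI (cleb {..<p}) (%x. f (L x))) * (NI (cleb {..<p}) (%y. g y)) =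
 (NI (cleb {..<p}) (%x. g (%j. - L x j))) * (NI (cleb {..<p}) (%y. f y))"
proof -
 let ?mu = "cleb {..<p}"
 interpret sigma_finite_measure ?mu by (rule sigma_finite_coord_lebesgue) simp
 interpret pair_sigma_finite ?mu ?mu by standard
 have L[measurable]: "L : bmb" unfolding L_def by measurable
 have Lc[measurable]: "(%x. L x j) : bmb" for j
 by (rule measurable_product_then_coordinatewise) measurable
 have Le: "L x : euclid p" for x using F by (auto simp: L_def zero_pad_def euclid_def)
 have La: "L (%j. x j + y j) = (%j. L x j + L y j)" for x y
 unfolding L_def by (rule vec_linear_image_add[OF F])
 define Li where "Li y = zero_pad (Fi *. vec p y)" for y
 have LiE: "Li y : euclid p" for y using Fi by (auto simp: Li_def zero_pad_def euclid_def)
 have LLi: "L (Li y) = y" if "y : euclid p" for y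
 proof -
 have "vec p (Li y) = Fi *. vec p y" using Fi by (auto simp: Li_def zero_pad_def)
 then have "F *. vec p (Li y) = vec p y"
 using assoc_mult_mat_vec[OF F Fi(1), of "vec p y"] Fi(2) by simp
 then show ?thesis using that F by (auto simp: L_def zero_pad_def euclid_def fun_eq_iff)
 qed
 have m1: "(%(x,y). %j. y j - L x j) : borel_measurable (?mu \<Otimes>\<^sub>M ?mu)"
 unfolding split_beta'
 by (rule meas_coord, intro borel_measurable_diff borel_measurable_add
 mcomp[OF measurable_fst] mcomp[OF measurable_snd]) (simp_all add: measurable_cong_sets[OF sets_coord_lebesgue refl])
 have m2: "(%(x,y). %j. L x j + y j) : borel_measurable (?mu \<Otimes>\<^sub>M ?mu)"
 unfolding split_beta'
 by (rule meas_coord, intro borel_measurable_diff borel_measurable_add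
 mcomp[OF measurable_fst] mcomp[OF measurable_snd]) (simp_all add: measurable_cong_sets[OF sets_coord_lebesgue refl])
 have [measurable]: "(%x. g (%j. y j - L x j)) : bmb" for y
 by (rule mcomp[OF _ g], rule meas_coord) measurable
 have [measurable]: "(%y. g (%j. y j - L x j)) : bmb" for x
 by (rule mcomp[OF _ g], rule meas_coord) measurable
 have [measurable]: "(%x. g (%j. - L x j)) : bmb"
 by (rule mcomp[OF _ g], rule meas_coord) measurable
 have [measurable]: "(%y. f (%j. L x j + y j)) : bmb" for x
 by (rule mcomp[OF _ f], rule meas_coord) measurable
 have mf: "(%y. f (%j. y j + L x j)) : bmb" for x
 by (rule mcomp[OF _ f], rule meas_coord) measurable
 have [measurable]: "(%(x,y). f (L x) * g (%j. y j - L x j)) : borel_measurable (?mu \<Otimes>\<^sub>M ?mu)"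
 using mcomp[OF m1 g] by (simp add: split_beta')
 have [measurable]: "(%(x,y). f (%j. L x j + y j) * g (%j. - L x j)) : borel_measurable (?mu \<Otimes>\<^sub>M ?mu)"
 using mcomp[OF m2 f] by (simp add: split_beta')
 have "(NI ?mu (%x. f (L x))) * (NI ?mu (%y. g y)) = (\<integral>\<^sup>+x. \<integral>\<^sup>+y. f (L x) * g y \<partial>?mu \<partial>?mu)"
 by (simp add: nn_integral_cmult nn_integral_multc)
 also have "... = (\<integral>\<^sup>+x. \<integral>\<^sup>+y. f (L x) * g (%j. y j - L x j) \<partial>?mu \<partial>?mu)"
 proof (rule nn_integral_cong)
 fix x
 have "(%j. - L x j) : euclid p" using Le[of x] by (auto simp: euclid_def)
 from nn_integral_coord_translate[OF g this]
 show "(NI ?mu (%y. f (L x) * g y)) = (NI ?mu (%y. f (L x) * g (%j. y j - L x j)))"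
 by (simp add: nn_integral_cmult)
 qed
 also have "... = (\<integral>\<^sup>+y. \<integral>\<^sup>+x. f (L x) * g (%j. y j - L x j) \<partial>?mu \<partial>?mu)"
 using Fubini'[of "%x y. f (L x) * g (%j. y j - L x j)"] by (simp add: split_beta')
 also have "... = (\<integral>\<^sup>+y. \<integral>\<^sup>+x. f (%j. L x j + y j) * g (%j. - L x j) \<partial>?mu \<partial>?mu)"
 proof (rule nn_integral_cong_AE)
 show "AE y in ?mu. (NI ?mu (%x. f (L x) * g (%j. y j - L x j))) =
 (NI ?mu (%x. f (%j. L x j + y j) * g (%j. - L x j)))"
 using AE_coord_lebesgue_support
 proof eventually_elim
 case (elim y)
 then have y: "y : euclid p" by (auto simp: euclid_def)
 have "(NI ?mu (%x. f (L x) * g (%j. y j - L x j))) =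
 (NI ?mu (%x. f (L (%j. x j + Li y j)) * g (%j. y j - L (%j. x j + Li y j) j)))"
 by (rule nn_integral_coord_translate[OF _ LiE, symmetric]) measurable
 also have "... = (NI ?mu (%x. f (%j. L x j + y j) * g (%j. - L x j)))"
 unfolding La LLi[OF y] by simp
 finally show ?case .
 qed
 qed
 also have "... = (\<integral>\<^sup>+x. \<integral>\<^sup>+y. f (%j. L x j + y j) * g (%j. - L x j) \<partial>?mu \<partial>?mu)"
 using Fubini'[of "%x y. f (%j. L x j + y j) * g (%j. - L x j)"] by (simp add: split_beta')
 also have "... = (\<integral>\<^sup>+x. (NI ?mu (%y. f y)) * g (%j. - L x j) \<partial>?mu)"
 proof (rule nn_integral_cong)
 fix x
 have "(NI ?mu (%y. f (%j. y j + L x j))) = (NI ?mu (%y. f y))"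
 by (rule nn_integral_coord_translate[OF f Le])
 then show "(NI ?mu (%y. f (%j. L x j + y j) * g (%j. - L x j))) = (NI ?mu (%y. f y)) * g (%j. - L x j)"
 by (subst nn_integral_multc) (simp_all add: add.commute[of "L x _"] measurable_cong_sets[OF sets_coord_lebesgue refl] mf)
 qed
 also have "... = (NI ?mu (%x. g (%j. - L x j))) * (NI ?mu (%y. f y))"
 by (simp add: nn_integral_cmult mult.commute)
 finally show ?thesis .
qed

section \<open>Gaussian integrals and the density of the studentised estimator\<close>

text \<open>The normalising integral of exp (- x A x / 2). It takes the place of the determinant of A, with
 which it agrees up to a constant and a power.\<close>

definition gauss_int :: "nat => real mat => ennreal" where
 "gauss_int p A = (NI (cleb {..<p}) (%x. enn (exp (- (vec p x .* (A *. vec p x)) / 2))))"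

lemma exp_minus_le_inverse_power:
 assumes "c > 0" "r >= (0::real)"
 shows "exp (- c * r) <= (1 + fact q / c ^ q) / (1 + r ^ q)"
proof -
 have "(c * r) ^ q / fact q <= exp (c * r)"
 proof -
 have "(c * r) ^ q / fact q = (\<Sum>k\<in>{q}. inverse (fact k) * (c * r) ^ k)" by (simp add: divide_simps)
 also have "... <= (\<Sum>k. inverse (fact k) * (c * r) ^ k)"
 using assms summable_exp[of "c * r"] by (intro sum_le_suminf) auto
 finally show ?thesis by (simp add: exp_def)
 qed
 then have "r ^ q <= fact q / c ^ q * exp (c * r)"
 using assms by (simp add: power_mult_distrib field_simps)
 moreover have "1 <= exp (c * r)" using assms by (simp add: zero_le_mult_iff)
 ultimately have "1 + r ^ q <= exp (c * r) + fact q / c ^ q * exp (c * r)" by (rule add_mono[rotated])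
 then have "1 + r ^ q <= (1 + fact q / c ^ q) * exp (c * r)" by (simp only: distrib_right mult_1)
 then show ?thesis using assms by (simp add: exp_minus field_simps add_pos_nonneg)
qed

lemma gauss_le_exp: "0 <= c ==> exp (- c * r\<^sup>2) <= exp c * exp (- c * (r::real))"
proof -
 assume c: "0 <= c"
 have "0 <= (r - 1/2)\<^sup>2" by simp
 then have "r <= 1 + r\<^sup>2" by (simp add: power2_eq_square algebra_simps)
 then have "c * r <= c * (1 + r\<^sup>2)" using c by (rule mult_left_mono)
 then show ?thesis by (simp add: exp_add[symmetric] algebra_simps)
qed

lemma gauss_le_inverse_power:
 assumes "c > 0" "r >= (0::real)"
 shows "exp (- c * r\<^sup>2) <= exp c * (1 + fact q / c ^ q) / (1 + r ^ q)"
proof -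
 have "exp (- c * r\<^sup>2) <= exp c * exp (- c * r)" using assms by (intro gauss_le_exp) simp
 also have "... <= exp c * ((1 + fact q / c ^ q) / (1 + r ^ q))"
 by (intro mult_left_mono exp_minus_le_inverse_power assms) simp
 finally show ?thesis by simp
qed

lemma measurable_quadratic_form [measurable]:
 assumes "(A :: real mat) : cmat p p"
 shows "(%x. vec p x .* (A *. vec p x)) : bmb"
 unfolding quadratic_form_sum[OF assms] by measurable

lemma nrm_sq: "vec p x .* vec p x = (nrm p x)\<^sup>2"
 by (simp add: nrm_def vnorm_sq)

lemma gauss_int_le:
 assumes c: "coercive p l u A"
 shows "gauss_int p A <= enn (exp (l/2) * (1 + fact (p+1) / (l/2) ^ (p+1)) * 2 ^ (2 * p + 2))"
proof -
 have l: "l > 0" using c by (simp add: coercive_def)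
 let ?K = "exp (l/2) * (1 + fact (p+1) / (l/2) ^ (p+1))"
 have "gauss_int p A <= (NI (cleb {..<p}) (%x. ennreal ?K * enn (1 / (1 + nrm p x ^ (p+1)))))"
 unfolding gauss_int_def
 proof (rule nn_integral_mono)
 fix x
 have "l * (nrm p x)\<^sup>2 <= vec p x .* (A *. vec p x)"
 using c by (auto simp: coercive_def nrm_sq[symmetric])
 then have "exp (- (vec p x .* (A *. vec p x)) / 2) <= exp (- (l/2) * (nrm p x)\<^sup>2)" by simp
 also have "... <= ?K * (1 / (1 + nrm p x ^ (p+1)))"
 using gauss_le_inverse_power[of "l/2" "nrm p x" "p+1"] l by simp
 finally show "enn (exp (- (vec p x .* (A *. vec p x)) / 2)) <= ennreal ?K * enn (1 / (1 + nrm p x ^ (p+1)))"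
 using l by (subst ennreal_mult[symmetric]) (auto intro!: ennreal_leI mult_nonneg_nonneg add_nonneg_nonneg)
 qed
 also have "... = ennreal ?K * (NI (cleb {..<p}) (%x. enn (1 / (1 + nrm p x ^ (p+1)))))"
 by (rule nn_integral_cmult) measurable
 also have "... <= ennreal ?K * enn (2 ^ (p + 1 + card {..<p} + 1))"
 by (intro mult_left_mono nn_integral_inverse_power_le) auto
 also have "p + 1 + card {..<p} + 1 = 2 * p + 2" by simp
 also have "ennreal ?K * enn (2 ^ (2 * p + 2)) = enn (?K * 2 ^ (2 * p + 2))"
 using l by (intro ennreal_mult[symmetric] mult_nonneg_nonneg add_nonneg_nonneg divide_nonneg_nonneg) simp_all
 finally show ?thesis .
qed

lemma gauss_int_ge:
 assumes c: "coercive p l u A"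
 shows "enn (exp (- u * real p / 2)) <= gauss_int p A"
proof -
 let ?B = "{x::nat=>real. ALL j:{..<p}. \<bar>x j\<bar> <= 1}"
 have [measurable]: "?B : sets borel" by measurable
 have "enn (exp (- u * real p / 2)) <= enn (exp (- u * real p / 2)) * enn (2 ^ p)"
 by (subst ennreal_mult[symmetric]) (auto intro!: ennreal_leI)
 also have "... = (NI (cleb {..<p}) (%x. enn (exp (- u * real p / 2)) * indicator ?B x))"
 using emeasure_coord_cube[of "{..<p}" 1] by (subst nn_integral_cmult_indicator) auto
 also have "... <= gauss_int p A" unfolding gauss_int_def
 proof (rule nn_integral_mono)
 fix x
 show "enn (exp (- u * real p / 2)) * indicator ?B x <= enn (exp (- (vec p x .* (A *. vec p x)) / 2))"
 proof (cases "x : ?B")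
 case True
 have "(nrm p x)\<^sup>2 <= real p"
 proof -
 have "(\<Sum>j<p. (x j)\<^sup>2) <= (\<Sum>j<p. 1)"
 using True by (intro sum_mono) (simp add: abs_square_le_1)
 then show ?thesis by (simp add: nrm_eq sum_nonneg)
 qed
 moreover have "vec p x .* (A *. vec p x) <= u * (nrm p x)\<^sup>2"
 using c by (auto simp: coercive_def nrm_sq[symmetric])
 moreover have "0 <= u | p = 0"
 proof (rule ccontr)
 assume a: "\<not> ?thesis"
 then have "0 < p" by auto
 let ?e = "unit_vec p 0 :: real vec"
 have e: "?e : cvec p" "?e .* ?e = 1" using \<open>0 < p\<close> by auto
 then have "l * (?e .* ?e) <= ?e .* (A *. ?e)" "?e .* (A *. ?e) <= u * (?e .* ?e)" "0 < l"
 using c unfolding coercive_def by blast+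
 then show False using a e(2) by simp
 qed
 ultimately have "vec p x .* (A *. vec p x) <= u * real p"
 proof -
 assume a: "(nrm p x)\<^sup>2 <= real p" "vec p x .* (A *. vec p x) <= u * (nrm p x)\<^sup>2" "0 <= u | p = 0"
 show "vec p x .* (A *. vec p x) <= u * real p"
 proof (cases "p = 0")
 case True then show ?thesis using a(2) by (simp add: nrm_eq)
 next
 case False
 then have "u * (nrm p x)\<^sup>2 <= u * real p" using a by (intro mult_left_mono) auto
 then show ?thesis using a(2) by linarith
 qed
 qed
 then show ?thesis using True by (simp add: ennreal_leI)
 qed simp
 qed
 finally show ?thesis .
qed

lemma gauss_int_scale:
 assumes s: "s > 0" and A: "A : cmat p p"
 shows "(NI (cleb {..<p}) (%x. enn (exp (- (s\<^sup>2 * (vec p x .* (A *. vec p x))) / 2)))) =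
 enn (1 / s ^ p) * gauss_int p A"
proof -
 have e: "vec p (%j. s * (x j - 0)) = s \<cdot>\<^sub>v vec p x" for x by auto
 have "(s \<cdot>\<^sub>v vec p x) .* (A *. (s \<cdot>\<^sub>v vec p x)) = s\<^sup>2 * (vec p x .* (A *. vec p x))" for x
 using A by (simp add: mult_mat_vec power2_eq_square)
 then show ?thesis
 using nn_integral_coord_affine[of "{..<p}" s "%x. enn (exp (- (vec p x .* (A *. vec p x)) / 2))" "%_. 0"] s A
 by (simp add: e[simplified] gauss_int_def)
qed

text \<open>If A is at most B + dl, then A is at most (1 + dl/l) B, and scaling the argument turns the factor
 into a power.\<close>

lemma gauss_int_perturb:
 assumes A: "A : cmat p p" and cB: "coercive p l u B" and d: "0 <= dl"
 and close: "\<And>x. x : cvec p ==> x .* (A *. x) <= x .* (B *. x) + dl * (x .* x)"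
 shows "gauss_int p B <= enn ((1 + dl / l) ^ p) * gauss_int p A"
proof -
 have l: "l > 0" and B: "B : cmat p p" using cB by (auto simp: coercive_def)
 define s where "s = sqrt (1 + dl / l)"
 have s: "s >= 1" "s > 0" "s\<^sup>2 = 1 + dl / l" using d l by (auto simp: s_def intro!: add_pos_nonneg)
 have "enn (1 / s ^ p) * gauss_int p B = (NI (cleb {..<p}) (%x. enn (exp (- (s\<^sup>2 * (vec p x .* (B *. vec p x))) / 2))))"
 using gauss_int_scale[OF s(2) B] by simp
 also have "... <= gauss_int p A" unfolding gauss_int_def
 proof (intro nn_integral_mono ennreal_leI)
 fix x :: "nat => real"
 let ?v = "vec p x"
 have "dl * (?v .* ?v) <= dl / l * (?v .* (B *. ?v))"
 proof -
 have "l * (?v .* ?v) <= ?v .* (B *. ?v)" using cB by (auto simp: coercive_def)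
 then have "dl / l * (l * (?v .* ?v)) <= dl / l * (?v .* (B *. ?v))" using d l by (intro mult_left_mono) auto
 then show ?thesis using l by simp
 qed
 then show "exp (- (s\<^sup>2 * (?v .* (B *. ?v))) / 2) <= exp (- (?v .* (A *. ?v)) / 2)"
 using close[of ?v] by (simp add: s(3) algebra_simps)
 qed
 finally have "enn (s ^ p) * (enn (1 / s ^ p) * gauss_int p B) <= enn (s ^ p) * gauss_int p A"
 by (rule mult_left_mono) simp
 moreover have "enn (s ^ p) * (enn (1 / s ^ p) * gauss_int p B) = gauss_int p B"
 using s by (simp add: mult.assoc[symmetric] ennreal_mult[symmetric])
 moreover have "enn (s ^ p) * gauss_int p A <= enn ((1 + dl / l) ^ p) * gauss_int p A"
 proof (intro mult_right_mono ennreal_leI power_mono)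
 show "s <= 1 + dl / l" using s self_le_power[of s 2] by simp
 qed (use s in auto)
 ultimately show ?thesis by (metis order_trans)
qed

text \<open>
 The Jacobian of an invertible linear map appears as a quotient of two Gaussian integrals.
\<close>

lemma nn_integral_linear_map:
 assumes F: "F : cmat p p" and Fi: "Fi : cmat p p" "F * Fi = 1\<^sub>m p"
 and f: "f : bmb"
 shows "(NI (cleb {..<p}) (%x. f (zero_pad (F *. vec p x)))) * gauss_int p (1\<^sub>m p) =
 gauss_int p (transpose_mat F * F) * (NI (cleb {..<p}) (%y. f y))"
proof -
 let ?g = "%y. enn (exp (- (vec p y .* (1\<^sub>m p *. vec p y)) / 2))"
 have "?g (%j. - zero_pad (F *. vec p x) j) = enn (exp (- (vec p x .* ((transpose_mat F * F) *. vec p x)) / 2))" for x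
 proof -
 have 1: "vec p (%j. - zero_pad (F *. vec p x) j) = - (F *. vec p x)"
 using F by (auto simp: zero_pad_def)
 have "(- (F *. vec p x)) .* (- (F *. vec p x)) = (F *. vec p x) .* (F *. vec p x)"
 using F by simp
 also have "... = vec p x .* (transpose_mat F *. (F *. vec p x))"
 using transpose_vec_mult_scalar[of F p p "vec p x" "F *. vec p x"] F
 comm_scalar_prod[of "vec p x" p "transpose_mat F *. (F *. vec p x)"] by auto
 also have "transpose_mat F *. (F *. vec p x) = (transpose_mat F * F) *. vec p x"
 using F by (subst assoc_mult_mat_vec[of _ p p _ p]) auto
 finally show ?thesis unfolding 1 using F by simp
 qed
 moreover have "?g : bmb" by measurable
 ultimately show ?thesis
 using nn_integral_linear_exchange[OF F Fi f, of ?g] by (simp add: gauss_int_def)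
qed

text \<open>The densities of an estimator and of its affine image determine each other; the Jacobian is
 expressed by Gaussian integrals.\<close>

lemma (in prob_space) studentised_density:
 assumes F: "F : cmat p p" and Fi: "Fi : cmat p p" "F * Fi = 1\<^sub>m p" "Fi * F = 1\<^sub>m p"
 and s: "s > 0" and thr: "th : euclid p" and TE: "\<And>om. om : space M ==> T om : euclid p"
 and T: "distributed M (cleb {..<p}) T e"
 and Z: "distributed M (cleb {..<p})
 (%om. zero_pad (s \<cdot>\<^sub>v (F *. (vec p (T om) - vec p th)))) z"
 shows "AE t in cleb {..<p}. gauss_int p (transpose_mat F * F) * e t =
 gauss_int p (1\<^sub>m p) * (enn (s ^ p) * z (zero_pad (s \<cdot>\<^sub>v (F *. (vec p t - vec p th)))))"
proof -
 let ?mu = "cleb {..<p}"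
 interpret L: sigma_finite_measure ?mu by (rule sigma_finite_coord_lebesgue) simp
 define \<Phi> where "\<Phi> t = zero_pad (s \<cdot>\<^sub>v (F *. (vec p t - vec p th)))" for t
 define L where "L x = zero_pad (F *. vec p x)" for x
 define \<Psi> where "\<Psi> y = (%j. th j + (1/s) * zero_pad (Fi *. vec p y) j)" for y
 have \<Phi>L: "\<Phi> t = L (%j. s * (t j - th j))" for t
 proof -
 have "vec p (%j. s * (t j - th j)) = s \<cdot>\<^sub>v (vec p t - vec p th)" by auto
 then show ?thesis using F by (simp add: \<Phi>_def L_def mult_mat_vec)
 qed
 have \<Psi>L: "\<Psi> (L x) = (%j. th j + x j / s)" if "x : euclid p" for x
 proof -
 have "vec p (L x) = F *. vec p x" using F by (auto simp: L_def zero_pad_def)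
 then have "Fi *. vec p (L x) = vec p x"
 using assoc_mult_mat_vec[OF Fi(1) F, of "vec p x"] Fi(3) by simp
 then show ?thesis using that by (auto simp: \<Psi>_def zero_pad_def euclid_def fun_eq_iff)
 qed
 have \<Psi>\<Phi>: "\<Psi> (\<Phi> t) = t" if "t : euclid p" for t
 proof -
 have "(%j. s * (t j - th j)) : euclid p" using that thr by (auto simp: euclid_def)
 then show ?thesis unfolding \<Phi>L using s by (subst \<Psi>L) auto
 qed
 have e[measurable]: "e : bmb" and z[measurable]: "z : bmb"
 using T Z by (auto simp: distributed_def measurable_cong_sets[OF sets_coord_lebesgue refl])
 have L[measurable]: "L : bmb" unfolding L_def by measurable
 have sh[measurable]: "(%t j. s * (t j - th j)) : borel_measurable (borel :: (nat => real) measure)"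
 by (rule meas_coord) measurable
 have \<Phi>[measurable]: "\<Phi> : bmb"
 unfolding \<Phi>L using mcomp[OF sh L] .
 have \<Psi>[measurable]: "\<Psi> : bmb"
 proof -
 have [measurable]: "(%y. zero_pad (Fi *. vec p y) j) : bmb" for j
 by (rule measurable_product_then_coordinatewise) (rule measurable_zero_pad_linear)
 show ?thesis unfolding \<Psi>_def by (rule meas_coord) measurable
 qed
 have "density ?mu (%t. gauss_int p (transpose_mat F * F) * e t) =
 density ?mu (%t. gauss_int p (1\<^sub>m p) * (enn (s ^ p) * z (\<Phi> t)))"
 proof (rule measure_eqI)
 fix B assume "B : sets (density ?mu (%t. gauss_int p (transpose_mat F * F) * e t))"
 then have B[measurable]: "B : sets borel" by simp
 let ?f = "%y. z y * indicator B (\<Psi> y)"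
 have f[measurable]: "?f : bmb" by measurable
 have "(NI ?mu (%t. e t * indicator B t)) = (NI M (%om. indicator B (T om)))"
 by (rule distributed_nn_integral[OF T]) measurable
 also have "... = (NI M (%om. indicator B (\<Psi> (\<Phi> (T om)))))"
 by (intro nn_integral_cong) (simp add: \<Psi>\<Phi> TE)
 also have "... = (NI ?mu (%y. ?f y))"
 unfolding \<Phi>_def by (rule distributed_nn_integral[OF Z, symmetric]) measurable
 finally have 1: "(NI ?mu (%t. e t * indicator B t)) = (NI ?mu (%y. ?f y))" .
 have "(NI ?mu (%x. ?f (L x))) = enn (s ^ p) * (enn (1 / s ^ card {..<p}) * (NI ?mu (%x. ?f (L x))))"
 using s by (simp add: mult.assoc[symmetric] ennreal_mult[symmetric])
 also have "enn (1 / s ^ card {..<p}) * (NI ?mu (%x. ?f (L x))) =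
 (NI ?mu (%t. ?f (L (%j. s * (t j - th j)))))"
 using thr s by (intro nn_integral_coord_affine[symmetric]) (auto simp: euclid_def)
 also have "... = (NI ?mu (%t. z (\<Phi> t) * indicator B t))"
 proof (rule nn_integral_cong_AE)
 show "AE t in ?mu. ?f (L (%j. s * (t j - th j))) = z (\<Phi> t) * indicator B t"
 using AE_coord_lebesgue_support
 by eventually_elim (auto simp: \<Phi>L[symmetric] \<Psi>\<Phi> euclid_def)
 qed
 finally have 2: "(NI ?mu (%x. ?f (L x))) = enn (s ^ p) * (NI ?mu (%t. z (\<Phi> t) * indicator B t))" .
 have 3: "(NI ?mu (%x. ?f (L x))) * gauss_int p (1\<^sub>m p) = gauss_int p (transpose_mat F * F) * (NI ?mu (%y. ?f y))"
 unfolding L_def by (rule nn_integral_linear_map[OF F Fi(1,2) f])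
 have "emeasure (density ?mu (%t. gauss_int p (transpose_mat F * F) * e t)) B =
 gauss_int p (transpose_mat F * F) * (NI ?mu (%t. e t * indicator B t))"
 by (simp add: emeasure_density mult.assoc nn_integral_cmult)
 also have "... = gauss_int p (1\<^sub>m p) * (enn (s ^ p) * (NI ?mu (%t. z (\<Phi> t) * indicator B t)))"
 unfolding 1 3[symmetric] 2 by (simp add: mult.commute)
 also have "... = emeasure (density ?mu (%t. gauss_int p (1\<^sub>m p) * (enn (s ^ p) * z (\<Phi> t)))) B"
 by (simp add: emeasure_density mult.assoc nn_integral_cmult)
 finally show "emeasure (density ?mu (%t. gauss_int p (transpose_mat F * F) * e t)) B =
 emeasure (density ?mu (%t. gauss_int p (1\<^sub>m p) * (enn (s ^ p) * z (\<Phi> t)))) B" .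
 qed simp
 then have "AE t in ?mu. gauss_int p (transpose_mat F * F) * e t = gauss_int p (1\<^sub>m p) * (enn (s ^ p) * z (\<Phi> t))"
 by (subst (asm) L.density_unique_iff) measurable
 then show ?thesis by (simp add: \<Phi>_def)
qed

section \<open>Probabilities of possibly non-measurable events\<close>

lemma prob_ge_mono:
 "prob_ge P E r ==> (\<And>om. om : space P ==> E om ==> E' om) ==> r' <= r ==> prob_ge P E' r'"
 unfolding prob_ge_def by (meson order_trans sets.sets_into_space subsetD)

lemma prob_ge_conj:
 assumes "prob_space P" "prob_ge P E (1 - a)" "prob_ge P E' (1 - b)"
 shows "prob_ge P (%om. E om & E' om) (1 - (a + b))"
proof -
 interpret prob_space P by fact
 obtain S T where S: "S : sets P" "ALL om:S. E om" "1 - a <= measure P S"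
 and T: "T : sets P" "ALL om:T. E' om" "1 - b <= measure P T"
 using assms unfolding prob_ge_def by blast
 have "measure P (S \<union> T) = measure P S + measure P (T - S)"
 using S T by (intro finite_measure_Union') auto
 moreover have "measure P T = measure P (S \<inter> T) + measure P (T - S)"
 using S T by (simp add: finite_measure_Diff' Int_commute)
 moreover have "measure P (S \<union> T) <= 1" by (rule prob_le_1)
 ultimately have "1 - (a + b) <= measure P (S \<inter> T)" using S T by linarith
 then show ?thesis unfolding prob_ge_def using S T by (intro bexI[of _ "S \<inter> T"]) auto
qed

lemma prob_ge_AE:
 assumes "prob_space P" "AE om in P. E om"
 shows "prob_ge P E 1"
proof -
 interpret prob_space P by fact
 obtain N where N: "{om : space P. \<not> E om} <= N" "N : sets P" "emeasure P N = 0"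
 using assms(2) by (rule AE_E)
 have "measure P (space P - N) = 1"
 using N prob_compl[of N] by (simp add: measure_def)
 then show ?thesis unfolding prob_ge_def using N by (intro bexI[of _ "space P - N"]) auto
qed

text \<open>The only route from expected values to probabilities in the whole argument.\<close>

lemma prob_ge_Markov:
 assumes "prob_space P" and Y: "Y : borel_measurable P"
 and E: "(NI P (%om. Y om)) <= enn (c * ep)" and eps: "ep > 0" and c: "c >= 0"
 shows "prob_ge P (%om. Y om <= enn ep) (1 - c)"
proof -
 interpret prob_space P by fact
 let ?B = "{om\<in>space P. 1 <= enn (1/ep) * Y om}"
 have B: "?B : sets P" using Y by measurable
 have "emeasure P ?B <= enn (1/ep) * (NI P (%om. Y om * indicator (space P) om))"
 using nn_integral_Markov_inequality[of "Y" "space P" P "enn (1/ep)"] Y by simp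
 also have "... <= enn (1/ep) * enn (c * ep)"
 using E by (intro mult_left_mono) (auto simp: nn_integral_set_ennreal[symmetric] cong: nn_integral_cong)
 also have "... = enn c" using eps c by (simp add: ennreal_mult[symmetric])
 finally have "measure P ?B <= c" using c by (simp add: emeasure_eq_measure)
 then have m: "1 - c <= measure P (space P - ?B)" using prob_compl[OF B] by simp
 show ?thesis unfolding prob_ge_def
 proof (intro bexI conjI ballI)
 fix om assume w: "om : space P - ?B"
 show "Y om <= enn ep"
 proof (rule ccontr)
 assume "\<not> Y om <= enn ep"
 then have "enn (1/ep) * enn ep <= enn (1/ep) * Y om" by (intro mult_left_mono) auto
 then have "1 <= enn (1/ep) * Y om" using eps by (simp add: ennreal_mult[symmetric])
 then show False using w by auto
 qed
 qed (use m B in auto)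
qed

lemma wpa1_mono:
 assumes "wpa1 P E" "EV n. ALL om:space (P n). E n om --> E' n om"
 shows "wpa1 P E'"
 unfolding wpa1_def
proof (intro allI impI)
 fix dl :: real assume "dl > 0"
 then have "EV n. prob_ge (P n) (E n) (1 - dl)" using assms by (simp add: wpa1_def)
 with assms(2) show "EV n. prob_ge (P n) (E' n) (1 - dl)"
 by eventually_elim (erule prob_ge_mono, auto)
qed

lemma wpa1_conj:
 assumes "EV n. prob_space (P n)" "wpa1 P E" "wpa1 P E'"
 shows "wpa1 P (%n om. E n om & E' n om)"
 unfolding wpa1_def
proof (intro allI impI)
 fix dl :: real assume "dl > 0"
 then have "EV n. prob_ge (P n) (E n) (1 - dl/2)"
 "EV n. prob_ge (P n) (E' n) (1 - dl/2)" using assms by (simp_all add: wpa1_def)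
 with assms(1) show "EV n. prob_ge (P n) (%om. E n om & E' n om) (1 - dl)"
 by eventually_elim (use prob_ge_conj in force)
qed

section \<open>Sums of independent copies\<close>

context
 fixes P :: "'d measure" and n :: nat
 assumes P: "prob_space P"
begin

lemma product_prob_space_iid: "product_prob_space (%_::nat. P)"
 using P by (simp add: product_prob_space_def product_sigma_finite_def product_prob_space_axioms_def
 prob_space_imp_sigma_finite)

lemma prob_space_sample: "prob_space (PiM {..<n} (%_. P))"
 using P by (intro prob_space_PiM)

lemma measurable_sample_component [measurable]:
 "k < n ==> (%om. om k) : PiM {..<n} (%_. P) \<rightarrow>\<^sub>M P"
 by (rule measurable_component_singleton) simp

lemma integral_sq_iid_sum:
 assumes X[measurable]: "X : borel_measurable P" and X2: "integrable P (%x. (X x)\<^sup>2)"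
 defines "S == %om. \<Sum>k<n. (X (om k) - (\<integral>x. X x \<partial>P))"
 shows "integrable (PiM {..<n} (%_. P)) (%om. (S om)\<^sup>2)"
 "(\<integral>om. (S om)\<^sup>2 \<partial>PiM {..<n} (%_. P)) <= real n * (\<integral>x. (X x)\<^sup>2 \<partial>P)"
proof -
 interpret P: prob_space P by (rule P)
 interpret PP: product_prob_space "%_::nat. P" by (rule product_prob_space_iid)
 let ?OM = "PiM {..<n} (%_. P)"
 define Y where "Y x = X x - (\<integral>x. X x \<partial>P)" for x
 have Xi: "integrable P X" using P.square_integrable_imp_integrable X X2 by blast
 have Y[measurable]: "Y : borel_measurable P" unfolding Y_def by measurable
 have Yi: "integrable P Y" unfolding Y_def using Xi by auto
 have Y0: "(\<integral>x. Y x \<partial>P) = 0" unfolding Y_def using Xi by (simp add: P.prob_space)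
 have Y2: "integrable P (%x. (Y x)\<^sup>2)" unfolding Y_def using Xi X2 by (auto simp: power2_diff)
 have Yle: "(\<integral>x. (Y x)\<^sup>2 \<partial>P) <= (\<integral>x. (X x)\<^sup>2 \<partial>P)"
 proof -
 have "(\<integral>x. (Y x)\<^sup>2 \<partial>P) = (\<integral>x. (X x)\<^sup>2 \<partial>P) - (\<integral>x. X x \<partial>P)\<^sup>2"
 unfolding Y_def using Xi X2 P.variance_eq[of X] by simp
 then show ?thesis by simp
 qed
 have key: "integrable ?OM (%om. Y (om k) * Y (om l)) &
 (\<integral>om. Y (om k) * Y (om l) \<partial>?OM) = (if k = l then (\<integral>x. (Y x)\<^sup>2 \<partial>P) else 0)"
 if k: "k < n" and l: "l < n" for k l
 proof -
 define f where "f i = (if i = k then (if k = l then (%x. (Y x)\<^sup>2) else Y) else if i = l then Y else (%_. 1))" for i :: nat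
 have fi: "integrable P (f i)" for i unfolding f_def using Yi Y2 by auto
 have pr: "(\<Prod>i<n. f i (om i)) = Y (om k) * Y (om l)" for om
 proof -
 have "(\<Prod>i<n. f i (om i)) = (\<Prod>i\<in>{k,l}. f i (om i))"
 using k l by (intro prod.mono_neutral_right) (auto simp: f_def)
 then show ?thesis by (auto simp: f_def power2_eq_square)
 qed
 have pr2: "(\<Prod>i<n. \<integral>x. f i x \<partial>P) = (if k = l then (\<integral>x. (Y x)\<^sup>2 \<partial>P) else 0)"
 proof -
 have "(\<Prod>i<n. \<integral>x. f i x \<partial>P) = (\<Prod>i\<in>{k,l}. \<integral>x. f i x \<partial>P)"
 using k l by (intro prod.mono_neutral_right) (auto simp: f_def P.prob_space)
 then show ?thesis by (auto simp: f_def Y0)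
 qed
 show ?thesis
 using PP.product_integrable_prod[of "{..<n}" f] PP.product_integral_prod[of "{..<n}" f] fi pr pr2 by simp
 qed
 have S: "(S om)\<^sup>2 = (\<Sum>k<n. \<Sum>l<n. Y (om k) * Y (om l))" for om
 by (simp add: S_def Y_def power2_eq_square sum_product)
 show "integrable ?OM (%om. (S om)\<^sup>2)"
 unfolding S using key by (intro Bochner_Integration.integrable_sum) auto
 have "(\<integral>om. (S om)\<^sup>2 \<partial>?OM) = (\<Sum>k<n. \<Sum>l<n. \<integral>om. Y (om k) * Y (om l) \<partial>?OM)"
 unfolding S using key by (subst Bochner_Integration.integral_sum) (auto intro!: Bochner_Integration.integrable_sum sum.cong)
 also have "... = (\<Sum>k<n. \<Sum>l<n. if k = l then (\<integral>x. (Y x)\<^sup>2 \<partial>P) else 0)"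
 using key by (intro sum.cong refl) auto
 also have "... = real n * (\<integral>x. (Y x)\<^sup>2 \<partial>P)" by simp
 finally show "(\<integral>om. (S om)\<^sup>2 \<partial>?OM) <= real n * (\<integral>x. (X x)\<^sup>2 \<partial>P)"
 using Yle by (simp add: mult_left_mono)
qed

lemma nn_integral_sq_iid_sum:
 assumes X[measurable]: "X : borel_measurable P" and X2: "integrable P (%x. (X x)\<^sup>2)"
 and B: "(\<integral>x. (X x)\<^sup>2 \<partial>P) <= B"
 shows "(\<integral>\<^sup>+om. enn ((\<Sum>k<n. (X (om k) - (\<integral>x. X x \<partial>P)))\<^sup>2) \<partial>PiM {..<n} (%_. P)) <= enn (real n * B)"
proof -
 have "real n * (\<integral>x. (X x)\<^sup>2 \<partial>P) <= real n * B" using B by (rule mult_left_mono) simp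
 then show ?thesis
 using integral_sq_iid_sum[OF X X2] by (subst nn_integral_eq_integral) (auto intro!: ennreal_leI)
qed

text \<open>Feeds the exponential moment bound of a centred bounded variable.\<close>

lemma exp_le_quadratic: "\<bar>x\<bar> <= 1 ==> exp x <= 1 + x + (x::real)\<^sup>2"
proof (cases "x >= 0")
 case True
 assume "\<bar>x\<bar> <= 1" then show ?thesis using True exp_bound[of x] by simp
next
 case False
 assume x: "\<bar>x\<bar> <= 1"
 define y where "y = - x"
 have y: "0 < y" "y <= 1" using x False by (auto simp: y_def)
 have "1 <= 1 + y ^ 3" using y by simp
 also have "... = (1 + x + x\<^sup>2) * (1 + y)" by (simp add: y_def power2_eq_square power3_eq_cube algebra_simps)
 also have "... <= (1 + x + x\<^sup>2) * exp y"
 proof (rule mult_left_mono)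
 show "0 <= 1 + x + x\<^sup>2" using y x by (simp add: y_def)
 qed (rule exp_ge_add_one_self)
 finally show ?thesis by (simp add: y_def exp_minus field_simps)
qed

lemma nn_integral_exp_iid_sum:
 assumes X[measurable]: "X : borel_measurable P" and b: "\<And>x. x : space P ==> \<bar>X x\<bar> <= b"
 and X2: "(\<integral>x. (X x)\<^sup>2 \<partial>P) <= v" and lam: "2 * \<bar>lm\<bar> * b <= 1"
 shows "(\<integral>\<^sup>+om. enn (exp (lm * (\<Sum>k<n. (X (om k) - (\<integral>x. X x \<partial>P))))) \<partial>PiM {..<n} (%_. P))
 <= enn (exp (real n * lm\<^sup>2 * v))"
proof -
 interpret P: prob_space P by (rule P)
 interpret PP: product_prob_space "%_::nat. P" by (rule product_prob_space_iid)
 define mu where "mu = (\<integral>x. X x \<partial>P)"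
 have Xb: "integrable P X" using b by (intro P.integrable_const_bound[of _ b]) (auto intro: AE_I2)
 have b0: "b >= 0"
 proof -
 obtain x where "x : space P" using P.not_empty by auto
 then show ?thesis using b[of x] by simp
 qed
 have X2b: "integrable P (%x. (X x)\<^sup>2)"
 using b b0 by (intro P.integrable_const_bound[of _ "b\<^sup>2"]) (auto intro!: AE_I2 simp: abs_le_square_iff[symmetric])
 have mu: "\<bar>mu\<bar> <= b"
 proof -
 have "\<bar>mu\<bar> <= (\<integral>x. \<bar>X x\<bar> \<partial>P)" unfolding mu_def by (rule integral_abs_bound)
 also have "... <= (\<integral>x. b \<partial>P)" using Xb b by (intro integral_mono) auto
 finally show ?thesis by (simp add: P.prob_space)
 qed
 have one: "(NI P (%x. enn (exp (lm * (X x - mu))))) <= enn (exp (lm\<^sup>2 * v))"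
 proof -
 have "(NI P (%x. enn (exp (lm * (X x - mu))))) <= (NI P (%x. enn (1 + lm * (X x - mu) + (lm * (X x - mu))\<^sup>2)))"
 proof (intro nn_integral_mono ennreal_leI exp_le_quadratic)
 fix x assume "x : space P"
 then have "\<bar>X x - mu\<bar> <= 2 * b" using b[of x] mu by linarith
 then have "\<bar>lm\<bar> * \<bar>X x - mu\<bar> <= \<bar>lm\<bar> * (2 * b)" by (rule mult_left_mono) simp
 then show "\<bar>lm * (X x - mu)\<bar> <= 1" using lam unfolding abs_mult by linarith
 qed
 also have "... = enn (\<integral>x. 1 + lm * (X x - mu) + (lm * (X x - mu))\<^sup>2 \<partial>P)"
 proof (rule nn_integral_eq_integral)
 show "integrable P (%x. 1 + lm * (X x - mu) + (lm * (X x - mu))\<^sup>2)"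
 using Xb X2b by (auto simp: power_mult_distrib power2_diff)
 have "0 <= 1 + t + t\<^sup>2" for t :: real
 proof -
 have "0 <= (t + 1/2)\<^sup>2" by simp
 then show ?thesis by (simp add: power2_eq_square algebra_simps)
 qed
 then show "AE x in P. 0 <= 1 + lm * (X x - mu) + (lm * (X x - mu))\<^sup>2" by simp
 qed
 also have "(\<integral>x. 1 + lm * (X x - mu) + (lm * (X x - mu))\<^sup>2 \<partial>P) = 1 + lm\<^sup>2 * ((\<integral>x. (X x)\<^sup>2 \<partial>P) - mu\<^sup>2)"
 proof -
 have "(\<integral>x. (X x - mu)\<^sup>2 \<partial>P) = (\<integral>x. (X x)\<^sup>2 \<partial>P) - mu\<^sup>2"
 unfolding mu_def using Xb X2b P.variance_eq[of X] by simp
 moreover have "(\<integral>x. (X x - mu) \<partial>P) = 0" using Xb by (simp add: mu_def P.prob_space)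
 moreover have "integrable P (%x. (X x - mu)\<^sup>2)" using Xb X2b by (auto simp: power2_diff)
 ultimately show ?thesis using Xb by (simp add: power_mult_distrib P.prob_space)
 qed
 also have "... <= 1 + lm\<^sup>2 * v"
 proof -
 have "lm\<^sup>2 * ((\<integral>x. (X x)\<^sup>2 \<partial>P) - mu\<^sup>2) <= lm\<^sup>2 * v"
 using order_trans[OF diff_right_mono[OF X2, of "mu\<^sup>2"]] by (intro mult_left_mono) simp_all
 then show ?thesis by simp
 qed
 also have "... <= exp (lm\<^sup>2 * v)" by (rule exp_ge_add_one_self)
 finally show ?thesis by (simp add: ennreal_leI)
 qed
 have "(NI (PiM {..<n} (%_. P)) (%om. enn (exp (lm * (\<Sum>k<n. (X (om k) - mu)))))) =
 (NI (PiM {..<n} (%_. P)) (%om. (\<Prod>k<n. enn (exp (lm * (X (om k) - mu))))))"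
 by (intro nn_integral_cong) (simp add: sum_distrib_left exp_sum prod_ennreal)
 also have "... = (\<Prod>k<n. \<integral>\<^sup>+x. enn (exp (lm * (X x - mu))) \<partial>P)"
 by (rule PP.product_nn_integral_prod) auto
 also have "... <= (\<Prod>k<n. enn (exp (lm\<^sup>2 * v)))" by (intro prod_mono_ennreal one)
 also have "... = enn (exp (real n * lm\<^sup>2 * v))"
 by (simp add: ennreal_power exp_of_nat_mult[symmetric] mult.assoc)
 finally show ?thesis unfolding mu_def .
qed

text \<open>The exponent lm is free subject to 2 lm b at most 1, so bounds of order sqrt n and of order n both
 follow.\<close>

lemma Chernoff_iid_sum:
 assumes X[measurable]: "X : borel_measurable P" and b: "\<And>x. x : space P ==> \<bar>X x\<bar> <= b"
 and X2: "(\<integral>x. (X x)\<^sup>2 \<partial>P) <= v" and lam: "0 <= lm" "2 * lm * b <= 1"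
 shows "(\<integral>\<^sup>+om. (if t <= \<bar>\<Sum>k<n. (X (om k) - (\<integral>x. X x \<partial>P))\<bar> then 1 else 0) \<partial>PiM {..<n} (%_. P))
 <= enn (2 * exp (- lm * t + real n * lm\<^sup>2 * v))"
proof -
 let ?S = "%om. \<Sum>k<n. (X (om k) - (\<integral>x. X x \<partial>P))" and ?OM = "PiM {..<n} (%_. P)"
 have [measurable]: "?S : borel_measurable ?OM" by measurable
 have "(NI ?OM (%om. (if t <= \<bar>?S om\<bar> then 1 else 0))) <=
 (NI ?OM (%om. enn (exp (- lm * t)) * (enn (exp (lm * ?S om)) + enn (exp ((- lm) * ?S om)))))"
 proof (rule nn_integral_mono)
 fix om
 have "1 <= exp (- lm * t) * (exp (lm * ?S om) + exp ((- lm) * ?S om))" if "t <= \<bar>?S om\<bar>"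
 proof -
 have "lm * t <= lm * \<bar>?S om\<bar>" using that lam by (intro mult_left_mono)
 then have "1 <= exp (- lm * t) * exp (lm * \<bar>?S om\<bar>)" by (simp flip: exp_add)
 also have "... <= exp (- lm * t) * (exp (lm * ?S om) + exp ((- lm) * ?S om))"
 by (intro mult_left_mono) (auto simp: abs_if intro: less_imp_le)
 finally show ?thesis .
 qed
 then show "(if t <= \<bar>?S om\<bar> then 1 else 0) <=
 enn (exp (- lm * t)) * (enn (exp (lm * ?S om)) + enn (exp ((- lm) * ?S om)))"
 by (auto simp flip: ennreal_plus ennreal_mult simp: ennreal_ge_1)
 qed
 also have "... = enn (exp (- lm * t)) * ((NI ?OM (%om. enn (exp (lm * ?S om)))) + (NI ?OM (%om. enn (exp ((- lm) * ?S om)))))"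
 by (subst nn_integral_cmult, measurable) (subst nn_integral_add, measurable)
 also have "... <= enn (exp (- lm * t)) * (enn (exp (real n * lm\<^sup>2 * v)) + enn (exp (real n * (-lm)\<^sup>2 * v)))"
 using lam by (intro mult_left_mono add_mono nn_integral_exp_iid_sum[OF X b X2]) auto
 also have "... = enn (2 * exp (- lm * t + real n * lm\<^sup>2 * v))"
 by (simp add: mult_exp_exp algebra_simps flip: ennreal_plus ennreal_mult)
 finally show ?thesis .
qed

text \<open>Fubini in the form used throughout: a bound for each fixed parameter suffices for the integral
 over the prior.\<close>

lemma nn_integral_sample_exchange:
 assumes \<nu>: "sigma_finite_measure \<nu>"
 and h: "(%(om, th). h om th) : borel_measurable (PiM {..<n} (%_. P) \<Otimes>\<^sub>M \<nu>)"
 and b: "\<And>th. th : space \<nu> ==> (NI (PiM {..<n} (%_. P)) (%om. h om th)) <= B th"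
 shows "(\<integral>\<^sup>+om. \<integral>\<^sup>+th. h om th \<partial>\<nu> \<partial>PiM {..<n} (%_. P)) <= (NI \<nu> (%th. B th))"
proof -
 interpret pair_sigma_finite "PiM {..<n} (%_. P)" \<nu>
 using prob_space_imp_sigma_finite[OF prob_space_sample] \<nu> by (simp add: pair_sigma_finite_def)
 have "(\<integral>\<^sup>+om. \<integral>\<^sup>+th. h om th \<partial>\<nu> \<partial>PiM {..<n} (%_. P)) = (\<integral>\<^sup>+th. \<integral>\<^sup>+om. h om th \<partial>PiM {..<n} (%_. P) \<partial>\<nu>)"
 using Fubini'[OF h] by simp
 also have "... <= (NI \<nu> (%th. B th))" using b by (rule nn_integral_mono)
 finally show ?thesis .
qed

end

declare measurable_sample_component [measurable del]

section \<open>Sandwich forms and completing the square\<close>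

text \<open>The function exp (- x / 2) is Lipschitz on the positive half-line.\<close>

lemma exp_half_diff_le:
 assumes "0 <= a" "0 <= (b::real)"
 shows "\<bar>exp (- a / 2) - exp (- b / 2)\<bar> <= \<bar>a - b\<bar>"
proof -
 have *: "exp (- a / 2) - exp (- b / 2) <= b - a" if "0 <= a" "a <= b" for a b :: real
 proof -
 have "exp (- a / 2) * (1 - exp (- (b - a) / 2)) <= 1 * (1 - exp (- (b - a) / 2))"
 using that by (intro mult_right_mono) auto
 also have "... <= (b - a) / 2" using exp_ge_add_one_self[of "- (b - a) / 2"] by (simp add: field_simps del: exp_ge_add_one_self)
 also have "... <= b - a" using that by simp
 finally show ?thesis by (simp add: right_diff_distrib mult_exp_exp diff_divide_distrib)
 qed
 show ?thesis
 proof (cases "a <= b")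
 case True
 then have "exp (- b / 2) <= exp (- a / 2)" by simp
 then show ?thesis using *[of a b] True assms by simp
 next
 case False
 then have "exp (- a / 2) <= exp (- b / 2)" by simp
 then show ?thesis using *[of b a] False assms by simp
 qed
qed

lemma gram_norm_le:
 assumes J: "J : cmat m p" and G: "coercive p l u (transpose_mat J * J)" and x: "x : cvec p"
 shows "(vnorm (J *. x))\<^sup>2 <= u * (vnorm x)\<^sup>2" "l * (vnorm x)\<^sup>2 <= (vnorm (J *. x))\<^sup>2"
proof -
 have "(vnorm (J *. x))\<^sup>2 = (J *. x) .* (J *. x)" by (simp add: vnorm_sq)
 also have "... = x .* (transpose_mat J *. (J *. x))"
 using transpose_vec_mult_scalar[OF J x, of "J *. x"] J x
 comm_scalar_prod[of x p "transpose_mat J *. (J *. x)"] by auto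
 also have "transpose_mat J *. (J *. x) = (transpose_mat J * J) *. x"
 using J x by (subst assoc_mult_mat_vec[of _ p m _ p]) auto
 finally have "(vnorm (J *. x))\<^sup>2 = x .* ((transpose_mat J * J) *. x)" .
 then show "(vnorm (J *. x))\<^sup>2 <= u * (vnorm x)\<^sup>2" "l * (vnorm x)\<^sup>2 <= (vnorm (J *. x))\<^sup>2"
 using G x by (auto simp: coercive_def vnorm_sq)
qed

text \<open>The information matrix of the optimally weighted problem.\<close>

definition sandwich :: "real mat => real mat => real mat" where
 "sandwich J V = transpose_mat J * minv V * J"

context
 fixes m p :: nat and l u :: real and J V :: "real mat"
 assumes J: "J : cmat m p" and G: "coercive p l u (transpose_mat J * J)"
 and V: "coercive m l u V" and u: "0 < u"
begin

lemma sandwich_l: "0 < l" using V by (simp add: coercive_def)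

lemma minv_V_carrier: "minv V : cmat m m" by (rule coercive_minv[OF V])

lemma sandwich_carrier: "sandwich J V : cmat p p"
 using J minv_V_carrier by (auto simp: sandwich_def)

lemma sandwich_mult_vec:
 assumes "x : cvec p"
 shows "sandwich J V *. x = transpose_mat J *. (minv V *. (J *. x))"
 unfolding sandwich_def using J minv_V_carrier assms
 by (subst assoc_mult_mat_vec[of _ p m _ p]) (auto intro!: assoc_mult_mat_vec[of _ p m _ m])

lemma scalar_prod_transpose:
 assumes "x : cvec p" "y : cvec m"
 shows "x .* (transpose_mat J *. y) = (J *. x) .* (y :: real vec)"
proof -
 have "x .* (transpose_mat J *. y) = (transpose_mat J *. y) .* x"
 using J assms by (intro comm_scalar_prod[of _ p]) auto
 also have "... = y .* (J *. x)" using transpose_vec_mult_scalar[OF J assms] by simp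
 also have "... = (J *. x) .* y" using J assms by (intro comm_scalar_prod[of _ m]) auto
 finally show ?thesis .
qed

lemma sandwich_form:
 assumes "x : cvec p" "y : cvec p"
 shows "x .* (sandwich J V *. y) = (J *. x) .* (minv V *. (J *. y))"
 unfolding sandwich_mult_vec[OF assms(2)] using J minv_V_carrier assms
 by (intro scalar_prod_transpose) (auto intro!: mult_mat_vec_carrier)

lemma coercive_sandwich: "coercive p (l / u\<^sup>2 * l) (u / l) (sandwich J V)"
proof -
 note l = sandwich_l
 have sym: "transpose_mat (sandwich J V) = sandwich J V"
 proof (rule eq_matI)
 fix i j assume "i < dim_row (sandwich J V)" "j < dim_col (sandwich J V)"
 then have ij: "i < p" "j < p" using sandwich_carrier by auto
 have "sandwich J V $$ (j,i) = unit_vec p j .* (sandwich J V *. unit_vec p i)"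
 using entry_eq_unit_form[OF sandwich_carrier] ij by simp
 also have "... = unit_vec p i .* (sandwich J V *. unit_vec p j)"
 proof -
 let ?a = "J *. unit_vec p i" and ?b = "J *. unit_vec p j"
 have ab: "?a : cvec m" "?b : cvec m" using J by auto
 have "?b .* (minv V *. ?a) = (minv V *. ?b) .* ?a" by (rule coercive_minv_sym[OF V ab(2,1)])
 also have "... = ?a .* (minv V *. ?b)"
 using ab coercive_minv_vec(1)[OF V ab(2)] by (intro comm_scalar_prod[of _ m]) auto
 finally show ?thesis by (simp add: sandwich_form)
 qed
 also have "... = sandwich J V $$ (i,j)" using entry_eq_unit_form[OF sandwich_carrier] ij by simp
 finally show "transpose_mat (sandwich J V) $$ (i,j) = sandwich J V $$ (i,j)" using ij sandwich_carrier by simp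
 qed (use sandwich_carrier in auto)
 have "l / u\<^sup>2 * l * (y .* y) <= y .* (sandwich J V *. y) & y .* (sandwich J V *. y) <= u / l * (y .* y)"
 if y: "y : cvec p" for y
 proof -
 have Jy: "J *. y : cvec m" using J y by auto
 have "l / u\<^sup>2 * (l * (y .* y)) <= l / u\<^sup>2 * ((J *. y) .* (J *. y))"
 using gram_norm_le(2)[OF J G y] l u by (intro mult_left_mono) (auto simp: vnorm_sq)
 also have "... <= (J *. y) .* (minv V *. (J *. y))" by (rule coercive_minv_form_ge[OF V Jy u])
 finally have 1: "l / u\<^sup>2 * (l * (y .* y)) <= y .* (sandwich J V *. y)" using sandwich_form[OF y y] by simp
 have "(J *. y) .* (minv V *. (J *. y)) <= ((J *. y) .* (J *. y)) / l" by (rule coercive_minv_form_le[OF V Jy])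
 also have "... <= (u * (y .* y)) / l"
 using gram_norm_le(1)[OF J G y] l by (intro divide_right_mono) (auto simp: vnorm_sq)
 finally show ?thesis using 1 sandwich_form[OF y y] by (simp add: mult.assoc)
 qed
 then show ?thesis unfolding coercive_def using sandwich_carrier sym l u by auto
qed

definition lsq_point :: "real vec => real vec" where
 "lsq_point w = (-1) \<cdot>\<^sub>v (minv (sandwich J V) *. (transpose_mat J *. (minv V *. w)))"

lemma lsq_point_carrier: "w : cvec m ==> lsq_point w : cvec p"
 using coercive_minv_vec(1)[OF coercive_sandwich, of "transpose_mat J *. (minv V *. w)"]
 coercive_minv_vec(1)[OF V, of w] J by (simp add: lsq_point_def)

text \<open>The normal equations make the residual at the least squares point orthogonal, in the metric of V,
 to the range of J.\<close>

lemma complete_square: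
 assumes w: "w : cvec m" and h: "h : cvec p"
 shows "(w + J *. h) .* (minv V *. (w + J *. h)) =
 (w + J *. lsq_point w) .* (minv V *. (w + J *. lsq_point w)) +
 (h - lsq_point w) .* (sandwich J V *. (h - lsq_point w))"
proof -
 define h0 where "h0 = lsq_point w"
 define r where "r = w + J *. h0"
 define k where "k = h - h0"
 have c: "h0 : cvec p" "r : cvec m" "k : cvec p"
 using lsq_point_carrier[OF w] w h J by (auto simp: h0_def r_def k_def)
 have Jk: "J *. k : cvec m" using J c by auto
 have i: "minv V *. x : cvec m" if "x : cvec m" for x
 using coercive_minv_vec(1)[OF V that] .
 define g where "g = transpose_mat J *. (minv V *. w)"
 have g: "g : cvec p" using J i[OF w] by (auto simp: g_def)
 have Ah0: "sandwich J V *. h0 = (-1) \<cdot>\<^sub>v g"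
 unfolding h0_def lsq_point_def g_def[symmetric]
 using coercive_minv_vec[OF coercive_sandwich g] sandwich_carrier by (simp add: mult_mat_vec)
 have "(J *. k) .* (minv V *. r) = k .* (transpose_mat J *. (minv V *. r))"
 using scalar_prod_transpose[OF c(3) i[OF c(2)]] by simp
 also have "transpose_mat J *. (minv V *. r) = g + sandwich J V *. h0"
 proof -
 have "minv V *. r = minv V *. w + minv V *. (J *. h0)"
 unfolding r_def using minv_V_carrier w J c by (intro mult_add_distrib_mat_vec) auto
 moreover have "transpose_mat J *. (minv V *. w + minv V *. (J *. h0)) =
 transpose_mat J *. (minv V *. w) + transpose_mat J *. (minv V *. (J *. h0))"
 using J c i w by (intro mult_add_distrib_mat_vec[of _ p m]) auto
 ultimately show ?thesis by (simp add: sandwich_mult_vec[OF c(1)] g_def)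
 qed
 also have "... = 0\<^sub>v p" unfolding Ah0 using g by auto
 finally have cross: "(J *. k) .* (minv V *. r) = 0" using c by simp
 have "w + J *. h = r + J *. k"
 proof -
 have "J *. k = J *. h - J *. h0" unfolding k_def using J h c by (intro mult_minus_distrib_mat_vec) auto
 then show ?thesis unfolding r_def using J w h c by auto
 qed
 moreover have "minv V *. (r + J *. k) = minv V *. r + minv V *. (J *. k)"
 using minv_V_carrier c Jk by (intro mult_add_distrib_mat_vec) auto
 moreover have "r .* (minv V *. (J *. k)) = (J *. k) .* (minv V *. r)"
 using coercive_minv_sym[OF V c(2) Jk] comm_scalar_prod[OF i[OF c(2)] Jk] by simp
 ultimately have "(w + J *. h) .* (minv V *. (w + J *. h)) =
 r .* (minv V *. r) + (J *. k) .* (minv V *. (J *. k))"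
 using c Jk i cross
 by (simp add: add_scalar_prod_distrib[of _ m] scalar_prod_add_distrib[of _ m])
 then show ?thesis using sandwich_form[OF c(3) c(3)] by (simp add: r_def k_def h0_def)
qed

lemma residual_form_nonneg:
 "w : cvec m ==> h : cvec p ==> 0 <= (w + J *. h) .* (minv V *. (w + J *. h))"
proof -
 assume w: "w : cvec m" and h: "h : cvec p"
 have "0 <= l / u\<^sup>2 * ((w + J *. h) .* (w + J *. h))" using sandwich_l u by simp
 also have "... <= (w + J *. h) .* (minv V *. (w + J *. h))"
 using J w h by (intro coercive_minv_form_ge[OF V _ u]) auto
 finally show ?thesis .
qed

lemma vnorm_lsq_point_le:
 assumes w: "w : cvec m"
 shows "vnorm (lsq_point w) <= u\<^sup>2 * sqrt u / l ^ 3 * vnorm w"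
proof -
 note l = sandwich_l
 define y where "y = minv V *. w"
 define g where "g = transpose_mat J *. y"
 have y: "y : cvec m" "vnorm y <= vnorm w / l"
 using coercive_minv_vec(1)[OF V w] coercive_minv_vnorm[OF V w] by (auto simp: y_def)
 have g: "g : cvec p" using J y by (auto simp: g_def)
 have "vnorm g <= sqrt u * vnorm y"
 proof (cases "vnorm g = 0")
 case False
 have "(vnorm g)\<^sup>2 = (J *. g) .* y" unfolding vnorm_sq using scalar_prod_transpose[OF g y(1)] by (simp add: g_def)
 also have "... <= vnorm (J *. g) * vnorm y"
 using abs_scalar_prod_le[of "J *. g" m y] J g y by auto
 also have "... <= (sqrt u * vnorm g) * vnorm y"
 proof (rule mult_right_mono)
 have "sqrt ((vnorm (J *. g))\<^sup>2) <= sqrt (u * (vnorm g)\<^sup>2)"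
 by (rule real_sqrt_le_mono) (rule gram_norm_le(1)[OF J G g])
 then show "vnorm (J *. g) <= sqrt u * vnorm g" by (simp add: real_sqrt_mult)
 qed simp
 finally show ?thesis using False by (simp add: power2_eq_square ac_simps less_le)
 qed (use u in simp)
 also have "... <= sqrt u * (vnorm w / l)" using y u by (intro mult_left_mono) auto
 finally have gb: "vnorm g <= sqrt u * (vnorm w / l)" .
 have "vnorm (lsq_point w) = vnorm (minv (sandwich J V) *. g)"
 by (simp add: lsq_point_def vnorm_smult g_def y_def)
 also have "... <= vnorm g / (l / u\<^sup>2 * l)" by (rule coercive_minv_vnorm[OF coercive_sandwich g])
 also have "... <= (sqrt u * (vnorm w / l)) / (l / u\<^sup>2 * l)" using gb l u by (intro divide_right_mono) auto
 also have "... = u\<^sup>2 * sqrt u / l ^ 3 * vnorm w" using l by (simp add: power3_eq_cube field_simps)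
 finally show ?thesis .
qed

end

lemma form_diff_le:
 assumes V: "coercive m l u V" and V': "coercive m l u' V'" and dl: "0 <= dl"
 and d: "\<And>v. v : cvec m ==> vnorm ((V' - V) *. v) <= dl * vnorm v"
 and y: "y : cvec m" and y0: "y0 : cvec m"
 shows "\<bar>y .* (minv V' *. y) - y0 .* (minv V *. y0)\<bar> <=
 dl / l\<^sup>2 * (vnorm y)\<^sup>2 + vnorm (y - y0) * (vnorm y + vnorm y0) / l"
proof -
 have l: "0 < l" using V by (simp add: coercive_def)
 have iV: "minv V : cmat m m" "minv V' : cmat m m" using coercive_minv(1) V V' by auto
 have 1: "\<bar>y .* (minv V' *. y) - y .* (minv V *. y)\<bar> <= dl / l\<^sup>2 * (vnorm y)\<^sup>2"
 proof -
 define a b where "a = minv V' *. y" and "b = minv V *. y"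
 have M: "V : cmat m m" "V' : cmat m m" using V V' by (auto simp: coercive_def)
 have a: "a : cvec m" "V' *. a = y" using coercive_minv_vec[OF V' y] by (auto simp: a_def)
 have b: "b : cvec m" "V *. b = y" using coercive_minv_vec[OF V y] by (auto simp: b_def)
 have e1: "y .* a = b .* (V *. a)"
 using scalar_prod_sym_form[of V m b a] V a b by (simp add: coercive_def)
 have e2: "y .* b = b .* (V' *. a)"
 using a b y comm_scalar_prod[of y m b] by simp
 have "b .* (V' *. a) - b .* (V *. a) = b .* ((V' - V) *. a)"
 using M a(1) b(1) scalar_prod_minus_distrib[of b m "V' *. a" "V *. a"]
 by (simp add: minus_mult_distrib_mat_vec)
 then have "\<bar>y .* a - y .* b\<bar> = \<bar>b .* ((V' - V) *. a)\<bar>" unfolding e1 e2 by linarith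
 also have "... <= vnorm b * vnorm ((V' - V) *. a)"
 using M a(1) b(1) by (intro abs_scalar_prod_le[of _ m] mult_mat_vec_carrier[of _ m m]) auto
 also have "... <= (vnorm y / l) * (dl * (vnorm y / l))"
 using coercive_minv_vnorm[OF V' y] coercive_minv_vnorm[OF V y] d[OF a(1)] dl l
 by (intro mult_mono order_trans[OF d[OF a(1)] mult_left_mono]) (auto simp: a_def b_def)
 finally show ?thesis by (simp add: power2_eq_square field_simps a_def b_def)
 qed
 define d0 where "d0 = y - y0"
 have d0: "d0 : cvec m" using y y0 by (auto simp: d0_def)
 have "y .* (minv V *. y) - y0 .* (minv V *. y0) = d0 .* (minv V *. y) + d0 .* (minv V *. y0)"
 proof -
 have "y0 .* (minv V *. y) = y .* (minv V *. y0)"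
 using coercive_minv_sym[OF V y0 y] comm_scalar_prod[OF coercive_minv_vec(1)[OF V y0] y] by simp
 then show ?thesis unfolding d0_def using y y0 iV
 by (simp add: minus_scalar_prod_distrib[of _ m] mult_mat_vec_carrier[OF iV(1)])
 qed
 also have "\<bar>...\<bar> <= vnorm d0 * (vnorm y / l) + vnorm d0 * (vnorm y0 / l)"
 proof -
 have "\<bar>d0 .* (minv V *. x)\<bar> <= vnorm d0 * (vnorm x / l)" if "x : cvec m" for x
 using abs_scalar_prod_le[OF d0 coercive_minv_vec(1)[OF V that]] coercive_minv_vnorm[OF V that]
 mult_left_mono[of "vnorm (minv V *. x)" "vnorm x / l" "vnorm d0"] by simp
 from this[OF y] this[OF y0] show ?thesis by linarith
 qed
 finally have "\<bar>y .* (minv V *. y) - y0 .* (minv V *. y0)\<bar> <= vnorm d0 * (vnorm y + vnorm y0) / l"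
 by (simp add: distrib_left add_divide_distrib)
 with 1 show ?thesis unfolding d0_def by linarith
qed

section \<open>Taylor expansion of the expected moments\<close>

lemma has_jacobian_component_bound:
 assumes J: "has_jacobian p S f A x" and i: "i < dim_vec (f x)" and e: "e > 0"
 and dims: "\<And>y. y : S ==> dim_vec (f y) = dim_vec (f x)"
 shows "\<exists>d>0. ALL y:S. edist p y x < d -->
 \<bar>f y $ i - f x $ i - (A *. (vec p y - vec p x)) $ i\<bar> <= e * edist p y x"
proof -
 have A: "A : cmat (dim_vec (f x)) p" using J by (simp add: has_jacobian_def)
 obtain d where d: "d > 0" "\<And>y. y : S ==> edist p y x < d ==>
 vnorm (f y - f x - A *. (vec p y - vec p x)) <= e * edist p y x"
 using J e unfolding has_jacobian_def by blast
 have "\<bar>f y $ i - f x $ i - (A *. (vec p y - vec p x)) $ i\<bar> <= e * edist p y x"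
 if y: "y : S" "edist p y x < d" for y
 proof -
 have "\<bar>(f y - f x - A *. (vec p y - vec p x)) $ i\<bar> <= vnorm (f y - f x - A *. (vec p y - vec p x))"
 using i A dims[OF y(1)] by (intro abs_component_le_vnorm) auto
 then show ?thesis using d(2)[OF y] i A dims[OF y(1)] by simp
 qed
 then show ?thesis using d(1) by blast
qed

lemma has_jacobian_segment_deriv:
 assumes J: "has_jacobian p S f A (%j. a j + t * v j)" and i: "i < dim_vec (f (%j. a j + t * v j))"
 and dims: "\<And>y. y : S ==> dim_vec (f y) = dim_vec (f (%j. a j + t * v j))"
 and seg: "\<And>s. s : T ==> (%j. a j + s * v j) : S"
 shows "((%s. f (%j. a j + s * v j) $ i) has_real_derivative (A *. vec p v) $ i) (at t within T)"
proof -
 let ?x = "%s j. a j + s * v j"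
 have A: "A : cmat (dim_vec (f (?x t))) p" using J by (simp add: has_jacobian_def)
 have vd: "vec p (?x s) - vec p (?x t) = (s - t) \<cdot>\<^sub>v vec p v" for s by (auto simp: algebra_simps)
 have ed: "edist p (?x s) (?x t) = \<bar>s - t\<bar> * nrm p v" for s
 unfolding edist_def vd vnorm_smult nrm_def ..
 have Ai: "(A *. ((s - t) \<cdot>\<^sub>v vec p v)) $ i = (s - t) * (A *. vec p v) $ i" for s
 using A i by (simp add: mult_mat_vec)
 show ?thesis
 unfolding has_field_derivative_def
 proof (rule has_derivativeI)
 show "bounded_linear ((*) ((A *. vec p v) $ i))" by (rule bounded_linear_mult_right)
 show "((%s. (f (?x s) $ i - f (?x t) $ i - (A *. vec p v) $ i * (s - t)) /\<^sub>R norm (s - t)) \<longlongrightarrow> 0) (at t within T)"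
 unfolding Lim_within
 proof (intro allI impI)
 fix e :: real assume e: "e > 0"
 define q where "q = nrm p v + 1"
 define e' where "e' = e / (2 * q)"
 have np: "0 < q" "nrm p v <= q" by (simp_all add: q_def add_nonneg_pos)
 have e': "e' > 0" using e np by (simp add: e'_def)
 obtain d where d: "d > 0" "\<And>y. y : S ==> edist p y (?x t) < d ==>
 \<bar>f y $ i - f (?x t) $ i - (A *. (vec p y - vec p (?x t))) $ i\<bar> <= e' * edist p y (?x t)"
 using has_jacobian_component_bound[OF J i e' dims] by blast
 show "\<exists>d>0. ALL s:T. 0 < dist s t & dist s t < d -->
 dist ((f (?x s) $ i - f (?x t) $ i - (A *. vec p v) $ i * (s - t)) /\<^sub>R norm (s - t)) 0 < e"
 proof (intro exI conjI ballI impI)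
 show "d / q > 0" using d np by simp
 fix s assume s: "s : T" and ds: "0 < dist s t & dist s t < d / q"
 have "\<bar>s - t\<bar> * nrm p v <= \<bar>s - t\<bar> * q" using np by (intro mult_left_mono) auto
 also have "... < d" using ds np by (simp add: dist_real_def pos_less_divide_eq)
 finally have "edist p (?x s) (?x t) < d" by (simp add: ed)
 from d(2)[OF seg[OF s] this]
 have b: "\<bar>f (?x s) $ i - f (?x t) $ i - (A *. vec p v) $ i * (s - t)\<bar> <= e' * (\<bar>s - t\<bar> * nrm p v)"
 by (simp add: vd Ai ed mult.commute)
 have st: "\<bar>s - t\<bar> > 0" using ds by (simp add: dist_real_def)
 have "\<bar>f (?x s) $ i - f (?x t) $ i - (A *. vec p v) $ i * (s - t)\<bar> / \<bar>s - t\<bar> <= e' * nrm p v"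
 using b st by (simp add: field_simps)
 also have "... <= e' * q" using e' np by (intro mult_left_mono) auto
 also have "... = e / 2" using np by (simp add: e'_def)
 also have "... < e" using e by simp
 finally show "dist ((f (?x s) $ i - f (?x t) $ i - (A *. vec p v) $ i * (s - t)) /\<^sub>R norm (s - t)) 0 < e"
 using st by (simp add: dist_real_def divide_inverse abs_mult mult.commute)
 qed
 qed
 qed
qed

text \<open>Mean value theorem along the segment to the centre, applied to each moment and to each entry of
 the Jacobian.\<close>

lemma taylor_bounds:
 fixes f :: "(nat => real) => real vec" and Jm :: "(nat => real) => real mat"
 assumes H1: "\<And>th. th : S ==> edist p th a < \<rho> ==> has_jacobian p S f (Jm th) th"
 and H2: "\<And>th i. th : S ==> edist p th a < \<rho> ==> i < m ==>
 has_jacobian p S (%th'. row (Jm th') i) (H th i) th"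
 and H3: "\<And>th u v. th : S ==> edist p th a < \<rho> ==> u : cvec p ==> v : cvec p ==>
 vnorm u = 1 ==> vnorm v = 1 ==> vnorm (vec m (%i. u .* (H th i *. v))) <= K"
 and ball: "{th : euclid p. edist p th a < \<rho>} <= S" and S: "S <= euclid p" and a: "a : S"
 and fc: "\<And>th. th : S ==> f th : cvec m" and Jc: "\<And>th. th : S ==> Jm th : cmat m p"
 and th: "th : S" "edist p th a < \<rho>" and i: "i < m"
 shows "\<bar>f th $ i - f a $ i - (Jm a *. (vec p th - vec p a)) $ i\<bar> <= K * (edist p th a)\<^sup>2"
 and "j < p ==> \<bar>Jm th $$ (i,j) - Jm a $$ (i,j)\<bar> <= K * edist p th a"
proof -
 define v where "v = (%j. th j - a j)"
 define x where "x s = (%j. a j + s * v j)" for s :: real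
 have vv: "vec p v = vec p th - vec p a" by (auto simp: v_def)
 have dist: "edist p th a = nrm p v" by (simp add: edist_def nrm_def vv)
 have xs: "edist p (x s) a = \<bar>s\<bar> * nrm p v" for s
 proof -
 have "vec p (x s) - vec p a = s \<cdot>\<^sub>v vec p v" by (auto simp: x_def)
 then show ?thesis by (simp add: edist_def nrm_def vnorm_smult)
 qed
 have near: "edist p (x s) a < \<rho>" if "s : {0..1}" for s
 proof -
 have "\<bar>s\<bar> * nrm p v <= 1 * nrm p v" using that by (intro mult_right_mono) auto
 then show ?thesis using th(2) unfolding xs dist by simp
 qed
 have inS: "x s : S" if "s : {0..1}" for s
 proof -
 have "a : euclid p" "th : euclid p" using S a th(1) by auto
 then have "x s : euclid p" by (auto simp: x_def v_def euclid_def)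
 then show ?thesis using ball near[OF that] by auto
 qed
 have x0: "x 0 = a" and x1: "x 1 = th" by (auto simp: x_def v_def)
 have Hc: "H (x s) i : cmat p p" if "s : {0..1}" for s
 using H2[OF inS[OF that] near[OF that] i] Jc[OF inS[OF that]] i by (simp add: has_jacobian_def)
 have Hb: "\<bar>w .* (H (x s) i *. vec p v)\<bar> <= K * (vnorm w * nrm p v)" if s: "s : {0..1}" and w: "w : cvec p" for s w
 proof (cases "vnorm w = 0 | nrm p v = 0")
 case True
 have "w .* (H (x s) i *. vec p v) = 0"
 proof (cases "vnorm w = 0")
 case True
 then have "w = 0\<^sub>v p" using vnorm_eq_0_iff[OF w] by simp
 then show ?thesis using Hc[OF s] by (simp add: mult_mat_vec_carrier[OF Hc[OF s]])
 next
 case False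
 then have "vec p v = 0\<^sub>v p" using True vnorm_eq_0_iff[of "vec p v" p] by (simp add: nrm_def)
 then show ?thesis using mult_mat_vec_zero[OF Hc[OF s]] w by simp
 qed
 then show ?thesis using True by auto
 next
 case False
 define w' v' where "w' = (1 / vnorm w) \<cdot>\<^sub>v w" and "v' = (1 / nrm p v) \<cdot>\<^sub>v vec p v"
 have c: "w' : cvec p" "v' : cvec p" "vnorm w' = 1" "vnorm v' = 1"
 using False w by (auto simp: w'_def v'_def vnorm_smult nrm_def)
 have "\<bar>w' .* (H (x s) i *. v')\<bar> <= vnorm (vec m (%i. w' .* (H (x s) i *. v')))"
 using abs_component_le_vnorm[of i "vec m (%i. w' .* (H (x s) i *. v'))"] i by simp
 also have "... <= K" by (rule H3[OF inS[OF s] near[OF s] c])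
 finally have "\<bar>w' .* (H (x s) i *. v')\<bar> <= K" .
 moreover have "w' .* (H (x s) i *. v') = (1 / vnorm w) * ((1 / nrm p v) * (w .* (H (x s) i *. vec p v)))"
 unfolding w'_def v'_def using Hc[OF s] w by (simp add: mult_mat_vec mult_mat_vec_carrier[OF Hc[OF s]])
 ultimately show ?thesis using False
 by (simp add: abs_mult pos_divide_le_eq less_le mult.commute mult.left_commute mult.assoc)
 qed
 have inner: "\<bar>(\<Sum>j<p. w $ j * Jm (x s) $$ (i,j)) - (\<Sum>j<p. w $ j * Jm a $$ (i,j))\<bar> <= K * (vnorm w * nrm p v)"
 if s: "s : {0..1}" and w: "w : cvec p" for s w
 proof -
 have rw: "row (Jm (x r)) i $ j = Jm (x r) $$ (i,j)" if "r : {0..1}" "j < p" for r j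
 using Jc[OF inS[OF that(1)]] i that(2) by simp
 have K0: "0 <= K * (vnorm w * nrm p v)" using Hb[OF s w] by simp
 have der: "((%r. \<Sum>j<p. w $ j * Jm (x r) $$ (i,j)) has_real_derivative w .* (H (x t) i *. vec p v)) (at t within {0..1})"
 if t: "t : {0..1}" for t
 proof -
 have "((%r. row (Jm (x r)) i $ j) has_real_derivative (H (x t) i *. vec p v) $ j) (at t within {0..1})"
 if j: "j < p" for j
 unfolding x_def
 proof (rule has_jacobian_segment_deriv)
 show "has_jacobian p S (%th'. row (Jm th') i) (H (%j. a j + t * v j) i) (%j. a j + t * v j)"
 using H2[OF inS[OF t] near[OF t] i] by (simp add: x_def)
 show "j < dim_vec (row (Jm (%j. a j + t * v j)) i)" using Jc[OF inS[OF t]] j by (simp add: x_def)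
 show "dim_vec (row (Jm y) i) = dim_vec (row (Jm (%j. a j + t * v j)) i)" if "y : S" for y
 using Jc[OF that] Jc[OF inS[OF t]] by (simp add: x_def)
 show "(%j. a j + s * v j) : S" if "s : {0..1}" for s using inS[OF that] by (simp add: x_def)
 qed
 then have "((%r. \<Sum>j<p. w $ j * row (Jm (x r)) i $ j) has_real_derivative
 (\<Sum>j<p. w $ j * (H (x t) i *. vec p v) $ j)) (at t within {0..1})"
 by (intro DERIV_sum DERIV_cmult) auto
 moreover have "(\<Sum>j<p. w $ j * (H (x t) i *. vec p v) $ j) = w .* (H (x t) i *. vec p v)"
 using Hc[OF t] by (simp add: scalar_prod_def lessThan_atLeast0)
 moreover have "((%r. \<Sum>j<p. w $ j * row (Jm (x r)) i $ j) has_real_derivative D) (at t within {0..1}) =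
 ((%r. \<Sum>j<p. w $ j * Jm (x r) $$ (i,j)) has_real_derivative D) (at t within {0..1})" for D
 proof (rule has_field_derivative_cong_eventually)
 show "\<forall>\<^sub>F r in at t within {0..1}. (\<Sum>j<p. w $ j * row (Jm (x r)) i $ j) = (\<Sum>j<p. w $ j * Jm (x r) $$ (i,j))"
 unfolding eventually_at using rw by (intro exI[of _ 1]) auto
 show "(\<Sum>j<p. w $ j * row (Jm (x t)) i $ j) = (\<Sum>j<p. w $ j * Jm (x t) $$ (i,j))"
 using rw[OF t] by simp
 qed
 ultimately show ?thesis by simp
 qed
 have "\<exists>t\<in>{0..s}. (\<Sum>j<p. w $ j * Jm (x s) $$ (i,j)) - (\<Sum>j<p. w $ j * Jm (x 0) $$ (i,j)) =
 ((*) (w .* (H (x t) i *. vec p v))) (s - 0)"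
 proof (rule mvt_very_simple[where f'="%t. (*) (w .* (H (x t) i *. vec p v))"])
 show "0 <= s" using s by simp
 fix t assume "0 <= t" "t <= s"
 then have t: "t : {0..1}" using s by auto
 show "((%r. \<Sum>j<p. w $ j * Jm (x r) $$ (i,j)) has_derivative ((*) (w .* (H (x t) i *. vec p v)))) (at t within {0..s})"
 using has_derivative_subset[OF der[OF t, unfolded has_field_derivative_def], of "{0..s}"] s
 by auto
 qed
 then obtain t where t: "t : {0..s}" "(\<Sum>j<p. w $ j * Jm (x s) $$ (i,j)) - (\<Sum>j<p. w $ j * Jm a $$ (i,j)) =
 s * (w .* (H (x t) i *. vec p v))" by (auto simp: x0 mult.commute)
 have "\<bar>s * (w .* (H (x t) i *. vec p v))\<bar> <= 1 * (K * (vnorm w * nrm p v))"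
 unfolding abs_mult using s t Hb[of t w] w by (intro mult_mono) auto
 then show ?thesis using t(2) by simp
 qed
 show "\<bar>Jm th $$ (i,j) - Jm a $$ (i,j)\<bar> <= K * edist p th a" if j: "j < p"
 proof -
 have "(\<Sum>k<p. unit_vec p j $ k * B $$ (i,k)) = B $$ (i,j)" for B :: "real mat"
 using j by (simp add: unit_vec_def if_distrib[of "%x. x * _"] cong: if_cong)
 then show ?thesis using inner[of 1 "unit_vec p j"] by (simp add: x1 dist vnorm_unit_vec[OF j])
 qed
 have d: "((%s. f (x s) $ i) has_real_derivative (Jm (x t) *. vec p v) $ i) (at t within {0..1})" if t: "t : {0..1}" for t
 unfolding x_def
 proof (rule has_jacobian_segment_deriv)
 show "has_jacobian p S f (Jm (%j. a j + t * v j)) (%j. a j + t * v j)"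
 using H1[OF inS[OF t] near[OF t]] by (simp add: x_def)
 show "i < dim_vec (f (%j. a j + t * v j))" using fc[OF inS[OF t]] i by (simp add: x_def)
 show "dim_vec (f y) = dim_vec (f (%j. a j + t * v j))" if "y : S" for y
 using fc[OF that] fc[OF inS[OF t]] by (simp add: x_def)
 show "(%j. a j + s * v j) : S" if "s : {0..1}" for s using inS[OF that] by (simp add: x_def)
 qed
 have "\<exists>t\<in>{0..1}. f (x 1) $ i - f (x 0) $ i = ((*) ((Jm (x t) *. vec p v) $ i)) (1 - 0)"
 by (rule mvt_very_simple[where f'="%t. (*) ((Jm (x t) *. vec p v) $ i)"]) (use d in \<open>auto simp: has_field_derivative_def\<close>)
 then obtain t where t: "t : {0..1}" "f th $ i - f a $ i = (Jm (x t) *. vec p v) $ i"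
 by (auto simp: x0 x1)
 have e: "(B *. vec p v) $ i = (\<Sum>j<p. vec p v $ j * B $$ (i,j))" if "B : cmat m p" for B
 using that i by (auto simp: scalar_prod_def lessThan_atLeast0 intro!: sum.cong)
 have "\<bar>f th $ i - f a $ i - (Jm a *. vec p v) $ i\<bar> <= K * (vnorm (vec p v) * nrm p v)"
 unfolding t(2) e[OF Jc[OF inS[OF t(1)]]] e[OF Jc[OF a]] by (rule inner[OF t(1)]) simp
 then show "\<bar>f th $ i - f a $ i - (Jm a *. (vec p th - vec p a)) $ i\<bar> <= K * (edist p th a)\<^sup>2"
 unfolding vv[symmetric] dist by (simp add: nrm_def power2_eq_square)
qed

section \<open>A model at a fixed sample size\<close>

locale rg =
 fixes n :: nat and X :: "'d gmm" and N0 :: nat and env :: "'d => real"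
 and l u R r0 c1 K4 \<alpha> KF cpi c0 tmin rr \<tau> :: real
 assumes n_pos: "0 < n"
 and vm: "valid_moments X" and vw: "valid_weights n X" and vp: "valid_prior X" and ve: "valid_estimator n X"
 and mean0: "mean_mom X (theta0 X) = 0\<^sub>v (mdim X)"
 and compact_Theta: "compact (Theta X)"
 and Theta_le: "\<And>th. th : Theta X ==> nrm (pdim X) th <= R"
 and r0: "0 < r0" and ball: "{th : euclid (pdim X). edist (pdim X) th (theta0 X) < r0} <= Theta X"
 and dims: "1 <= pdim X" "pdim X <= mdim X" "mdim X <= N0"
 and hoelder: "\<And>th et. th : Theta X ==> et : cvec (mdim X) ==> vnorm et = 1 ==>
 L2_norm_of (data_law X) (%d. et .* (mom X d th - mom X d (theta0 X))) <= K4 * edist (pdim X) th (theta0 X) powr \<alpha>"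
 and \<alpha>: "0 < \<alpha>" and K4: "0 <= K4"
 and env: "env : square_integrable (data_law X)"
 "\<And>f d. f : moment_class X ==> d : space (data_law X) ==> \<bar>f d\<bar> <= env d"
 "(LINT d|data_law X. (env d)\<^sup>2) <= KF"
 and sep: "\<And>th. th : Theta X ==> c1 * edist (pdim X) th (theta0 X) <= vnorm (mean_mom X th)" and c1: "0 < c1"
 and jac: "\<And>th. th : Theta X ==> has_jacobian (pdim X) (Theta X) (mean_mom X) (Jac X th) th"
 and lu: "0 < l" "l <= u"
 and eig_J: "\<And>th. th : Theta X ==> eigenvalues_in (transpose_mat (Jac X th) * Jac X th) l u"
 and eig_V: "\<And>th. th : Theta X ==> eigenvalues_in (var_mom X th) l u"
 and cont_V: "\<And>i j. i < mdim X ==> j < mdim X ==> continuous_on (Theta X) (%th. var_mom X th $$ (i,j))"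
 and cont_J: "\<And>i j. i < mdim X ==> j < pdim X ==> continuous_on (Theta X) (%th. Jac X th $$ (i,j))"
 and prior_le: "\<And>M th. M : models X ==> th : Theta_of X M ==> cond_prior X M th <= cpi" and cpi: "0 <= cpi"
 and prior_ge: "\<And>M. M : models X ==> true_model X <= M ==>
 exp (- c0 * real (card M)) <= cond_prior X M (theta0 X)" and c0: "0 < c0"
 and signal: "\<And>j. j : true_model X ==> tmin <= \<bar>theta0 X j\<bar>" and tmin: "0 < tmin"
 and model_pos: "\<And>M. M : models X ==> 0 < model_prior X M"
 and model_ratio: "\<And>M M'. M : models X ==> M' : models X ==> model_prior X M' / model_prior X M <= rr"
 and Fmat: "\<And>th. th : Theta X ==> Fmat X th : cmat (pdim X) (pdim X)"
 "\<And>th. th : Theta X ==> transpose_mat (Fmat X th) * Fmat X th = sandwich (Jac X th) (var_mom X th)"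
 and Z_nonneg: "\<And>th z. th : Theta X ==> 0 <= Z_dens X z th"
 and Z_dist: "\<And>th. th : Theta X ==> distributed (sample_law_at n X th) (cleb {..<pdim X})
 (Z_stat n X th) (%z. enn (Z_dens X z th))"
 and Z_normal: "\<And>th z. th : Theta X ==> z : euclid (pdim X) ==>
 (1 + nrm (pdim X) z ^ (pdim X + 1)) *
 \<bar>Z_dens X z th - normal_dens (pdim X) (0\<^sub>v (pdim X)) (1\<^sub>m (pdim X)) (vec (pdim X) z)\<bar> <= \<tau>"
begin

abbreviation "Tm == true_model X"
abbreviation "p == pdim X"
abbreviation "m == mdim X"
abbreviation "\<Theta> == Theta X"
abbreviation "t0 == theta0 X"
abbreviation "s == sqrt (real n)"
abbreviation "P == data_law X"
abbreviation "OM == sample_law n X"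

lemma s: "0 < s" "1 <= s" "s * s = real n" "s\<^sup>2 = real n"
 using n_pos by auto

lemma t0_in: "t0 : \<Theta>" using vm by (simp add: valid_moments_def)

lemma Theta_euclid: "\<Theta> <= euclid p" using vm by (auto simp: valid_moments_def)

lemma u_pos: "0 < u" using lu by simp

lemma closed_Theta: "closed \<Theta>" using compact_Theta by (rule compact_imp_closed)

lemma sets_Theta [measurable]: "\<Theta> : sets borel" using closed_Theta by (rule borel_closed)

lemma p_le: "p <= N0" using dims by simp

lemma prob_P: "prob_space P"
 using vm by (auto simp: valid_moments_def data_law_def)

lemma OM_eq: "OM = PiM {..<n} (%_. P)"
 by (simp add: sample_law_def sample_law_at_def data_law_def)

lemma prob_OM: "prob_space OM"
 unfolding OM_eq by (rule prob_space_sample[OF prob_P])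

lemma sample_in_space: "D : space OM ==> k < n ==> D k : space P"
 unfolding OM_eq by (auto simp: space_PiM PiE_def Pi_def)

text \<open>Parameters outside the parameter space are mapped to theta0, so that the likelihoods become
 measurable functions on the whole space.\<close>

definition clamp :: "(nat => real) => nat => real" where
 "clamp th = (if th : \<Theta> then th else t0)"

lemma clamp_in [simp]: "clamp th : \<Theta>" and clamp_id [simp]: "th : \<Theta> ==> clamp th = th"
 by (auto simp: clamp_def t0_in)

lemma measurable_clamp [measurable]: "clamp : borel \<rightarrow>\<^sub>M restrict_space borel \<Theta>"
 unfolding clamp_def by (intro measurable_restrict_space2) (auto simp: t0_in)

lemma measurable_clamp_compose:
 "f : borel_measurable (restrict_space borel \<Theta>) ==> (%th. f (clamp th)) : bmb"
 by (rule mcomp[OF measurable_clamp])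

lemma continuous_clamp_measurable:
 "continuous_on \<Theta> f ==> (%th. f (clamp th) :: real) : bmb"
 by (intro measurable_clamp_compose borel_measurable_continuous_on_restrict)

text \<open>The local coordinate at the root n rate.\<close>

definition hsc :: "(nat => real) => nat => real" where
 "hsc th = (%j. s * (th j - t0 j))"

abbreviation "hn th == nrm (pdim X) (hsc th)"

lemma measurable_hsc [measurable]: "hsc : bmb"
 unfolding hsc_def by (rule meas_coord) measurable

lemma vec_hsc: "vec p (hsc th) = s \<cdot>\<^sub>v (vec p th - vec p t0)"
 by (auto simp: hsc_def)

lemma nrm_hsc: "hn th = s * edist p th t0"
 unfolding nrm_def vec_hsc vnorm_smult edist_def using s by simp

subsection \<open>Moments\<close>

lemma mom_carrier: "d : space P ==> th : \<Theta> ==> mom X d th : cvec m"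
 using vm by (auto simp: valid_moments_def)

definition momc :: "nat => 'd => (nat => real) => real" where
 "momc i d th = mom X d (clamp th) $ i"

lemma measurable_momc:
 assumes "i < m" shows "(%(d,th). momc i d th) : borel_measurable (P \<Otimes>\<^sub>M borel)"
proof -
 have "(%(d, th). mom X d th $ i) : borel_measurable (P \<Otimes>\<^sub>M restrict_space borel \<Theta>)"
 using vm assms by (simp add: valid_moments_def)
 moreover have "(%(d,th). (d, clamp th)) : P \<Otimes>\<^sub>M borel \<rightarrow>\<^sub>M P \<Otimes>\<^sub>M restrict_space borel \<Theta>" by measurable
 ultimately have "(%x. (%(d, th). mom X d th $ i) ((%(d,th). (d, clamp th)) x)) : borel_measurable (P \<Otimes>\<^sub>M borel)"
 by (rule measurable_compose[rotated])
 then show ?thesis by (simp add: momc_def split_beta')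
qed

lemma mom_square_integrable:
 "i < m ==> th : \<Theta> ==> (%d. mom X d th $ i) : borel_measurable P &
 integrable P (%d. (mom X d th $ i)\<^sup>2) & integrable P (%d. mom X d th $ i)"
proof -
 assume "i < m" "th : \<Theta>"
 then have *: "(%d. mom X d th $ i) : borel_measurable P" "integrable P (%d. (mom X d th $ i)\<^sup>2)"
 using vm by (auto simp: valid_moments_def square_integrable_def)
 interpret prob_space P by (rule prob_P)
 show ?thesis using * square_integrable_imp_integrable[OF *] by blast
qed

definition fm :: "nat => (nat => real) => 'd => real" where
 "fm i th d = momc i d th - momc i d t0"

lemma measurable_fm:
 assumes i: "i < m" shows "(%(d,th). fm i th d) : borel_measurable (P \<Otimes>\<^sub>M borel)"
proof -
 note [measurable] = measurable_momc[OF i]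
 have "(%(d,th). momc i d t0) : borel_measurable (P \<Otimes>\<^sub>M (borel :: (nat => real) measure))" by measurable
 then show ?thesis unfolding fm_def by measurable
qed

lemma measurable_fm1 [measurable (raw)]: "i < m ==> fm i th : borel_measurable P"
 using mom_square_integrable[of i "clamp th"] mom_square_integrable[of i t0]
 unfolding fm_def momc_def by (auto simp: t0_in)

lemma fm_eq_unit:
 assumes "i < m" "d : space P"
 shows "fm i th d = unit_vec m i .* (mom X d (clamp th) - mom X d t0)"
 using assms mom_carrier[OF assms(2) clamp_in[of th]] mom_carrier[OF assms(2) t0_in]
 by (simp add: fm_def momc_def t0_in)

lemma fm_env: "i < m ==> d : space P ==> \<bar>fm i th d\<bar> <= env d"
proof -
 assume i: "i < m" and d: "d : space P"
 have "(%d. unit_vec m i .* (mom X d (clamp th) - mom X d t0)) : moment_class X"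
 unfolding moment_class_def using i vnorm_unit_vec[OF i] by (auto intro!: exI[of _ "clamp th"] exI[of _ "unit_vec m i"])
 from env(2)[OF this d] show ?thesis by (simp add: fm_eq_unit[OF i d])
qed

lemma env_measurable [measurable]: "env : borel_measurable P"
 and env_integrable: "integrable P (%d. (env d)\<^sup>2)"
 using env(1) by (auto simp: square_integrable_def)

lemma KF_nonneg: "0 <= KF"
 using env(3) integral_nonneg_AE[of "%d. (env d)\<^sup>2" P] by (smt (verit) always_eventually zero_le_power2)

lemma fm_sq_integrable: "i < m ==> integrable P (%d. (fm i th d)\<^sup>2)"
proof (rule Bochner_Integration.integrable_bound[OF env_integrable])
 assume i: "i < m"
 show "(%d. (fm i th d)\<^sup>2) : borel_measurable P" using i by measurable
 have "(fm i th d)\<^sup>2 <= (env d)\<^sup>2" if "d : space P" for d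
 using fm_env[OF i that, of th] by (auto simp: abs_le_square_iff[symmetric])
 then show "AE x in P. norm ((fm i th x)\<^sup>2) <= norm ((env x)\<^sup>2)" by (intro AE_I2) auto
qed

lemma fm_sq_le:
 assumes i: "i < m"
 shows "(LINT d|P. (fm i th d)\<^sup>2) <= (K4 * edist p (clamp th) t0 powr \<alpha>)\<^sup>2" "(LINT d|P. (fm i th d)\<^sup>2) <= KF"
proof -
 have "L2_norm_of P (%d. unit_vec m i .* (mom X d (clamp th) - mom X d t0)) <= K4 * edist p (clamp th) t0 powr \<alpha>"
 using i by (intro hoelder vnorm_unit_vec) auto
 moreover have "L2_norm_of P (%d. unit_vec m i .* (mom X d (clamp th) - mom X d t0)) = sqrt (LINT d|P. (fm i th d)\<^sup>2)"
 unfolding L2_norm_of_def using fm_eq_unit[OF i] by (intro arg_cong[where f=sqrt] Bochner_Integration.integral_cong) auto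
 ultimately have "sqrt (LINT d|P. (fm i th d)\<^sup>2) <= K4 * edist p (clamp th) t0 powr \<alpha>" by simp
 moreover have "0 <= (LINT d|P. (fm i th d)\<^sup>2)" by simp
 ultimately show "(LINT d|P. (fm i th d)\<^sup>2) <= (K4 * edist p (clamp th) t0 powr \<alpha>)\<^sup>2"
 by (metis power_mono real_sqrt_ge_zero real_sqrt_pow2)
 have "(LINT d|P. (fm i th d)\<^sup>2) <= (LINT d|P. (env d)\<^sup>2)"
 using fm_env[OF i, of _ th]
 by (intro integral_mono fm_sq_integrable env_integrable i)
 (auto simp: abs_le_square_iff[symmetric] intro: order_trans[OF _ abs_ge_self])
 then show "(LINT d|P. (fm i th d)\<^sup>2) <= KF" using env(3) by simp
qed

lemma mean_fm: "i < m ==> (LINT d|P. fm i th d) = mean_mom X (clamp th) $ i"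
proof -
 assume i: "i < m"
 have "mean_mom X t0 $ i = 0" using mean0 i by simp
 then have "(LINT d|P. mom X d t0 $ i) = 0" using i by (simp add: mean_mom_def)
 then show ?thesis
 using mom_square_integrable[OF i clamp_in] mom_square_integrable[OF i t0_in] i
 by (simp add: fm_def momc_def t0_in mean_mom_def)
qed

lemma mean_mom_carrier [simp]: "mean_mom X th : cvec m" by (simp add: mean_mom_def)

definition W :: "(nat => 'd) => real vec" where "W D = s \<cdot>\<^sub>v gbar n X D t0"

definition Y :: "(nat => 'd) => (nat => real) => real vec" where "Y D th = s \<cdot>\<^sub>v gbar n X D (clamp th)"

text \<open>The centred fluctuation of a moment between theta0 and th; the scaled sample moment is the score
 plus the scaled mean plus this term (Y_decomp).\<close>

definition Rm :: "(nat => 'd) => (nat => real) => nat => real" where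
 "Rm D th i = (\<Sum>k<n. (fm i th (D k) - (LINT d|P. fm i th d))) / s"

lemma W_carrier [simp]: "W D : cvec m" and Y_carrier [simp]: "Y D th : cvec m"
 by (auto simp: W_def Y_def gbar_def)

lemma s_div: "s * x / real n = x / s"
 using s by (simp add: field_simps)

lemma Y_decomp: "i < m ==> Y D th $ i = W D $ i + s * mean_mom X (clamp th) $ i + Rm D th i"
proof -
 assume i: "i < m"
 have 1: "Y D th $ i = (\<Sum>k<n. momc i (D k) th) / s" "W D $ i = (\<Sum>k<n. momc i (D k) t0) / s"
 using i by (auto simp: Y_def W_def gbar_def momc_def t0_in s_div)
 have "Rm D th i = ((\<Sum>k<n. momc i (D k) th) - (\<Sum>k<n. momc i (D k) t0) - real n * mean_mom X (clamp th) $ i) / s"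
 proof -
 have "Rm D th i = ((\<Sum>k<n. fm i th (D k)) - real n * mean_mom X (clamp th) $ i) / s"
 using i by (simp add: Rm_def mean_fm sum_subtractf)
 then show ?thesis by (simp add: fm_def sum_subtractf)
 qed
 also have "... = Y D th $ i - W D $ i - s * mean_mom X (clamp th) $ i"
 proof -
 have "real n * x / s = s * x" for x
 proof -
 have "real n * x / s = (s * s) * x / s" by (simp only: s(3))
 also have "... = s * x" using s(1) by (simp only: mult.assoc) simp
 finally show ?thesis .
 qed
 then show ?thesis unfolding 1 by (simp only: diff_divide_distrib)
 qed
 finally show ?thesis by simp
qed

lemma measurable_sample_comp [measurable]: "k < n ==> (%D. D k) : OM \<rightarrow>\<^sub>M P"
 unfolding OM_eq by measurable

lemma measurable_sample_fm:
 assumes i: "i < m" and k: "k < n"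
 shows "(%(D,th). fm i th (D k)) : borel_measurable (OM \<Otimes>\<^sub>M borel)"
proof -
 have "(%(D,th). (D k, th)) : OM \<Otimes>\<^sub>M borel \<rightarrow>\<^sub>M P \<Otimes>\<^sub>M (borel :: (nat => real) measure)"
 unfolding split_beta'
 by (intro measurable_Pair mcomp[OF measurable_fst measurable_sample_comp[OF k]] measurable_snd)
 from mcomp[OF this measurable_fm[OF i]] show ?thesis by (simp add: split_beta')
qed

lemma measurable_mean_fm:
 assumes i: "i < m" shows "(%th. LINT d|P. fm i th d) : bmb"
proof -
 interpret prob_space P by (rule prob_P)
 have "(%(th,d). fm i th d) : borel_measurable (borel \<Otimes>\<^sub>M P)"
 using measurable_pair_swap[OF measurable_fm[OF i]] by (simp add: split_beta')
 then show ?thesis by (rule borel_measurable_lebesgue_integral)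
qed

lemma measurable_Rm:
 assumes i: "i < m" shows "(%(D,th). Rm D th i) : borel_measurable (OM \<Otimes>\<^sub>M borel)"
proof -
 have "(%x. (\<Sum>k<n. (fm i (snd x) (fst x k) - (LINT d|P. fm i (snd x) d))) / s) : borel_measurable (OM \<Otimes>\<^sub>M borel)"
 using measurable_sample_fm[OF i] mcomp[OF measurable_snd measurable_mean_fm[OF i]]
 by (intro borel_measurable_divide borel_measurable_sum borel_measurable_diff) (auto simp: split_beta')
 then show ?thesis by (simp add: Rm_def split_beta')
qed

text \<open>A single statistic controls the size of the score and of the envelope over the sample.\<close>

definition tight :: "(nat => 'd) => real" where
 "tight D = (vnorm (W D))\<^sup>2 + (\<Sum>k<n. (env (D k))\<^sup>2) / real n"

lemma coercive_V: "th : \<Theta> ==> coercive m l u (var_mom X th)"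
proof (rule eigenvalues_in_coercive)
 show "var_mom X th : cmat m m" by (simp add: var_mom_def)
 show "transpose_mat (var_mom X th) = var_mom X th" by (rule eq_matI) (auto simp: var_mom_def mult.commute)
qed (use eig_V lu in auto)

lemma Jac_carrier: "th : \<Theta> ==> Jac X th : cmat m p"
 using jac[of th] by (simp add: has_jacobian_def mean_mom_def)

lemma coercive_gram: "th : \<Theta> ==> coercive p l u (transpose_mat (Jac X th) * Jac X th)"
 using Jac_carrier[of th] by (intro eigenvalues_in_coercive) (auto simp: eig_J lu transpose_mult[of _ p m _ p])

lemma W_sq: "(vnorm (W D))\<^sup>2 = (\<Sum>i<m. ((\<Sum>k<n. momc i (D k) t0)\<^sup>2 / real n))"
proof -
 have d: "dim_vec (W D) = m" by (rule carrier_vecD) simp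
 have "(vnorm (W D))\<^sup>2 = (\<Sum>i<m. (W D $ i)\<^sup>2)"
 unfolding vnorm_sq by (simp add: d scalar_prod_def lessThan_atLeast0 power2_eq_square)
 also have "... = (\<Sum>i<m. ((\<Sum>k<n. momc i (D k) t0)\<^sup>2 / real n))"
 using s by (intro sum.cong) (auto simp: W_def gbar_def momc_def t0_in s_div power_divide)
 finally show ?thesis .
qed

lemma measurable_momc1: "i < m ==> (%d. momc i d t0) : borel_measurable P"
 using mom_square_integrable[of i t0] by (simp add: momc_def t0_in)

lemma measurable_momc_sample: "i < m ==> k < n ==> (%D. momc i (D k) t0) : borel_measurable OM"
 by (rule mcomp[OF measurable_sample_comp measurable_momc1])

lemma measurable_tight [measurable]: "tight : borel_measurable OM"
 unfolding tight_def W_sq using measurable_momc_sample by measurable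

lemma tight_nonneg: "0 <= tight D"
 by (auto simp: tight_def intro!: add_nonneg_nonneg divide_nonneg_nonneg sum_nonneg)

lemma score_second_moment:
 assumes i: "i < m"
 shows "(NI OM (%D. enn ((\<Sum>k<n. momc i (D k) t0)\<^sup>2 / real n))) <= enn u"
proof -
 note mi = mom_square_integrable[OF i t0_in]
 have mean: "(LINT d|P. mom X d t0 $ i) = 0"
 using arg_cong[OF mean0, of "%v. v $ i"] i by (simp add: mean_mom_def)
 have "(LINT d|P. (momc i d t0)\<^sup>2) = V0 X $$ (i,i)"
 using i mean by (simp add: var_mom_def mean_mom_def momc_def t0_in power2_eq_square)
 also have "... <= u" using coercive_entry_le[OF coercive_V[OF t0_in] i i] by simp
 finally have B: "(LINT d|P. (momc i d t0)\<^sup>2) <= u" .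
 have ms: "(%D. enn ((\<Sum>k<n. momc i (D k) t0)\<^sup>2)) : borel_measurable OM"
 using measurable_momc_sample[OF i] by measurable
 have "(NI OM (%D. enn ((\<Sum>k<n. momc i (D k) t0)\<^sup>2 / real n))) =
 (NI OM (%D. enn (1 / real n) * enn ((\<Sum>k<n. momc i (D k) t0)\<^sup>2)))"
 by (intro nn_integral_cong) (simp flip: ennreal_mult)
 also have "... = enn (1 / real n) * (NI OM (%D. enn ((\<Sum>k<n. momc i (D k) t0)\<^sup>2)))"
 by (rule nn_integral_cmult[OF ms])
 also have "... <= enn (1 / real n) * enn (real n * u)"
 proof (rule mult_left_mono)
 show "(NI OM (%D. enn ((\<Sum>k<n. momc i (D k) t0)\<^sup>2))) <= enn (real n * u)"
 using nn_integral_sq_iid_sum[OF prob_P measurable_momc1[OF i] _ B, of n] mi mean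
 by (simp add: OM_eq momc_def t0_in)
 qed simp
 also have "... = enn u" using n_pos u_pos by (simp flip: ennreal_mult)
 finally show ?thesis .
qed

lemma env_second_moment:
 assumes k: "k < n"
 shows "(NI OM (%D. enn ((env (D k))\<^sup>2 / real n))) <= enn (KF / real n)"
proof -
 interpret product_prob_space "%_::nat. P" by (rule product_prob_space_iid[OF prob_P])
 have "distr OM P (%D. D k) = P"
 unfolding OM_eq using k prob_P by (intro distr_PiM_component) auto
 then have "(NI OM (%D. enn ((env (D k))\<^sup>2 / real n))) = (NI P (%d. enn ((env d)\<^sup>2 / real n)))"
 using nn_integral_distr[OF measurable_sample_comp[OF k], of "%d. enn ((env d)\<^sup>2 / real n)"] by simp
 also have "... = enn ((LINT d|P. (env d)\<^sup>2) / real n)"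
 using env_integrable by (subst nn_integral_eq_integral) auto
 also have "... <= enn (KF / real n)" using env(3) by (intro ennreal_leI divide_right_mono) auto
 finally show ?thesis .
qed

lemma nn_integral_tight: "(NI OM (%D. enn (tight D))) <= enn (real N0 * u + KF)"
proof -
 define A where "A i D = enn ((\<Sum>k<n. momc i (D k) t0)\<^sup>2 / real n)" for i and D :: "nat => 'd"
 define B where "B k D = enn ((env (D k))\<^sup>2 / real n)" for k and D :: "nat => 'd"
 have ma: "A i : borel_measurable OM" if "i < m" for i
 unfolding A_def using measurable_momc_sample[OF that] by measurable
 have mb: "B k : borel_measurable OM" if "k < n" for k
 unfolding B_def using that by measurable
 have "(NI OM (%D. enn (tight D))) = (NI OM (%D. (\<Sum>i<m. A i D) + (\<Sum>k<n. B k D)))"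
 unfolding A_def B_def
 by (intro nn_integral_cong) (simp add: tight_def W_sq sum_divide_distrib sum_nonneg flip: ennreal_plus)
 also have "... = (\<Sum>i<m. \<integral>\<^sup>+D. A i D \<partial>OM) + (\<Sum>k<n. \<integral>\<^sup>+D. B k D \<partial>OM)"
 proof -
 have 1: "(NI OM (%D. (\<Sum>i<m. A i D))) = (\<Sum>i<m. \<integral>\<^sup>+D. A i D \<partial>OM)"
 by (rule nn_integral_sum) (simp add: ma)
 have 2: "(NI OM (%D. (\<Sum>k<n. B k D))) = (\<Sum>k<n. \<integral>\<^sup>+D. B k D \<partial>OM)"
 by (rule nn_integral_sum) (simp add: mb)
 have "(NI OM (%D. (\<Sum>i<m. A i D) + (\<Sum>k<n. B k D))) = (NI OM (%D. (\<Sum>i<m. A i D))) + (NI OM (%D. (\<Sum>k<n. B k D)))"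
 by (rule nn_integral_add; rule borel_measurable_sum) (simp_all add: ma mb)
 then show ?thesis unfolding 1 2 .
 qed
 also have "... <= (\<Sum>i<m. enn u) + (\<Sum>k<n. enn (KF / real n))"
 proof (rule add_mono)
 show "(\<Sum>i<m. \<integral>\<^sup>+D. A i D \<partial>OM) <= (\<Sum>i<m. enn u)"
 unfolding A_def by (rule sum_mono) (simp add: score_second_moment)
 show "(\<Sum>k<n. \<integral>\<^sup>+D. B k D \<partial>OM) <= (\<Sum>k<n. enn (KF / real n))"
 unfolding B_def by (rule sum_mono) (simp add: env_second_moment)
 qed
 also have "... = enn (real m * u) + enn (real n * (KF / real n))"
 using u_pos KF_nonneg by (simp add: ennreal_of_nat_eq_real_of_nat flip: ennreal_mult)
 also have "... = enn (real m * u + KF)"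
 using u_pos KF_nonneg n_pos by (simp flip: ennreal_plus)
 also have "... <= enn (real N0 * u + KF)"
 using dims u_pos by (intro ennreal_leI add_right_mono mult_right_mono) auto
 finally show ?thesis .
qed

end

lemma measurable_coord_lebesgue_eq [simp]: "measurable (cleb M) N = measurable borel N"
 by (rule measurable_cong_sets) auto

context rg begin

subsection \<open>The prior as a measure\<close>

definition pr :: "nat set => (nat => real) => real" where
 "pr M th = indicator (Theta_of X M) th * cond_prior X M th"

definition plaw :: "nat set => (nat => real) measure" where
 "plaw M = density (cleb M) (%th. enn (pr M th))"

lemma models_finite: "M : models X ==> finite M" "M : models X ==> M <= {..<p}" "M : models X ==> card M <= p"
 using card_mono[of "{..<p}" M] by (auto simp: models_def finite_subset)

lemma sets_Theta_of [measurable]: "Theta_of X M : sets borel"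
proof -
 have "Theta_of X M = \<Theta> \<inter> {th. ALL j:{..<p} - M. th j = 0}" by (auto simp: Theta_of_def)
 moreover have "{th::nat=>real. ALL j:{..<p} - M. th j = 0} : sets borel" by measurable
 ultimately show ?thesis by simp
qed

lemma Theta_of_subset: "Theta_of X M <= \<Theta>" by (auto simp: Theta_of_def)

lemma measurable_pr [measurable]: "M : models X ==> pr M : bmb"
proof -
 assume "M : models X"
 then have "cond_prior X M : borel_measurable (restrict_space borel (Theta_of X M))"
 using vp by (simp add: valid_prior_def)
 then show ?thesis unfolding pr_def
 by (subst (asm) borel_measurable_restrict_space_iff) auto
qed

lemma pr_nonneg: "M : models X ==> 0 <= pr M th"
 using vp by (auto simp: pr_def valid_prior_def indicator_def)

lemma pr_le: "M : models X ==> pr M th <= cpi"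
 using prior_le cpi by (auto simp: pr_def indicator_def)

lemma sets_plaw [simp, measurable_cong]: "sets (plaw M) = sets borel"
 and space_plaw [simp]: "space (plaw M) = UNIV"
 by (auto simp: plaw_def)

lemma measurable_plaw_eq [simp]: "measurable (plaw M) N = measurable borel N"
 by (rule measurable_cong_sets) auto

lemma measurable_pair_plaw_eq: "measurable (K \<Otimes>\<^sub>M plaw M) N = measurable (K \<Otimes>\<^sub>M borel) N"
 by (intro measurable_cong_sets sets_pair_measure_cong) auto

lemma prob_plaw: "M : models X ==> prob_space (plaw M)"
proof
 assume M: "M : models X"
 have "emeasure (plaw M) (space (plaw M)) = (NI (cleb M) (%th. enn (pr M th)))"
 unfolding plaw_def using M measurable_pr[OF M]
 by (subst emeasure_density) (auto intro!: mcomp[OF _ measurable_ennreal])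
 also have "... = (\<integral>\<^sup>+th\<in>Theta_of X M. enn (cond_prior X M th) \<partial>cleb M)"
 by (intro nn_integral_cong) (auto simp: pr_def indicator_def)
 also have "... = 1" using vp M by (simp add: valid_prior_def)
 finally show "emeasure (plaw M) (space (plaw M)) = 1" .
qed

lemma sigma_finite_plaw: "M : models X ==> sigma_finite_measure (plaw M)"
 by (rule prob_space_imp_sigma_finite[OF prob_plaw])

lemma AE_plaw: "M : models X ==> AE th in plaw M. th : Theta_of X M"
proof -
 assume M: "M : models X"
 have "(%th. enn (pr M th)) : borel_measurable (cleb M)" using measurable_pr[OF M] by simp
 then show ?thesis unfolding plaw_def by (subst AE_density) (auto simp: pr_def indicator_def split: if_splits)
qed

lemma t0_zero: "Tm <= M ==> j \<notin> M ==> t0 j = 0"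
 using subsetD[OF Theta_euclid t0_in] by (cases "j < p") (auto simp: true_model_def euclid_def)

text \<open>A bounded prior density sees a region of fixed size in the local coordinate with weight s^(-|M|).\<close>

lemma nn_integral_plaw_le:
 assumes M: "M : models X" "Tm <= M" and g[measurable]: "g : bmb"
 shows "(NI (plaw M) (%th. g (hsc th))) <= enn (cpi / s ^ card M) * (NI (cleb M) (%x. g x))"
proof -
 have "(NI (plaw M) (%th. g (hsc th))) = (NI (cleb M) (%th. enn (pr M th) * g (hsc th)))"
 unfolding plaw_def using measurable_pr[OF M(1)] mcomp[OF measurable_hsc g]
 by (intro nn_integral_density) simp_all
 also have "... <= (NI (cleb M) (%th. enn cpi * g (hsc th)))"
 using pr_le[OF M(1)] by (intro nn_integral_mono mult_right_mono ennreal_leI) auto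
 also have "... = enn cpi * (NI (cleb M) (%th. g (hsc th)))"
 by (rule nn_integral_cmult) measurable
 also have "(NI (cleb M) (%th. g (hsc th))) = enn (1 / s ^ card M) * (NI (cleb M) (%x. g x))"
 unfolding hsc_def using models_finite(1)[OF M(1)] s t0_zero[OF M(2)]
 by (intro nn_integral_coord_affine) auto
 finally show ?thesis using cpi s by (simp add: mult.assoc[symmetric] flip: ennreal_mult)
qed

lemma marg_lik_on_eq:
 assumes M: "M : models X" and L': "L' : bmb" and A: "A : sets borel"
 and eq: "\<And>th. th : \<Theta> ==> L th = L' th"
 shows "marg_lik_on X L M A = (\<integral>th. indicator A th * L' th \<partial>plaw M)"
proof -
 have "marg_lik_on X L M A = (\<integral>th. pr M th *\<^sub>R (indicator A th * L' th) \<partial>cleb M)"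
 unfolding marg_lik_on_def set_lebesgue_integral_def
 using eq Theta_of_subset[of M] by (intro Bochner_Integration.integral_cong) (auto simp: pr_def indicator_def)
 also have "... = (\<integral>th. indicator A th * L' th \<partial>plaw M)"
 unfolding plaw_def using measurable_pr[OF M] L' A pr_nonneg[OF M]
 by (intro integral_density[symmetric]) simp_all
 finally show ?thesis .
qed

subsection \<open>Integrals of local and tail functions\<close>

definition tail_const :: "real => real" where
 "tail_const c = (1 + fact (N0 + 2) / c ^ (N0 + 2)) * 2 * 2 ^ (2 * N0 + 2)"

lemma tail_const_pos: "0 < c ==> 0 < tail_const c"
 by (simp add: tail_const_def add_pos_nonneg)

lemma nn_integral_exp_tail:
 assumes M: "M : models X" and c: "0 < c" and C: "1 <= C"
 shows "(NI (cleb M) (%x. (if C < nrm p x then enn (exp (- c * nrm p x)) else 0))) <= enn (tail_const c / C)"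
proof -
 define K where "K = (1 + fact (N0 + 2) / c ^ (N0 + 2)) * 2"
 have K: "0 <= K" using c by (simp add: K_def)
 have key: "(if C < r then exp (- c * r) else 0) <= K / C * (1 / (1 + r ^ (N0 + 1)))" if r: "0 <= r" for r
 proof (cases "C < r")
 case True
 then have r1: "1 <= r" using C by simp
 have "exp (- c * r) <= (1 + fact (N0 + 2) / c ^ (N0 + 2)) / (1 + r ^ (N0 + 2))"
 by (rule exp_minus_le_inverse_power[OF c r])
 also have "... <= (1 + fact (N0 + 2) / c ^ (N0 + 2)) / (C / 2 * (1 + r ^ (N0 + 1)))"
 proof (rule divide_left_mono)
 have "C / 2 * (1 + r ^ (N0 + 1)) <= C / 2 * (r ^ (N0 + 1) + r ^ (N0 + 1))"
 using C one_le_power[OF r1, of "N0 + 1"] by (intro mult_left_mono add_right_mono) auto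
 also have "... = C * r ^ (N0 + 1)" by simp
 also have "... <= r * r ^ (N0 + 1)" using True r by (intro mult_right_mono) auto
 finally show "C / 2 * (1 + r ^ (N0 + 1)) <= 1 + r ^ (N0 + 2)" by simp
 show "0 <= 1 + fact (N0 + 2) / c ^ (N0 + 2)" using c by simp
 show "0 < (1 + r ^ (N0 + 2)) * (C / 2 * (1 + r ^ (N0 + 1)))"
 using C r by (intro mult_pos_pos add_pos_nonneg) auto
 qed
 also have "... = K / C * (1 / (1 + r ^ (N0 + 1)))" using C by (simp add: K_def)
 finally show ?thesis using True by simp
 next
 case False then show ?thesis using K C r by simp
 qed
 have "(NI (cleb M) (%x. (if C < nrm p x then enn (exp (- c * nrm p x)) else 0))) <=
 (NI (cleb M) (%x. enn (K / C) * enn (1 / (1 + nrm p x ^ (N0 + 1)))))"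
 proof (rule nn_integral_mono)
 fix x :: "nat => real"
 have "(if C < nrm p x then enn (exp (- c * nrm p x)) else 0) = enn (if C < nrm p x then exp (- c * nrm p x) else 0)"
 by simp
 also have "... <= enn (K / C * (1 / (1 + nrm p x ^ (N0 + 1))))"
 by (intro ennreal_leI key) simp
 also have "... = enn (K / C) * enn (1 / (1 + nrm p x ^ (N0 + 1)))"
 using K C by (intro ennreal_mult divide_nonneg_nonneg) auto
 finally show "(if C < nrm p x then enn (exp (- c * nrm p x)) else 0) <= enn (K / C) * enn (1 / (1 + nrm p x ^ (N0 + 1)))" .
 qed
 also have "... = enn (K / C) * (NI (cleb M) (%x. enn (1 / (1 + nrm p x ^ (N0 + 1)))))"
 by (rule nn_integral_cmult) measurable
 also have "... <= enn (K / C) * enn (2 ^ (N0 + 1 + card M + 1))"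
 using models_finite[OF M] p_le by (intro mult_left_mono nn_integral_inverse_power_le) auto
 also have "... <= enn (K / C) * enn (2 ^ (2 * N0 + 2))"
 using models_finite(3)[OF M] p_le by (intro mult_left_mono ennreal_leI power_increasing) auto
 also have "... = enn (tail_const c / C)"
 using K C by (simp add: K_def tail_const_def flip: ennreal_mult)
 finally show ?thesis .
qed

lemma nn_integral_ball:
 assumes M: "M : models X" and C: "1 <= C"
 shows "(NI (cleb M) (%x. (if nrm p x <= C then 1 else 0))) <= enn ((2 * C) ^ N0)"
proof -
 have [measurable]: "{x::nat=>real. ALL j:M. \<bar>x j\<bar> <= C} : sets borel"
 using models_finite(1)[OF M] by measurable
 have "(NI (cleb M) (%x. (if nrm p x <= C then 1 else 0))) <= (NI (cleb M) (%x. indicator {x. ALL j:M. \<bar>x j\<bar> <= C} x))"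
 proof (intro nn_integral_mono)
 fix x :: "nat => real"
 have "\<bar>x j\<bar> <= nrm p x" if "j : M" for j using models_finite(2)[OF M] that by (intro abs_le_nrm) auto
 then show "(if nrm p x <= C then 1 else 0) <= (indicator {x. ALL j:M. \<bar>x j\<bar> <= C} x :: ennreal)"
 by (auto simp: indicator_def intro: order_trans)
 qed
 also have "... = enn ((2 * C) ^ card M)"
 using emeasure_coord_cube[of M C] models_finite(1)[OF M] C by simp
 also have "... <= enn ((2 * C) ^ N0)"
 using C models_finite(3)[OF M] p_le by (intro ennreal_leI power_increasing) auto
 finally show ?thesis .
qed

lemma prior_exp_tail:
 assumes M: "M : models X" "Tm <= M" and c: "0 < c" and C: "1 <= C"
 shows "(NI (plaw M) (%th. (if C < hn th then enn (exp (- c * hn th)) else 0))) <=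
 enn (cpi / s ^ card M * (tail_const c / C))"
proof -
 have "(NI (plaw M) (%th. (if C < hn th then enn (exp (- c * hn th)) else 0))) <=
 enn (cpi / s ^ card M) * (NI (cleb M) (%x. (if C < nrm p x then enn (exp (- c * nrm p x)) else 0)))"
 by (rule nn_integral_plaw_le[OF M, of "%x. if C < nrm p x then enn (exp (- c * nrm p x)) else 0"]) measurable
 also have "... <= enn (cpi / s ^ card M) * enn (tail_const c / C)"
 by (intro mult_left_mono nn_integral_exp_tail M c C) simp
 also have "... = enn (cpi / s ^ card M * (tail_const c / C))"
 using cpi s C tail_const_pos[OF c] by (intro ennreal_mult[symmetric]) auto
 finally show ?thesis .
qed

lemma prior_ball:
 assumes M: "M : models X" "Tm <= M" and C: "1 <= C"
 shows "(NI (plaw M) (%th. (if hn th <= C then 1 else 0))) <= enn (cpi / s ^ card M * (2 * C) ^ N0)"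
proof -
 have "(NI (plaw M) (%th. (if hn th <= C then 1 else 0))) <=
 enn (cpi / s ^ card M) * (NI (cleb M) (%x. (if nrm p x <= C then 1 else 0)))"
 by (rule nn_integral_plaw_le[OF M, of "%x. if nrm p x <= C then 1 else 0"]) measurable
 also have "... <= enn (cpi / s ^ card M) * enn ((2 * C) ^ N0)"
 by (intro mult_left_mono nn_integral_ball M C) simp
 also have "... = enn (cpi / s ^ card M * (2 * C) ^ N0)"
 using cpi s C by (intro ennreal_mult[symmetric]) auto
 finally show ?thesis .
qed

subsection \<open>Fluctuations integrated over the prior\<close>

lemma measurable_sample_sum:
 assumes g: "g : borel_measurable P" shows "(%D. \<Sum>k<n. (g (D k) - (c::real))) : borel_measurable OM"
proof (rule borel_measurable_sum)
 fix k assume "k : {..<n}"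
 then have "(%D. D k) : OM \<rightarrow>\<^sub>M P" by (intro measurable_sample_comp) simp
 from mcomp[OF this g] show "(%D. g (D k) - c) : borel_measurable OM" by simp
qed

text \<open>The second moment of the fluctuation is at most that of the moment difference, which the Hoelder
 condition bounds on a shrinking ball.\<close>

lemma local_fluctuation:
 assumes M: "M : models X" "Tm <= M" and C: "1 <= C"
 shows "(\<integral>\<^sup>+D. \<integral>\<^sup>+th. enn ((if hn th <= C then 1 else 0) * (\<Sum>i<m. (Rm D th i)\<^sup>2)) \<partial>plaw M \<partial>OM) <=
 enn (real N0 * (K4 * (C / s) powr \<alpha>)\<^sup>2 * (cpi / s ^ card M * (2 * C) ^ N0))"
proof -
 let ?i = "%th. (if hn th <= C then 1 else 0) :: real"
 let ?E = "real N0 * (K4 * (C / s) powr \<alpha>)\<^sup>2"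
 have "(\<integral>\<^sup>+D. \<integral>\<^sup>+th. enn (?i th * (\<Sum>i<m. (Rm D th i)\<^sup>2)) \<partial>plaw M \<partial>OM) <=
 (NI (plaw M) (%th. ennreal ?E * (if hn th <= C then 1 else 0)))"
 unfolding OM_eq
 proof (rule nn_integral_sample_exchange[OF prob_P sigma_finite_plaw[OF M(1)]])
 have "(%(D,th). enn (?i th * (\<Sum>i<m. (Rm D th i)\<^sup>2))) : borel_measurable (OM \<Otimes>\<^sub>M borel)"
 unfolding split_beta' using measurable_Rm[unfolded split_beta'] by measurable
 then show "(%(D,th). enn (?i th * (\<Sum>i<m. (Rm D th i)\<^sup>2))) : borel_measurable (PiM {..<n} (%_. P) \<Otimes>\<^sub>M plaw M)"
 by (simp add: OM_eq measurable_pair_plaw_eq)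
 fix th
 show "(NI (PiM {..<n} (%_. P)) (%D. enn (?i th * (\<Sum>i<m. (Rm D th i)\<^sup>2)))) <= ennreal ?E * (if hn th <= C then 1 else 0)"
 proof (cases "hn th <= C")
 case True
 have ed: "edist p (clamp th) t0 <= C / s"
 proof (cases "th : \<Theta>")
 case True
 then show ?thesis using \<open>hn th <= C\<close> s unfolding nrm_hsc by (simp add: field_simps)
 next
 case False
 then have "edist p (clamp th) t0 = vnorm (vec p t0 - vec p t0)" by (simp add: clamp_def edist_def)
 then show ?thesis using C s vnorm_eq_0_iff[of "0\<^sub>v p" p] by simp
 qed
 have ed0: "0 <= edist p (clamp th) t0" by (simp add: edist_def)
 have one: "(NI OM (%D. enn ((Rm D th i)\<^sup>2))) <= enn ((K4 * (C / s) powr \<alpha>)\<^sup>2)" if i: "i < m" for i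
 proof -
 have "(NI OM (%D. enn ((Rm D th i)\<^sup>2))) =
 (NI OM (%D. enn (1 / real n) * enn ((\<Sum>k<n. (fm i th (D k) - (LINT d|P. fm i th d)))\<^sup>2)))"
 using s by (intro nn_integral_cong) (simp add: Rm_def power_divide flip: ennreal_mult)
 also have "... = enn (1 / real n) * (NI OM (%D. enn ((\<Sum>k<n. (fm i th (D k) - (LINT d|P. fm i th d)))\<^sup>2)))"
 by (intro nn_integral_cmult mcomp[OF _ measurable_ennreal] borel_measurable_power
 measurable_sample_sum measurable_fm1 i)
 also have "... <= enn (1 / real n) * enn (real n * (K4 * edist p (clamp th) t0 powr \<alpha>)\<^sup>2)"
 unfolding OM_eq using i
 by (intro mult_left_mono nn_integral_sq_iid_sum[OF prob_P] fm_sq_integrable fm_sq_le measurable_fm1) auto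
 also have "... = enn ((K4 * edist p (clamp th) t0 powr \<alpha>)\<^sup>2)" using n_pos by (simp flip: ennreal_mult)
 also have "... <= enn ((K4 * (C / s) powr \<alpha>)\<^sup>2)"
 using ed ed0 K4 \<alpha> by (intro ennreal_leI power_mono mult_left_mono powr_mono2) auto
 finally show ?thesis .
 qed
 have "(NI OM (%D. enn (?i th * (\<Sum>i<m. (Rm D th i)\<^sup>2)))) = (NI OM (%D. (\<Sum>i<m. enn ((Rm D th i)\<^sup>2))))"
 using True by (intro nn_integral_cong) simp
 also have "... = (\<Sum>i<m. \<integral>\<^sup>+D. enn ((Rm D th i)\<^sup>2) \<partial>OM)"
 proof (rule nn_integral_sum)
 fix i assume "i : {..<m}"
 then have i: "i < m" by simp
 have "(%D. Rm D th i) : borel_measurable OM"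
 unfolding Rm_def using measurable_sample_sum[OF measurable_fm1[OF i]] by simp
 then show "(%D. enn ((Rm D th i)\<^sup>2)) : borel_measurable OM" by simp
 qed
 also have "... <= (\<Sum>i<m. enn ((K4 * (C / s) powr \<alpha>)\<^sup>2))" by (intro sum_mono one) simp
 also have "... = enn (real m * (K4 * (C / s) powr \<alpha>)\<^sup>2)"
 by (simp add: ennreal_of_nat_eq_real_of_nat flip: ennreal_mult)
 also have "... <= ennreal ?E" using dims by (intro ennreal_leI mult_right_mono) auto
 finally show ?thesis using True by (simp add: OM_eq)
 qed simp
 qed
 also have "... = ennreal ?E * (NI (plaw M) (%th. (if hn th <= C then 1 else 0)))"
 by (rule nn_integral_cmult) measurable
 also have "... <= ennreal ?E * enn (cpi / s ^ card M * (2 * C) ^ N0)"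
 by (intro mult_left_mono prior_ball M C) simp
 also have "... = enn (?E * (cpi / s ^ card M * (2 * C) ^ N0))"
 using cpi s C by (intro ennreal_mult[symmetric]) auto
 finally show ?thesis .
qed

text \<open>Moment difference, set to zero where the envelope exceeds b.\<close>

definition tf :: "real => nat => (nat => real) => 'd => real" where
 "tf b i th d = (if env d <= b then fm i th d else 0)"

definition trS :: "real => (nat => 'd) => (nat => real) => nat => real" where
 "trS b D th i = (\<Sum>k<n. (tf b i th (D k) - (LINT d|P. tf b i th d)))"

lemma measurable_tf1 [measurable (raw)]: "i < m ==> tf b i th : borel_measurable P"
 unfolding tf_def by measurable

lemma measurable_tf:
 assumes i: "i < m" shows "(%(d,th). tf b i th d) : borel_measurable (P \<Otimes>\<^sub>M borel)"
 unfolding tf_def using measurable_fm[OF i] by (simp add: split_beta') measurable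

lemma measurable_trS:
 assumes i: "i < m" shows "(%(D,th). trS b D th i) : borel_measurable (OM \<Otimes>\<^sub>M borel)"
proof -
 interpret prob_space P by (rule prob_P)
 have "(%(th,d). tf b i th d) : borel_measurable (borel \<Otimes>\<^sub>M P)"
 using measurable_pair_swap[OF measurable_tf[OF i]] by (simp add: split_beta')
 then have m1: "(%th. LINT d|P. tf b i th d) : bmb" by (rule borel_measurable_lebesgue_integral)
 have m2: "(%x. tf b i (snd x) (fst x k)) : borel_measurable (OM \<Otimes>\<^sub>M borel)" if k: "k < n" for k
 proof -
 have "(%x. (fst x k, snd x)) : OM \<Otimes>\<^sub>M borel \<rightarrow>\<^sub>M P \<Otimes>\<^sub>M (borel :: (nat => real) measure)"
 by (intro measurable_Pair mcomp[OF measurable_fst measurable_sample_comp[OF k]] measurable_snd)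
 from mcomp[OF this measurable_tf[OF i]] show ?thesis by (simp add: split_beta')
 qed
 show ?thesis unfolding trS_def split_beta'
 by (intro borel_measurable_sum borel_measurable_diff m2 mcomp[OF measurable_snd m1]) simp
qed

lemma tf_bound: "i < m ==> d : space P ==> 0 <= b ==> \<bar>tf b i th d\<bar> <= b"
 using fm_env[of i d th] by (auto simp: tf_def)

lemma tf_sq: "i < m ==> (LINT d|P. (tf b i th d)\<^sup>2) <= KF"
proof -
 assume i: "i < m"
 have "(LINT d|P. (tf b i th d)\<^sup>2) <= (LINT d|P. (fm i th d)\<^sup>2)"
 proof (rule integral_mono)
 show "integrable P (%d. (tf b i th d)\<^sup>2)"
 using i by (intro Bochner_Integration.integrable_bound[OF fm_sq_integrable[OF i, of th]]) (auto simp: tf_def)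
 qed (auto simp: tf_def fm_sq_integrable i)
 then show ?thesis using fm_sq_le(2)[OF i, of th] by simp
qed

lemma trS_Chernoff:
 assumes i: "i < m" and b: "0 < b"
 shows "(NI OM (%D. (if t <= \<bar>trS b D th i\<bar> then 1 else 0))) <= enn (2 * exp (- t / (2 * b) + real n * KF / (4 * b\<^sup>2)))"
proof -
 have "(NI OM (%D. (if t <= \<bar>trS b D th i\<bar> then 1 else 0))) <=
 enn (2 * exp (- (1 / (2 * b)) * t + real n * (1 / (2 * b))\<^sup>2 * KF))"
 unfolding OM_eq trS_def
 using i b by (intro Chernoff_iid_sum[OF prob_P, where b=b] tf_bound tf_sq measurable_tf1) auto
 also have "- (1 / (2 * b)) * t + real n * (1 / (2 * b))\<^sup>2 * KF = - t / (2 * b) + real n * KF / (4 * b\<^sup>2)"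
 by (simp add: power_divide power_mult_distrib)
 finally show ?thesis .
qed

text \<open>Exponential inequality for the truncated sums at each parameter, integrated over the prior.\<close>

lemma truncated_deviation:
 assumes M: "M : models X" and b: "0 < b" and thr[measurable]: "thr : bmb"
 and [measurable]: "Measurable.pred borel I"
 shows "(\<integral>\<^sup>+D. \<integral>\<^sup>+th. (if I th & (\<exists>i<m. thr th <= \<bar>trS b D th i\<bar>) then 1 else 0) \<partial>plaw M \<partial>OM) <=
 (NI (plaw M) (%th. (if I th then enn (2 * real N0 * exp (- thr th / (2 * b) + real n * KF / (4 * b\<^sup>2))) else 0)))"
 unfolding OM_eq
proof (rule nn_integral_sample_exchange[OF prob_P sigma_finite_plaw[OF M]])
 have "(%x. if I (snd x) & (\<exists>i\<in>{..<m}. thr (snd x) <= \<bar>trS b (fst x) (snd x) i\<bar>) then 1 else 0 :: ennreal) : borel_measurable (OM \<Otimes>\<^sub>M borel)"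
 proof -
 have [measurable]: "(%x. trS b (fst x) (snd x) i) : borel_measurable (OM \<Otimes>\<^sub>M borel)" if "i : {..<m}" for i
 using measurable_trS[of i b] that by (simp add: split_beta')
 show ?thesis by measurable
 qed
 moreover have "(%(D,th). if I th & (\<exists>i<m. thr th <= \<bar>trS b D th i\<bar>) then 1 else 0 :: ennreal) =
 (%x. if I (snd x) & (\<exists>i\<in>{..<m}. thr (snd x) <= \<bar>trS b (fst x) (snd x) i\<bar>) then 1 else 0)"
 by (auto simp: fun_eq_iff)
 ultimately show "(%(D,th). if I th & (\<exists>i<m. thr th <= \<bar>trS b D th i\<bar>) then 1 else 0 :: ennreal)
 : borel_measurable (PiM {..<n} (%_. P) \<Otimes>\<^sub>M plaw M)"
 unfolding measurable_pair_plaw_eq OM_eq by (simp only:)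
 fix th
 have [measurable]: "(%D. trS b D th i) : borel_measurable OM" if "i < m" for i
 unfolding trS_def by (rule measurable_sample_sum[OF measurable_tf1[OF that]])
 have "(NI OM (%D. (if I th & (\<exists>i<m. thr th <= \<bar>trS b D th i\<bar>) then 1 else 0))) <=
 (NI OM (%D. (\<Sum>i<m. if I th & thr th <= \<bar>trS b D th i\<bar> then 1 else 0)))"
 proof (rule nn_integral_mono)
 fix D
 show "(if I th & (\<exists>i<m. thr th <= \<bar>trS b D th i\<bar>) then 1 else 0) <=
 (\<Sum>i<m. if I th & thr th <= \<bar>trS b D th i\<bar> then 1 else (0::ennreal))"
 proof (cases "I th & (\<exists>i<m. thr th <= \<bar>trS b D th i\<bar>)")
 case True
 then obtain i where i: "i < m" "I th" "thr th <= \<bar>trS b D th i\<bar>" by auto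
 have "(1::ennreal) = (\<Sum>j\<in>{i}. if I th & thr th <= \<bar>trS b D th j\<bar> then 1 else 0)" using i by simp
 also have "... <= (\<Sum>j<m. if I th & thr th <= \<bar>trS b D th j\<bar> then 1 else 0)"
 using i by (intro sum_mono2) auto
 finally show ?thesis using True by simp
 qed simp
 qed
 also have "... = (\<Sum>i<m. \<integral>\<^sup>+D. (if I th & thr th <= \<bar>trS b D th i\<bar> then 1 else 0) \<partial>OM)"
 by (intro nn_integral_sum) measurable
 also have "... <= (\<Sum>i<m. if I th then enn (2 * exp (- thr th / (2 * b) + real n * KF / (4 * b\<^sup>2))) else 0)"
 using trS_Chernoff[OF _ b, of _ "thr th" th] by (intro sum_mono) (cases "I th", auto)
 also have "... <= (if I th then enn (2 * real N0 * exp (- thr th / (2 * b) + real n * KF / (4 * b\<^sup>2))) else 0)"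
 proof (cases "I th")
 case True
 have "(\<Sum>i<m. enn (2 * exp (- thr th / (2 * b) + real n * KF / (4 * b\<^sup>2)))) =
 enn (real m * (2 * exp (- thr th / (2 * b) + real n * KF / (4 * b\<^sup>2))))"
 by (simp add: ennreal_of_nat_eq_real_of_nat flip: ennreal_mult)
 also have "... <= enn (real N0 * (2 * exp (- thr th / (2 * b) + real n * KF / (4 * b\<^sup>2))))"
 using dims by (intro ennreal_leI mult_right_mono) auto
 finally show ?thesis using True by (simp add: mult.assoc mult.left_commute)
 qed simp
 finally show "(NI (PiM {..<n} (%_. P)) (%D. (if I th & (\<exists>i<m. thr th <= \<bar>trS b D th i\<bar>) then 1 else 0))) <=
 (if I th then enn (2 * real N0 * exp (- thr th / (2 * b) + real n * KF / (4 * b\<^sup>2))) else 0)"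
 by (simp add: OM_eq)
qed

text \<open>The part cut off by the truncation has mean of order 1/b because the envelope is square
 integrable.\<close>

lemma excess_mean:
 assumes b: "0 < b"
 shows "(LINT d|P. (if env d <= b then 0 else \<bar>env d\<bar>)) <= KF / b" "integrable P (%d. if env d <= b then 0 else \<bar>env d\<bar>)"
 "(LINT d|P. (if env d <= b then 0 else \<bar>env d\<bar>)\<^sup>2) <= KF" "integrable P (%d. (if env d <= b then 0 else \<bar>env d\<bar>)\<^sup>2)"
proof -
 interpret prob_space P by (rule prob_P)
 let ?e = "%d. if env d <= b then 0 else \<bar>env d\<bar>"
 show 1: "integrable P (%d. (?e d)\<^sup>2)"
 by (rule Bochner_Integration.integrable_bound[OF env_integrable]) auto
 show 2: "integrable P ?e" by (rule square_integrable_imp_integrable[OF _ 1]) measurable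
 have "(LINT d|P. (?e d)\<^sup>2) <= (LINT d|P. (env d)\<^sup>2)" by (rule integral_mono[OF 1 env_integrable]) auto
 then show "(LINT d|P. (?e d)\<^sup>2) <= KF" using env(3) by simp
 have "(LINT d|P. ?e d) <= (LINT d|P. (env d)\<^sup>2 / b)"
 proof (rule integral_mono[OF 2])
 show "integrable P (%d. (env d)\<^sup>2 / b)" using env_integrable by simp
 fix d
 show "?e d <= (env d)\<^sup>2 / b"
 proof (cases "env d <= b")
 case False
 then have "b * env d <= env d * env d" using b by (intro mult_right_mono) auto
 then show ?thesis using False b by (simp add: field_simps power2_eq_square)
 qed (use b in auto)
 qed
 also have "... <= KF / b" using env(3) b by (simp add: divide_right_mono)
 finally show "(LINT d|P. ?e d) <= KF / b" .
qed

text \<open>Truncating the moment function costs at most the excess of the envelope over the truncation level.\<close>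

text \<open>The fluctuation splits into the truncated sum, the large envelope values in the sample, and a bias
 of order n/b.\<close>

lemma Rm_le_truncated:
 assumes D: "D : space OM" and i: "i < m" and b: "0 < b"
 shows "s * \<bar>Rm D th i\<bar> <= \<bar>trS b D th i\<bar> + (\<Sum>k<n. if env (D k) <= b then 0 else \<bar>env (D k)\<bar>) + real n * (KF / b)"
proof -
 let ?e = "%d. if env d <= b then 0 else \<bar>env d\<bar>"
 define x where "x d = fm i th d - tf b i th d" for d
 have xe: "\<bar>x d\<bar> <= ?e d" if "d : space P" for d using fm_env[OF i that, of th] by (auto simp: x_def tf_def)
 interpret prob_space P by (rule prob_P)
 have fi: "integrable P (fm i th)"
 by (rule square_integrable_imp_integrable[OF measurable_fm1[OF i] fm_sq_integrable[OF i]])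
 have ti: "integrable P (tf b i th)"
 by (rule Bochner_Integration.integrable_bound[OF fi measurable_tf1[OF i]]) (auto simp: tf_def)
 have xi: "integrable P x" unfolding x_def using fi ti by simp
 have "\<bar>LINT d|P. x d\<bar> <= (LINT d|P. \<bar>x d\<bar>)" by (rule integral_abs_bound)
 also have "... <= (LINT d|P. ?e d)" using xi excess_mean(2)[OF b] xe by (intro integral_mono) auto
 also have "... <= KF / b" by (rule excess_mean(1)[OF b])
 finally have 1: "\<bar>LINT d|P. x d\<bar> <= KF / b" .
 have "s * Rm D th i = (\<Sum>k<n. (fm i th (D k) - (LINT d|P. fm i th d)))" using s by (simp add: Rm_def)
 also have "... = trS b D th i + (\<Sum>k<n. x (D k)) - real n * (LINT d|P. x d)"
 unfolding trS_def x_def using fi ti by (simp add: sum_subtractf algebra_simps)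
 finally have "s * Rm D th i = trS b D th i + (\<Sum>k<n. x (D k)) - real n * (LINT d|P. x d)" .
 moreover have "\<bar>\<Sum>k<n. x (D k)\<bar> <= (\<Sum>k<n. ?e (D k))"
 using xe sample_in_space[OF D] by (intro order_trans[OF sum_abs] sum_mono) auto
 moreover have "\<bar>real n * (LINT d|P. x d)\<bar> <= real n * (KF / b)"
 using mult_left_mono[OF 1, of "real n"] by (simp add: abs_mult)
 ultimately have "\<bar>s * Rm D th i\<bar> <= \<bar>trS b D th i\<bar> + (\<Sum>k<n. ?e (D k)) + real n * (KF / b)" by linarith
 then show ?thesis using s by (simp add: abs_mult)
qed

end

lemma prob_ge_finite_ball:
 assumes "prob_space P" "finite I" "\<And>i. i : I ==> prob_ge P (E i) (1 - et)"
 shows "prob_ge P (%om. ALL i:I. E i om) (1 - real (card I) * et)"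
 using assms(2,3)
proof (induction I rule: finite_induct)
 case empty
 show ?case using prob_ge_AE[OF assms(1), of "%_. True"] by simp
next
 case (insert i I)
 have "prob_ge P (%om. E i om & (ALL i:I. E i om)) (1 - (et + real (card I) * et))"
 using insert by (intro prob_ge_conj[OF assms(1)]) auto
 then show ?case using insert by (simp add: algebra_simps)
qed

lemma quadratic_form_entries:
 assumes "A : cmat m m" "y : cvec m"
 shows "y .* (A *. y) = (\<Sum>i<m. \<Sum>j<m. A $$ (i,j) * y $ i * (y $ j :: real))"
proof -
 have "vec m (%i. y $ i) = y" using assms(2) by auto
 then show ?thesis using quadratic_form_sum[OF assms(1), of "%i. y $ i" "%i. y $ i"] by simp
qed

context rg begin

subsection \<open>The quasi-likelihood and its local Gaussian approximation\<close>

lemma dim_W [simp]: "dim_vec (W D) = m" and dim_Y [simp]: "dim_vec (Y D th) = m"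
 and dim_mean [simp]: "dim_vec (mean_mom X th) = m"
 by (auto simp: W_def Y_def gbar_def mean_mom_def)

definition Lq :: "(nat => 'd) => (nat => real) => real" where
 "Lq D th = exp (- (Y D th .* (minv (Vn X D) *. Y D th)) / 2)"

text \<open>Gaussian limit of both likelihoods, not normalised.\<close>

definition psi :: "(nat => 'd) => (nat => real) => real" where
 "psi D th = exp (- ((W D + G0 X *. vec p (hsc th)) .* (minv (V0 X) *. (W D + G0 X *. vec p (hsc th)))) / 2)"

text \<open>Second order behaviour of the expected moments and first order behaviour of the Jacobian within
 distance ro of theta0.\<close>

definition taylor :: "real => real => bool" where
 "taylor \<rho> KT \<longleftrightarrow> 0 <= KT & (ALL th:\<Theta>. edist p th t0 < \<rho> -->
 (ALL i<m. \<bar>mean_mom X th $ i - (G0 X *. (vec p th - vec p t0)) $ i\<bar> <= KT * (edist p th t0)\<^sup>2 &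
 (ALL j<p. \<bar>Jac X th $$ (i,j) - G0 X $$ (i,j)\<bar> <= KT * edist p th t0)))"

definition good_weight :: "real => (nat => 'd) => bool" where
 "good_weight dl D \<longleftrightarrow> coercive m l u (Vn X D) &
 (ALL v:cvec m. vnorm ((Vn X D - V0 X) *. v) <= dl * vnorm v)"

lemma G0_carrier: "G0 X : cmat m p" by (rule Jac_carrier[OF t0_in])

lemma coercive_V0: "coercive m l u (V0 X)" by (rule coercive_V[OF t0_in])

lemma ypsi_carrier: "W D + G0 X *. vec p x : cvec m"
 using G0_carrier by auto

lemma G0_norm: "vnorm (G0 X *. vec p x) <= sqrt u * nrm p x" "sqrt l * nrm p x <= vnorm (G0 X *. vec p x)"
proof -
 have c: "vec p x : cvec p" by simp
 have "sqrt ((vnorm (G0 X *. vec p x))\<^sup>2) <= sqrt (u * (vnorm (vec p x))\<^sup>2)"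
 by (rule real_sqrt_le_mono) (rule gram_norm_le(1)[OF G0_carrier coercive_gram[OF t0_in] c])
 then show "vnorm (G0 X *. vec p x) <= sqrt u * nrm p x" by (simp add: real_sqrt_mult nrm_def)
 have "sqrt (l * (vnorm (vec p x))\<^sup>2) <= sqrt ((vnorm (G0 X *. vec p x))\<^sup>2)"
 by (rule real_sqrt_le_mono) (rule gram_norm_le(2)[OF G0_carrier coercive_gram[OF t0_in] c])
 then show "sqrt l * nrm p x <= vnorm (G0 X *. vec p x)" by (simp add: real_sqrt_mult nrm_def)
qed

lemma coercive_form_nonneg: "coercive m l' u' A ==> 0 < u' ==> y : cvec m ==> 0 <= y .* (minv A *. y)"
 using coercive_minv_form_ge[of m l' u' A y] by (auto simp: coercive_def intro: order_trans[rotated])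

lemma psi_le_1: "psi D th <= 1" and psi_pos: "0 < psi D th"
 using coercive_form_nonneg[OF coercive_V0 u_pos ypsi_carrier] by (auto simp: psi_def)

lemma Lq_le_1: "coercive m l u (Vn X D) ==> Lq D th <= 1" and Lq_pos: "0 < Lq D th"
 using coercive_form_nonneg[OF _ u_pos Y_carrier] by (auto simp: Lq_def)

lemma tight_bounds:
 assumes D: "D : space OM" and T: "tight D <= T\<^sup>2" "0 < T"
 shows "vnorm (W D) <= T" "k < n ==> env (D k) <= T * s"
proof -
 have nn: "0 <= (\<Sum>k<n. (env (D k))\<^sup>2) / real n" by (intro divide_nonneg_nonneg sum_nonneg) auto
 then have "(vnorm (W D))\<^sup>2 <= T\<^sup>2" using T(1) by (simp add: tight_def)
 then show "vnorm (W D) <= T" using T(2) by (simp add: power2_le_iff_abs_le)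
 assume k: "k < n"
 have "(env (D k))\<^sup>2 <= (\<Sum>k<n. (env (D k))\<^sup>2)" using k by (intro member_le_sum) auto
 moreover have "(\<Sum>k<n. (env (D k))\<^sup>2) / real n <= T\<^sup>2" using T(1) zero_le_power2[of "vnorm (W D)"] unfolding tight_def by linarith
 ultimately have "(env (D k))\<^sup>2 <= (T * s)\<^sup>2" using n_pos by (simp add: power_mult_distrib field_simps)
 then have "\<bar>env (D k)\<bar> <= \<bar>T * s\<bar>" by (simp add: abs_le_square_iff)
 then show "env (D k) <= T * s" using T(2) s by simp
qed

definition KQ :: "real => real => real => real" where
 "KQ T C KT = 1 + (T + sqrt u * C + 1 + real N0 * KT * C\<^sup>2)\<^sup>2 / l\<^sup>2 +
 2 * (T + sqrt u * C + 1 + real N0 * KT * C\<^sup>2) * (1 + real N0 * KT * C\<^sup>2) / l"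

text \<open>The exponents are quadratic forms in nearby vectors with nearby weights, and exp (- x / 2) is
 Lipschitz.\<close>

lemma Lq_local:
 assumes D: "D : space OM" and gw: "good_weight dl D" "0 <= dl" and T: "tight D <= T\<^sup>2" "0 < T"
 and ta: "taylor \<rho> KT" and C: "1 <= C" "C < \<rho> * s" and th: "th : \<Theta>" and h: "hn th <= C"
 shows "\<bar>Lq D th - psi D th\<bar> <= KQ T C KT * (dl + (\<Sum>i<m. \<bar>Rm D th i\<bar>) + 1 / s)"
proof -
 define y0 where "y0 = W D + G0 X *. vec p (hsc th)"
 define y where "y = Y D th"
 define SR where "SR = (\<Sum>i<m. \<bar>Rm D th i\<bar>)"
 define B where "B = real N0 * KT * C\<^sup>2"
 define Ym where "Ym = T + sqrt u * C + 1 + B"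
 have KT: "0 <= KT" using ta by (simp add: taylor_def)
 have B: "0 <= B" using KT by (simp add: B_def)
 have Ym: "1 <= Ym" using T B C u_pos by (simp add: Ym_def add_nonneg_nonneg)
 have SR: "0 <= SR" by (simp add: SR_def sum_nonneg)
 have l: "0 < l" using lu by simp
 have KQ_eq: "KQ T C KT = 1 + Ym\<^sup>2 / l\<^sup>2 + 2 * Ym * (1 + B) / l" by (simp add: KQ_def Ym_def B_def)
 have K1: "1 <= KQ T C KT" unfolding KQ_eq using Ym B l by simp
 have V: "coercive m l u (Vn X D)" using gw by (simp add: good_weight_def)
 have cc: "y0 : cvec m" "y : cvec m" using ypsi_carrier by (auto simp: y0_def y_def)
 show ?thesis
 proof (cases "SR <= 1")
 case False
 have "\<bar>Lq D th - psi D th\<bar> <= 1" using Lq_le_1[OF V, of th] Lq_pos[of D th] psi_le_1[of D th] psi_pos[of D th] by linarith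
 moreover have "1 * 1 <= KQ T C KT * (dl + SR + 1 / s)"
 proof (rule mult_mono)
 have "0 <= 1 / s" using s by simp
 then show "1 <= dl + SR + 1 / s" using False gw(2) by linarith
 qed (use K1 in auto)
 ultimately show ?thesis by (simp add: SR_def)
 next
 case True
 define e where "e = edist p th t0"
 have se: "s * e <= C" using h unfolding nrm_hsc e_def .
 have e0: "0 <= e" by (simp add: e_def edist_def)
 have "e < \<rho>"
 proof -
 have "s * e < s * \<rho>" using se C(2) by (simp add: mult.commute)
 then show ?thesis using s by simp
 qed
 have see: "s * e\<^sup>2 <= C\<^sup>2 / s"
 proof -
 have "(s * e)\<^sup>2 <= C\<^sup>2" using se e0 s by (intro power_mono) auto
 then have "s * (s * e\<^sup>2) <= C\<^sup>2" by (simp add: power_mult_distrib power2_eq_square mult_ac)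
 then show ?thesis using s by (simp add: field_simps)
 qed
 have comp: "\<bar>(y - y0) $ i\<bar> <= \<bar>Rm D th i\<bar> + KT * (C\<^sup>2 / s)" if i: "i < m" for i
 proof -
 have "(G0 X *. vec p (hsc th)) $ i = s * (G0 X *. (vec p th - vec p t0)) $ i"
 unfolding vec_hsc using G0_carrier i by (simp add: mult_mat_vec)
 then have "(y - y0) $ i = Rm D th i + s * (mean_mom X th $ i - (G0 X *. (vec p th - vec p t0)) $ i)"
 unfolding y_def y0_def using i Y_decomp[OF i, of D th] th G0_carrier carrier_vecD[OF W_carrier[of D]]
 carrier_vecD[OF Y_carrier[of D th]] by (simp add: algebra_simps)
 moreover have "\<bar>s * (mean_mom X th $ i - (G0 X *. (vec p th - vec p t0)) $ i)\<bar> <= KT * (C\<^sup>2 / s)"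
 proof -
 have "\<bar>mean_mom X th $ i - (G0 X *. (vec p th - vec p t0)) $ i\<bar> <= KT * e\<^sup>2"
 using ta th i \<open>e < \<rho>\<close> by (simp add: taylor_def e_def)
 then have "s * \<bar>mean_mom X th $ i - (G0 X *. (vec p th - vec p t0)) $ i\<bar> <= s * (KT * e\<^sup>2)"
 using s by (intro mult_left_mono) auto
 also have "... = KT * (s * e\<^sup>2)" by simp
 also have "... <= KT * (C\<^sup>2 / s)" using see KT by (rule mult_left_mono)
 finally show ?thesis using s by (simp add: abs_mult)
 qed
 ultimately show ?thesis by linarith
 qed
 have dy: "vnorm (y - y0) <= SR + B / s"
 proof -
 have "vnorm (y - y0) <= (\<Sum>i<m. \<bar>(y - y0) $ i\<bar>)"
 using vnorm_le_sum_abs[of "y - y0"] cc by simp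
 also have "... <= (\<Sum>i<m. \<bar>Rm D th i\<bar> + KT * (C\<^sup>2 / s))" using comp by (intro sum_mono) auto
 also have "... = SR + real m * (KT * (C\<^sup>2 / s))" by (simp add: SR_def sum.distrib)
 also have "... <= SR + real N0 * (KT * (C\<^sup>2 / s))"
 using dims KT s by (intro add_left_mono mult_right_mono) auto
 finally show ?thesis by (simp add: B_def)
 qed
 have Bs: "B / s <= B" using B s by (simp add: divide_le_eq mult_le_cancel_left1)
 have ny0: "vnorm y0 <= T + sqrt u * C"
 proof -
 have "vnorm y0 <= vnorm (W D) + vnorm (G0 X *. vec p (hsc th))"
 unfolding y0_def using G0_carrier by (intro vnorm_triangle[of _ m]) auto
 also have "... <= T + sqrt u * hn th" using tight_bounds(1)[OF D T] G0_norm(1) by (rule add_mono)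
 also have "... <= T + sqrt u * C" using h u_pos by (intro add_left_mono mult_left_mono) auto
 finally show ?thesis .
 qed
 have ny: "vnorm y <= Ym"
 using vnorm_diff_le[OF cc(2,1)] dy True Bs ny0 by (simp add: Ym_def)
 have ny0': "vnorm y0 <= Ym" using ny0 B by (simp add: Ym_def)
 have "\<bar>Lq D th - psi D th\<bar> <= \<bar>y .* (minv (Vn X D) *. y) - y0 .* (minv (V0 X) *. y0)\<bar>"
 unfolding Lq_def psi_def y_def[symmetric] y0_def[symmetric]
 using coercive_form_nonneg[OF V u_pos cc(2)] coercive_form_nonneg[OF coercive_V0 u_pos cc(1)]
 by (rule exp_half_diff_le)
 also have "... <= dl / l\<^sup>2 * (vnorm y)\<^sup>2 + vnorm (y - y0) * (vnorm y + vnorm y0) / l"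
 using gw by (intro form_diff_le[OF coercive_V0 V _ _ cc(2,1)]) (auto simp: good_weight_def)
 also have "... <= dl / l\<^sup>2 * Ym\<^sup>2 + (SR + B / s) * (Ym + Ym) / l"
 using ny ny0' dy gw(2) l SR B s Ym
 by (intro add_mono mult_left_mono power_mono divide_right_mono mult_mono) auto
 also have "... = Ym\<^sup>2 / l\<^sup>2 * dl + 2 * Ym / l * SR + 2 * Ym * B / l * (1 / s)"
 by (simp add: algebra_simps add_divide_distrib)
 also have "... <= KQ T C KT * dl + KQ T C KT * SR + KQ T C KT * (1 / s)"
 proof (intro add_mono mult_right_mono)
 have a: "0 <= Ym\<^sup>2 / l\<^sup>2" "0 <= 2 * Ym / l" "0 <= 2 * Ym * B / l" using Ym B l by auto
 have b: "KQ T C KT = 1 + Ym\<^sup>2 / l\<^sup>2 + 2 * Ym / l + 2 * Ym * B / l"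
 unfolding KQ_eq by (simp add: algebra_simps add_divide_distrib)
 show "Ym\<^sup>2 / l\<^sup>2 <= KQ T C KT" "2 * Ym / l <= KQ T C KT" "2 * Ym * B / l <= KQ T C KT"
 unfolding b using a by linarith+
 qed (use gw(2) SR s in auto)
 also have "... = KQ T C KT * (dl + SR + 1 / s)" by (simp add: algebra_simps)
 finally show ?thesis by (simp add: SR_def)
 qed
qed

lemma psi_tail:
 assumes T: "vnorm (W D) <= T" and r: "2 * T <= sqrt l * hn th"
 shows "psi D th <= exp (- (l\<^sup>2 / (8 * u\<^sup>2)) * (hn th)\<^sup>2)"
proof -
 define y0 where "y0 = W D + G0 X *. vec p (hsc th)"
 define rr where "rr = hn th"
 have c: "y0 : cvec m" using ypsi_carrier by (simp add: y0_def)
 have "vnorm (G0 X *. vec p (hsc th)) <= vnorm y0 + vnorm (W D)"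
 proof -
 have "G0 X *. vec p (hsc th) = y0 - W D" unfolding y0_def using G0_carrier by (intro eq_vecI) auto
 then show ?thesis using vnorm_diff_triangle[OF c W_carrier] by simp
 qed
 then have "sqrt l * rr / 2 <= vnorm y0" using G0_norm(2)[of "hsc th"] T r by (simp add: rr_def)
 then have "(sqrt l * rr / 2)\<^sup>2 <= (vnorm y0)\<^sup>2" using lu by (intro power_mono) (auto simp: rr_def)
 then have "l * rr\<^sup>2 / 4 <= y0 .* y0" using lu by (simp add: power_mult_distrib power_divide vnorm_sq)
 then have "l / u\<^sup>2 * (l * rr\<^sup>2 / 4) <= l / u\<^sup>2 * (y0 .* y0)" using lu by (intro mult_left_mono) auto
 also have "... <= y0 .* (minv (V0 X) *. y0)" by (rule coercive_minv_form_ge[OF coercive_V0 c u_pos])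
 finally show ?thesis unfolding psi_def y0_def[symmetric] rr_def[symmetric] by (simp add: power2_eq_square)
qed

lemma vnorm_Y_ge:
 assumes th: "th : \<Theta>"
 shows "s * vnorm (mean_mom X th) - vnorm (W D) - (\<Sum>i<m. \<bar>Rm D th i\<bar>) <= vnorm (Y D th)"
proof -
 define Rv where "Rv = vec m (%i. Rm D th i)"
 define sm where "sm = s \<cdot>\<^sub>v mean_mom X th"
 have c: "sm : cvec m" "Rv : cvec m" by (auto simp: Rv_def sm_def)
 have eq: "sm = (Y D th - W D) - Rv"
 using Y_decomp[of _ D th] th by (intro eq_vecI) (auto simp: sm_def Rv_def)
 have "vnorm sm <= vnorm (Y D th - W D) + vnorm Rv"
 unfolding eq using c W_carrier Y_carrier by (intro vnorm_diff_triangle[of _ m]) auto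
 also have "vnorm (Y D th - W D) <= vnorm (Y D th) + vnorm (W D)"
 by (rule vnorm_diff_triangle[OF Y_carrier W_carrier])
 also have "vnorm Rv <= (\<Sum>i<m. \<bar>Rm D th i\<bar>)" using vnorm_le_sum_abs[of Rv] by (simp add: Rv_def)
 finally show ?thesis using s by (simp add: sm_def vnorm_smult)
qed

lemma Lq_le_of_vnorm:
 assumes V: "coercive m l u (Vn X D)" and a: "0 <= a" "a <= vnorm (Y D th)"
 shows "Lq D th <= exp (- (l / (2 * u\<^sup>2)) * a\<^sup>2)"
proof -
 have "a\<^sup>2 <= Y D th .* Y D th" using a power_mono[of a "vnorm (Y D th)" 2] by (simp add: vnorm_sq)
 then have "l / u\<^sup>2 * a\<^sup>2 <= l / u\<^sup>2 * (Y D th .* Y D th)" using lu by (intro mult_left_mono) auto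
 also have "... <= Y D th .* (minv (Vn X D) *. Y D th)" by (rule coercive_minv_form_ge[OF V Y_carrier u_pos])
 finally show ?thesis unfolding Lq_def by simp
qed

lemma N0_pos: "0 < N0" using dims by simp

definition c2 :: real where "c2 = c1 / (4 * real N0)"

lemma c2_pos: "0 < c2" using c1 N0_pos by (simp add: c2_def)

text \<open>Separation makes the mean moment at least of order |h|; where the truncated sums stay below a
 fixed fraction of it, the sample moment is of the same order.\<close>

lemma Lq_tail:
 assumes D: "D : space OM" and V: "coercive m l u (Vn X D)" and T: "tight D <= T\<^sup>2" "0 < T" and th: "th : \<Theta>"
 and r: "4 * (T + real N0 * KF / T) <= c1 * hn th"
 and nb: "\<And>i. i < m ==> \<bar>trS (T * s) D th i\<bar> < s * (c2 * hn th)"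
 shows "Lq D th <= exp (- (l * c1\<^sup>2 / (8 * u\<^sup>2)) * (hn th)\<^sup>2)"
proof -
 define rr where "rr = hn th"
 have b: "0 < T * s" using T s by simp
 have R: "\<bar>Rm D th i\<bar> <= c2 * rr + KF / T" if i: "i < m" for i
 proof -
 have "(\<Sum>k<n. if env (D k) <= T * s then 0 else \<bar>env (D k)\<bar>) = 0"
 using tight_bounds(2)[OF D T] by (intro sum.neutral) auto
 then have "s * \<bar>Rm D th i\<bar> <= s * (c2 * rr) + real n * (KF / (T * s))"
 using Rm_le_truncated[OF D i b, of th] nb[OF i] by (simp add: rr_def)
 also have "real n * (KF / (T * s)) = s * (KF / T)"
 proof -
 have "real n * (KF / (T * s)) = (s * s) * (KF / (T * s))" by (simp only: s(3))
 also have "... = s * (KF / T)" using s(1) T by (simp only: mult.assoc times_divide_eq_right) (simp add: field_simps)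
 finally show ?thesis .
 qed
 finally have "s * \<bar>Rm D th i\<bar> <= s * (c2 * rr + KF / T)" by (simp add: distrib_left)
 then show ?thesis using s by simp
 qed
 have rr0: "0 <= c2 * rr + KF / T" using c2_pos KF_nonneg T by (simp add: rr_def)
 have "(\<Sum>i<m. \<bar>Rm D th i\<bar>) <= (\<Sum>i<m. c2 * rr + KF / T)" using R by (intro sum_mono) auto
 also have "... = real m * (c2 * rr + KF / T)" by simp
 also have "... <= real N0 * (c2 * rr + KF / T)" using dims rr0 by (intro mult_right_mono) auto
 also have "... = c1 * rr / 4 + real N0 * KF / T" using N0_pos by (simp add: c2_def distrib_left)
 finally have SR: "(\<Sum>i<m. \<bar>Rm D th i\<bar>) <= c1 * rr / 4 + real N0 * KF / T" .
 have "c1 * rr = s * (c1 * edist p th t0)" unfolding rr_def nrm_hsc by simp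
 also have "... <= s * vnorm (mean_mom X th)" using sep[OF th] s by (intro mult_left_mono) auto
 finally have "c1 * rr <= s * vnorm (mean_mom X th)" .
 moreover have "a / 2 <= y"
 if "a <= b" "b - w - S <= y" "S <= a / 4 + q" "4 * (t + q) <= a" "w <= t" for a b w S q y t :: real
 using that by argo
 ultimately have "c1 * rr / 2 <= vnorm (Y D th)"
 using vnorm_Y_ge[OF th, of D] SR r tight_bounds(1)[OF D T] unfolding rr_def[symmetric] by blast
 then have "Lq D th <= exp (- (l / (2 * u\<^sup>2)) * (c1 * rr / 2)\<^sup>2)"
 using c1 by (intro Lq_le_of_vnorm[OF V]) (auto simp: rr_def)
 then show ?thesis unfolding rr_def[symmetric] by (simp add: power_mult_distrib power_divide mult.assoc)
qed

lemma measurable_Y: "D : space OM ==> i < m ==> (%th. Y D th $ i) : bmb"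
proof -
 assume D: "D : space OM" and i: "i < m"
 have "(%th. momc i (D k) th) : bmb" if "k < n" for k
 proof -
 have "(%th. (D k, th)) : borel \<rightarrow>\<^sub>M P \<Otimes>\<^sub>M (borel :: (nat => real) measure)"
 using sample_in_space[OF D that] by (rule measurable_Pair1')
 from mcomp[OF this measurable_momc[OF i]] show ?thesis by simp
 qed
 then have "(%th. s * ((\<Sum>k<n. momc i (D k) th) / real n)) : bmb"
 by (intro borel_measurable_times borel_measurable_divide borel_measurable_sum borel_measurable_const) auto
 moreover have "Y D th $ i = s * ((\<Sum>k<n. momc i (D k) th) / real n)" for th
 using i by (simp add: Y_def gbar_def momc_def)
 ultimately show ?thesis by simp
qed

lemma measurable_Lq: "D : space OM ==> coercive m l u (Vn X D) ==> Lq D : bmb"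
proof -
 assume D: "D : space OM" and V: "coercive m l u (Vn X D)"
 have "Lq D = (%th. exp (- (\<Sum>i\<in>{..<m}. \<Sum>j\<in>{..<m}. minv (Vn X D) $$ (i,j) * Y D th $ i * Y D th $ j) / 2))"
 unfolding Lq_def[abs_def] quadratic_form_entries[OF coercive_minv(1)[OF V] Y_carrier] ..
 moreover have "... : bmb"
 proof -
 have [measurable]: "(%th. Y D th $ i) : bmb" if "i : {..<m}" for i
 using measurable_Y[OF D] that by simp
 show ?thesis by measurable
 qed
 ultimately show ?thesis by simp
qed

lemma measurable_psi [measurable]: "psi D : bmb"
proof -
 have c: "(W D + G0 X *. vec p (hsc th)) $ i = W D $ i + (\<Sum>j<p. G0 X $$ (i,j) * hsc th j)" if "i < m" for i th
 using that G0_carrier carrier_vecD[OF W_carrier[of D]] by (auto simp: scalar_prod_def lessThan_atLeast0)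
 have "psi D = (%th. exp (- (\<Sum>i<m. \<Sum>j<m. minv (V0 X) $$ (i,j) * (W D $ i + (\<Sum>j<p. G0 X $$ (i,j) * hsc th j)) *
 (W D $ j + (\<Sum>k<p. G0 X $$ (j,k) * hsc th k))) / 2))"
 unfolding psi_def[abs_def] quadratic_form_entries[OF coercive_minv(1)[OF coercive_V0] ypsi_carrier]
 by (intro ext arg_cong[where f=exp] arg_cong2[where f="(/)"] arg_cong[where f=uminus] sum.cong refl) (simp add: c)
 moreover have [measurable]: "(%th. hsc th j) : bmb" for j
 by (rule measurable_product_then_coordinatewise) measurable
 ultimately show ?thesis by simp
qed

subsection \<open>Approximation of the quasi-posterior, integrated over a model containing the truth\<close>

definition cq :: real where "cq = min (l\<^sup>2 / (8 * u\<^sup>2)) (l * c1\<^sup>2 / (8 * u\<^sup>2))"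

lemma cq_pos: "0 < cq" using lu c1 by (simp add: cq_def)

definition B1 :: "real => nat set => (nat => 'd) => ennreal" where
 "B1 C M D = (NI (plaw M) (%th. enn ((if hn th <= C then 1 else 0) * (\<Sum>i<m. (Rm D th i)\<^sup>2))))"

definition B2 :: "real => real => nat set => (nat => 'd) => ennreal" where
 "B2 T C M D = (NI (plaw M) (%th. (if C < hn th & (\<exists>i<m. s * (c2 * hn th) <= \<bar>trS (T * s) D th i\<bar>) then 1 else 0)))"

text \<open>The prior is split at |h| = C. B1 carries the local fluctuation, B2 the set of tail parameters
 where a truncated sum is too large; there both functions are at most 1.\<close>

lemma Lq_psi_integral:
 assumes M: "M : models X" "Tm <= M"
 and D: "D : space OM" and gw: "good_weight dl D" "0 <= dl" and T: "tight D <= T\<^sup>2" "0 < T"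
 and ta: "taylor \<rho> KT" and C: "1 <= C" "C < \<rho> * s" "2 * T <= sqrt l * C" "4 * (T + real N0 * KF / T) <= c1 * C"
 and eps: "0 < ep"
 shows "(NI (plaw M) (%th. enn \<bar>Lq D th - psi D th\<bar>)) <=
 enn (KQ T C KT * (dl + real N0 * ep + 1 / s) * (cpi / s ^ card M * (2 * C) ^ N0)) + enn (KQ T C KT / ep) * B1 C M D +
 enn (2 * exp cq * (cpi / s ^ card M * (tail_const cq / C))) + B2 T C M D"
proof -
 define K where "K = KQ T C KT"
 have KT: "0 <= KT" using ta by (simp add: taylor_def)
 have K: "0 <= K" unfolding K_def KQ_def using T C KT lu
 by (intro add_nonneg_nonneg divide_nonneg_nonneg mult_nonneg_nonneg) auto
 have V: "coercive m l u (Vn X D)" using gw by (simp add: good_weight_def)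
 define r where "r th = hn th" for th
 define bad where "bad th \<longleftrightarrow> C < r th & (\<exists>i<m. s * (c2 * r th) <= \<bar>trS (T * s) D th i\<bar>)" for th
 define a1 where "a1 = K * (dl + real N0 * ep + 1 / s)"
 have a1: "0 <= a1" using K gw eps s by (simp add: a1_def)
 have [measurable]: "r : bmb" unfolding r_def by measurable
 have sec1: "(%th. Rm D th i) : bmb" if "i < m" for i
 using mcomp[OF measurable_Pair1'[OF D, of "borel :: (nat => real) measure"] measurable_Rm[OF that]] by simp
 have sec2: "(%th. trS b D th i) : bmb" if "i < m" for i b
 using mcomp[OF measurable_Pair1'[OF D, of "borel :: (nat => real) measure"] measurable_trS[OF that]] by simp
 have [measurable]: "Measurable.pred borel bad"
 proof -
 have p1: "Measurable.pred borel (%th. s * (c2 * r th) <= \<bar>trS (T * s) D th i\<bar>)" if "i : {..<m}" for i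
 proof -
 have "(%th. trS (T * s) D th i) : bmb" using sec2 that by simp
 then show ?thesis unfolding pred_def
 by (intro borel_measurable_le borel_measurable_times borel_measurable_abs borel_measurable_const) measurable
 qed
 have "Measurable.pred borel (%th. C < r th & (\<exists>i\<in>{..<m}. s * (c2 * r th) <= \<bar>trS (T * s) D th i\<bar>))"
 by (intro pred_intros_logic pred_intros_finite p1) measurable
 moreover have "bad = (%th. C < r th & (\<exists>i\<in>{..<m}. s * (c2 * r th) <= \<bar>trS (T * s) D th i\<bar>))"
 by (auto simp: bad_def fun_eq_iff)
 ultimately show ?thesis by simp
 qed
 have [measurable]: "(%th. enn ((if r th <= C then 1 else 0) * (\<Sum>i<m. (Rm D th i)\<^sup>2))) : bmb"
 proof -
 have [measurable]: "(%th. Rm D th i) : bmb" if "i : {..<m}" for i using sec1 that by simp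
 show ?thesis by measurable
 qed
 have tail: "\<bar>Lq D th - psi D th\<bar> <= (2 * exp cq) * exp (- cq * r th) + (if bad th then 1 else 0)"
 if "th : \<Theta>" "C < r th" for th
 proof -
 have C_r: "x * C <= x * r th" if "0 <= x" for x using \<open>C < r th\<close> that by (intro mult_left_mono) auto
 have g: "exp (- x * (r th)\<^sup>2) <= exp cq * exp (- cq * r th)" if "cq <= x" for x
 proof -
 have "exp (- x * (r th)\<^sup>2) <= exp (- cq * (r th)\<^sup>2)" using that by (simp add: mult_right_mono)
 also have "... <= exp cq * exp (- cq * r th)" using cq_pos by (intro gauss_le_exp) simp
 finally show ?thesis .
 qed
 have p: "psi D th <= exp cq * exp (- cq * r th)"
 proof -
 have "psi D th <= exp (- (l\<^sup>2 / (8 * u\<^sup>2)) * (hn th)\<^sup>2)"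
 proof (rule psi_tail[OF tight_bounds(1)[OF D T]])
 show "2 * T <= sqrt l * hn th"
 using order_trans[OF C(3) C_r[of "sqrt l"]] lu unfolding r_def by (metis less_imp_le real_sqrt_ge_zero)
 qed
 also have "... <= exp cq * exp (- cq * r th)" unfolding r_def[symmetric] by (rule g) (simp add: cq_def)
 finally show ?thesis .
 qed
 show ?thesis
 proof (cases "bad th")
 case True
 have "\<bar>Lq D th - psi D th\<bar> <= 1" using Lq_le_1[OF V, of th] Lq_pos[of D th] psi_le_1[of D th] psi_pos[of D th] by linarith
 then show ?thesis using True by (simp add: add_increasing)
 next
 case False
 have "Lq D th <= exp (- (l * c1\<^sup>2 / (8 * u\<^sup>2)) * (hn th)\<^sup>2)"
 proof (rule Lq_tail[OF D V T that(1)])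
 show "4 * (T + real N0 * KF / T) <= c1 * hn th"
 using order_trans[OF C(4) C_r[of c1]] c1 unfolding r_def by (metis less_imp_le)
 show "\<bar>trS (T * s) D th i\<bar> < s * (c2 * hn th)" if "i < m" for i
 using False \<open>C < r th\<close> that unfolding bad_def r_def by (meson not_le)
 qed
 also have "... <= exp cq * exp (- cq * r th)" unfolding r_def[symmetric] by (rule g) (simp add: cq_def)
 finally show ?thesis using p Lq_pos[of D th] psi_pos[of D th] False by (simp add: abs_le_iff)
 qed
 qed
 have near: "\<bar>Lq D th - psi D th\<bar> <= a1 + K / ep * (\<Sum>i<m. (Rm D th i)\<^sup>2)"
 if "th : \<Theta>" "r th <= C" for th
 proof -
 have ab: "\<bar>x\<bar> <= ep + x\<^sup>2 / ep" for x :: real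
 proof -
 have q: "0 <= x\<^sup>2 / ep" using eps by simp
 show ?thesis
 proof (cases "\<bar>x\<bar> <= ep")
 case True then show ?thesis using q by linarith
 next
 case False
 then have "ep * \<bar>x\<bar> <= \<bar>x\<bar> * \<bar>x\<bar>" by (intro mult_right_mono) auto
 then have "\<bar>x\<bar> <= x\<^sup>2 / ep" using eps by (simp add: pos_le_divide_eq power2_eq_square mult.commute)
 then show ?thesis using eps by linarith
 qed
 qed
 have "(\<Sum>i<m. \<bar>Rm D th i\<bar>) <= (\<Sum>i<m. ep + (Rm D th i)\<^sup>2 / ep)" by (intro sum_mono ab)
 also have "... = real m * ep + (\<Sum>i<m. (Rm D th i)\<^sup>2) / ep" by (simp add: sum.distrib sum_divide_distrib)
 also have "... <= real N0 * ep + (\<Sum>i<m. (Rm D th i)\<^sup>2) / ep" using dims eps by (intro add_right_mono mult_right_mono) auto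
 finally have "dl + (\<Sum>i<m. \<bar>Rm D th i\<bar>) + 1 / s <= (dl + real N0 * ep + 1 / s) + (\<Sum>i<m. (Rm D th i)\<^sup>2) / ep" by simp
 then have "K * (dl + (\<Sum>i<m. \<bar>Rm D th i\<bar>) + 1 / s) <= K * ((dl + real N0 * ep + 1 / s) + (\<Sum>i<m. (Rm D th i)\<^sup>2) / ep)"
 using K by (rule mult_left_mono)
 moreover have "\<bar>Lq D th - psi D th\<bar> <= K * (dl + (\<Sum>i<m. \<bar>Rm D th i\<bar>) + 1 / s)"
 unfolding K_def using that by (intro Lq_local[OF D gw T ta C(1,2)]) (auto simp: r_def)
 ultimately show ?thesis by (simp add: a1_def distrib_left)
 qed
 have "(NI (plaw M) (%th. enn \<bar>Lq D th - psi D th\<bar>)) <=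
 (NI (plaw M) (%th. enn a1 * (if r th <= C then 1 else 0) +
 enn (K / ep) * enn ((if r th <= C then 1 else 0) * (\<Sum>i<m. (Rm D th i)\<^sup>2)) +
 enn (2 * exp cq) * (if C < r th then enn (exp (- cq * r th)) else 0) + (if bad th then 1 else 0)))"
 proof (rule nn_integral_mono_AE)
 show "AE th in plaw M. enn \<bar>Lq D th - psi D th\<bar> <= enn a1 * (if r th <= C then 1 else 0) +
 enn (K / ep) * enn ((if r th <= C then 1 else 0) * (\<Sum>i<m. (Rm D th i)\<^sup>2)) +
 enn (2 * exp cq) * (if C < r th then enn (exp (- cq * r th)) else 0) + (if bad th then 1 else 0)"
 using AE_plaw[OF M(1)]
 proof eventually_elim
 case (elim th)
 then have th: "th : \<Theta>" using Theta_of_subset by auto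
 show ?case
 proof (cases "r th <= C")
 case True
 then have nb: "\<not> bad th" by (simp add: bad_def)
 have "enn \<bar>Lq D th - psi D th\<bar> <= enn (a1 + K / ep * (\<Sum>i<m. (Rm D th i)\<^sup>2))"
 by (rule ennreal_leI[OF near[OF th True]])
 also have "... = enn a1 + enn (K / ep) * enn (\<Sum>i<m. (Rm D th i)\<^sup>2)"
 proof -
 have e: "enn (a1 + x * y) = enn a1 + enn x * enn y" if "0 <= x" "0 <= y" for x y
 using a1 that by (simp add: ennreal_plus ennreal_mult)
 show ?thesis by (rule e) (use K eps in \<open>auto intro!: sum_nonneg\<close>)
 qed
 finally show ?thesis using True nb by simp
 next
 case False
 have "enn \<bar>Lq D th - psi D th\<bar> <= enn ((2 * exp cq) * exp (- cq * r th) + (if bad th then 1 else 0))"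
 using False by (intro ennreal_leI tail[OF th]) simp
 also have "... = enn (2 * exp cq) * enn (exp (- cq * r th)) + (if bad th then 1 else 0)"
 by (simp add: ennreal_plus ennreal_mult)
 finally show ?thesis using False by simp
 qed
 qed
 qed
 also have "... = enn a1 * (NI (plaw M) (%th. (if r th <= C then 1 else 0))) + enn (K / ep) * B1 C M D +
 enn (2 * exp cq) * (NI (plaw M) (%th. (if C < r th then enn (exp (- cq * r th)) else 0))) + B2 T C M D"
 unfolding B1_def B2_def r_def[symmetric] bad_def[symmetric]
 by (subst nn_integral_add, (measurable)[2])+ (simp add: nn_integral_cmult)
 also have "... <= enn a1 * enn (cpi / s ^ card M * (2 * C) ^ N0) + enn (K / ep) * B1 C M D +
 enn (2 * exp cq) * enn (cpi / s ^ card M * (tail_const cq / C)) + B2 T C M D"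
 unfolding r_def using prior_ball[OF M C(1)] prior_exp_tail[OF M cq_pos C(1)]
 by (intro add_mono mult_left_mono) auto
 also have "... = enn (a1 * (cpi / s ^ card M * (2 * C) ^ N0)) + enn (K / ep) * B1 C M D +
 enn (2 * exp cq * (cpi / s ^ card M * (tail_const cq / C))) + B2 T C M D"
 using a1 cpi s C tail_const_pos[OF cq_pos] by (subst (1 2) ennreal_mult) auto
 finally show ?thesis unfolding a1_def K_def by (simp add: mult.assoc)
qed

end

context rg begin

lemma measurable_B1:
 assumes M: "M : models X" shows "B1 C M : borel_measurable OM"
proof -
 interpret Q: sigma_finite_measure "plaw M" by (rule sigma_finite_plaw[OF M])
 have "(%(D,th). enn ((if hn th <= C then 1 else 0) * (\<Sum>i<m. (Rm D th i)\<^sup>2))) : borel_measurable (OM \<Otimes>\<^sub>M borel)"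
 unfolding split_beta' using measurable_Rm[unfolded split_beta'] by measurable
 then have "(%(D,th). enn ((if hn th <= C then 1 else 0) * (\<Sum>i<m. (Rm D th i)\<^sup>2))) : borel_measurable (OM \<Otimes>\<^sub>M plaw M)"
 by (simp add: measurable_pair_plaw_eq)
 from Q.borel_measurable_nn_integral[OF this] show ?thesis unfolding B1_def[abs_def] .
qed

lemma measurable_exists_trS:
 assumes M: "M : models X" and thr: "thr : bmb" and I: "Measurable.pred borel I"
 shows "(%D. \<integral>\<^sup>+th. (if I th & (\<exists>i<m. thr th <= \<bar>trS b D th i\<bar>) then 1 else 0) \<partial>plaw M) : borel_measurable OM"
proof -
 interpret Q: sigma_finite_measure "plaw M" by (rule sigma_finite_plaw[OF M])
 note [measurable] = thr I
 have "(%x. if I (snd x) & (\<exists>i\<in>{..<m}. thr (snd x) <= \<bar>trS b (fst x) (snd x) i\<bar>) then 1 else 0 :: ennreal) : borel_measurable (OM \<Otimes>\<^sub>M borel)"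
 proof -
 have [measurable]: "(%x. trS b (fst x) (snd x) i) : borel_measurable (OM \<Otimes>\<^sub>M borel)" if "i : {..<m}" for i
 using measurable_trS[of i b] that by (simp add: split_beta')
 show ?thesis by measurable
 qed
 moreover have "(%(D,th). if I th & (\<exists>i<m. thr th <= \<bar>trS b D th i\<bar>) then 1 else 0 :: ennreal) =
 (%x. if I (snd x) & (\<exists>i\<in>{..<m}. thr (snd x) <= \<bar>trS b (fst x) (snd x) i\<bar>) then 1 else 0)"
 by (auto simp: fun_eq_iff)
 ultimately have "(%(D,th). if I th & (\<exists>i<m. thr th <= \<bar>trS b D th i\<bar>) then 1 else 0 :: ennreal)
 : borel_measurable (OM \<Otimes>\<^sub>M plaw M)"
 unfolding measurable_pair_plaw_eq by (simp only:)
 from Q.borel_measurable_nn_integral[OF this] show ?thesis .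
qed

definition E1 :: "real => real" where
 "E1 C = real N0 * (K4 * (C / s) powr \<alpha>)\<^sup>2 * (cpi * (2 * C) ^ N0)"

definition E2 :: "real => real => real" where
 "E2 T C = 2 * real N0 * exp (KF / (4 * T\<^sup>2)) * cpi * (tail_const (c2 / (2 * T)) / C)"

lemma nn_integral_B1:
 assumes M: "M : models X" "Tm <= M" and C: "1 <= C"
 shows "(NI OM (%D. B1 C M D)) <= enn (E1 C / s ^ card M)"
 using local_fluctuation[OF M C] by (simp add: B1_def E1_def)

lemma nn_integral_B2:
 assumes M: "M : models X" "Tm <= M" and C: "1 <= C" and T: "0 < T"
 shows "(NI OM (%D. B2 T C M D)) <= enn (E2 T C / s ^ card M)"
proof -
 let ?thr = "%th. s * (c2 * hn th)"
 define q where "q = 2 * real N0 * exp (KF / (4 * T\<^sup>2))"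
 have q: "0 <= q" by (simp add: q_def)
 have c: "0 < c2 / (2 * T)" using c2_pos T by simp
 have Ts: "0 < T * s" using T s by simp
 have "(NI OM (%D. B2 T C M D)) <=
 (NI (plaw M) (%th. (if C < hn th then enn (2 * real N0 * exp (- ?thr th / (2 * (T * s)) + real n * KF / (4 * (T * s)\<^sup>2))) else 0)))"
 unfolding B2_def by (rule truncated_deviation[OF M(1) Ts]) measurable
 also have "... = (NI (plaw M) (%th. enn q * (if C < hn th then enn (exp (- (c2 / (2 * T)) * hn th)) else 0)))"
 proof (rule nn_integral_cong)
 fix th
 have 1: "- ?thr th / (2 * (T * s)) = - (c2 / (2 * T)) * hn th" using s(1) T by (simp add: field_simps)
 have 2: "real n * KF / (4 * (T * s)\<^sup>2) = KF / (4 * T\<^sup>2)"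
 unfolding power_mult_distrib s(4) using n_pos by simp
 have "2 * real N0 * exp (- ?thr th / (2 * (T * s)) + real n * KF / (4 * (T * s)\<^sup>2)) = q * exp (- (c2 / (2 * T)) * hn th)"
 unfolding 1 2 by (simp add: q_def mult_exp_exp algebra_simps)
 then show "(if C < hn th then enn (2 * real N0 * exp (- ?thr th / (2 * (T * s)) + real n * KF / (4 * (T * s)\<^sup>2))) else 0) =
 enn q * (if C < hn th then enn (exp (- (c2 / (2 * T)) * hn th)) else 0)"
 using q by (simp add: ennreal_mult)
 qed
 also have "... = enn q * (NI (plaw M) (%th. (if C < hn th then enn (exp (- (c2 / (2 * T)) * hn th)) else 0)))"
 by (rule nn_integral_cmult) measurable
 also have "... <= enn q * enn (cpi / s ^ card M * (tail_const (c2 / (2 * T)) / C))"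
 by (intro mult_left_mono prior_exp_tail M c C) simp
 also have "... = enn (E2 T C / s ^ card M)"
 using q cpi s C tail_const_pos[OF c] by (subst ennreal_mult[symmetric]) (auto simp: E2_def q_def mult_ac)
 finally show ?thesis .
qed

definition qval :: "real => real => real => real => real => real => real" where
 "qval T C KT dl ep et = KQ T C KT * (dl + real N0 * ep + 1 / s) * (cpi * (2 * C) ^ N0) +
 KQ T C KT / ep * ((E1 C + 1 / s) / et) + 2 * exp cq * cpi * (tail_const cq / C) + (E2 T C + 1 / s) / et"

lemma card_models_le: "real (card I) * et <= 2 ^ N0 * et" if "I <= models X" "0 <= et"
proof -
 have "card I <= card (models X)" using that by (intro card_mono) (auto simp: models_def)
 also have "... = 2 ^ p" by (simp add: models_def card_Pow)
 also have "... <= 2 ^ N0" using p_le by (intro power_increasing) auto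
 finally have "real (card I) <= real (2 ^ N0)" by (rule of_nat_mono)
 then show ?thesis using that(2) by (intro mult_right_mono) auto
qed

lemma finite_models: "finite (models X)" by (simp add: models_def)

text \<open>B1 and B2 are controlled by Markov, simultaneously for the finitely many models.\<close>

lemma Lq_psi_prob:
 assumes ta: "taylor \<rho> KT" and dl: "0 <= dl" and T: "0 < T" and ep: "0 < ep" and et: "0 < et"
 and C: "1 <= C" "C < \<rho> * s" "2 * T <= sqrt l * C" "4 * (T + real N0 * KF / T) <= c1 * C"
 shows "prob_ge OM (%D. good_weight dl D & tight D <= T\<^sup>2 -->
 (ALL M:models X. Tm <= M -->
 (NI (plaw M) (%th. enn \<bar>Lq D th - psi D th\<bar>)) <= enn (qval T C KT dl ep et / s ^ card M))) (1 - 2 ^ N0 * (2 * et))"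
proof -
 let ?I = "{M\<in>models X. Tm <= M}"
 let ?E = "%M D. B1 C M D <= enn ((E1 C + 1/s) / et / s ^ card M) & B2 T C M D <= enn ((E2 T C + 1/s) / et / s ^ card M)"
 have KT: "0 <= KT" using ta by (simp add: taylor_def)
 have K: "0 <= KQ T C KT" unfolding KQ_def using T C KT lu
 by (intro add_nonneg_nonneg divide_nonneg_nonneg mult_nonneg_nonneg) auto
 have E1: "0 <= E1 C" using K4 cpi C by (simp add: E1_def)
 have E2: "0 <= E2 T C" using cpi C tail_const_pos[of "c2 / (2 * T)"] c2_pos T by (simp add: E2_def)
 have "prob_ge OM (%D. ALL M:?I. ?E M D) (1 - real (card ?I) * (et + et))"
 proof (rule prob_ge_finite_ball[OF prob_OM])
 show "finite ?I" using finite_models by simp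
 fix M assume "M : ?I"
 then have M: "M : models X" "Tm <= M" by auto
 have sk: "0 < s ^ card M" using s by simp
 show "prob_ge OM (?E M) (1 - (et + et))"
 proof (rule prob_ge_conj[OF prob_OM]; rule prob_ge_Markov[OF prob_OM])
 show "B1 C M : borel_measurable OM" by (rule measurable_B1[OF M(1)])
 show "B2 T C M : borel_measurable OM"
 unfolding B2_def[abs_def] by (rule measurable_exists_trS[OF M(1)]) measurable
 have "E1 C / s ^ card M <= et * ((E1 C + 1/s) / et / s ^ card M)" using et sk s by (simp add: divide_right_mono)
 then show "(NI OM (%D. B1 C M D)) <= enn (et * ((E1 C + 1/s) / et / s ^ card M))"
 using nn_integral_B1[OF M C(1)] by (meson ennreal_leI order_trans)
 have "E2 T C / s ^ card M <= et * ((E2 T C + 1/s) / et / s ^ card M)" using et sk s by (simp add: divide_right_mono)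
 then show "(NI OM (%D. B2 T C M D)) <= enn (et * ((E2 T C + 1/s) / et / s ^ card M))"
 using nn_integral_B2[OF M C(1) T] by (meson ennreal_leI order_trans)
 show "0 < (E1 C + 1/s) / et / s ^ card M" "0 < (E2 T C + 1/s) / et / s ^ card M"
 using E1 E2 et sk s by (auto intro!: divide_pos_pos add_nonneg_pos)
 qed (use et in auto)
 qed
 then show ?thesis
 proof (rule prob_ge_mono)
 show "1 - 2 ^ N0 * (2 * et) <= 1 - real (card ?I) * (et + et)"
 using card_models_le[of ?I "2 * et"] et by simp
 fix D assume D: "D : space OM" and E: "ALL M:?I. ?E M D"
 show "good_weight dl D & tight D <= T\<^sup>2 --> (ALL M:models X. Tm <= M -->
 (NI (plaw M) (%th. enn \<bar>Lq D th - psi D th\<bar>)) <= enn (qval T C KT dl ep et / s ^ card M))"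
 proof (intro impI ballI)
 fix M assume gt: "good_weight dl D & tight D <= T\<^sup>2" and M: "M : models X" "Tm <= M"
 have b: "B1 C M D <= enn ((E1 C + 1/s) / et / s ^ card M)" "B2 T C M D <= enn ((E2 T C + 1/s) / et / s ^ card M)"
 using E M by auto
 have sk: "0 < s ^ card M" using s by simp
 have tc: "0 < tail_const cq" using tail_const_pos[OF cq_pos] .
 define x1 where "x1 = KQ T C KT * (dl + real N0 * ep + 1 / s) * (cpi / s ^ card M * (2 * C) ^ N0)"
 define x2 where "x2 = KQ T C KT / ep * ((E1 C + 1/s) / et / s ^ card M)"
 define x3 where "x3 = 2 * exp cq * (cpi / s ^ card M * (tail_const cq / C))"
 define x4 where "x4 = (E2 T C + 1/s) / et / s ^ card M"
 have nn: "0 <= x1" "0 <= x2" "0 <= x3" "0 <= x4"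
 proof -
 have a: "0 <= dl + real N0 * ep + 1 / s" using dl ep s by simp
 have b: "0 <= cpi / s ^ card M * (2 * C) ^ N0" using cpi sk C by simp
 have c: "0 <= (E1 C + 1/s) / et / s ^ card M" using E1 et sk s by simp
 show "0 <= x1" unfolding x1_def by (rule mult_nonneg_nonneg[OF mult_nonneg_nonneg[OF K a] b])
 show "0 <= x2" unfolding x2_def by (rule mult_nonneg_nonneg[OF divide_nonneg_pos[OF K ep] c])
 show "0 <= x3" unfolding x3_def using cpi sk C tc by simp
 show "0 <= x4" unfolding x4_def using E2 et sk s by simp
 qed
 have "(NI (plaw M) (%th. enn \<bar>Lq D th - psi D th\<bar>)) <=
 enn x1 + enn (KQ T C KT / ep) * B1 C M D + enn x3 + B2 T C M D"
 unfolding x1_def x3_def using Lq_psi_integral[OF M D _ dl _ T ta C ep] gt by simp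
 also have "... <= enn x1 + enn (KQ T C KT / ep) * enn ((E1 C + 1/s) / et / s ^ card M) + enn x3 + enn x4"
 unfolding x4_def using b by (intro add_mono mult_left_mono) auto
 also have "enn (KQ T C KT / ep) * enn ((E1 C + 1/s) / et / s ^ card M) = enn x2"
 unfolding x2_def using K ep E1 et sk s by (intro ennreal_mult[symmetric]) (auto intro!: divide_nonneg_nonneg add_nonneg_nonneg)
 also have "enn x1 + enn x2 + enn x3 + enn x4 = enn (x1 + x2 + x3 + x4)"
 using nn by (simp flip: ennreal_plus)
 also have "x1 + x2 + x3 + x4 = qval T C KT dl ep et / s ^ card M"
 proof -
 have "x1 = KQ T C KT * (dl + real N0 * ep + 1 / s) * (cpi * (2 * C) ^ N0) / s ^ card M" by (simp add: x1_def)
 moreover have "x2 = KQ T C KT / ep * ((E1 C + 1 / s) / et) / s ^ card M" by (simp add: x2_def)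
 moreover have "x3 = 2 * exp cq * cpi * (tail_const cq / C) / s ^ card M" by (simp add: x3_def mult_ac)
 moreover have "x4 = (E2 T C + 1 / s) / et / s ^ card M" by (simp add: x4_def)
 ultimately show ?thesis unfolding qval_def by (simp only: add_divide_distrib)
 qed
 finally show "(NI (plaw M) (%th. enn \<bar>Lq D th - psi D th\<bar>)) <= enn (qval T C KT dl ep et / s ^ card M)" .
 qed
 qed
qed

subsection \<open>Models missing a signal\<close>

lemma missing_signal_edist:
 assumes M: "M : models X" "\<not> Tm <= M" and th: "th : Theta_of X M"
 shows "tmin <= edist p th t0"
proof -
 obtain j where j: "j : Tm" "j \<notin> M" using M by auto
 then have jp: "j < p" by (auto simp: true_model_def)
 have "th j = 0" using th j jp by (auto simp: Theta_of_def)
 then have "tmin <= \<bar>(vec p th - vec p t0) $ j\<bar>" using signal[OF j(1)] jp by simp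
 also have "... <= edist p th t0" unfolding edist_def using jp by (intro abs_component_le_vnorm) simp
 finally show ?thesis .
qed

definition gm :: real where "gm = c1 * tmin"
definition et0 :: real where "et0 = gm / (16 * real N0)"
definition b0 :: real where "b0 = KF / et0 + 1"
definition cA :: real where "cA = l * gm\<^sup>2 / (8 * u\<^sup>2)"
definition cB :: real where "cB = et0 / (8 * b0)"

lemma gm_pos: "0 < gm" "0 < et0" "0 < b0" "0 < cA" "0 < cB" "KF / b0 <= et0"
proof -
 show g: "0 < gm" using c1 tmin by (simp add: gm_def)
 then show e: "0 < et0" using N0_pos by (simp add: et0_def)
 then show b: "0 < b0" using KF_nonneg by (simp add: b0_def add_nonneg_pos)
 show "0 < cA" using g lu by (simp add: cA_def)
 show "0 < cB" using e b by (simp add: cB_def)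
 have "KF <= et0 * b0" using e by (simp add: b0_def distrib_left)
 then show "KF / b0 <= et0" using b by (simp add: pos_divide_le_eq)
qed

definition excess :: "(nat => 'd) => real" where
 "excess D = (\<Sum>k<n. if env (D k) <= b0 then 0 else \<bar>env (D k)\<bar>)"

lemma excess_prob: "prob_ge OM (%D. excess D <= real n * (2 * et0)) (1 - KF / (real n * et0\<^sup>2))"
proof -
 let ?e = "%d. if env d <= b0 then 0 else \<bar>env d\<bar>"
 let ?Q = "%D. enn ((\<Sum>k<n. (?e (D k) - (LINT d|P. ?e d)))\<^sup>2)"
 note em = excess_mean[OF gm_pos(3)]
 have me: "?e : borel_measurable P" by measurable
 have "prob_ge OM (%D. ?Q D <= enn ((real n * et0)\<^sup>2)) (1 - KF / (real n * et0\<^sup>2))"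
 proof (rule prob_ge_Markov[OF prob_OM])
 show "?Q : borel_measurable OM"
 by (intro mcomp[OF _ measurable_ennreal] borel_measurable_power measurable_sample_sum me)
 have "(NI OM (%D. ?Q D)) <= enn (real n * KF)"
 unfolding OM_eq by (rule nn_integral_sq_iid_sum[OF prob_P me em(4,3)])
 also have "real n * KF = KF / (real n * et0\<^sup>2) * (real n * et0)\<^sup>2"
 using n_pos gm_pos(2) by (simp add: power2_eq_square field_simps)
 finally show "(NI OM (%D. ?Q D)) <= enn (KF / (real n * et0\<^sup>2) * (real n * et0)\<^sup>2)" .
 qed (use n_pos gm_pos(2) KF_nonneg in auto)
 then show ?thesis
 proof (rule prob_ge_mono)
 fix D assume "?Q D <= enn ((real n * et0)\<^sup>2)"
 then have "(\<Sum>k<n. (?e (D k) - (LINT d|P. ?e d)))\<^sup>2 <= (real n * et0)\<^sup>2" by simp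
 then have "\<bar>\<Sum>k<n. (?e (D k) - (LINT d|P. ?e d))\<bar> <= \<bar>real n * et0\<bar>" by (simp only: abs_le_square_iff)
 then have "(\<Sum>k<n. (?e (D k) - (LINT d|P. ?e d))) <= real n * et0" using gm_pos(2) by simp
 moreover have "(\<Sum>k<n. (?e (D k) - (LINT d|P. ?e d))) = excess D - real n * (LINT d|P. ?e d)"
 by (simp add: excess_def sum_subtractf)
 moreover have "real n * (LINT d|P. ?e d) <= real n * et0"
 using em(1) gm_pos(6) by (intro mult_left_mono) auto
 ultimately show "excess D <= real n * (2 * et0)" by (simp add: algebra_simps)
 qed simp
qed

definition B3 :: "nat set => (nat => 'd) => ennreal" where
 "B3 M D = (NI (plaw M) (%th. (if True & (\<exists>i<m. real n * et0 <= \<bar>trS b0 D th i\<bar>) then 1 else 0)))"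

lemma nn_integral_B3:
 assumes M: "M : models X"
 shows "(NI OM (%D. B3 M D)) <= enn (2 * real N0 * exp (- 2 * cB * real n))"
proof -
 interpret Q: prob_space "plaw M" by (rule prob_plaw[OF M])
 have "(NI OM (%D. B3 M D)) <= (NI (plaw M) (%th. (if True then enn (2 * real N0 * exp (- (real n * et0) / (2 * b0) + real n * KF / (4 * b0\<^sup>2))) else 0)))"
 unfolding B3_def by (rule truncated_deviation[OF M gm_pos(3)]) auto
 also have "... = enn (2 * real N0 * exp (- (real n * et0) / (2 * b0) + real n * KF / (4 * b0\<^sup>2)))"
 using Q.emeasure_space_1 by simp
 also have "... <= enn (2 * real N0 * exp (- 2 * cB * real n))"
 proof (intro ennreal_leI mult_left_mono)
 have "real n * KF / (4 * b0\<^sup>2) = real n / (4 * b0) * (KF / b0)" by (simp add: power2_eq_square)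
 also have "... <= real n / (4 * b0) * et0" using gm_pos by (intro mult_left_mono) auto
 finally have "- (real n * et0) / (2 * b0) + real n * KF / (4 * b0\<^sup>2) <= - (real n * et0) / (2 * b0) + real n / (4 * b0) * et0" by simp
 also have "... = - 2 * cB * real n" using gm_pos by (simp add: cB_def field_simps)
 finally show "exp (- (real n * et0) / (2 * b0) + real n * KF / (4 * b0\<^sup>2)) <= exp (- 2 * cB * real n)" by simp
 qed simp
 finally show ?thesis .
qed

lemma Lq_missing_signal:
 assumes D: "D : space OM" and V: "coercive m l u (Vn X D)" and T: "tight D <= T\<^sup>2" "0 < T" "T <= s * gm / 4"
 and ex: "excess D <= real n * (2 * et0)" and th: "th : \<Theta>" "tmin <= edist p th t0"
 and nb: "\<And>i. i < m ==> \<bar>trS b0 D th i\<bar> < real n * et0"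
 shows "Lq D th <= exp (- cA * real n)"
proof -
 have R: "\<bar>Rm D th i\<bar> <= s * (4 * et0)" if i: "i < m" for i
 proof -
 have "s * \<bar>Rm D th i\<bar> <= real n * et0 + real n * (2 * et0) + real n * (KF / b0)"
 using Rm_le_truncated[OF D i gm_pos(3), of th] nb[OF i] ex by (simp add: excess_def)
 also have "real n * (KF / b0) <= real n * et0" using gm_pos(6) by (intro mult_left_mono) auto
 finally have "s * \<bar>Rm D th i\<bar> <= (s * s) * (4 * et0)" unfolding s(3) by simp
 then show ?thesis using s(1) by (simp only: mult.assoc mult_le_cancel_left_pos)
 qed
 have "(\<Sum>i<m. \<bar>Rm D th i\<bar>) <= (\<Sum>i<m. s * (4 * et0))" using R by (intro sum_mono) auto
 also have "... = real m * (s * (4 * et0))" by simp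
 also have "... <= real N0 * (s * (4 * et0))" using dims s gm_pos by (intro mult_right_mono) auto
 also have "... = s * gm / 4" using N0_pos by (simp add: et0_def)
 finally have SR: "(\<Sum>i<m. \<bar>Rm D th i\<bar>) <= s * gm / 4" .
 have "s * gm <= s * vnorm (mean_mom X th)"
 proof (rule mult_left_mono)
 have "gm <= c1 * edist p th t0" unfolding gm_def using th(2) c1 by (intro mult_left_mono) auto
 then show "gm <= vnorm (mean_mom X th)" using sep[OF th(1)] by simp
 qed (use s in simp)
 moreover have "a / 2 <= y" if "a <= b" "b - w - S <= y" "S <= a / 4" "w <= t" "t <= a / 4" for a b w S y t :: real
 using that by linarith
 ultimately have "s * gm / 2 <= vnorm (Y D th)"
 using vnorm_Y_ge[OF th(1), of D] SR tight_bounds(1)[OF D T(1,2)] T(3) by blast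
 then have "Lq D th <= exp (- (l / (2 * u\<^sup>2)) * (s * gm / 2)\<^sup>2)"
 using s gm_pos by (intro Lq_le_of_vnorm[OF V]) auto
 moreover have "- (l / (2 * u\<^sup>2)) * (s * gm / 2)\<^sup>2 = - cA * real n"
 unfolding power_mult_distrib power_divide s(4) cA_def by simp
 ultimately show ?thesis by (simp only:)
qed

text \<open>Here the mean moment has fixed size, so a fixed truncation level gives deviations of exponentially
 small probability; the excess of the envelope is controlled by Chebyshev.\<close>

lemma Lq_missing_prob:
 assumes T: "0 < T" "T <= s * gm / 4"
 shows "prob_ge OM (%D. coercive m l u (Vn X D) & tight D <= T\<^sup>2 -->
 (ALL M:models X. \<not> Tm <= M -->
 (NI (plaw M) (%th. enn (Lq D th))) <= enn (exp (- cA * real n) + exp (- cB * real n))))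
 (1 - (KF / (real n * et0\<^sup>2) + 2 ^ N0 * (2 * real N0 * exp (- cB * real n))))"
proof -
 let ?E = "%M D. B3 M D <= enn (exp (- cB * real n))"
 have "prob_ge OM (%D. ALL M:models X. ?E M D) (1 - real (card (models X)) * (2 * real N0 * exp (- cB * real n)))"
 proof (rule prob_ge_finite_ball[OF prob_OM finite_models])
 fix M assume M: "M : models X"
 show "prob_ge OM (?E M) (1 - 2 * real N0 * exp (- cB * real n))"
 proof (rule prob_ge_Markov[OF prob_OM])
 show "B3 M : borel_measurable OM"
 unfolding B3_def[abs_def]
 by (rule measurable_exists_trS[OF M, where I="%_. True" and thr="%_. real n * et0"]) simp_all
 show "(NI OM (%D. B3 M D)) <= enn (2 * real N0 * exp (- cB * real n) * exp (- cB * real n))"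
 proof -
 have "exp (- 2 * cB * real n) = exp (- cB * real n) * exp (- cB * real n)" by (simp add: mult_exp_exp)
 then show ?thesis using nn_integral_B3[OF M] by (simp only: mult.assoc)
 qed
 qed auto
 qed
 from prob_ge_conj[OF prob_OM excess_prob this]
 show ?thesis
 proof (rule prob_ge_mono)
 show "1 - (KF / (real n * et0\<^sup>2) + 2 ^ N0 * (2 * real N0 * exp (- cB * real n)))
 <= 1 - (KF / (real n * et0\<^sup>2) + real (card (models X)) * (2 * real N0 * exp (- cB * real n)))"
 using card_models_le[of "models X" "2 * real N0 * exp (- cB * real n)"] by simp
 fix D assume D: "D : space OM" and E: "excess D <= real n * (2 * et0) & (ALL M:models X. ?E M D)"
 show "coercive m l u (Vn X D) & tight D <= T\<^sup>2 --> (ALL M:models X. \<not> Tm <= M -->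
 (NI (plaw M) (%th. enn (Lq D th))) <= enn (exp (- cA * real n) + exp (- cB * real n)))"
 proof (intro impI ballI)
 fix M assume V: "coercive m l u (Vn X D) & tight D <= T\<^sup>2" and M: "M : models X" "\<not> Tm <= M"
 interpret Q: prob_space "plaw M" by (rule prob_plaw[OF M(1)])
 define bad where "bad th \<longleftrightarrow> True & (\<exists>i<m. real n * et0 <= \<bar>trS b0 D th i\<bar>)" for th
 have mb: "(%th. if bad th then 1 else 0 :: ennreal) : borel_measurable (plaw M)"
 proof -
 have p1: "Measurable.pred borel (%th. real n * et0 <= \<bar>trS b0 D th i\<bar>)" if "i : {..<m}" for i
 proof -
 have "i < m" using that by simp
 from mcomp[OF measurable_Pair1'[OF D, of "borel :: (nat => real) measure"] measurable_trS[OF this]]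
 have "(%th. trS b0 D th i) : bmb" by simp
 then show ?thesis unfolding pred_def
 by (intro borel_measurable_le borel_measurable_times borel_measurable_abs borel_measurable_const)
 qed
 have [measurable]: "Measurable.pred borel (%th. \<exists>i\<in>{..<m}. real n * et0 <= \<bar>trS b0 D th i\<bar>)"
 by (intro pred_intros_finite p1) auto
 have "bad = (%th. \<exists>i\<in>{..<m}. real n * et0 <= \<bar>trS b0 D th i\<bar>)" by (auto simp: bad_def fun_eq_iff)
 then show ?thesis by simp
 qed
 have "(NI (plaw M) (%th. enn (Lq D th))) <= (NI (plaw M) (%th. enn (exp (- cA * real n)) + (if bad th then 1 else 0)))"
 proof (rule nn_integral_mono_AE)
 show "AE th in plaw M. enn (Lq D th) <= enn (exp (- cA * real n)) + (if bad th then 1 else 0)"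
 using AE_plaw[OF M(1)]
 proof eventually_elim
 case (elim th)
 then have th: "th : \<Theta>" using Theta_of_subset by auto
 show ?case
 proof (cases "bad th")
 case True
 have "enn (Lq D th) <= 1" using Lq_le_1[of D th] V ennreal_leI[of "Lq D th" 1] by simp
 then show ?thesis using True by (simp add: add_increasing)
 next
 case False
 have "Lq D th <= exp (- cA * real n)"
 using False E V by (intro Lq_missing_signal[OF D _ _ T _ th missing_signal_edist[OF M elim]])
 (auto simp: bad_def not_le)
 then show ?thesis using False by (simp add: ennreal_leI)
 qed
 qed
 qed
 also have "... = enn (exp (- cA * real n)) + B3 M D"
 unfolding B3_def bad_def[symmetric] using mb Q.emeasure_space_1 by (subst nn_integral_add) auto
 also have "... <= enn (exp (- cA * real n)) + enn (exp (- cB * real n))" using E M by (intro add_left_mono) auto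
 finally show "(NI (plaw M) (%th. enn (Lq D th))) <= enn (exp (- cA * real n) + exp (- cB * real n))"
 by (simp flip: ennreal_plus)
 qed
 qed
qed

end

lemma minv_one: "minv (1\<^sub>m k) = (1\<^sub>m k :: real mat)"
proof -
 have c: "coercive k 1 1 (1\<^sub>m k)" by (simp add: coercive_def)
 from coercive_minv[OF c] show ?thesis by simp
qed

lemma power_ratio_le:
 fixes x :: real assumes "0 <= x" "x <= 1" "k <= N"
 shows "(1 + x) ^ k - 1 <= real N * 2 ^ N * x"
proof -
 have "(1 + x) ^ k - 1 <= real k * 2 ^ k * x" for k
 proof (induction k)
 case (Suc k)
 have "(1 + x) ^ Suc k - 1 = ((1 + x) ^ k - 1) * (1 + x) + x" by (simp add: algebra_simps)
 also have "... <= (real k * 2 ^ k * x) * 2 + 2 ^ Suc k * x"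
 proof (rule add_mono)
 have "((1 + x) ^ k - 1) * (1 + x) <= (real k * 2 ^ k * x) * (1 + x)" using Suc assms by (intro mult_right_mono) auto
 also have "... <= (real k * 2 ^ k * x) * 2" using assms by (intro mult_left_mono) auto
 finally show "((1 + x) ^ k - 1) * (1 + x) <= (real k * 2 ^ k * x) * 2" .
 have "1 * x <= 2 ^ Suc k * x" using assms one_le_power[of "2::real" "Suc k"] by (intro mult_right_mono) auto
 then show "x <= 2 ^ Suc k * x" by simp
 qed
 also have "... = real (Suc k) * 2 ^ Suc k * x" by (simp add: algebra_simps)
 finally show ?case .
 qed simp
 also have "real k * 2 ^ k * x <= real N * 2 ^ N * x"
 using assms by (intro mult_right_mono mult_mono power_increasing) auto
 finally show ?thesis .
qed

context rg begin

subsection \<open>The likelihood of the estimator\<close>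

definition Am :: "(nat => real) => real mat" where
 "Am th = sandwich (Jac X (clamp th)) (var_mom X (clamp th))"

definition lA :: real where "lA = l / u\<^sup>2 * l"
definition uA :: real where "uA = u / l"

lemma lA_pos: "0 < lA" and uA_pos: "0 < uA"
 using lu by (auto simp: lA_def uA_def)

lemma coercive_Am: "coercive p lA uA (Am th)"
 unfolding Am_def lA_def uA_def
 by (rule coercive_sandwich[OF Jac_carrier coercive_gram coercive_V u_pos]) auto

lemma Am_carrier: "Am th : cmat p p" using coercive_Am by (simp add: coercive_def)

definition jint :: "(nat => real) => real" where "jint th = enn2real (gauss_int p (Am th))"

definition jI :: real where "jI = enn2real (gauss_int p (1\<^sub>m p))"

lemma gauss_int_finite: "coercive p l' u' A ==> gauss_int p A = enn (enn2real (gauss_int p A))"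
 using gauss_int_le[of p l' u' A] by (metis ennreal_enn2real ennreal_less_top le_less_trans)

lemma gauss_int_Am: "gauss_int p (Am th) = enn (jint th)"
 unfolding jint_def by (rule gauss_int_finite[OF coercive_Am])

lemma gauss_int_pos: "coercive p l' u' A ==> 0 < enn2real (gauss_int p A)"
proof -
 assume c: "coercive p l' u' A"
 have "0 < exp (- u' * real p / 2)" by simp
 also have "... <= enn2real (gauss_int p A)"
 using gauss_int_ge[OF c] gauss_int_finite[OF c] by (metis ennreal_le_iff enn2real_nonneg)
 finally show ?thesis .
qed

lemma jint_pos: "0 < jint th" unfolding jint_def by (rule gauss_int_pos[OF coercive_Am])

lemma coercive_one: "coercive p 1 1 (1\<^sub>m p)" by (simp add: coercive_def)

lemma jI_pos: "0 < jI" unfolding jI_def by (rule gauss_int_pos[OF coercive_one])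

lemma gauss_int_one: "gauss_int p (1\<^sub>m p) = enn jI"
 unfolding jI_def by (rule gauss_int_finite[OF coercive_one])

definition jhi :: real where
 "jhi = (\<Sum>k\<le>N0. exp (lA/2) * (1 + fact (k+1) / (lA/2) ^ (k+1)) * 2 ^ (2 * k + 2))"
definition jlo :: real where "jlo = exp (- uA * real N0 / 2)"

lemma jint_bounds: "jlo <= jint th" "jint th <= jhi"
proof -
 have "enn (exp (- uA * real p / 2)) <= enn (jint th)"
 using gauss_int_ge[OF coercive_Am] by (simp add: gauss_int_Am)
 then have "exp (- uA * real p / 2) <= jint th" using jint_pos[of th] by (subst (asm) ennreal_le_iff) auto
 moreover have "jlo <= exp (- uA * real p / 2)" using uA_pos p_le by (simp add: jlo_def)
 ultimately show "jlo <= jint th" by simp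
 let ?f = "%k. exp (lA/2) * (1 + fact (k+1) / (lA/2) ^ (k+1)) * 2 ^ (2 * k + 2)"
 have f0: "0 <= ?f k" for k using lA_pos by (intro mult_nonneg_nonneg add_nonneg_nonneg divide_nonneg_nonneg) auto
 have "enn (jint th) <= enn (?f p)"
 using gauss_int_le[OF coercive_Am[of th]] by (simp add: gauss_int_Am)
 then have "jint th <= ?f p" using f0[of p] by (subst (asm) ennreal_le_iff) auto
 also have "... <= jhi" unfolding jhi_def using p_le by (intro member_le_sum f0) auto
 finally show "jint th <= jhi" .
qed

lemma jlo_pos: "0 < jlo" by (simp add: jlo_def)

definition kap :: real where "kap = det ((2 * pi) \<cdot>\<^sub>m 1\<^sub>m p :: real mat) powr (- 1 / 2)"
definition kap0 :: real where "kap0 = ((2 * pi) ^ N0) powr (- 1 / 2)"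

lemma kap_ge: "kap0 <= kap" and kap0_pos: "0 < kap0" and kap_pos: "0 < kap"
proof -
 have d: "det ((2 * pi) \<cdot>\<^sub>m 1\<^sub>m p :: real mat) = (2 * pi) ^ p" by (simp add: det_smult)
 have "(2 * pi) ^ p <= (2 * pi) ^ N0" using p_le pi_ge_two by (intro power_increasing) auto
 then show 1: "kap0 <= kap" unfolding kap_def kap0_def d by (intro powr_mono2') auto
 show 2: "0 < kap0" by (simp add: kap0_def)
 show "0 < kap" using 1 2 by simp
qed

lemma normal_dens_eq: "normal_dens p (0\<^sub>v p) (1\<^sub>m p) (vec p z) = kap * exp (- (nrm p z)\<^sup>2 / 2)"
proof -
 have "vec p z - 0\<^sub>v p = vec p z" by auto
 then show ?thesis by (simp add: normal_dens_def kap_def minv_one nrm_sq)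
qed

text \<open>Squared length of the studentised estimation error.\<close>

definition zeta :: "(nat => real) => (nat => real) => real" where
 "zeta t th = real n * ((vec p t - vec p (clamp th)) .* (Am th *. (vec p t - vec p (clamp th))))"

definition rho :: "(nat => real) => real" where "rho th = jint t0 / jint th"

text \<open>Likelihood of the estimator, normalised to have limit exp (- zeta / 2) at theta0.\<close>

definition Pt :: "(nat => real) => (nat => real) => real" where
 "Pt t th = est_dens X t (clamp th) * (jint t0 / (s ^ p * jI * kap))"

definition Pbound :: "(nat => real) => (nat => real) => bool" where
 "Pbound t th \<longleftrightarrow> \<bar>Pt t th - rho th * exp (- zeta t th / 2)\<bar> <= rho th * (\<tau> / kap) / (1 + sqrt (zeta t th) ^ (p + 1))"

definition rhomax :: real where "rhomax = jhi / jlo"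

lemma rho_bounds: "0 < rho th" "rho th <= rhomax"
proof -
 show "0 < rho th" using jint_pos by (simp add: rho_def)
 show "rho th <= rhomax" unfolding rho_def rhomax_def
 using jint_bounds[of th] jint_bounds[of t0] jlo_pos jint_pos[of t0] by (intro frac_le) auto
qed

lemma zeta_nonneg: "0 <= zeta t th"
proof -
 let ?v = "vec p t - vec p (clamp th)"
 have "0 <= lA * (?v .* ?v)" using lA_pos by simp
 also have "... <= ?v .* (Am th *. ?v)" using coercive_Am[of th] by (auto simp: coercive_def)
 finally show ?thesis by (simp add: zeta_def)
qed

lemma \<tau>_nonneg: "0 <= \<tau>"
proof -
 have z: "(%_. 0) : euclid p" by (simp add: euclid_def)
 have "0 <= (1 + nrm p (%_. 0) ^ (p + 1)) *
 \<bar>Z_dens X (%_. 0) t0 - normal_dens p (0\<^sub>v p) (1\<^sub>m p) (vec p (%_. 0))\<bar>"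
 by (intro mult_nonneg_nonneg add_nonneg_nonneg) auto
 also have "... <= \<tau>" by (rule Z_normal[OF t0_in z])
 finally show ?thesis .
qed

lemma space_sample_law_at: "th : \<Theta> ==> space (sample_law_at n X th) = space OM"
proof -
 assume "th : \<Theta>"
 then have "sets (obs_law X th) = sets P" using vm by (simp add: valid_moments_def)
 then have "space (obs_law X th) = space P" by (rule sets_eq_imp_space_eq)
 then show ?thesis by (simp add: OM_eq sample_law_at_def space_PiM)
qed

lemma theta_hat_euclid: "D : space OM ==> theta_hat X D : euclid p"
 using ve vm by (auto simp: valid_estimator_def valid_moments_def is_arg_min_def)

text \<open>The studentised density is within tau / (1 + |z|^(p+1)) of the normal density; the change of
 variables transports this to the density of the estimator, outside a null set.\<close>

lemma Pbound_AE:
 assumes th: "th : \<Theta>"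
 shows "AE t in cleb {..<p}. Pbound t th"
proof -
 define F where "F = Fmat X th"
 have F: "F : cmat p p" using Fmat(1)[OF th] by (simp add: F_def)
 have FF: "transpose_mat F * F = Am th" using Fmat(2)[OF th] th by (simp add: F_def Am_def)
 have inj: "y = 0\<^sub>v p" if y: "y : cvec p" "F *. y = 0\<^sub>v p" for y
 proof -
 have "Am th *. y = transpose_mat F *. (F *. y)"
 unfolding FF[symmetric] using F y(1) by (intro assoc_mult_mat_vec[of _ p p _ p]) auto
 also have "... = 0\<^sub>v p" using y(2) F mult_mat_vec_zero[of "transpose_mat F" p p] by simp
 finally have "y .* (Am th *. y) = 0" using y(1) by simp
 then have "lA * (y .* y) <= 0" using coercive_Am[of th] y(1) by (auto simp: coercive_def)
 then have "y .* y = 0" using lA_pos scalar_prod_self_nonneg[of y] by (simp add: mult_le_0_iff)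
 then show ?thesis using scalar_prod_self_eq_0[OF y(1)] by simp
 qed
 note Fi = minv_inverse[OF F inj]
 have psp: "prob_space (sample_law_at n X th)"
 unfolding sample_law_at_def using vm th by (intro prob_space_PiM) (auto simp: valid_moments_def)
 have dist: "distributed (sample_law_at n X th) (cleb {..<p}) (theta_hat X) (%t. enn (est_dens X t th))"
 using ve th by (simp add: valid_estimator_def)
 have Zd: "distributed (sample_law_at n X th) (cleb {..<p})
 (%D. zero_pad (s \<cdot>\<^sub>v (F *. (vec p (theta_hat X D) - vec p th)))) (%z. enn (Z_dens X z th))"
 using Z_dist[OF th] by (simp add: Z_stat_def[abs_def] F_def)
 define z where "z t = zero_pad (s \<cdot>\<^sub>v (F *. (vec p t - vec p th)))" for t
 have "AE t in cleb {..<p}. gauss_int p (transpose_mat F * F) * enn (est_dens X t th) =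
 gauss_int p (1\<^sub>m p) * (enn (s ^ p) * enn (Z_dens X (z t) th))"
 unfolding z_def
 by (rule prob_space.studentised_density[OF psp F Fi s(1) _ _ dist Zd])
 (use th Theta_euclid theta_hat_euclid space_sample_law_at[OF th] in auto)
 then show ?thesis
 proof eventually_elim
 case (elim t)
 have e0: "0 <= est_dens X t th" using ve th by (simp add: valid_estimator_def)
 have z0: "0 <= Z_dens X (z t) th" by (rule Z_nonneg[OF th])
 have "enn (jint th * est_dens X t th) = enn (jI * (s ^ p * Z_dens X (z t) th))"
 using elim jint_pos[of th] jI_pos s e0 z0 by (simp add: FF gauss_int_Am gauss_int_one ennreal_mult)
 then have eq: "jint th * est_dens X t th = jI * (s ^ p * Z_dens X (z t) th)"
 using jint_pos[of th] jI_pos s e0 z0 by (subst (asm) ennreal_inj) auto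
 have "est_dens X t th = jI * (s ^ p * Z_dens X (z t) th) / jint th"
 using eq jint_pos[of th] by (simp add: field_simps)
 then have Pt: "Pt t th = rho th / kap * Z_dens X (z t) th"
 using th jI_pos s by (simp add: Pt_def rho_def)
 have zE: "z t : euclid p" using F by (auto simp: z_def zero_pad_def euclid_def)
 have vz: "vec p (z t) = s \<cdot>\<^sub>v (F *. (vec p t - vec p th))" using F by (auto simp: z_def zero_pad_def)
 have nz: "(nrm p (z t))\<^sup>2 = zeta t th"
 proof -
 let ?v = "vec p t - vec p th"
 have v: "?v : cvec p" "F *. ?v : cvec p" using F by auto
 have "(nrm p (z t))\<^sup>2 = s\<^sup>2 * ((F *. ?v) .* (F *. ?v))"
 unfolding nrm_def vz vnorm_smult power_mult_distrib vnorm_sq by simp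
 also have "(F *. ?v) .* (F *. ?v) = ?v .* (transpose_mat F *. (F *. ?v))"
 using transpose_vec_mult_scalar[OF F v] F v
 comm_scalar_prod[of ?v p "transpose_mat F *. (F *. ?v)"] by auto
 also have "transpose_mat F *. (F *. ?v) = Am th *. ?v"
 unfolding FF[symmetric] using F v by (intro assoc_mult_mat_vec[symmetric, of _ p p _ p]) auto
 finally show ?thesis using th n_pos by (simp add: zeta_def)
 qed
 then have nz': "nrm p (z t) = sqrt (zeta t th)" by (metis nrm_nonneg real_sqrt_unique)
 have "(1 + nrm p (z t) ^ (p + 1)) * \<bar>Z_dens X (z t) th - kap * exp (- zeta t th / 2)\<bar> <= \<tau>"
 using Z_normal[OF th zE] unfolding normal_dens_eq nz .
 then have "\<bar>Z_dens X (z t) th - kap * exp (- zeta t th / 2)\<bar> <= \<tau> / (1 + sqrt (zeta t th) ^ (p + 1))"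
 unfolding nz' by (simp add: pos_le_divide_eq add_pos_nonneg zeta_nonneg mult.commute)
 then have "rho th / kap * \<bar>Z_dens X (z t) th - kap * exp (- zeta t th / 2)\<bar> <= rho th / kap * (\<tau> / (1 + sqrt (zeta t th) ^ (p + 1)))"
 using rho_bounds(1)[of th] kap_pos by (intro mult_left_mono) auto
 moreover have "rho th / kap * \<bar>Z_dens X (z t) th - kap * exp (- zeta t th / 2)\<bar> = \<bar>Pt t th - rho th * exp (- zeta t th / 2)\<bar>"
 proof -
 have "Pt t th - rho th * exp (- zeta t th / 2) = rho th / kap * (Z_dens X (z t) th - kap * exp (- zeta t th / 2))"
 unfolding Pt using kap_pos by (simp add: right_diff_distrib)
 then show ?thesis using rho_bounds(1)[of th] kap_pos by (simp add: abs_mult)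
 qed
 ultimately show ?case by (simp add: Pbound_def)
 qed
qed

subsection \<open>Measurability in the parameter\<close>

text \<open>Joint measurability in the estimate and the parameter is needed below, and it reduces to
 continuity of the inverse covariance.\<close>

lemma continuous_minv_V:
 assumes ab: "a < m" "b < m"
 shows "continuous_on \<Theta> (%th. minv (var_mom X th) $$ (a,b))"
 unfolding continuous_on_def
proof
 fix th0 assume th0: "th0 : \<Theta>"
 let ?V = "var_mom X" and ?F = "at th0 within \<Theta>"
 let ?d = "%th. \<Sum>i<m. \<Sum>j<m. \<bar>?V th $$ (i,j) - ?V th0 $$ (i,j)\<bar>"
 have Vc: "?V th : cmat m m" for th by (simp add: var_mom_def)
 have "(?d \<longlongrightarrow> (\<Sum>i<m. \<Sum>j<m. \<bar>?V th0 $$ (i,j) - ?V th0 $$ (i,j)\<bar>)) ?F"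
 using cont_V th0 by (intro tendsto_sum tendsto_rabs tendsto_diff tendsto_const) (auto simp: continuous_on_def)
 then have "(?d \<longlongrightarrow> 0) ?F" by simp
 then have lim: "((%th. real m * real m * ?d th / l\<^sup>2) \<longlongrightarrow> 0) ?F"
 using tendsto_mult_right_zero[of ?d ?F "real m * real m / l\<^sup>2"] by (simp add: mult_ac)
 have bd: "norm (minv (?V th) $$ (a,b) - minv (?V th0) $$ (a,b)) <= real m * real m * ?d th / l\<^sup>2" if th: "th : \<Theta>" for th
 proof -
 have d0: "0 <= ?d th" by (intro sum_nonneg) auto
 have e: "\<bar>(?V th - ?V th0) $$ (i,j)\<bar> <= ?d th" if ij: "i < m" "j < m" for i j
 proof -
 have "\<bar>?V th $$ (i,j) - ?V th0 $$ (i,j)\<bar> <= (\<Sum>j<m. \<bar>?V th $$ (i,j) - ?V th0 $$ (i,j)\<bar>)"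
 using ij by (intro member_le_sum) auto
 also have "... <= ?d th" using ij
 by (intro member_le_sum[where f="%i. \<Sum>j<m. \<bar>?V th $$ (i,j) - ?V th0 $$ (i,j)\<bar>"]) (auto intro: sum_nonneg)
 finally show ?thesis using ij Vc[of th] Vc[of th0] by simp
 qed
 have "\<bar>unit_vec m a .* (minv (?V th) *. unit_vec m b) - unit_vec m a .* (minv (?V th0) *. unit_vec m b)\<bar> <=
 (real m * real m * ?d th) / l\<^sup>2 * (vnorm (unit_vec m a) * vnorm (unit_vec m b))"
 proof (rule coercive_minv_diff[OF coercive_V[OF th] coercive_V[OF th0]])
 show "vnorm ((?V th - ?V th0) *. v) <= real m * real m * ?d th * vnorm v" if "v : cvec m" for v
 by (rule vnorm_mult_mat_vec_le_entries[OF minus_carrier_mat[OF Vc[of th0]] e that])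
 qed (use d0 in auto)
 then show ?thesis
 using entry_eq_unit_form[OF coercive_minv(1)[OF coercive_V[OF th]] ab]
 entry_eq_unit_form[OF coercive_minv(1)[OF coercive_V[OF th0]] ab] ab by (simp add: vnorm_unit_vec)
 qed
 have "((%th. minv (?V th) $$ (a,b) - minv (?V th0) $$ (a,b)) \<longlongrightarrow> 0) ?F"
 by (rule Lim_null_comparison[OF _ lim]) (unfold eventually_at_filter, rule always_eventually, use bd in blast)
 then show "((%th. minv (?V th) $$ (a,b)) \<longlongrightarrow> minv (?V th0) $$ (a,b)) ?F" by (rule LIM_zero_cancel)
qed

lemma Am_entry:
 assumes ij: "i < p" "j < p"
 shows "Am th $$ (i,j) = (\<Sum>a<m. \<Sum>b<m. minv (var_mom X (clamp th)) $$ (a,b) * Jac X (clamp th) $$ (a,i) * Jac X (clamp th) $$ (b,j))"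
proof -
 let ?J = "Jac X (clamp th)" and ?V = "var_mom X (clamp th)"
 have J: "?J : cmat m p" by (rule Jac_carrier) simp
 note sc = sandwich_form[OF J coercive_gram[OF clamp_in] coercive_V[OF clamp_in] u_pos]
 have col: "?J *. unit_vec p k = vec m (%a. ?J $$ (a,k))" if "k < p" for k
 using J that by (intro eq_vecI) auto
 have "Am th $$ (i,j) = unit_vec p i .* (Am th *. unit_vec p j)" by (rule entry_eq_unit_form[OF Am_carrier ij])
 also have "... = (?J *. unit_vec p i) .* (minv ?V *. (?J *. unit_vec p j))"
 unfolding Am_def by (rule sc) auto
 also have "... = (\<Sum>a<m. \<Sum>b<m. minv ?V $$ (a,b) * ?J $$ (a,i) * ?J $$ (b,j))"
 unfolding col[OF ij(1)] col[OF ij(2)]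
 by (rule quadratic_form_sum[OF coercive_minv(1)[OF coercive_V[OF clamp_in]]])
 finally show ?thesis .
qed

lemma measurable_Am_entry: "i < p ==> j < p ==> (%th. Am th $$ (i,j)) : bmb"
proof -
 assume ij: "i < p" "j < p"
 have "(%th. minv (var_mom X (clamp th)) $$ (a,b)) : bmb" if "a < m" "b < m" for a b
 using continuous_clamp_measurable[OF continuous_minv_V[OF that]] .
 moreover have "(%th. Jac X (clamp th) $$ (a,k)) : bmb" if "a < m" "k < p" for a k
 using continuous_clamp_measurable[OF cont_J[OF that]] .
 ultimately show ?thesis unfolding Am_entry[OF ij] using ij
 by (intro borel_measurable_sum borel_measurable_times) auto
qed

lemma measurable_clamp_comp: "(%th. clamp th j) : bmb"
 by (rule continuous_clamp_measurable[OF continuous_on_subset[OF continuous_on_product_coordinates]]) simp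

lemma measurable_zeta: "(%(t,th). zeta t th) : borel_measurable (borel \<Otimes>\<^sub>M borel)"
proof -
 have "zeta t th = real n * (\<Sum>i<p. \<Sum>j<p. Am th $$ (i,j) * (t i - clamp th i) * (t j - clamp th j))" for t th
 unfolding zeta_def by (subst quadratic_form_entries[OF Am_carrier]) auto
 moreover have "(%x. real n * (\<Sum>i<p. \<Sum>j<p. Am (snd x) $$ (i,j) * (fst x i - clamp (snd x) i) * (fst x j - clamp (snd x) j)))
 : borel_measurable ((borel :: (nat => real) measure) \<Otimes>\<^sub>M borel)"
 by (intro borel_measurable_times borel_measurable_const borel_measurable_sum borel_measurable_diff
 mcomp[OF measurable_snd measurable_Am_entry] mcomp[OF measurable_snd measurable_clamp_comp]
 mcomp[OF measurable_fst measurable_product_coordinates]) auto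
 ultimately show ?thesis by (simp add: split_beta')
qed

lemma measurable_jint: "jint : bmb"
proof -
 interpret L: sigma_finite_measure "cleb {..<p}" by (rule sigma_finite_coord_lebesgue) simp
 have "(%x. enn (exp (- (\<Sum>i<p. \<Sum>j<p. Am (fst x) $$ (i,j) * snd x i * snd x j) / 2)))
 : borel_measurable ((borel :: (nat => real) measure) \<Otimes>\<^sub>M borel)"
 by (intro mcomp[OF _ measurable_ennreal] mcomp[OF _ borel_measurable_exp]
 borel_measurable_divide borel_measurable_uminus borel_measurable_times borel_measurable_const borel_measurable_sum
 mcomp[OF measurable_fst measurable_Am_entry]
 mcomp[OF measurable_snd measurable_product_coordinates]) auto
 then have "(%(th,x). enn (exp (- (vec p x .* (Am th *. vec p x)) / 2)))
 : borel_measurable ((borel :: (nat => real) measure) \<Otimes>\<^sub>M cleb {..<p})"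
 unfolding quadratic_form_sum[OF Am_carrier] split_beta'
 by (subst measurable_cong_sets[OF sets_pair_measure_cong[OF refl sets_coord_lebesgue] refl])
 from L.borel_measurable_nn_integral[OF this]
 have g: "(%th. gauss_int p (Am th)) : bmb" unfolding gauss_int_def .
 show ?thesis unfolding jint_def[abs_def] by (rule borel_measurable_enn2real[OF g])
qed

lemma measurable_rho: "rho : bmb"
 unfolding rho_def[abs_def] by (intro borel_measurable_divide borel_measurable_const measurable_jint)

lemma measurable_Pt: "(%(t,th). Pt t th) : borel_measurable (borel \<Otimes>\<^sub>M borel)"
proof -
 have "(%(t, th). est_dens X t th) : borel_measurable (borel \<Otimes>\<^sub>M restrict_space borel \<Theta>)"
 using ve by (simp add: valid_estimator_def)
 moreover have "(%x. (fst x, clamp (snd x))) : (borel :: (nat => real) measure) \<Otimes>\<^sub>M borel \<rightarrow>\<^sub>M borel \<Otimes>\<^sub>M restrict_space borel \<Theta>"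
 by (intro measurable_Pair measurable_fst mcomp[OF measurable_snd measurable_clamp])
 ultimately have "(%x. est_dens X (fst x) (clamp (snd x))) : borel_measurable ((borel :: (nat => real) measure) \<Otimes>\<^sub>M borel)"
 using measurable_compose by force
 then show ?thesis unfolding Pt_def split_beta' by (intro borel_measurable_times borel_measurable_const)
qed

lemma measurable_Pbound: "Measurable.pred (borel \<Otimes>\<^sub>M borel) (%x. Pbound (fst x) (snd x))"
proof -
 note z = measurable_zeta[unfolded split_beta'] and P = measurable_Pt[unfolded split_beta']
 and r = mcomp[OF measurable_snd measurable_rho]
 show ?thesis unfolding Pbound_def pred_def
 by (intro borel_measurable_le borel_measurable_abs borel_measurable_diff borel_measurable_times borel_measurable_divide
 borel_measurable_add borel_measurable_const borel_measurable_power mcomp[OF _ borel_measurable_exp]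
 borel_measurable_uminus mcomp[OF z borel_measurable_sqrt] z P r)
qed

text \<open>The null sets of Pbound_AE depend on the parameter. Fubini on the product of Lebesgue measure and
 the prior exchanges the quantifiers, and the estimator has a density.\<close>

lemma Pbound_sample_AE: "AE D in OM. ALL M:models X. AE th in plaw M. Pbound (theta_hat X D) th"
proof -
 have dist: "distributed OM (cleb {..<p}) (theta_hat X) (%t. enn (est_dens X t t0))"
 using ve t0_in by (simp add: valid_estimator_def sample_law_def)
 have "AE D in OM. AE th in plaw M. Pbound (theta_hat X D) th" if M: "M : models X" for M
 proof -
 interpret A: sigma_finite_measure "cleb {..<p}" by (rule sigma_finite_coord_lebesgue) simp
 interpret B: sigma_finite_measure "plaw M" by (rule sigma_finite_plaw[OF M])
 interpret pair_sigma_finite "cleb {..<p}" "plaw M" by standard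
 have m1: "{x : space (cleb {..<p} \<Otimes>\<^sub>M plaw M). Pbound (fst x) (snd x)} : sets (cleb {..<p} \<Otimes>\<^sub>M plaw M)"
 using measurable_Pbound unfolding pred_def
 by (simp add: space_pair_measure sets_pair_measure_cong[OF sets_coord_lebesgue sets_plaw])
 have "AE th in plaw M. AE t in cleb {..<p}. Pbound t th"
 using AE_plaw[OF M] by eventually_elim (use Theta_of_subset Pbound_AE in blast)
 then have ae: "AE t in cleb {..<p}. AE th in plaw M. Pbound t th"
 using AE_commute[OF m1] by blast
 have dm: "(%t. enn (est_dens X t t0)) : borel_measurable (cleb {..<p})"
 using dist by (simp add: distributed_def)
 have "AE t in density (cleb {..<p}) (%t. enn (est_dens X t t0)). AE th in plaw M. Pbound t th"
 by (subst AE_density[OF dm]) (use ae in eventually_elim, simp)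
 then have "AE t in distr OM (cleb {..<p}) (theta_hat X). AE th in plaw M. Pbound t th"
 by (simp only: distributed_distr_eq_density[OF dist])
 then show ?thesis using distributed_measurable[OF dist] by (rule AE_distrD[rotated])
 qed
 then show ?thesis by (subst AE_ball_countable) (auto simp: countable_finite models_def)
qed

end

lemma expectation_product_le:
 fixes X Y :: "'b => real"
 assumes X: "X : borel_measurable M" "integrable M (%x. (X x)\<^sup>2)" "(LINT x|M. (X x)\<^sup>2) <= a"
 and Y: "Y : borel_measurable M" "integrable M (%x. (Y x)\<^sup>2)" "(LINT x|M. (Y x)\<^sup>2) <= \<sigma>\<^sup>2" and \<sigma>: "0 < \<sigma>"
 shows "integrable M (%x. X x * Y x)" "\<bar>LINT x|M. X x * Y x\<bar> <= \<sigma> * (1 + a) / 2"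
proof -
 let ?B = "%x. (\<sigma> * (X x)\<^sup>2 + (Y x)\<^sup>2 / \<sigma>) / 2"
 have pt: "\<bar>x * y\<bar> <= (\<sigma> * x\<^sup>2 + y\<^sup>2 / \<sigma>) / 2" for x y :: real
 proof -
 have "0 <= (\<sigma> * \<bar>x\<bar> - \<bar>y\<bar>)\<^sup>2" by simp
 then have "2 * (\<sigma> * (\<bar>x\<bar> * \<bar>y\<bar>)) <= \<sigma>\<^sup>2 * x\<^sup>2 + y\<^sup>2" by (simp add: power2_diff power_mult_distrib algebra_simps)
 then show ?thesis using \<sigma> by (simp add: abs_mult field_simps power2_eq_square)
 qed
 have iB: "integrable M ?B" using X Y by simp
 show i: "integrable M (%x. X x * Y x)"
 by (rule Bochner_Integration.integrable_bound[OF iB]) (use X(1) Y(1) pt in \<open>auto intro: order_trans[OF _ abs_ge_self]\<close>)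
 have "\<bar>LINT x|M. X x * Y x\<bar> <= (LINT x|M. \<bar>X x * Y x\<bar>)" by (rule integral_abs_bound)
 also have "... <= (LINT x|M. ?B x)" using i iB pt by (intro integral_mono) auto
 also have "... = (\<sigma> * (LINT x|M. (X x)\<^sup>2) + (LINT x|M. (Y x)\<^sup>2) / \<sigma>) / 2" using X Y by simp
 also have "... <= (\<sigma> * a + \<sigma>\<^sup>2 / \<sigma>) / 2"
 using X(3) Y(3) \<sigma> by (intro divide_right_mono add_mono mult_left_mono) auto
 also have "... = \<sigma> * (1 + a) / 2" using \<sigma> by (simp add: power2_eq_square algebra_simps)
 finally show "\<bar>LINT x|M. X x * Y x\<bar> <= \<sigma> * (1 + a) / 2" .
qed

lemma quadratic_form_diff_le:
 assumes A: "coercive p l u A" and a: "a : cvec p" and b: "b : cvec p"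
 shows "\<bar>a .* (A *. a) - b .* (A *. b)\<bar> <= u * vnorm (a - b) * (vnorm a + vnorm b)"
proof -
 have Ac: "A : cmat p p" using A by (simp add: coercive_def)
 have c: "A *. a : cvec p" "A *. b : cvec p" "a - b : cvec p" "A *. (a - b) : cvec p"
 using Ac a b by auto
 have "(a - b) .* (A *. a) + b .* (A *. (a - b)) = a .* (A *. a) - b .* (A *. b)"
 using c a b by (simp add: mult_minus_distrib_mat_vec[OF Ac a b] minus_scalar_prod_distrib[of _ p] scalar_prod_minus_distrib[of _ p])
 then have "\<bar>a .* (A *. a) - b .* (A *. b)\<bar> <= \<bar>(a - b) .* (A *. a)\<bar> + \<bar>b .* (A *. (a - b))\<bar>" by linarith
 also have "... <= vnorm (a - b) * vnorm (A *. a) + vnorm b * vnorm (A *. (a - b))"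
 using c a b by (intro add_mono abs_scalar_prod_le[of _ p])
 also have "... <= vnorm (a - b) * (u * vnorm a) + vnorm b * (u * vnorm (a - b))"
 using a c by (intro add_mono mult_left_mono coercive_norm_le[OF A]) auto
 finally show ?thesis by (simp add: algebra_simps)
qed

context rg begin

subsection \<open>Continuity of the information matrix at rate one over root n\<close>

definition sg :: "real => real" where "sg C = K4 * (C / s) powr \<alpha> + 1 / s"
definition dV :: "real => real" where "dV C = sg C * (1 + u) + sg C * (1 + (sg C)\<^sup>2) / 2"
definition dA :: "real => real => real" where
 "dA C KT = real N0 * real N0 * dV C * u / l\<^sup>2 + real N0 * real N0 * KT * (C / s) * 2 * sqrt u / l"

lemma sg_pos: "0 < sg C" using K4 s by (simp add: sg_def add_nonneg_pos)
lemma dV_nonneg: "0 <= dV C" using sg_pos[of C] u_pos by (simp add: dV_def)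
lemma dA_nonneg: "0 <= C ==> 0 <= KT ==> 0 <= dA C KT"
 using dV_nonneg[of C] lu u_pos by (simp add: dA_def)

lemma edist_local: "hn th <= C ==> edist p th t0 <= C / s"
 using s(1) by (simp add: nrm_hsc pos_le_divide_eq mult.commute)

text \<open>Expands the covariance at th around the one at theta0; every difference term contains a factor
 whose second moment the Hoelder condition makes small.\<close>

lemma cov_close:
 assumes th: "th : \<Theta>" and h: "hn th <= C" and ij: "i < m" "j < m"
 shows "\<bar>var_mom X th $$ (i,j) - V0 X $$ (i,j)\<bar> <= dV C"
proof -
 interpret prob_space P by (rule prob_P)
 define \<sigma> where "\<sigma> = sg C"
 have \<sigma>: "0 < \<sigma>" using sg_pos by (simp add: \<sigma>_def)
 define g where "g i d = momc i d t0" for i d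
 define F where "F i d = fm i th d - mean_mom X th $ i" for i d
 have mz: "mean_mom X t0 $ i = 0" if "i < m" for i using mean0 that by simp
 have g: "g i : borel_measurable P" "integrable P (%d. (g i d)\<^sup>2)" "(LINT d|P. (g i d)\<^sup>2) <= u" if i: "i < m" for i
 proof -
 have e: "g i = (%d. mom X d t0 $ i)" by (rule ext) (simp add: g_def momc_def t0_in)
 show "g i : borel_measurable P" "integrable P (%d. (g i d)\<^sup>2)" unfolding e using mom_square_integrable[OF i t0_in] by auto
 have "(LINT d|P. (g i d)\<^sup>2) = V0 X $$ (i,i)" using i mz[OF i] by (simp add: e var_mom_def power2_eq_square)
 also have "... <= u" using coercive_entry_le[OF coercive_V[OF t0_in] i i] by simp
 finally show "(LINT d|P. (g i d)\<^sup>2) <= u" .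
 qed
 have F: "F i : borel_measurable P" "integrable P (%d. (F i d)\<^sup>2)" "(LINT d|P. (F i d)\<^sup>2) <= \<sigma>\<^sup>2" if i: "i < m" for i
 proof -
 note f2 = fm_sq_integrable[OF i, of th] and fme = measurable_fm1[OF i, of th]
 have f1: "integrable P (fm i th)" by (rule square_integrable_imp_integrable[OF fme f2])
 show "F i : borel_measurable P" unfolding F_def using fme by measurable
 have sq: "(%d. (F i d)\<^sup>2) = (%d. (fm i th d)\<^sup>2 - 2 * mean_mom X th $ i * fm i th d + (mean_mom X th $ i)\<^sup>2)"
 by (auto simp: F_def power2_diff)
 show "integrable P (%d. (F i d)\<^sup>2)" unfolding sq using f1 f2 by simp
 have "(LINT d|P. (F i d)\<^sup>2) = (LINT d|P. (fm i th d)\<^sup>2) - (mean_mom X th $ i)\<^sup>2"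
 unfolding sq using f1 f2 mean_fm[OF i, of th] th by (simp add: prob_space power2_eq_square)
 also have "... <= (K4 * edist p (clamp th) t0 powr \<alpha>)\<^sup>2" using fm_sq_le(1)[OF i, of th] by (smt (verit) zero_le_power2)
 also have "... <= \<sigma>\<^sup>2"
 proof (rule power_mono)
 have "edist p th t0 powr \<alpha> <= (C / s) powr \<alpha>"
 using \<alpha> edist_local[OF h] by (intro powr_mono2) (auto simp: edist_def)
 then have "K4 * edist p (clamp th) t0 powr \<alpha> <= K4 * (C / s) powr \<alpha>" using K4 th by (simp add: mult_left_mono)
 also have "... <= \<sigma>" using s by (simp add: \<sigma>_def sg_def)
 finally show "K4 * edist p (clamp th) t0 powr \<alpha> <= \<sigma>" .
 qed (use K4 in auto)
 finally show "(LINT d|P. (F i d)\<^sup>2) <= \<sigma>\<^sup>2" .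
 qed
 have mom: "mom X d th $ i - mean_mom X th $ i = g i d + F i d" if "i < m" for i d
 using th by (simp add: g_def F_def fm_def momc_def)
 have gF1: "integrable P (%d. g i d * F j d)" "\<bar>LINT d|P. g i d * F j d\<bar> <= \<sigma> * (1 + u) / 2" if "i < m" "j < m" for i j
 using expectation_product_le[OF g[OF that(1)] F[OF that(2)] \<sigma>] by auto
 have FF: "integrable P (%d. F i d * F j d)" "\<bar>LINT d|P. F i d * F j d\<bar> <= \<sigma> * (1 + \<sigma>\<^sup>2) / 2"
 using expectation_product_le[OF F[OF ij(1)] F[OF ij(2)] \<sigma>] by auto
 have gg: "integrable P (%d. g i d * g j d)"
 proof -
 have "(sqrt u)\<^sup>2 = u" using u_pos by simp
 then show ?thesis using expectation_product_le(1)[OF g[OF ij(1)] g(1,2)[OF ij(2)], of "sqrt u"] g(3)[OF ij(2)] u_pos by simp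
 qed
 have "var_mom X th $$ (i,j) = (LINT d|P. (g i d + F i d) * (g j d + F j d))"
 using ij by (simp add: var_mom_def mom)
 also have "... = (LINT d|P. g i d * g j d + g i d * F j d + g j d * F i d + F i d * F j d)"
 by (intro Bochner_Integration.integral_cong) (auto simp: algebra_simps)
 also have "... = (LINT d|P. g i d * g j d) + (LINT d|P. g i d * F j d) + (LINT d|P. g j d * F i d) + (LINT d|P. F i d * F j d)"
 using gg gF1(1)[OF ij] gF1(1)[OF ij(2,1)] FF(1) by simp
 also have "(LINT d|P. g i d * g j d) = V0 X $$ (i,j)"
 using ij mz by (simp add: g_def momc_def t0_in var_mom_def)
 finally have "\<bar>var_mom X th $$ (i,j) - V0 X $$ (i,j)\<bar> <= \<sigma> * (1 + u) / 2 + \<sigma> * (1 + u) / 2 + \<sigma> * (1 + \<sigma>\<^sup>2) / 2"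
 using gF1(2)[OF ij] gF1(2)[OF ij(2,1)] FF(2) by linarith
 then show ?thesis by (simp add: dV_def \<sigma>_def mult.commute)
qed

lemma Am_close:
 assumes ta: "taylor \<rho> KT" and th: "th : \<Theta>" and h: "hn th <= C" and C: "0 <= C" "C < \<rho> * s"
 and x: "x : cvec p"
 shows "\<bar>x .* (Am th *. x) - x .* (Am t0 *. x)\<bar> <= dA C KT * (x .* x)"
proof -
 have KT: "0 <= KT" using ta by (simp add: taylor_def)
 let ?J = "Jac X th" and ?G = "G0 X" and ?V = "var_mom X th"
 have J: "?J : cmat m p" by (rule Jac_carrier[OF th])
 note G = G0_carrier
 define y where "y = ?J *. x"
 define y0 where "y0 = ?G *. x"
 have yc: "y : cvec m" "y0 : cvec m" using J G x by (auto simp: y_def y0_def)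
 have e: "edist p th t0 <= C / s" by (rule edist_local[OF h])
 have e2: "edist p th t0 < \<rho>" using e C(2) s(1) by (simp add: pos_divide_less_eq order_le_less_trans)
 have V: "vnorm ((?V - V0 X) *. v) <= real N0 * real N0 * dV C * vnorm v" if v: "v : cvec m" for v
 proof -
 have "vnorm ((?V - V0 X) *. v) <= real m * real m * dV C * vnorm v"
 proof (rule vnorm_mult_mat_vec_le_entries[OF _ _ v])
 show "?V - V0 X : cmat m m" by (auto simp: var_mom_def)
 show "\<bar>(?V - V0 X) $$ (i,j)\<bar> <= dV C" if "i < m" "j < m" for i j
 proof -
 have "(?V - V0 X) $$ (i,j) = ?V $$ (i,j) - V0 X $$ (i,j)"
 by (rule index_minus_mat(1)) (use that in \<open>auto simp: var_mom_def\<close>)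
 then show ?thesis using cov_close[OF th h that] by simp
 qed
 qed
 also have "... <= real N0 * real N0 * dV C * vnorm v"
 using dims dV_nonneg[of C] by (intro mult_right_mono mult_mono) auto
 finally show ?thesis .
 qed
 have ny: "vnorm y <= sqrt u * vnorm x" "vnorm y0 <= sqrt u * vnorm x"
 proof -
 have "(vnorm y)\<^sup>2 <= (sqrt u * vnorm x)\<^sup>2" "(vnorm y0)\<^sup>2 <= (sqrt u * vnorm x)\<^sup>2"
 using gram_norm_le(1)[OF J coercive_gram[OF th] x] gram_norm_le(1)[OF G coercive_gram[OF t0_in] x] u_pos
 by (auto simp: y_def y0_def power_mult_distrib)
 then show "vnorm y <= sqrt u * vnorm x" "vnorm y0 <= sqrt u * vnorm x"
 using u_pos by (auto intro!: power2_le_imp_le)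
 qed
 have "y - y0 = (?J - ?G) *. x" using J G x by (auto simp: y_def y0_def minus_mult_distrib_mat_vec)
 moreover have "vnorm ((?J - ?G) *. x) <= real m * real p * (KT * (C / s)) * vnorm x"
 proof (rule vnorm_mult_mat_vec_le_entries[OF _ _ x])
 show "?J - ?G : cmat m p" using G by (rule minus_carrier_mat)
 fix i j assume ij: "i < m" "j < p"
 have "\<bar>?J $$ (i,j) - ?G $$ (i,j)\<bar> <= KT * edist p th t0" using ta th e2 ij by (simp add: taylor_def)
 also have "... <= KT * (C / s)" using e KT by (rule mult_left_mono)
 finally show "\<bar>(?J - ?G) $$ (i,j)\<bar> <= KT * (C / s)" using ij J G by simp
 qed
 moreover have "real m * real p * (KT * (C / s)) * vnorm x <= real N0 * real N0 * (KT * (C / s)) * vnorm x"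
 using dims p_le C KT s by (intro mult_right_mono mult_mono) auto
 ultimately have nd: "vnorm (y - y0) <= real N0 * real N0 * (KT * (C / s)) * vnorm x" by simp
 have F: "x .* (Am th *. x) = y .* (minv ?V *. y)" "x .* (Am t0 *. x) = y0 .* (minv (V0 X) *. y0)"
 using sandwich_form[OF J coercive_gram[OF th] coercive_V[OF th] u_pos x x]
 sandwich_form[OF G coercive_gram[OF t0_in] coercive_V[OF t0_in] u_pos x x] th t0_in
 by (simp_all add: Am_def y_def y0_def)
 have "\<bar>y .* (minv ?V *. y) - y0 .* (minv (V0 X) *. y0)\<bar> <=
 real N0 * real N0 * dV C / l\<^sup>2 * (vnorm y)\<^sup>2 + vnorm (y - y0) * (vnorm y + vnorm y0) / l"
 by (rule form_diff_le[OF coercive_V0 coercive_V[OF th] _ V yc]) (use dV_nonneg[of C] in simp)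
 also have "... <= real N0 * real N0 * dV C / l\<^sup>2 * (sqrt u * vnorm x)\<^sup>2 +
 (real N0 * real N0 * (KT * (C / s)) * vnorm x) * (sqrt u * vnorm x + sqrt u * vnorm x) / l"
 using ny nd dV_nonneg[of C] lu C KT s
 by (intro add_mono mult_left_mono divide_right_mono mult_mono power_mono) auto
 also have "... = dA C KT * (vnorm x)\<^sup>2"
 using u_pos by (simp add: dA_def power_mult_distrib power2_eq_square algebra_simps add_divide_distrib)
 finally show ?thesis unfolding F vnorm_sq .
qed

text \<open>The Jacobian varies continuously because nearby coercive forms have nearby Gaussian integrals.\<close>

lemma rho_close:
 assumes ta: "taylor \<rho> KT" and th: "th : \<Theta>" and h: "hn th <= C" and C: "0 <= C" "C < \<rho> * s"
 and small: "dA C KT <= lA"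
 shows "\<bar>rho th - 1\<bar> <= real N0 * 2 ^ N0 * (dA C KT / lA)"
proof -
 define x where "x = dA C KT / lA"
 have "0 <= dA C KT" using C ta by (intro dA_nonneg) (auto simp: taylor_def)
 then have x: "0 <= x" "x <= 1" using small lA_pos by (auto simp: x_def)
 have close: "\<bar>v .* (Am th *. v) - v .* (Am t0 *. v)\<bar> <= dA C KT * (v .* v)" if "v : cvec p" for v
 by (rule Am_close[OF ta th h C that])
 have g: "gauss_int p B <= enn ((1 + x) ^ p) * gauss_int p A"
 if "A = Am th & B = Am t0 | A = Am t0 & B = Am th" for A B
 unfolding x_def
 proof (rule gauss_int_perturb)
 show "v .* (A *. v) <= v .* (B *. v) + dA C KT * (v .* v)" if "v : cvec p" for v
 using \<open>A = Am th & B = Am t0 | A = Am t0 & B = Am th\<close> close[OF that] by (auto simp: abs_le_iff)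
 qed (use that coercive_Am Am_carrier \<open>0 <= dA C KT\<close> in auto)
 define q where "q = (1 + x) ^ p"
 have q: "1 <= q" unfolding q_def using x by (intro one_le_power) auto
 have "enn (jint t0) <= enn (q * jint th)" "enn (jint th) <= enn (q * jint t0)"
 using g[of "Am th" "Am t0"] g[of "Am t0" "Am th"] q jint_pos by (auto simp: gauss_int_Am q_def ennreal_mult less_imp_le)
 then have "jint t0 <= q * jint th" "jint th <= q * jint t0"
 using q jint_pos[of th] jint_pos[of t0] by (auto simp: ennreal_le_iff)
 then have r: "rho th <= q" "1 / q <= rho th"
 using jint_pos[of th] q by (auto simp: rho_def field_simps)
 have "1 - (q - 1) <= 1 / q"
 proof -
 have "(2 - q) * q <= 1" using zero_le_power2[of "q - 1"] by (simp add: power2_eq_square algebra_simps)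
 then show ?thesis using q by (simp add: pos_le_divide_eq)
 qed
 then have "\<bar>rho th - 1\<bar> <= q - 1" using r by (intro abs_leI) linarith+
 also have "... <= real N0 * 2 ^ N0 * x" unfolding q_def by (rule power_ratio_le[OF x p_le])
 finally show ?thesis by (simp add: x_def)
qed

subsection \<open>The least squares form of the limit\<close>

definition hb :: "(nat => 'd) => real vec" where "hb D = lsq_point (G0 X) (V0 X) (W D)"

definition kp :: "(nat => 'd) => real" where
 "kp D = (W D + G0 X *. hb D) .* (minv (V0 X) *. (W D + G0 X *. hb D))"

definition psit :: "(nat => 'd) => (nat => real) => real" where
 "psit D th = exp (- ((vec p (hsc th) - hb D) .* (Am t0 *. (vec p (hsc th) - hb D))) / 2)"

definition CH :: real where "CH = u\<^sup>2 * sqrt u / l ^ 3"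

lemma CH_pos: "0 < CH" using lu u_pos by (simp add: CH_def)

lemma Am_t0: "Am t0 = sandwich (G0 X) (V0 X)" by (simp add: Am_def t0_in)

lemma hb_carrier: "hb D : cvec p"
 unfolding hb_def by (rule lsq_point_carrier[OF G0_carrier coercive_gram[OF t0_in] coercive_V0 u_pos W_carrier])

lemma hb_le: "vnorm (hb D) <= CH * vnorm (W D)"
 unfolding hb_def CH_def by (rule vnorm_lsq_point_le[OF G0_carrier coercive_gram[OF t0_in] coercive_V0 u_pos W_carrier])

text \<open>The minimal value of the quadratic form does not depend on the parameter, so it cancels from every
 posterior quantity.\<close>

lemma psi_factor: "psi D th = exp (- kp D / 2) * psit D th"
 using complete_square[OF G0_carrier coercive_gram[OF t0_in] coercive_V0 u_pos W_carrier, of "vec p (hsc th)" D]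
 by (simp add: psi_def psit_def kp_def hb_def Am_t0 exp_add[symmetric] add_divide_distrib)

lemma kp_nonneg: "0 <= kp D"
 unfolding kp_def by (rule residual_form_nonneg[OF G0_carrier coercive_gram[OF t0_in] coercive_V0 u_pos W_carrier hb_carrier])

lemma theta_bar_carrier: "theta_bar n X D : cvec p"
proof -
 have A: "minv (sandwich (G0 X) (V0 X)) : cmat p p"
 by (rule coercive_minv(1)[OF coercive_sandwich[OF G0_carrier coercive_gram[OF t0_in] coercive_V0 u_pos]])
 show ?thesis unfolding theta_bar_def sandwich_def[symmetric]
 by (rule minus_carrier_vec[OF vec_carrier carrier_vecI]) (use A in simp)
qed

text \<open>The linearised estimator is the least squares point of the limit.\<close>

lemma theta_bar_scaled: "s \<cdot>\<^sub>v (theta_bar n X D - vec p t0) = hb D"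
proof -
 have g: "gbar n X D t0 : cvec m" by (simp add: gbar_def)
 let ?V = "minv (V0 X)" and ?A = "minv (sandwich (G0 X) (V0 X))" and ?T = "transpose_mat (G0 X)"
 have V: "?V : cmat m m" by (rule coercive_minv(1)[OF coercive_V0])
 have A: "?A : cmat p p"
 by (rule coercive_minv(1)[OF coercive_sandwich[OF G0_carrier coercive_gram[OF t0_in] coercive_V0 u_pos]])
 have T: "?T : cmat p m" using G0_carrier by simp
 let ?x = "?A *. (?T *. (?V *. gbar n X D t0))"
 have x: "?x : cvec p" using A T V g by auto
 have tb: "theta_bar n X D = vec p t0 - ?x" by (simp add: theta_bar_def sandwich_def)
 have cancel: "a - y - a = - y" if "a : cvec p" "y : cvec p" for a y :: "real vec"
 using that by (intro eq_vecI) auto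
 have "theta_bar n X D - vec p t0 = - ?x" unfolding tb by (rule cancel[OF vec_carrier x])
 moreover have "s \<cdot>\<^sub>v (- y) = (-1) \<cdot>\<^sub>v (s \<cdot>\<^sub>v y)" for y by (intro eq_vecI) auto
 ultimately have "s \<cdot>\<^sub>v (theta_bar n X D - vec p t0) = (-1) \<cdot>\<^sub>v (s \<cdot>\<^sub>v ?x)" by simp
 also have "s \<cdot>\<^sub>v ?x = ?A *. (?T *. (?V *. W D))"
 using A T V g by (simp add: W_def mult_mat_vec[of _ m m] mult_mat_vec[of _ p m] mult_mat_vec[of _ p p])
 finally show ?thesis by (simp add: hb_def lsq_point_def[OF G0_carrier coercive_gram[OF t0_in] coercive_V0 u_pos])
qed

definition hh :: "(nat => 'd) => real vec" where "hh D = vec p (hsc (theta_hat X D))"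

definition est_close :: "real => (nat => 'd) => bool" where
 "est_close dl D \<longleftrightarrow> s * vnorm (vec p (theta_hat X D) - theta_bar n X D) <= dl"

lemma hh_carrier: "hh D : cvec p" by (simp add: hh_def)

lemma hh_close: "est_close dl D ==> vnorm (hh D - hb D) <= dl"
proof -
 assume e: "est_close dl D"
 note c = theta_bar_carrier[of D]
 have "hh D - hb D = s \<cdot>\<^sub>v (vec p (theta_hat X D) - theta_bar n X D)"
 unfolding hh_def vec_hsc theta_bar_scaled[symmetric] using c by (intro eq_vecI) (auto simp: algebra_simps)
 then show ?thesis using e s by (simp add: vnorm_smult est_close_def)
qed

lemma zeta_theta_hat:
 assumes "th : \<Theta>"
 shows "zeta (theta_hat X D) th = (hh D - vec p (hsc th)) .* (Am th *. (hh D - vec p (hsc th)))"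
proof -
 let ?v = "vec p (theta_hat X D) - vec p th"
 have "hh D - vec p (hsc th) = s \<cdot>\<^sub>v ?v" unfolding hh_def vec_hsc by (intro eq_vecI) (auto simp: algebra_simps)
 moreover have "(s \<cdot>\<^sub>v ?v) .* (Am th *. (s \<cdot>\<^sub>v ?v)) = (s * s) * (?v .* (Am th *. ?v))"
 using Am_carrier[of th] by (simp add: mult_mat_vec[of _ p p])
 ultimately show ?thesis using assms by (simp only: zeta_def s(3) clamp_id)
qed

lemma zeta_ge:
 assumes "th : \<Theta>" shows "lA * (vnorm (hh D - vec p (hsc th)))\<^sup>2 <= zeta (theta_hat X D) th"
 unfolding zeta_theta_hat[OF assms] vnorm_sq using coercive_Am[of th] hh_carrier[of D] by (auto simp: coercive_def)

lemma psit_le: "psit D th <= exp (- lA * (vnorm (vec p (hsc th) - hb D))\<^sup>2 / 2)"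
proof -
 have "lA * (vnorm (vec p (hsc th) - hb D))\<^sup>2 <= (vec p (hsc th) - hb D) .* (Am t0 *. (vec p (hsc th) - hb D))"
 unfolding vnorm_sq using coercive_Am[of t0] hb_carrier[of D] by (auto simp: coercive_def)
 then show ?thesis by (simp add: psit_def)
qed

lemma psit_pos: "0 < psit D th" by (simp add: psit_def)

lemma psit_le_1: "psit D th <= 1"
proof -
 have "- lA * (vnorm (vec p (hsc th) - hb D))\<^sup>2 / 2 <= 0" using lA_pos by simp
 then show ?thesis using psit_le[of D th] by (meson exp_le_one_iff order_trans)
qed

lemma Pt_nonneg: "0 <= Pt t th"
proof -
 have "0 <= est_dens X t (clamp th)" using ve clamp_in[of th] by (simp add: valid_estimator_def)
 then show ?thesis using jint_pos[of t0] jI_pos kap_pos s by (simp add: Pt_def)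
qed

lemma Pbound_le:
 assumes "Pbound t th"
 shows "\<bar>Pt t th - rho th * exp (- zeta t th / 2)\<bar> <= rhomax * (\<tau> / kap0) / (1 + sqrt (zeta t th) ^ (p + 1))"
proof -
 have "rho th * (\<tau> / kap) / (1 + sqrt (zeta t th) ^ (p + 1)) <= rhomax * (\<tau> / kap0) / (1 + sqrt (zeta t th) ^ (p + 1))"
 using rho_bounds[of th] \<tau>_nonneg kap_ge kap0_pos kap_pos
 by (intro divide_right_mono mult_mono divide_left_mono) (auto simp: zeta_nonneg intro!: divide_nonneg_nonneg add_nonneg_nonneg)
 then show ?thesis using assms by (simp add: Pbound_def)
qed

subsection \<open>Integrated closeness of the estimator likelihood to its limit\<close>

definition BB :: "real => real => real" where "BB T C = CH * T + 1 + C"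

definition eP :: "real => real => real => real => real" where
 "eP T C KT dl = real N0 * 2 ^ N0 * (dA C KT / lA) + dA C KT * (BB T C)\<^sup>2 + 2 * uA * dl * BB T C"

definition kk :: real where "kk = 1 + (1 + 2 / sqrt lA) ^ (N0 + 1)"

lemma kk_pos: "0 < kk" using lA_pos by (simp add: kk_def add_pos_nonneg)

lemma rhomax_pos: "0 < rhomax" using rho_bounds[of t0] by linarith

lemma hb_hh_bounds:
 assumes D: "D : space OM" and T: "tight D <= T\<^sup>2" "0 < T" and e: "est_close dl D" "dl <= 1"
 shows "vnorm (hb D) <= CH * T" "vnorm (hh D) <= CH * T + 1"
proof -
 have "CH * vnorm (W D) <= CH * T" using tight_bounds(1)[OF D T] CH_pos by (intro mult_left_mono) auto
 then show 1: "vnorm (hb D) <= CH * T" using hb_le[of D] by simp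
 have "vnorm (hh D) - vnorm (hb D) <= vnorm (hh D - hb D)" by (rule vnorm_diff_le[OF hh_carrier hb_carrier])
 then show "vnorm (hh D) <= CH * T + 1" using 1 hh_close[OF e(1)] e(2) by simp
qed

lemma Pt_local:
 assumes D: "D : space OM" and T: "tight D <= T\<^sup>2" "0 < T" and e: "est_close dl D" "0 <= dl" "dl <= 1"
 and ta: "taylor \<rho> KT" and th: "th : \<Theta>" and h: "hn th <= C" and C: "0 <= C" "C < \<rho> * s"
 and small: "dA C KT <= lA"
 shows "\<bar>rho th * exp (- zeta (theta_hat X D) th / 2) - psit D th\<bar> <= eP T C KT dl"
proof -
 define x where "x = vec p (hsc th)"
 define a where "a = hh D - x"
 define b where "b = x - hb D"
 define Q where "Q = b .* (Am t0 *. b)"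
 have xc: "x : cvec p" by (simp add: x_def)
 have ac: "a : cvec p" "b : cvec p" "-b : cvec p" using xc hh_carrier[of D] hb_carrier[of D] by (auto simp: a_def b_def)
 have dA0: "0 <= dA C KT" using C ta by (intro dA_nonneg) (auto simp: taylor_def)
 have nx: "vnorm x <= C" using h by (simp add: x_def nrm_def)
 note hbd = hb_hh_bounds[OF D T e(1,3)]
 have na: "vnorm a <= BB T C" using vnorm_diff_triangle[OF hh_carrier[of D] xc] hbd nx by (simp add: a_def BB_def)
 have nb: "vnorm b <= BB T C" using vnorm_diff_triangle[OF xc hb_carrier[of D]] hbd nx by (simp add: b_def BB_def)
 have B0: "0 <= BB T C" using na by (meson order_trans vnorm_nonneg)
 have neg: "Am t0 *. (- b) = - (Am t0 *. b)" using Am_carrier[of t0] ac by (intro eq_vecI) auto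
 have Q': "(-b) .* (Am t0 *. (-b)) = Q" unfolding neg Q_def using ac Am_carrier[of t0] by simp
 have nnb: "vnorm (- b) = vnorm b" using vnorm_smult[of "-1" b] ac by (simp add: uminus_eq_vec vnorm_def)
 have ab: "a - (- b) = hh D - hb D" using xc hh_carrier[of D] hb_carrier[of D] by (intro eq_vecI) (auto simp: a_def b_def)
 have 1: "\<bar>a .* (Am t0 *. a) - Q\<bar> <= uA * dl * (2 * BB T C)"
 proof -
 have "\<bar>a .* (Am t0 *. a) - (-b) .* (Am t0 *. (-b))\<bar> <= uA * vnorm (a - (- b)) * (vnorm a + vnorm (- b))"
 by (rule quadratic_form_diff_le[OF coercive_Am ac(1,3)])
 also have "... <= uA * dl * (2 * BB T C)"
 unfolding ab nnb using hh_close[OF e(1)] na nb uA_pos e by (intro mult_mono mult_left_mono) auto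
 finally show ?thesis by (simp only: Q')
 qed
 have 2: "\<bar>zeta (theta_hat X D) th - a .* (Am t0 *. a)\<bar> <= dA C KT * (BB T C)\<^sup>2"
 proof -
 have "\<bar>a .* (Am th *. a) - a .* (Am t0 *. a)\<bar> <= dA C KT * (vnorm a)\<^sup>2"
 unfolding vnorm_sq by (rule Am_close[OF ta th h C ac(1)])
 also have "... <= dA C KT * (BB T C)\<^sup>2" using na dA0 by (intro mult_left_mono power_mono) auto
 finally show ?thesis using zeta_theta_hat[OF th, of D] by (simp add: a_def x_def)
 qed
 have Q0: "0 <= Q"
 proof -
 have "0 <= lA * (b .* b)" using lA_pos by simp
 also have "... <= Q" unfolding Q_def using coercive_Am[of t0] ac by (auto simp: coercive_def)
 finally show ?thesis .
 qed
 have 3: "\<bar>exp (- zeta (theta_hat X D) th / 2) - psit D th\<bar> <= uA * dl * (2 * BB T C) + dA C KT * (BB T C)\<^sup>2"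
 using exp_half_diff_le[OF zeta_nonneg[of "theta_hat X D" th] Q0] 1 2 by (simp add: psit_def Q_def b_def x_def)
 define E where "E = exp (- zeta (theta_hat X D) th / 2)"
 have E: "0 <= E" "E <= 1" using zeta_nonneg[of "theta_hat X D" th] by (auto simp: E_def)
 have "rho th * E - E = (rho th - 1) * E" by (simp add: left_diff_distrib)
 then have "\<bar>rho th * E - E\<bar> = \<bar>rho th - 1\<bar> * E" using E(1) by (simp add: abs_mult)
 also have "... <= \<bar>rho th - 1\<bar> * 1" using E by (intro mult_left_mono) auto
 also have "... <= real N0 * 2 ^ N0 * (dA C KT / lA)" using rho_close[OF ta th h C small] by simp
 finally have 4: "\<bar>rho th * E - E\<bar> <= real N0 * 2 ^ N0 * (dA C KT / lA)" .
 have tri: "\<bar>x - z\<bar> <= c + d" if "\<bar>x - y\<bar> <= c" "\<bar>y - z\<bar> <= d" for x y z c d :: real using that by linarith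
 show ?thesis using tri[OF 4 3[folded E_def]] by (simp add: E_def eP_def algebra_simps)
qed

lemma Pt_far:
 assumes D: "D : space OM" and T: "tight D <= T\<^sup>2" "0 < T" and e: "est_close dl D" "dl <= 1"
 and th: "th : \<Theta>" and r: "2 * (CH * T + 1) <= hn th"
 shows "lA * (hn th / 2)\<^sup>2 <= zeta (theta_hat X D) th"
 "psit D th <= exp (- (lA / 8) * (hn th)\<^sup>2)"
 "exp (- zeta (theta_hat X D) th / 2) <= exp (- (lA / 8) * (hn th)\<^sup>2)"
proof -
 define x where "x = vec p (hsc th)"
 have xc: "x : cvec p" by (simp add: x_def)
 have nx: "vnorm x = hn th" by (simp add: x_def nrm_def)
 note hbd = hb_hh_bounds[OF D T e]
 have "vnorm x - vnorm (hh D) <= vnorm (x - hh D)" by (rule vnorm_diff_le[OF xc hh_carrier])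
 then have a: "vnorm x / 2 <= vnorm (hh D - x)"
 using vnorm_minus_commute[OF xc hh_carrier[of D]] hbd(2) r by (simp add: nx)
 have "vnorm x - vnorm (hb D) <= vnorm (x - hb D)" by (rule vnorm_diff_le[OF xc hb_carrier])
 then have b: "vnorm x / 2 <= vnorm (x - hb D)" using hbd(1) r by (simp add: nx)
 have "lA * (vnorm x / 2)\<^sup>2 <= lA * (vnorm (hh D - x))\<^sup>2" using a lA_pos by (intro mult_left_mono power_mono) auto
 then show z: "lA * (hn th / 2)\<^sup>2 <= zeta (theta_hat X D) th"
 using zeta_ge[OF th, of D] by (simp add: x_def[symmetric] nx)
 then show "exp (- zeta (theta_hat X D) th / 2) <= exp (- (lA / 8) * (hn th)\<^sup>2)"
 by (simp add: power_divide)
 have "lA * (vnorm x / 2)\<^sup>2 <= lA * (vnorm (x - hb D))\<^sup>2" using b lA_pos by (intro mult_left_mono power_mono) auto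
 then have "exp (- lA * (vnorm (x - hb D))\<^sup>2 / 2) <= exp (- (lA / 8) * (hn th)\<^sup>2)"
 by (simp add: power_divide nx)
 then show "psit D th <= exp (- (lA / 8) * (hn th)\<^sup>2)" by (rule order_trans[OF psit_le[of D th, folded x_def]])
qed

text \<open>Compares the decay in the studentised error with decay in |h|.\<close>

lemma power_sqrt_ge:
 assumes z: "lA * (r / 2)\<^sup>2 <= z" and r: "0 <= r"
 shows "1 / (1 + sqrt z ^ (p + 1)) <= kk / (1 + r ^ (p + 1))"
proof -
 define a where "a = sqrt lA / 2"
 have a: "0 < a" using lA_pos by (simp add: a_def)
 have "a * r <= sqrt z"
 proof (rule real_le_rsqrt)
 show "(a * r)\<^sup>2 <= z" using z lA_pos by (simp add: a_def power_mult_distrib power_divide)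
 qed
 then have q: "(a * r) ^ (p + 1) <= sqrt z ^ (p + 1)" using a r by (intro power_mono) auto
 have "r ^ (p + 1) = (1 / a) ^ (p + 1) * (a * r) ^ (p + 1)" using a by (simp add: power_mult_distrib[symmetric])
 also have "... <= (1 + 2 / sqrt lA) ^ (N0 + 1) * sqrt z ^ (p + 1)"
 proof (rule mult_mono[OF _ q])
 have "(1 / a) ^ (p + 1) <= (1 + 2 / sqrt lA) ^ (p + 1)" using a lA_pos by (intro power_mono) (auto simp: a_def)
 also have "... <= (1 + 2 / sqrt lA) ^ (N0 + 1)" using p_le lA_pos by (intro power_increasing) auto
 finally show "(1 / a) ^ (p + 1) <= (1 + 2 / sqrt lA) ^ (N0 + 1)" .
 qed (use a r lA_pos in auto)
 finally have 1: "r ^ (p + 1) <= (kk - 1) * sqrt z ^ (p + 1)" by (simp add: kk_def)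
 have z0: "0 <= z" using z lA_pos by (meson mult_nonneg_nonneg order_trans less_imp_le zero_le_power2)
 have zz: "0 <= sqrt z ^ (p + 1)" using z0 by simp
 have "1 + r ^ (p + 1) <= kk * (1 + sqrt z ^ (p + 1))"
 proof -
 have k: "1 <= kk" using lA_pos by (simp add: kk_def)
 have "kk * (1 + sqrt z ^ (p + 1)) = kk + (kk - 1) * sqrt z ^ (p + 1) + sqrt z ^ (p + 1)" by (simp add: algebra_simps)
 then show ?thesis using 1 k zz by linarith
 qed
 moreover have "0 < 1 + r ^ (p + 1)" "0 < 1 + sqrt z ^ (p + 1)" using r zz by (auto intro: add_pos_nonneg simp del: power_Suc)
 ultimately show ?thesis by (simp add: field_simps)
qed

definition pval :: "real => real => real => real => real" where
 "pval T C KT dl = eP T C KT dl * (cpi * (2 * C) ^ N0) + (rhomax + 1) * exp (lA / 8) * cpi * (tail_const (lA / 8) / C) +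
 rhomax * (\<tau> / kap0) * kk * (2 * C) ^ (N0 + 1) * (cpi * 2 ^ (2 * N0 + 2))"

text \<open>Near theta0 the exponents agree up to the errors in the information matrix and in the estimator;
 far away both sides have Gaussian tails; the tau term is integrable at infinity.\<close>

lemma Pt_error:
 assumes D: "D : space OM" and T: "tight D <= T\<^sup>2" "0 < T" and e: "est_close dl D" "0 <= dl" "dl <= 1"
 and ta: "taylor \<rho> KT" and th: "th : \<Theta>" and C: "1 <= C" "C < \<rho> * s" "2 * (CH * T + 1) <= C"
 and small: "dA C KT <= lA" and pb: "Pbound (theta_hat X D) th"
 shows "\<bar>Pt (theta_hat X D) th - psit D th\<bar> <=
 eP T C KT dl * (if hn th <= C then 1 else 0) +
 (rhomax + 1) * exp (lA / 8) * (if C < hn th then exp (- (lA / 8) * hn th) else 0) +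
 rhomax * (\<tau> / kap0) * kk * (2 * C) ^ (N0 + 1) * (1 / (1 + hn th ^ (p + 1)))"
proof -
 define r where "r = hn th"
 define z where "z = zeta (theta_hat X D) th"
 have r0: "0 <= r" by (simp add: r_def)
 have K: "0 <= rhomax * (\<tau> / kap0)" using rhomax_pos \<tau>_nonneg kap0_pos by simp
 have zz: "0 <= sqrt z ^ (p + 1)" using zeta_nonneg by (simp add: z_def)
 have CC: "1 <= (2 * C) ^ (N0 + 1)" using C by (intro one_le_power) auto
 have k1: "1 <= kk" using lA_pos by (simp add: kk_def)
 have tau: "1 / (1 + sqrt z ^ (p + 1)) <= kk * (2 * C) ^ (N0 + 1) * (1 / (1 + r ^ (p + 1)))"
 proof (cases "r <= C")
 case True
 have "1 + r ^ (p + 1) <= (2 * C) ^ (N0 + 1)"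
 proof -
 have "r ^ (p + 1) <= C ^ (p + 1)" using True r0 by (intro power_mono) auto
 moreover have "1 <= C ^ (p + 1)" using C by (intro one_le_power) auto
 moreover have "C ^ (p + 1) + C ^ (p + 1) <= (2 * C) ^ (p + 1)"
 proof -
 have "2 * C ^ (p + 1) <= 2 ^ (p + 1) * C ^ (p + 1)" using C by (intro mult_right_mono) auto
 then show ?thesis by (simp add: power_mult_distrib mult_ac)
 qed
 moreover have "(2 * C) ^ (p + 1) <= (2 * C) ^ (N0 + 1)" using C p_le by (intro power_increasing) auto
 ultimately show ?thesis by linarith
 qed
 also have "... <= kk * (2 * C) ^ (N0 + 1)" using mult_right_mono[OF k1, of "(2 * C) ^ (N0 + 1)"] C by simp
 finally have kC: "1 + r ^ (p + 1) <= kk * (2 * C) ^ (N0 + 1)" .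
 have "0 < 1 + r ^ (p + 1)" using r0 by (intro add_pos_nonneg zero_le_power) auto
 then have "1 <= kk * (2 * C) ^ (N0 + 1) * (1 / (1 + r ^ (p + 1)))" using kC by (simp add: pos_le_divide_eq)
 moreover have "1 / (1 + sqrt z ^ (p + 1)) <= 1" using zz by (simp add: divide_le_eq del: power_Suc)
 ultimately show ?thesis by linarith
 next
 case False
 then have "2 * (CH * T + 1) <= hn th" using C by (simp add: r_def)
 from power_sqrt_ge[OF Pt_far(1)[OF D T e(1,3) th this] nrm_nonneg]
 have "1 / (1 + sqrt z ^ (p + 1)) <= kk * 1 * (1 / (1 + r ^ (p + 1)))" by (simp add: z_def r_def)
 also have "... <= kk * (2 * C) ^ (N0 + 1) * (1 / (1 + r ^ (p + 1)))"
 using CC k1 r0 by (intro mult_right_mono mult_left_mono) auto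
 finally show ?thesis .
 qed
 have "rhomax * (\<tau> / kap0) / (1 + sqrt z ^ (p + 1)) = rhomax * (\<tau> / kap0) * (1 / (1 + sqrt z ^ (p + 1)))" by simp
 also have "... <= rhomax * (\<tau> / kap0) * (kk * (2 * C) ^ (N0 + 1) * (1 / (1 + r ^ (p + 1))))" by (rule mult_left_mono[OF tau K])
 finally have A: "\<bar>Pt (theta_hat X D) th - rho th * exp (- z / 2)\<bar> <=
 rhomax * (\<tau> / kap0) * (kk * (2 * C) ^ (N0 + 1) * (1 / (1 + r ^ (p + 1))))"
 using Pbound_le[OF pb] by (simp add: z_def)
 have B: "\<bar>rho th * exp (- z / 2) - psit D th\<bar> <= eP T C KT dl * (if r <= C then 1 else 0) +
 (rhomax + 1) * exp (lA / 8) * (if C < r then exp (- (lA / 8) * r) else 0)"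
 proof (cases "r <= C")
 case True
 then show ?thesis using Pt_local[OF D T e ta th _ _ C(2) small] C(1) by (simp add: z_def r_def)
 next
 case False
 then have "2 * (CH * T + 1) <= hn th" using C by (simp add: r_def)
 note f = Pt_far(2,3)[OF D T e(1,3) th this]
 have "rho th * exp (- z / 2) <= rhomax * exp (- (lA / 8) * r\<^sup>2)"
 using f(2) rho_bounds[of th] rhomax_pos by (intro mult_mono) (auto simp: z_def r_def)
 moreover have "0 <= rho th * exp (- z / 2)" using rho_bounds[of th] by simp
 moreover have "psit D th <= exp (- (lA / 8) * r\<^sup>2)" using f(1) by (simp add: r_def)
 moreover have "0 <= psit D th" using psit_pos[of D th] by simp
 moreover have gen: "\<bar>a - b\<bar> <= (rhomax + 1) * y" if "a <= rhomax * y" "0 <= a" "b <= y" "0 <= b" for a b y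
 unfolding distrib_right using that by linarith
 ultimately have "\<bar>rho th * exp (- z / 2) - psit D th\<bar> <= (rhomax + 1) * exp (- (lA / 8) * r\<^sup>2)" by blast
 also have "... <= (rhomax + 1) * (exp (lA / 8) * exp (- (lA / 8) * r))"
 using gauss_le_exp[of "lA / 8" r] lA_pos rhomax_pos by (intro mult_left_mono) auto
 finally show ?thesis using False by (simp add: mult.assoc)
 qed
 have tri: "\<bar>x - z\<bar> <= d + c" if "\<bar>x - y\<bar> <= c" "\<bar>y - z\<bar> <= d" for x y z c d :: real using that by linarith
 show ?thesis using tri[OF A B] by (simp only: r_def mult.assoc)
qed

lemma measurable_psit: "psit D : bmb"
proof -
 have "psit D = (%th. exp (kp D / 2) * psi D th)" by (simp add: psi_factor mult.assoc[symmetric] exp_add[symmetric])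
 then show ?thesis using measurable_psi by simp
qed

lemma measurable_Pt_1: "(%th. Pt t th) : bmb"
proof -
 have "(%th. (t, th)) : (borel :: (nat => real) measure) \<rightarrow>\<^sub>M (borel :: (nat => real) measure) \<Otimes>\<^sub>M borel"
 by measurable
 from mcomp[OF this measurable_Pt] show ?thesis by simp
qed

lemma prior_inverse_power:
 assumes M: "M : models X" "Tm <= M"
 shows "(NI (plaw M) (%th. enn (1 / (1 + hn th ^ (p + 1))))) <= enn (cpi / s ^ card M * 2 ^ (2 * N0 + 2))"
proof -
 have "(NI (plaw M) (%th. enn (1 / (1 + hn th ^ (p + 1))))) <=
 enn (cpi / s ^ card M) * (NI (cleb M) (%x. enn (1 / (1 + nrm p x ^ (p + 1)))))"
 by (rule nn_integral_plaw_le[OF M, of "%x. enn (1 / (1 + nrm p x ^ (p + 1)))"])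
 (intro mcomp[OF _ measurable_ennreal] borel_measurable_divide borel_measurable_add
 borel_measurable_const borel_measurable_power measurable_nrm)
 also have "... <= enn (cpi / s ^ card M) * enn (2 ^ (p + 1 + card M + 1))"
 using models_finite[OF M(1)] by (intro mult_left_mono nn_integral_inverse_power_le) auto
 also have "... <= enn (cpi / s ^ card M) * enn (2 ^ (2 * N0 + 2))"
 using models_finite[OF M(1)] p_le by (intro mult_left_mono ennreal_leI power_increasing) auto
 also have "... = enn (cpi / s ^ card M * 2 ^ (2 * N0 + 2))" using cpi s by (intro ennreal_mult[symmetric]) auto
 finally show ?thesis .
qed

lemma Pt_psit_integral:
 assumes M: "M : models X" "Tm <= M"
 and D: "D : space OM" and T: "tight D <= T\<^sup>2" "0 < T" and e: "est_close dl D" "0 <= dl" "dl <= 1"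
 and ta: "taylor \<rho> KT" and C: "1 <= C" "C < \<rho> * s" "2 * (CH * T + 1) <= C"
 and small: "dA C KT <= lA" and pb: "AE th in plaw M. Pbound (theta_hat X D) th"
 shows "(NI (plaw M) (%th. enn \<bar>Pt (theta_hat X D) th - psit D th\<bar>)) <= enn (pval T C KT dl / s ^ card M)"
proof -
 define a where "a = eP T C KT dl"
 define b where "b = (rhomax + 1) * exp (lA / 8)"
 define c where "c = rhomax * (\<tau> / kap0) * kk * (2 * C) ^ (N0 + 1)"
 have dA0: "0 <= dA C KT" using C ta by (intro dA_nonneg) (auto simp: taylor_def)
 have B0: "0 <= BB T C" using CH_pos T C by (simp add: BB_def add_nonneg_nonneg)
 have a0: "0 <= a" unfolding a_def eP_def using dA0 B0 lA_pos uA_pos e by (intro add_nonneg_nonneg mult_nonneg_nonneg divide_nonneg_nonneg) auto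
 have b0: "0 <= b" using rhomax_pos by (simp add: b_def)
 have c0: "0 <= c" using rhomax_pos \<tau>_nonneg kap0_pos kk_pos C by (simp add: c_def)
 have split: "enn (a * x + b * y + c * w) = enn a * enn x + enn b * enn y + enn c * enn w"
 if "0 <= x" "0 <= y" "0 <= w" for x y w
 using a0 b0 c0 that by (simp add: ennreal_mult)
 let ?f = "%th. (if hn th <= C then 1 else 0) :: ennreal"
 let ?g = "%th. if C < hn th then enn (exp (- (lA / 8) * hn th)) else 0"
 let ?k = "%th. enn (1 / (1 + hn th ^ (p + 1)))"
 have mf: "?f : bmb" "?g : bmb" by measurable
 have mk: "?k : bmb"
 by (intro mcomp[OF _ measurable_ennreal] borel_measurable_divide borel_measurable_add
 borel_measurable_const borel_measurable_power mcomp[OF measurable_hsc measurable_nrm])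
 have "(NI (plaw M) (%th. enn \<bar>Pt (theta_hat X D) th - psit D th\<bar>)) <=
 (NI (plaw M) (%th. enn a * ?f th + enn b * ?g th + enn c * ?k th))"
 proof (rule nn_integral_mono_AE)
 show "AE th in plaw M. enn \<bar>Pt (theta_hat X D) th - psit D th\<bar> <= enn a * ?f th + enn b * ?g th + enn c * ?k th"
 using pb AE_plaw[OF M(1)]
 proof eventually_elim
 case (elim th)
 have th: "th : \<Theta>" using elim Theta_of_subset by auto
 have "enn \<bar>Pt (theta_hat X D) th - psit D th\<bar> <= enn (a * (if hn th <= C then 1 else 0) +
 b * (if C < hn th then exp (- (lA / 8) * hn th) else 0) + c * (1 / (1 + hn th ^ (p + 1))))"
 using Pt_error[OF D T e ta th C small elim(1)] unfolding a_def b_def c_def by (rule ennreal_leI)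
 also have "... = enn a * ?f th + enn b * ?g th + enn c * ?k th"
 by (subst split) (simp_all add: if_distrib[of ennreal] add_nonneg_nonneg)
 finally show ?case .
 qed
 qed
 also have "... = enn a * (NI (plaw M) (%th. ?f th)) + enn b * (NI (plaw M) (%th. ?g th)) + enn c * (NI (plaw M) (%th. ?k th))"
 using mf mk by (simp add: nn_integral_add nn_integral_cmult)
 also have "... <= enn a * enn (cpi / s ^ card M * (2 * C) ^ N0) + enn b * enn (cpi / s ^ card M * (tail_const (lA / 8) / C)) +
 enn c * enn (cpi / s ^ card M * 2 ^ (2 * N0 + 2))"
 using lA_pos by (intro add_mono mult_left_mono prior_ball[OF M C(1)] prior_exp_tail[OF M _ C(1)] prior_inverse_power[OF M]) auto
 also have "... = enn (a * (cpi / s ^ card M * (2 * C) ^ N0) + b * (cpi / s ^ card M * (tail_const (lA / 8) / C)) +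
 c * (cpi / s ^ card M * 2 ^ (2 * N0 + 2)))"
 using cpi C s tail_const_pos[of "lA / 8"] lA_pos by (intro split[symmetric]) auto
 also have "... = enn (pval T C KT dl / s ^ card M)"
 using s by (intro arg_cong[where f=ennreal]) (simp add: pval_def a_def b_def c_def add_divide_distrib mult_ac)
 finally show ?thesis .
qed

subsection \<open>Models that miss a relevant coordinate\<close>

definition kmiss :: real where "kmiss = rhomax / kap0 * kk * (1 + 1 / tmin) ^ (N0 + 1)"

text \<open>The studentised error is of order sqrt n on the whole model, which yields the Gaussian term and
 tau / s^(p+1).\<close>

lemma Pt_missing_integral:
 assumes M: "M : models X" "\<not> Tm <= M"
 and D: "D : space OM" and T: "tight D <= T\<^sup>2" "0 < T" and e: "est_close dl D" "dl <= 1"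
 and big: "2 * (CH * T + 1) <= s * tmin" and pb: "AE th in plaw M. Pbound (theta_hat X D) th"
 shows "(NI (plaw M) (%th. enn (Pt (theta_hat X D) th))) <=
 enn (rhomax * exp (- (lA / 8 * tmin\<^sup>2) * real n) + kmiss * \<tau> / s ^ (p + 1))"
proof -
 interpret Q: prob_space "plaw M" by (rule prob_plaw[OF M(1)])
 let ?B = "rhomax * exp (- (lA / 8 * tmin\<^sup>2) * real n) + kmiss * \<tau> / s ^ (p + 1)"
 have "(NI (plaw M) (%th. enn (Pt (theta_hat X D) th))) <= (NI (plaw M) (%th. ennreal ?B))"
 proof (rule nn_integral_mono_AE)
 show "AE th in plaw M. enn (Pt (theta_hat X D) th) <= ennreal ?B"
 using pb AE_plaw[OF M(1)]
 proof eventually_elim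
 case (elim th)
 have th: "th : \<Theta>" using elim Theta_of_subset by auto
 define r where "r = hn th"
 define z where "z = zeta (theta_hat X D) th"
 have r: "s * tmin <= r" unfolding r_def nrm_hsc using missing_signal_edist[OF M elim(2)] s by (intro mult_left_mono) auto
 then have "2 * (CH * T + 1) <= hn th" using big by (simp add: r_def)
 note f = Pt_far(1,3)[OF D T e th this]
 have st: "0 < s * tmin" using s tmin by simp
 have "(s * tmin)\<^sup>2 <= r\<^sup>2" using r st by (intro power_mono) auto
 then have "exp (- (lA / 8) * r\<^sup>2) <= exp (- (lA / 8 * tmin\<^sup>2) * real n)"
 using lA_pos n_pos by (simp add: power_mult_distrib mult_ac)
 then have "exp (- z / 2) <= exp (- (lA / 8 * tmin\<^sup>2) * real n)" by (rule order_trans[OF f(2)[folded z_def r_def]])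
 then have E: "rho th * exp (- z / 2) <= rhomax * exp (- (lA / 8 * tmin\<^sup>2) * real n)"
 by (rule mult_mono[OF rho_bounds(2)]) (use rhomax_pos in auto)
 have "1 / (1 + sqrt z ^ (p + 1)) <= kk / (1 + r ^ (p + 1))"
 unfolding z_def r_def by (rule power_sqrt_ge[OF f(1) nrm_nonneg])
 also have "... <= kk / (s * tmin) ^ (p + 1)"
 proof (rule divide_left_mono)
 have "(s * tmin) ^ (p + 1) <= r ^ (p + 1)" using r st by (intro power_mono) auto
 then show "(s * tmin) ^ (p + 1) <= 1 + r ^ (p + 1)" by simp
 have "0 <= r" using r st by linarith
 then show "0 < (1 + r ^ (p + 1)) * (s * tmin) ^ (p + 1)"
 using n_pos tmin by (intro mult_pos_pos zero_less_power add_pos_nonneg) auto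
 qed (use kk_pos in simp)
 also have "... = kk * (1 / tmin) ^ (p + 1) / s ^ (p + 1)" by (simp add: power_mult_distrib power_one_over)
 also have "... <= kk * (1 + 1 / tmin) ^ (N0 + 1) / s ^ (p + 1)"
 proof -
 have "(1 / tmin) ^ (p + 1) <= (1 + 1 / tmin) ^ (p + 1)" using tmin by (intro power_mono) auto
 also have "... <= (1 + 1 / tmin) ^ (N0 + 1)" using tmin p_le by (intro power_increasing) auto
 finally show ?thesis using kk_pos s by (intro divide_right_mono mult_left_mono) auto
 qed
 finally have i: "1 / (1 + sqrt z ^ (p + 1)) <= kk * (1 + 1 / tmin) ^ (N0 + 1) / s ^ (p + 1)" .
 have "rhomax * (\<tau> / kap0) * (1 / (1 + sqrt z ^ (p + 1))) <= rhomax * (\<tau> / kap0) * (kk * (1 + 1 / tmin) ^ (N0 + 1) / s ^ (p + 1))"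
 using i rhomax_pos \<tau>_nonneg kap0_pos by (intro mult_left_mono) auto
 also have "... = kmiss * \<tau> / s ^ (p + 1)" by (simp add: kmiss_def)
 finally have "Pt (theta_hat X D) th <= ?B" using Pbound_le[OF elim(1)] E by (simp add: z_def abs_le_iff)
 then show ?case by (rule ennreal_leI)
 qed
 qed
 also have "... = ennreal ?B" using Q.emeasure_space_1 by simp
 finally show ?thesis .
qed

subsection \<open>Two-sided bounds on the integrated limit\<close>

definition local_prior :: "real => bool" where
 "local_prior C \<longleftrightarrow> (ALL M:models X. Tm <= M -->
 (ALL th:Theta_of X M. hn th <= C --> exp (- 1 - c0 * real N0) <= cond_prior X M th))"

definition mlo :: real where "mlo = exp (- 1 - c0 * real N0) * (1 / real N0) ^ N0"

lemma mlo_pos: "0 < mlo" using N0_pos by (simp add: mlo_def)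

lemma nrm_triangle: "nrm p x <= nrm p (%j. x j - a j) + nrm p a"
proof -
 have "vec p x = vec p (%j. x j - a j) + vec p a" by auto
 then show ?thesis using vnorm_triangle[of "vec p (%j. x j - a j)" p "vec p a"] by (simp add: nrm_def)
qed

text \<open>The prior density is bounded below near theta0, so a unit ball in the local coordinate has prior
 mass of exact order s^(-|M|).\<close>

lemma prior_mass:
 assumes M: "M : models X" "Tm <= M" and a: "\<And>j. j \<notin> M ==> a j = 0"
 and C: "nrm p a + 1 <= C" "C < r0 * s" and lp: "local_prior C"
 shows "enn (mlo / s ^ card M) <= (NI (plaw M) (%th. (if nrm p (%j. hsc th j - a j) <= 1 then 1 else 0)))"
proof -
 define cpr where "cpr = exp (- 1 - c0 * real N0)"
 let ?f = "%x::nat => real. (if nrm p x <= 1 then 1 else 0) :: ennreal"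
 let ?i = "%th. ?f (%j. hsc th j - a j)"
 let ?B = "{x::nat => real. ALL j:M. \<bar>x j\<bar> <= 1 / real N0}"
 note fin = models_finite(1)[OF M(1)]
 have Bm: "?B : sets borel" using fin by measurable
 have mf: "?f : bmb" by measurable
 have ms: "(%th j. hsc th j - a j) : borel \<rightarrow>\<^sub>M borel"
 by (rule meas_coord)
 (intro borel_measurable_diff borel_measurable_const mcomp[OF measurable_hsc measurable_product_coordinates])
 have mi: "?i : bmb" by (rule mcomp[OF ms mf])
 have "enn ((1 / real N0) ^ N0) <= enn ((2 * (1 / real N0)) ^ card M)"
 proof (rule ennreal_leI)
 have "(1 / real N0) ^ N0 <= (1 / real N0) ^ card M"
 using models_finite(3)[OF M(1)] p_le N0_pos by (intro power_decreasing) auto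
 also have "... <= (2 * (1 / real N0)) ^ card M" by (intro power_mono) (auto intro: divide_right_mono)
 finally show "(1 / real N0) ^ N0 <= (2 * (1 / real N0)) ^ card M" .
 qed
 also have "... = emeasure (cleb M) ?B" using emeasure_coord_cube[OF fin, of "1 / real N0"] by simp
 also have "... = (NI (cleb M) (%x. indicator ?B x))" using Bm by simp
 also have "... <= (NI (cleb M) (%x. ?f x))"
 proof (rule nn_integral_mono_AE)
 show "AE x in cleb M. indicator ?B x <= ?f x"
 using AE_coord_lebesgue_support[of M]
 proof eventually_elim
 case (elim x)
 have "nrm p x <= 1" if "x : ?B"
 proof -
 have "nrm p x <= (\<Sum>j<p. \<bar>x j\<bar>)" using vnorm_le_sum_abs[of "vec p x"] by (simp add: nrm_def)
 also have "... <= (\<Sum>j<p. 1 / real N0)"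
 proof (rule sum_mono)
 fix j show "\<bar>x j\<bar> <= 1 / real N0" using that elim by (cases "j : M") auto
 qed
 also have "... <= 1" using p_le N0_pos by (simp add: divide_le_eq)
 finally show ?thesis .
 qed
 then show ?case by (cases "x : ?B") simp_all
 qed
 qed
 finally have vol: "enn ((1 / real N0) ^ N0) <= (NI (cleb M) (%x. ?f x))" .
 have sh: "(NI (cleb M) (%th. ?i th)) = enn (1 / s ^ card M) * (NI (cleb M) (%x. ?f x))"
 proof -
 have e: "(%j. hsc th j - a j) = (%j. s * (th j - (t0 j + a j / s)))" for th
 using s(1) by (simp add: hsc_def right_diff_distrib distrib_left fun_eq_iff)
 show ?thesis unfolding e
 by (rule nn_integral_coord_affine[OF fin s(1) mf]) (use a t0_zero[OF M(2)] in auto)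
 qed
 have "enn (mlo / s ^ card M) = enn cpr * (enn (1 / s ^ card M) * enn ((1 / real N0) ^ N0))"
 using s by (simp add: mlo_def cpr_def flip: ennreal_mult)
 also have "... <= enn cpr * (NI (cleb M) (%th. ?i th))"
 unfolding sh by (intro mult_left_mono vol) auto
 also have "... = (NI (cleb M) (%th. enn cpr * ?i th))"
 using mi by (intro nn_integral_cmult[symmetric]) simp
 also have "... <= (NI (cleb M) (%th. enn (pr M th) * ?i th))"
 proof (rule nn_integral_mono_AE)
 show "AE th in cleb M. enn cpr * ?i th <= enn (pr M th) * ?i th"
 using AE_coord_lebesgue_support[of M]
 proof eventually_elim
 case (elim th)
 have "cpr <= pr M th" if i: "nrm p (%j. hsc th j - a j) <= 1"
 proof -
 have h: "hn th <= C" using nrm_triangle[of "hsc th" a] i C(1) by simp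
 have "s * edist p th t0 < s * r0" using h C(2) by (simp add: nrm_hsc mult.commute)
 then have "edist p th t0 < r0" using s(1) by simp
 moreover have "th : euclid p" using elim models_finite(2)[OF M(1)] by (auto simp: euclid_def)
 ultimately have "th : \<Theta>" using ball by blast
 then have "th : Theta_of X M" using elim by (auto simp: Theta_of_def)
 then show ?thesis using lp M h by (simp add: local_prior_def pr_def cpr_def)
 qed
 then show ?case by (cases "nrm p (%j. hsc th j - a j) <= 1") (simp_all add: ennreal_leI)
 qed
 qed
 also have "... = (NI (plaw M) (%th. ?i th))"
 unfolding plaw_def using measurable_pr[OF M(1)] mi by (intro nn_integral_density[symmetric]) simp_all
 finally show ?thesis .
qed

definition clo :: "real => real" where "clo T = exp (- (T + sqrt u)\<^sup>2 / (2 * l)) * mlo"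

lemma clo_pos: "0 < clo T" using mlo_pos by (simp add: clo_def)

lemma integral_ge_of_ball:
 assumes M: "M : models X" and m: "measurable_set : sets borel" and g: "g : bmb"
 and b: "enn B <= (NI (plaw M) (%th. indicator measurable_set th))" and B: "0 <= B" "0 <= v"
 and ge: "\<And>th. th : measurable_set ==> v <= g th"
 shows "enn (v * B) <= (NI (plaw M) (%th. enn (g th)))"
proof -
 have "enn (v * B) <= enn v * (NI (plaw M) (%th. indicator measurable_set th))"
 using B b by (simp add: ennreal_mult mult_left_mono)
 also have "... = (NI (plaw M) (%th. enn v * indicator measurable_set th))"
 using m by (intro nn_integral_cmult[symmetric]) simp
 also have "... <= (NI (plaw M) (%th. enn (g th)))"
 using ge by (intro nn_integral_mono) (auto simp: indicator_def intro: ennreal_leI)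
 finally show ?thesis .
qed

lemma psi_lower:
 assumes M: "M : models X" "Tm <= M" and D: "D : space OM" and T: "tight D <= T\<^sup>2" "0 < T"
 and C: "1 <= C" "C < r0 * s" and lp: "local_prior C"
 shows "enn (clo T / s ^ card M) <= (NI (plaw M) (%th. enn (psi D th)))"
proof -
 let ?S = "{th. hn th <= 1}"
 have S: "?S : sets borel" using mcomp[OF measurable_hsc measurable_nrm[of p]] by measurable
 have b: "enn (mlo / s ^ card M) <= (NI (plaw M) (%th. indicator ?S th))"
 proof -
 have i: "(indicator ?S th :: ennreal) = (if nrm p (%j. hsc th j - (%_. 0) j) <= 1 then 1 else 0)" for th
 by (auto simp: indicator_def)
 show ?thesis unfolding i by (rule prior_mass[OF M _ _ C(2) lp]) (use C in \<open>auto simp: nrm_eq\<close>)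
 qed
 have ge: "exp (- (T + sqrt u)\<^sup>2 / (2 * l)) <= psi D th" if "th : ?S" for th
 proof -
 define y where "y = W D + G0 X *. vec p (hsc th)"
 have c: "y : cvec m" unfolding y_def by (rule ypsi_carrier)
 have "vnorm y <= vnorm (W D) + vnorm (G0 X *. vec p (hsc th))"
 unfolding y_def using G0_carrier by (intro vnorm_triangle[of _ m]) auto
 also have "... <= T + sqrt u * 1"
 using tight_bounds(1)[OF D T] that u_pos
 by (intro add_mono order_trans[OF G0_norm(1)] mult_left_mono) auto
 finally have "(vnorm y)\<^sup>2 <= (T + sqrt u)\<^sup>2" by (intro power_mono) auto
 then have "y .* (minv (V0 X) *. y) <= (T + sqrt u)\<^sup>2 / l"
 using coercive_minv_form_le[OF coercive_V0 c] lu divide_right_mono[of "y .* y" "(T + sqrt u)\<^sup>2" l] by (simp add: vnorm_sq)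
 then show ?thesis by (simp add: psi_def y_def[symmetric] mult.commute)
 qed
 have "enn (exp (- (T + sqrt u)\<^sup>2 / (2 * l)) * (mlo / s ^ card M)) <= (NI (plaw M) (%th. enn (psi D th)))"
 using integral_ge_of_ball[OF M(1) S measurable_psi b _ _ ge] mlo_pos s by simp
 then show ?thesis by (simp add: clo_def)
qed

definition cup :: "real => real" where
 "cup C = cpi * (2 * C) ^ N0 + exp (l\<^sup>2 / (8 * u\<^sup>2)) * (cpi * (tail_const (l\<^sup>2 / (8 * u\<^sup>2)) / C))"

lemma psi_upper:
 assumes M: "M : models X" "Tm <= M" and D: "D : space OM" and T: "tight D <= T\<^sup>2" "0 < T"
 and C: "1 <= C" "2 * T <= sqrt l * C"
 shows "(NI (plaw M) (%th. enn (psi D th))) <= enn (cup C / s ^ card M)"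
proof -
 define c where "c = l\<^sup>2 / (8 * u\<^sup>2)"
 have c: "0 < c" using lu by (simp add: c_def)
 let ?f = "%th. (if hn th <= C then 1 else 0) :: ennreal"
 let ?g = "%th. if C < hn th then enn (exp (- c * hn th)) else 0"
 have mf: "?f : bmb" "?g : bmb" by measurable
 have "(NI (plaw M) (%th. enn (psi D th))) <= (NI (plaw M) (%th. ?f th + enn (exp c) * ?g th))"
 proof (rule nn_integral_mono)
 fix th
 show "enn (psi D th) <= ?f th + enn (exp c) * ?g th"
 proof (cases "hn th <= C")
 case True
 then show ?thesis using psi_le_1[of D th] by (simp add: ennreal_le_1)
 next
 case False
 have "sqrt l * C <= sqrt l * hn th" using False lu by (intro mult_left_mono) auto
 then have "psi D th <= exp (- c * (hn th)\<^sup>2)"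
 unfolding c_def using C by (intro psi_tail[OF tight_bounds(1)[OF D T]]) simp
 also have "... <= exp c * exp (- c * hn th)" using c by (intro gauss_le_exp) simp
 finally have "enn (psi D th) <= enn (exp c * exp (- c * hn th))" by (rule ennreal_leI)
 then show ?thesis using False by (simp add: ennreal_mult)
 qed
 qed
 also have "... = (NI (plaw M) (%th. ?f th)) + enn (exp c) * (NI (plaw M) (%th. ?g th))"
 using mf by (simp add: nn_integral_add nn_integral_cmult)
 also have "... <= enn (cpi / s ^ card M * (2 * C) ^ N0) + enn (exp c) * enn (cpi / s ^ card M * (tail_const c / C))"
 by (intro add_mono mult_left_mono prior_ball[OF M C(1)] prior_exp_tail[OF M c C(1)]) simp
 also have "... = enn (cpi / s ^ card M * (2 * C) ^ N0 + exp c * (cpi / s ^ card M * (tail_const c / C)))"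
 proof -
 have "enn x + enn (exp c) * enn y = enn (x + exp c * y)" if "0 <= x" "0 <= y" for x y
 using that by (simp add: ennreal_mult)
 then show ?thesis using cpi C s tail_const_pos[OF c] by simp
 qed
 also have "... = enn (cup C / s ^ card M)"
 by (intro arg_cong[where f=ennreal]) (simp add: cup_def c_def add_divide_distrib mult_ac)
 finally show ?thesis .
qed

text \<open>The ball is centred at the least squares point, which belongs to the full model. Hence the
 constant does not depend on the size of the score, as the uniform constant in the bound for the
 full model requires.\<close>

lemma psit_lower:
 assumes full: "Tm = full_model X" and D: "D : space OM" and T: "tight D <= T\<^sup>2" "0 < T"
 and C: "CH * T + 1 <= C" "C < r0 * s" and lp: "local_prior C"
 shows "enn (exp (- uA / 2) * mlo / s ^ p) <= (NI (plaw (full_model X)) (%th. enn (psit D th)))"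
proof -
 let ?a = "zero_pad (hb D)"
 let ?S = "{th. nrm p (%j. hsc th j - ?a j) <= 1}"
 have M: "full_model X : models X" "Tm <= full_model X" using full by (auto simp: models_def full_model_def)
 have dh: "dim_vec (hb D) = p" using hb_carrier by auto
 have va: "vec p ?a = hb D" using dh by (auto simp: zero_pad_def)
 have na: "nrm p ?a <= CH * T"
 proof -
 have "CH * vnorm (W D) <= CH * T" using tight_bounds(1)[OF D T] CH_pos by (intro mult_left_mono) auto
 then show ?thesis using hb_le[of D] by (simp add: nrm_def va)
 qed
 have ms: "(%th j. hsc th j - ?a j) : borel \<rightarrow>\<^sub>M borel"
 by (rule meas_coord)
 (intro borel_measurable_diff borel_measurable_const mcomp[OF measurable_hsc measurable_product_coordinates])
 have S: "?S : sets borel" using mcomp[OF ms measurable_nrm[of p]] by measurable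
 have b: "enn (mlo / s ^ card (full_model X)) <= (NI (plaw (full_model X)) (%th. indicator ?S th))"
 proof -
 have i: "(indicator ?S th :: ennreal) = (if nrm p (%j. hsc th j - ?a j) <= 1 then 1 else 0)" for th
 by (auto simp: indicator_def)
 show ?thesis unfolding i
 by (rule prior_mass[OF M _ _ C(2) lp]) (use C na dh in \<open>auto simp: zero_pad_def full_model_def\<close>)
 qed
 have ge: "exp (- uA / 2) <= psit D th" if "th : ?S" for th
 proof -
 define v where "v = vec p (hsc th) - hb D"
 have v: "v : cvec p" using hb_carrier by (simp add: v_def)
 have "v = vec p (%j. hsc th j - ?a j)" using dh by (auto simp: v_def zero_pad_def)
 then have "vnorm v <= 1" using that by (simp add: nrm_def)
 then have "v .* v <= 1" using power_mono[of "vnorm v" 1 2] by (simp add: vnorm_sq)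
 then have "uA * (v .* v) <= uA * 1" using uA_pos by (intro mult_left_mono) auto
 moreover have "v .* (Am t0 *. v) <= uA * (v .* v)" using coercive_Am[of t0] v by (auto simp: coercive_def)
 ultimately show ?thesis by (simp add: psit_def v_def)
 qed
 have "enn (exp (- uA / 2) * (mlo / s ^ card (full_model X))) <= (NI (plaw (full_model X)) (%th. enn (psit D th)))"
 using integral_ge_of_ball[OF M(1) S measurable_psit b _ _ ge] mlo_pos s by simp
 then show ?thesis by (simp add: full_model_def)
qed

end

text \<open>Relative errors e in four positive numbers change a ratio of ratios by a factor 1 + O(e).\<close>

lemma ratio_of_perturbed:
 fixes S E e :: real
 assumes S: "0 < S" and E: "0 < E" and e: "0 <= e" "e <= 1/4"
 and q: "\<bar>Sq - S\<bar> <= e * S" "\<bar>Eq - E\<bar> <= e * E" and p: "\<bar>Sp - S\<bar> <= e * S" "\<bar>Ep - E\<bar> <= e * E"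
 shows "\<bar>(Sq / Eq) / (Sp / Ep) - 1\<bar> <= 8 * e" "0 < Sp / Ep"
 "1/2 * (S / E) <= Sp / Ep" "Sp / Ep <= 2 * (S / E)"
proof -
 define a b c d where "a = Sq / S" and "b = Eq / E" and "c = Sp / S" and "d = Ep / E"
 have bd: "1 - e <= x / y & x / y <= 1 + e" if "0 < y" "\<bar>x - y\<bar> <= e * y" for x y :: real
 proof -
 have "x / y - 1 = (x - y) / y" using that(1) by (simp add: diff_divide_distrib)
 then have "\<bar>x / y - 1\<bar> = \<bar>x - y\<bar> / y" using that(1) by (simp add: abs_divide)
 then have "\<bar>x / y - 1\<bar> <= e" using that by (simp add: pos_divide_le_eq)
 then show ?thesis by linarith
 qed
 have a: "1 - e <= a" "a <= 1 + e" and b: "1 - e <= b" "b <= 1 + e" and c: "1 - e <= c" "c <= 1 + e" and d: "1 - e <= d" "d <= 1 + e"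
 using bd[OF S q(1)] bd[OF E q(2)] bd[OF S p(1)] bd[OF E p(2)] by (auto simp: a_def b_def c_def d_def)
 have eqs: "Sq = a * S" "Eq = b * E" "Sp = c * S" "Ep = d * E" using S E by (auto simp: a_def b_def c_def d_def)
 have pos: "0 < a" "0 < b" "0 < c" "0 < d" using a b c d e by auto
 have r: "(Sq / Eq) / (Sp / Ep) = (a * d) / (b * c)" unfolding eqs using S E pos by (simp add: field_simps)
 have m: "(1 - e)\<^sup>2 <= x * y" "x * y <= (1 + e)\<^sup>2" if "1 - e <= x" "x <= 1 + e" "1 - e <= y" "y <= 1 + e" for x y :: real
 proof -
 have "(1 - e) * (1 - e) <= x * y" using that e by (intro mult_mono) auto
 then show "(1 - e)\<^sup>2 <= x * y" by (simp add: power2_eq_square)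
 have "x * y <= (1 + e) * (1 + e)" using that e by (intro mult_mono) auto
 then show "x * y <= (1 + e)\<^sup>2" by (simp add: power2_eq_square)
 qed
 have bc: "1/2 <= b * c"
 proof -
 have "(3/4)\<^sup>2 <= (1 - e)\<^sup>2" using e by (intro power_mono) auto
 then show ?thesis using m(1)[OF b c] by (simp add: power2_eq_square)
 qed
 have "\<bar>a * d - b * c\<bar> <= (1 + e)\<^sup>2 - (1 - e)\<^sup>2" using m[OF a d] m[OF b c] by linarith
 also have "... = 4 * e" by (simp add: power2_eq_square algebra_simps)
 also have "... <= 8 * e * (b * c)" using mult_left_mono[OF bc, of "8 * e"] e by simp
 finally have "\<bar>a * d - b * c\<bar> / (b * c) <= 8 * e" using bc by (simp add: pos_divide_le_eq)
 moreover have "(a * d) / (b * c) - 1 = (a * d - b * c) / (b * c)" using pos by (simp add: diff_divide_distrib)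
 ultimately show "\<bar>(Sq / Eq) / (Sp / Ep) - 1\<bar> <= 8 * e" unfolding r using bc by (simp add: abs_divide)
 have q: "Sp / Ep = (c / d) * (S / E)" unfolding eqs using S E pos by simp
 then show "0 < Sp / Ep" using pos S E by simp
 have "1/2 <= c / d" "c / d <= 2" using c d e pos by (auto simp: pos_le_divide_eq pos_divide_le_eq)
 moreover have "0 <= S / E" using S E by simp
 ultimately have "1/2 * (S / E) <= c / d * (S / E)" "c / d * (S / E) <= 2 * (S / E)" by (simp_all only: mult_right_mono)
 then show "1/2 * (S / E) <= Sp / Ep" "Sp / Ep <= 2 * (S / E)" unfolding q by simp_all
qed

lemma normalised_diff_le:
 fixes E e :: real
 assumes E: "0 < E" and e: "0 <= e" "e <= 1/2" and x: "\<bar>x - z\<bar> <= e * E" and z: "0 <= z" "z <= E" and Eq: "\<bar>Eq - E\<bar> <= e * E"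
 shows "\<bar>x / Eq - z / E\<bar> <= 4 * e"
proof -
 have EqE: "E / 2 <= Eq"
 proof -
 have "e * E <= 1/2 * E" using E e by (intro mult_right_mono) auto
 then show ?thesis using Eq by linarith
 qed
 then have Eqp: "0 < Eq" using E by linarith
 have "x / Eq - z / E = (x - z) / Eq + (z / E) * ((E - Eq) / Eq)"
 using E Eqp by (simp add: field_simps)
 then have "\<bar>x / Eq - z / E\<bar> <= \<bar>(x - z) / Eq\<bar> + \<bar>(z / E) * ((E - Eq) / Eq)\<bar>" by (simp only: abs_triangle_ineq)
 also have "... = \<bar>x - z\<bar> / Eq + (z / E) * (\<bar>E - Eq\<bar> / Eq)" using E Eqp z by (simp add: abs_mult)
 also have "... <= (e * E) / Eq + 1 * ((e * E) / Eq)"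
 using x Eq E Eqp z e by (intro add_mono mult_mono divide_right_mono) (auto simp: abs_minus_commute)
 also have "... = 2 * e * (E / Eq)" by simp
 also have "... <= 2 * e * 2" using EqE Eqp e by (intro mult_left_mono) (auto simp: pos_divide_le_eq)
 finally show ?thesis by simp
qed

context rg begin

subsection \<open>Posterior quantities as prior integrals\<close>

definition mass :: "((nat => real) => real) => nat set => (nat => real) set => real" where
 "mass L M A = (\<integral>th. indicator A th * L th \<partial>plaw M)"

abbreviation wm :: "nat set => real" where "wm == model_prior X"

lemma marg_lik_on_scaled:
 assumes M: "M : models X" and L': "L' : bmb" and A: "A : sets borel"
 and eq: "\<And>th. th : \<Theta> ==> L th = k * L' th"
 shows "marg_lik_on X L M A = k * mass L' M A"
proof -
 have "marg_lik_on X L M A = (\<integral>th. indicator A th * (k * L' th) \<partial>plaw M)"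
 using L' by (intro marg_lik_on_eq[OF M _ A eq]) simp_all
 also have "... = (\<integral>th. k * (indicator A th * L' th) \<partial>plaw M)" by (simp add: mult_ac)
 finally show ?thesis by (simp add: mass_def)
qed

lemma marg_lik_scaled:
 assumes "M : models X" "L' : bmb" "\<And>th. th : \<Theta> ==> L th = k * L' th"
 shows "marg_lik X L M = k * mass L' M UNIV"
 using marg_lik_on_scaled[OF assms(1,2) _ assms(3), of UNIV] by (simp add: marg_lik_on_def marg_lik_def)

text \<open>Factors that do not involve the parameter cancel.\<close>

lemma posterior_scaled:
 assumes L': "L' : bmb" and k: "k ~= 0" and eq: "\<And>th. th : \<Theta> ==> L th = k * L' th"
 shows "wrong_model_post X L = (\<Sum>M\<in>models X - {Tm}. wm M * mass L' M UNIV) / (\<Sum>M\<in>models X. wm M * mass L' M UNIV)"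
 "A : sets borel ==> post_measure X L A = (\<Sum>M\<in>models X. wm M * mass L' M A) / (\<Sum>M\<in>models X. wm M * mass L' M UNIV)"
proof -
 note me = marg_lik_scaled[OF _ L' eq]
 have ev: "evidence X L = k * (\<Sum>M\<in>models X. wm M * mass L' M UNIV)"
 unfolding evidence_def sum_distrib_left by (intro sum.cong) (auto simp: me)
 have "wrong_model_post X L = (\<Sum>M\<in>models X - {Tm}. k * (wm M * mass L' M UNIV)) / evidence X L"
 unfolding wrong_model_post_def model_post_def sum_divide_distrib by (intro sum.cong) (auto simp: me)
 then show "wrong_model_post X L = (\<Sum>M\<in>models X - {Tm}. wm M * mass L' M UNIV) / (\<Sum>M\<in>models X. wm M * mass L' M UNIV)"
 unfolding ev sum_distrib_left[symmetric] using k by simp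
 assume A: "A : sets borel"
 have "post_measure X L A = (\<Sum>M\<in>models X. k * (wm M * mass L' M A)) / evidence X L"
 unfolding post_measure_def using marg_lik_on_scaled[OF _ L' A eq] by (intro arg_cong2[where f="(/)"] sum.cong) auto
 then show "post_measure X L A = (\<Sum>M\<in>models X. wm M * mass L' M A) / (\<Sum>M\<in>models X. wm M * mass L' M UNIV)"
 unfolding ev sum_distrib_left[symmetric] using k by simp
qed

lemma det_pos_of_coercive:
 assumes c: "coercive m l u V" and k: "k ~= 0"
 shows "det (k \<cdot>\<^sub>m V) ~= 0"
proof -
 note cm = coercive_minv[OF c]
 have V: "V : cmat m m" using c by (simp add: coercive_def)
 have "det V * det (minv V) = det (V * minv V)" using V cm(1) by (simp add: det_mult)
 also have "... = 1" using cm by simp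
 finally have "det V ~= 0" by auto
 then show ?thesis using V k by (simp add: det_smult)
qed

lemma q_lik_eq:
 assumes V: "coercive m l u (Vn X D)"
 shows "\<exists>k>0. ALL th:\<Theta>. q_lik n X D th = k * Lq D th"
proof (intro exI conjI ballI)
 let ?k = "det ((2 * pi / real n) \<cdot>\<^sub>m Vn X D) powr (- 1 / 2)"
 have "det ((2 * pi / real n) \<cdot>\<^sub>m Vn X D) ~= 0" using n_pos by (intro det_pos_of_coercive[OF V]) simp
 then show "0 < ?k" by simp
 fix th assume th: "th : \<Theta>"
 let ?g = "gbar n X D th"
 have g: "?g : cvec m" by (simp add: gbar_def)
 have iV: "minv (Vn X D) : cmat m m" by (rule coercive_minv(1)[OF V])
 have "Y D th .* (minv (Vn X D) *. Y D th) = (s * s) * (?g .* (minv (Vn X D) *. ?g))"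
 unfolding Y_def clamp_id[OF th] using g iV by (simp add: mult_mat_vec[of _ m m])
 then have "Y D th .* (minv (Vn X D) *. Y D th) = real n * (?g .* (minv (Vn X D) *. ?g))" by (simp only: s(3))
 then show "q_lik n X D th = ?k * Lq D th" by (simp add: q_lik_def Lq_def)
qed

definition Lp :: "(nat => 'd) => (nat => real) => real" where
 "Lp D th = exp (- kp D / 2) * Pt (theta_hat X D) th"

lemma p_lik_eq: "\<exists>k>0. ALL th:\<Theta>. p_lik X D th = k * Lp D th"
proof (intro exI conjI ballI)
 let ?j = "jint t0 / (s ^ p * jI * kap)"
 have j: "0 < ?j" using jint_pos[of t0] jI_pos kap_pos s by simp
 show "0 < exp (kp D / 2) / ?j" by (rule divide_pos_pos[OF exp_gt_zero j])
 fix th assume th: "th : \<Theta>"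
 have cancel: "a / j * (b * (e * j)) = e" if "0 < j" "a * b = 1" for a b e j :: real
 proof -
 have "a / j * (b * (e * j)) = (a * b) * e" using that(1) by simp
 then show ?thesis using that(2) by simp
 qed
 have "exp (kp D / 2) / ?j * Lp D th = exp (kp D / 2) / ?j * (exp (- kp D / 2) * (est_dens X (theta_hat X D) th * ?j))"
 using th by (simp only: Lp_def Pt_def clamp_id)
 also have "... = est_dens X (theta_hat X D) th" by (rule cancel[OF j]) (simp add: exp_add[symmetric])
 finally show "p_lik X D th = exp (kp D / 2) / ?j * Lp D th" by (simp add: p_lik_def)
qed

lemma measurable_Lp: "Lp D : bmb"
 unfolding Lp_def[abs_def] by (intro borel_measurable_times borel_measurable_const measurable_Pt_1)

lemma Lp_nonneg: "0 <= Lp D th" by (simp add: Lp_def Pt_nonneg)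

lemma Lp_psi_le: "\<bar>Lp D th - psi D th\<bar> <= \<bar>Pt (theta_hat X D) th - psit D th\<bar>"
proof -
 have "Lp D th - psi D th = exp (- kp D / 2) * (Pt (theta_hat X D) th - psit D th)"
 by (simp add: Lp_def psi_factor right_diff_distrib)
 then have "\<bar>Lp D th - psi D th\<bar> = exp (- kp D / 2) * \<bar>Pt (theta_hat X D) th - psit D th\<bar>" by (simp add: abs_mult)
 also have "... <= 1 * \<bar>Pt (theta_hat X D) th - psit D th\<bar>" using kp_nonneg[of D] by (intro mult_right_mono) auto
 finally show ?thesis by simp
qed

lemma Lp_le_Pt: "Lp D th <= Pt (theta_hat X D) th"
 using mult_right_mono[of "exp (- kp D / 2)" 1 "Pt (theta_hat X D) th"] kp_nonneg[of D] Pt_nonneg by (simp add: Lp_def)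

subsection \<open>Closeness of masses\<close>

lemma mass_close:
 assumes M: "M : models X" and L: "L : bmb" and g: "g : bmb"
 and gi: "integrable (plaw M) g" and A: "A : sets borel"
 and d: "(NI (plaw M) (%th. enn \<bar>L th - g th\<bar>)) <= enn b" and b: "0 <= b"
 shows "integrable (plaw M) L" "\<bar>mass L M A - mass g M A\<bar> <= b"
proof -
 have di: "integrable (plaw M) (%th. L th - g th)"
 proof (rule integrableI_bounded)
 show "(NI (plaw M) (%th. enn (norm (L th - g th)))) < \<infinity>" using d by (simp add: le_less_trans)
 qed (use L g in simp)
 have "integrable (plaw M) (%th. (L th - g th) + g th)" using di gi by (rule Bochner_Integration.integrable_add)
 then show Li: "integrable (plaw M) L" by simp
 have As: "A : sets (plaw M)" using A by simp
 have iL: "integrable (plaw M) (%th. indicator A th * L th)" and ig: "integrable (plaw M) (%th. indicator A th * g th)"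
 using integrable_real_mult_indicator[OF As Li] integrable_real_mult_indicator[OF As gi] by (simp_all add: mult.commute)
 have "mass L M A - mass g M A = (\<integral>th. indicator A th * L th - indicator A th * g th \<partial>plaw M)"
 using iL ig by (simp add: mass_def)
 then have "\<bar>mass L M A - mass g M A\<bar> <= (\<integral>th. \<bar>indicator A th * L th - indicator A th * g th\<bar> \<partial>plaw M)"
 by (simp only: integral_abs_bound)
 also have "... <= (\<integral>th. \<bar>L th - g th\<bar> \<partial>plaw M)"
 using iL ig di by (intro integral_mono) (auto simp: indicator_def)
 also have "... <= b"
 proof -
 have "enn (\<integral>th. \<bar>L th - g th\<bar> \<partial>plaw M) = (NI (plaw M) (%th. enn \<bar>L th - g th\<bar>))"
 using di by (intro nn_integral_eq_integral[symmetric]) auto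
 then have "enn (\<integral>th. \<bar>L th - g th\<bar> \<partial>plaw M) <= enn b" using d by (simp only:)
 then show ?thesis using b by (simp only: ennreal_le_iff)
 qed
 finally show "\<bar>mass L M A - mass g M A\<bar> <= b" .
qed

lemma integrable_psi: "M : models X ==> integrable (plaw M) (psi D)"
proof -
 assume M: "M : models X"
 interpret Q: prob_space "plaw M" by (rule prob_plaw[OF M])
 show ?thesis
 by (rule Q.integrable_const_bound[of _ 1]) (use psi_le_1[of D] psi_pos[of D] measurable_psi[of D] in \<open>auto simp: less_imp_le\<close>)
qed

lemma mass_nonneg: "(\<And>th. 0 <= L th) ==> 0 <= mass L M A"
 unfolding mass_def by (intro integral_nonneg_AE AE_I2 mult_nonneg_nonneg) auto

lemma mass_mono:
 assumes M: "M : models X" and L: "integrable (plaw M) L" "\<And>th. 0 <= L th" and A: "A : sets borel"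
 shows "mass L M A <= mass L M UNIV"
proof -
 have As: "A : sets (plaw M)" using A by simp
 show ?thesis unfolding mass_def using integrable_real_mult_indicator[OF As L(1)] L
 by (intro integral_mono) (auto simp: indicator_def mult.commute)
qed

text \<open>The error on a model that contains the true one is measured relative to the order of its mass; a
 model that misses a coordinate must be negligible even against the full model with one more
 coordinate.\<close>

definition approx :: "((nat => real) => real) => (nat => 'd) => real => bool" where
 "approx L D ep \<longleftrightarrow> (ALL M:models X.
 (Tm <= M --> (NI (plaw M) (%th. enn \<bar>L th - psi D th\<bar>)) <= enn (ep / s ^ card M)) &
 (\<not> Tm <= M --> (NI (plaw M) (%th. enn (L th))) <= enn (ep / s ^ (p + 1))))"

definition psi_range :: "real => real => (nat => 'd) => bool" where
 "psi_range c U D \<longleftrightarrow> (ALL M:models X. Tm <= M -->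
 enn (c / s ^ card M) <= (NI (plaw M) (%th. enn (psi D th))) &
 (NI (plaw M) (%th. enn (psi D th))) <= enn (U / s ^ card M))"

lemma psi_range_mass:
 assumes r: "psi_range c U D" and M: "M : models X" "Tm <= M" and c: "0 <= c" "0 <= U"
 shows "c / s ^ card M <= mass (psi D) M UNIV" "mass (psi D) M UNIV <= U / s ^ card M"
proof -
 have "(NI (plaw M) (%th. enn (psi D th))) = enn (mass (psi D) M UNIV)"
 unfolding mass_def using integrable_psi[OF M(1), of D] psi_pos[of D] by (subst nn_integral_eq_integral) (auto simp: less_imp_le)
 moreover have "0 <= mass (psi D) M UNIV" using psi_pos[of D] by (intro mass_nonneg) (simp add: less_imp_le)
 ultimately show "c / s ^ card M <= mass (psi D) M UNIV" "mass (psi D) M UNIV <= U / s ^ card M"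
 using r M c s by (auto simp: psi_range_def ennreal_le_iff)
qed

text \<open>Masses of the limit, with the models that miss a relevant coordinate discarded.\<close>

definition pmass :: "(nat => 'd) => nat set => (nat => real) set => real" where
 "pmass D M A = (if Tm <= M then mass (psi D) M A else 0)"

lemma pmass_nonneg: "0 <= pmass D M A"
 using mass_nonneg[of "psi D" M A] psi_pos[of D] by (simp add: pmass_def less_imp_le)

lemma approx_mass:
 assumes L: "L : bmb" "\<And>th. 0 <= L th" and ap: "approx L D ep" "0 <= ep" and A: "A : sets borel" and M: "M : models X"
 shows "\<bar>mass L M A - pmass D M A\<bar> <= (if Tm <= M then ep / s ^ card M else ep / s ^ (p + 1))"
proof (cases "Tm <= M")
 case True
 show ?thesis using True s mass_close(2)[OF M L(1) measurable_psi integrable_psi[OF M] A, of D "ep / s ^ card M"] ap M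
 by (simp add: approx_def pmass_def)
next
 case False
 have b: "(NI (plaw M) (%th. enn \<bar>L th - 0\<bar>)) <= enn (ep / s ^ (p + 1))" using ap False M L(2) by (simp add: approx_def)
 have "\<bar>mass L M A - mass (%_. 0) M A\<bar> <= ep / s ^ (p + 1)"
 by (rule mass_close(2)[OF M L(1) _ _ A b]) (use ap s in auto)
 then show ?thesis using False by (simp add: pmass_def mass_def)
qed

lemma models_rr: "M : models X ==> M' : models X ==> wm M' <= rr * wm M"
 using model_ratio[of M M'] model_pos[of M] by (simp add: pos_divide_le_eq)

lemma rr_ge_1: "1 <= rr"
proof -
 have f: "full_model X : models X" by (simp add: models_def full_model_def)
 show ?thesis using model_ratio[OF f f] model_pos[OF f] by simp
qed

lemma sum_models_le:
 assumes J: "J <= models X" and m1: "m1 : models X" and y: "\<And>M. M : J ==> x M <= wm M * y" "0 <= y"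
 shows "(\<Sum>M\<in>J. x M) <= 2 ^ N0 * rr * (wm m1 * y)"
proof -
 have "(\<Sum>M\<in>J. x M) <= (\<Sum>M\<in>J. rr * (wm m1 * y))"
 proof (rule sum_mono)
 fix M assume M: "M : J"
 have "x M <= wm M * y" by (rule y(1)[OF M])
 also have "... <= (rr * wm m1) * y" using M J y(2) by (intro mult_right_mono models_rr m1) auto
 finally show "x M <= rr * (wm m1 * y)" by (simp add: mult.assoc)
 qed
 also have "... = real (card J) * (rr * (wm m1 * y))" by simp
 also have "... <= 2 ^ N0 * (rr * (wm m1 * y))"
 using model_pos[OF m1] rr_ge_1 y(2) by (intro card_models_le J) auto
 finally show ?thesis by (simp add: mult.assoc)
qed

definition closeness :: "real => real => real" where "closeness ep c = ep / c * (1 + 2 ^ N0 * rr)"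

text \<open>Each supermodel of the true one has relative error ep/c; the other models are negligible against
 the single model m1, as the prior ratios are bounded.\<close>

lemma sum_close:
 assumes J: "J <= models X" and m1: "m1 : J" "Tm <= m1" and r: "psi_range c U D" and c: "0 < c" "0 <= U" "0 <= ep"
 and xy: "\<And>M. M : J ==> \<bar>x M - y M\<bar> <= (if Tm <= M then ep / s ^ card M else ep / s ^ (p + 1))"
 shows "\<bar>(\<Sum>M\<in>J. wm M * x M) - (\<Sum>M\<in>J. wm M * y M)\<bar> <= closeness ep c * (\<Sum>M\<in>J. wm M * pmass D M UNIV)"
proof -
 let ?T = "{M\<in>J. Tm <= M}"
 have fJ: "finite J" using J finite_models by (rule finite_subset)
 have w: "0 < wm M" if "M : J" for M using that J by (intro model_pos) auto
 have pm: "0 <= wm M * pmass D M UNIV" if "M : J" for M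
 using w[OF that] pmass_nonneg[of D M UNIV] by simp
 have rng: "c / s ^ card M <= pmass D M UNIV" if "M : J" "Tm <= M" for M
 using psi_range_mass(1)[OF r _ that(2)] that J c by (auto simp: pmass_def)
 have "\<bar>(\<Sum>M\<in>J. wm M * x M) - (\<Sum>M\<in>J. wm M * y M)\<bar> <= (\<Sum>M\<in>J. \<bar>wm M * x M - wm M * y M\<bar>)"
 unfolding sum_subtractf[symmetric] by (rule sum_abs)
 also have "... <= (\<Sum>M\<in>J. ep / c * (wm M * pmass D M UNIV) + (if Tm <= M then 0 else wm M * (ep / s ^ (p + 1))))"
 proof (rule sum_mono)
 fix M assume M: "M : J"
 have "\<bar>wm M * x M - wm M * y M\<bar> = wm M * \<bar>x M - y M\<bar>" using w[OF M] by (simp add: abs_mult flip: right_diff_distrib)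
 also have "... <= wm M * (if Tm <= M then ep / s ^ card M else ep / s ^ (p + 1))"
 using xy[OF M] w[OF M] by (intro mult_left_mono) auto
 also have "... <= ep / c * (wm M * pmass D M UNIV) + (if Tm <= M then 0 else wm M * (ep / s ^ (p + 1)))"
 proof (cases "Tm <= M")
 case True
 have "wm M * (ep / s ^ card M) = ep / c * (wm M * (c / s ^ card M))" using c by simp
 also have "... <= ep / c * (wm M * pmass D M UNIV)" using rng[OF M True] w[OF M] c by (intro mult_left_mono) auto
 finally show ?thesis using True by simp
 qed (simp add: pmass_def)
 finally show "\<bar>wm M * x M - wm M * y M\<bar> <= ep / c * (wm M * pmass D M UNIV) + (if Tm <= M then 0 else wm M * (ep / s ^ (p + 1)))" .
 qed
 also have "... = ep / c * (\<Sum>M\<in>J. wm M * pmass D M UNIV) + (\<Sum>M\<in>J. if Tm <= M then 0 else wm M * (ep / s ^ (p + 1)))"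
 by (simp add: sum.distrib sum_distrib_left)
 finally have h1: "\<bar>(\<Sum>M\<in>J. wm M * x M) - (\<Sum>M\<in>J. wm M * y M)\<bar> <= ep / c * (\<Sum>M\<in>J. wm M * pmass D M UNIV) +
 (\<Sum>M\<in>J. if Tm <= M then 0 else wm M * (ep / s ^ (p + 1)))" .
 have h2: "(\<Sum>M\<in>J. if Tm <= M then 0 else wm M * (ep / s ^ (p + 1))) <= 2 ^ N0 * rr * (wm m1 * (ep / s ^ (p + 1)))"
 using J m1 w c s by (intro sum_models_le) (auto intro!: mult_nonneg_nonneg simp: less_imp_le)
 have "wm m1 * (ep / s ^ (p + 1)) <= wm m1 * (ep / s ^ card m1)"
 proof -
 have "card m1 <= p + 1" using models_finite(3)[of m1] m1(1) J by auto
 then have "s ^ card m1 <= s ^ (p + 1)" using s by (intro power_increasing) auto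
 then show ?thesis using w[OF m1(1)] c s by (intro mult_left_mono divide_left_mono) auto
 qed
 also have "wm m1 * (ep / s ^ card m1) = ep / c * (wm m1 * (c / s ^ card m1))" using c by simp
 also have "... <= ep / c * (wm m1 * pmass D m1 UNIV)" using rng[OF m1] w[OF m1(1)] c by (intro mult_left_mono) auto
 also have "... <= ep / c * (\<Sum>M\<in>J. wm M * pmass D M UNIV)"
 proof (rule mult_left_mono)
 show "wm m1 * pmass D m1 UNIV <= (\<Sum>M\<in>J. wm M * pmass D M UNIV)"
 using m1(1) fJ pm by (intro member_le_sum) auto
 qed (use c in simp)
 finally have h3: "2 ^ N0 * rr * (wm m1 * (ep / s ^ (p + 1))) <= 2 ^ N0 * rr * (ep / c * (\<Sum>M\<in>J. wm M * pmass D M UNIV))"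
 using rr_ge_1 by (intro mult_left_mono) auto
 have "\<bar>(\<Sum>M\<in>J. wm M * x M) - (\<Sum>M\<in>J. wm M * y M)\<bar> <=
 ep / c * (\<Sum>M\<in>J. wm M * pmass D M UNIV) + 2 ^ N0 * rr * (ep / c * (\<Sum>M\<in>J. wm M * pmass D M UNIV))"
 using h1 h2 h3 by linarith
 then show ?thesis by (simp add: closeness_def algebra_simps)
qed

lemma true_in_models: "Tm : models X" and full_in_models: "full_model X : models X"
 by (auto simp: models_def true_model_def full_model_def)

lemma evidence_lower:
 assumes r: "psi_range c U D" and c: "0 < c" "0 <= U" and M: "M : J" "J <= models X" "Tm <= M"
 shows "wm M * (c / s ^ card M) <= (\<Sum>M\<in>J. wm M * pmass D M UNIV)"
proof -
 have Mm: "M : models X" using M by auto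
 have "wm M * (c / s ^ card M) <= wm M * pmass D M UNIV"
 using psi_range_mass(1)[OF r Mm M(3)] c M(3) model_pos[OF Mm] by (intro mult_left_mono) (auto simp: pmass_def)
 also have "... <= (\<Sum>M\<in>J. wm M * pmass D M UNIV)"
 using M model_pos finite_subset[OF M(2) finite_models] pmass_nonneg[of D]
 by (intro member_le_sum) (auto intro!: mult_nonneg_nonneg less_imp_le[OF model_pos])
 finally show ?thesis .
qed

lemma evidence_pos:
 assumes r: "psi_range c U D" and c: "0 < c" "0 <= U" and M: "M : J" "J <= models X" "Tm <= M"
 shows "0 < (\<Sum>M\<in>J. wm M * pmass D M UNIV)"
proof -
 have "0 < wm M * (c / s ^ card M)" using model_pos[of M] M c s by (intro mult_pos_pos divide_pos_pos) auto
 then show ?thesis using evidence_lower[OF r c M] by linarith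
qed

lemma approx_sum_close:
 assumes L: "L : bmb" "\<And>th. 0 <= L th" and ap: "approx L D ep" "0 <= ep" and A: "A : sets borel"
 and r: "psi_range c U D" and c: "0 < c" "0 <= U" and J: "M1 : J" "J <= models X" "Tm <= M1"
 shows "\<bar>(\<Sum>M\<in>J. wm M * mass L M A) - (\<Sum>M\<in>J. wm M * pmass D M A)\<bar> <= closeness ep c * (\<Sum>M\<in>J. wm M * pmass D M UNIV)"
 by (rule sum_close[OF J(2,1,3) r c ap(2)], rule approx_mass[OF L ap A]) (use J in blast)

lemma closeness_nonneg: "0 < c ==> 0 <= ep ==> 0 <= closeness ep c"
 using rr_ge_1 by (simp add: closeness_def)

lemma posterior_distance:
 assumes L1: "L1 : bmb" "\<And>th. 0 <= L1 th" "approx L1 D ep"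
 and L2: "L2 : bmb" "\<And>th. 0 <= L2 th" "approx L2 D ep"
 and r: "psi_range c U D" and c: "0 < c" "0 <= U" "0 <= ep" "closeness ep c <= 1/4" and A: "A : sets borel"
 shows "\<bar>(\<Sum>M\<in>models X. wm M * mass L1 M A) / (\<Sum>M\<in>models X. wm M * mass L1 M UNIV) -
 (\<Sum>M\<in>models X. wm M * mass L2 M A) / (\<Sum>M\<in>models X. wm M * mass L2 M UNIV)\<bar> <= 8 * closeness ep c"
proof -
 note e0 = closeness_nonneg[OF c(1,3)]
 note J = true_in_models subset_refl[of "models X"] subset_refl[of "Tm"]
 let ?E = "\<Sum>M\<in>models X. wm M * pmass D M UNIV" and ?z = "\<Sum>M\<in>models X. wm M * pmass D M A"
 have E: "0 < ?E" by (rule evidence_pos[OF r c(1,2) J])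
 have z: "0 <= ?z" "?z <= ?E"
 proof -
 show "0 <= ?z" using model_pos pmass_nonneg by (intro sum_nonneg mult_nonneg_nonneg) (auto simp: less_imp_le)
 have "pmass D M A <= pmass D M UNIV" if "M : models X" for M
 using mass_mono[OF that integrable_psi[OF that] _ A, of D] psi_pos[of D] by (simp add: pmass_def less_imp_le)
 then show "?z <= ?E" using model_pos by (intro sum_mono mult_left_mono) (auto simp: less_imp_le)
 qed
 have a1: "\<bar>(\<Sum>M\<in>models X. wm M * mass L1 M B) - (\<Sum>M\<in>models X. wm M * pmass D M B)\<bar> <= closeness ep c * ?E"
 if "B : sets borel" for B by (rule approx_sum_close[OF L1 c(3) that r c(1,2) J])
 have a2: "\<bar>(\<Sum>M\<in>models X. wm M * mass L2 M B) - (\<Sum>M\<in>models X. wm M * pmass D M B)\<bar> <= closeness ep c * ?E"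
 if "B : sets borel" for B by (rule approx_sum_close[OF L2 c(3) that r c(1,2) J])
 have c2: "closeness ep c <= 1/2" using c(4) by simp
 have U: "UNIV : sets (borel :: (nat => real) measure)" by simp
 have tri: "\<bar>x - y\<bar> <= a + b" if "\<bar>x - z\<bar> <= a" "\<bar>y - z\<bar> <= b" for x y z a b :: real using that by linarith
 show ?thesis
 using tri[OF normalised_diff_le[OF E e0 c2 a1[OF A] z a1[OF U]] normalised_diff_le[OF E e0 c2 a2[OF A] z a2[OF U]]] by simp
qed

text \<open>Adding one superfluous coordinate gives a competitor of relative mass exactly of order 1/s, and no
 other wrong model has larger order.\<close>

lemma wrong_posterior_rate:
 assumes L1: "L1 : bmb" "\<And>th. 0 <= L1 th" "approx L1 D ep"
 and L2: "L2 : bmb" "\<And>th. 0 <= L2 th" "approx L2 D ep"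
 and r: "psi_range c U D" and c: "0 < c" "0 < U" "0 <= ep" "closeness ep c <= 1/4"
 and nf: "Tm ~= full_model X"
 defines "q == (\<Sum>M\<in>models X - {Tm}. wm M * mass L1 M UNIV) / (\<Sum>M\<in>models X. wm M * mass L1 M UNIV)"
 and "p' == (\<Sum>M\<in>models X - {Tm}. wm M * mass L2 M UNIV) / (\<Sum>M\<in>models X. wm M * mass L2 M UNIV)"
 shows "\<bar>q / p' - 1\<bar> <= 8 * closeness ep c" "0 < p'"
 "c / (2 * (2 ^ N0 * rr * U)) / s <= p'" "p' <= 2 * (2 ^ N0 * rr * U) / c / s"
proof -
 note e0 = closeness_nonneg[OF c(1,3)]
 have U0: "0 <= U" using c by simp
 let ?M0 = "Tm" and ?K = "2 ^ N0 * rr"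
 have K: "0 < ?K" using rr_ge_1 by simp
 obtain j where j: "j < p" "j \<notin> ?M0" using nf by (auto simp: true_model_def full_model_def)
 define M1 where "M1 = insert j ?M0"
 have fin: "finite ?M0" using models_finite(1)[OF true_in_models] .
 have M1: "M1 : models X" "?M0 <= M1" "M1 ~= ?M0" "card M1 = card ?M0 + 1"
 using true_in_models j fin by (auto simp: M1_def models_def)
 let ?J = "models X - {?M0}"
 have J: "M1 : ?J" "?J <= models X" "?M0 <= M1" using M1 by auto
 note I = true_in_models subset_refl[of "models X"] subset_refl[of ?M0]
 define S where "S = (\<Sum>M\<in>?J. wm M * pmass D M UNIV)"
 define E where "E = (\<Sum>M\<in>models X. wm M * pmass D M UNIV)"
 have S: "0 < S" unfolding S_def by (rule evidence_pos[OF r c(1) U0 J])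
 have E: "0 < E" unfolding E_def by (rule evidence_pos[OF r c(1) U0 I])
 have U: "UNIV : sets (borel :: (nat => real) measure)" by simp
 note c1 = approx_sum_close[OF L1 c(3) U r c(1) U0 J, folded S_def] and c2 = approx_sum_close[OF L1 c(3) U r c(1) U0 I, folded E_def]
 and c3 = approx_sum_close[OF L2 c(3) U r c(1) U0 J, folded S_def] and c4 = approx_sum_close[OF L2 c(3) U r c(1) U0 I, folded E_def]
 note R = ratio_of_perturbed[OF S E e0 c(4) c1 c2 c3 c4, folded q_def p'_def]
 show "\<bar>q / p' - 1\<bar> <= 8 * closeness ep c" by (rule R(1))
 show "0 < p'" by (rule R(2))
 have pu: "pmass D M UNIV <= U / s ^ card ?M0" if "M : models X" for M
 proof (cases "?M0 <= M")
 case True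
 have "pmass D M UNIV <= U / s ^ card M" using psi_range_mass(2)[OF r that True] c True by (simp add: pmass_def)
 also have "... <= U / s ^ card ?M0"
 using s c card_mono[OF models_finite(1)[OF that] True] by (intro divide_left_mono power_increasing) auto
 finally show ?thesis .
 qed (use s c in \<open>simp add: pmass_def\<close>)
 have pu1: "pmass D M UNIV <= U / s ^ (card ?M0 + 1)" if "M : ?J" for M
 proof (cases "?M0 <= M")
 case True
 then have "card ?M0 < card M" using that models_finite(1)[of M] by (intro psubset_card_mono) auto
 then have le: "card ?M0 + 1 <= card M" by simp
 have "pmass D M UNIV <= U / s ^ card M" using psi_range_mass(2)[OF r _ True] that c True by (simp add: pmass_def)
 also have "... <= U / s ^ (card ?M0 + 1)"
 using s c le by (intro divide_left_mono power_increasing) auto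
 finally show ?thesis .
 qed (use s c in \<open>simp add: pmass_def\<close>)
 define k where "k = s ^ card ?M0"
 have k: "0 < k" "s ^ (card ?M0 + 1) = s * k" using s by (auto simp: k_def)
 have w0: "0 < wm ?M0" "0 < wm M1" using model_pos true_in_models M1 by auto
 have Su: "S <= ?K * (wm ?M0 * (U / (s * k)))"
 unfolding S_def k(2)[symmetric]
 by (rule sum_models_le[OF J(2) true_in_models mult_left_mono[OF pu1 less_imp_le[OF model_pos]]]) (use J c s in auto)
 have El: "wm ?M0 * (c / k) <= E" unfolding E_def k_def by (rule evidence_lower[OF r c(1) U0 I])
 have Sl: "wm M1 * (c / (s * k)) <= S" using evidence_lower[OF r c(1) U0 J] unfolding S_def M1(4) k(2) .
 have Eu: "E <= ?K * (wm M1 * (U / k))"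
 unfolding E_def k_def
 by (rule sum_models_le[OF subset_refl M1(1) mult_left_mono[OF pu less_imp_le[OF model_pos]]]) (use c s in auto)
 have "S / E <= (?K * (wm ?M0 * (U / (s * k)))) / (wm ?M0 * (c / k))"
 using Su El w0 k c S by (intro frac_le) auto
 also have "... = ?K * U / c / s" using w0 k c s(1) by (simp add: field_simps)
 finally have "S / E <= ?K * U / c / s" .
 then have "2 * (S / E) <= 2 * (?K * U) / c / s" by simp
 then show "p' <= 2 * (?K * U) / c / s" using R(4) by linarith
 have "c / (?K * U) / s = (wm M1 * (c / (s * k))) / (?K * (wm M1 * (U / k)))" using w0 k c s(1) K by (simp add: field_simps)
 also have "... <= S / E" using Sl Eu E less_imp_le[OF S] by (intro frac_le) auto
 finally have "c / (?K * U) / s <= S / E" .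
 then have h: "1/2 * (c / (?K * U) / s) <= 1/2 * (S / E)" by (rule mult_left_mono) simp
 have "c / (2 * (?K * U)) / s = 1/2 * (c / (?K * U) / s)" by simp
 also note h
 also note R(3)
 finally show "c / (2 * (?K * U)) / s <= p'" .
qed

lemma mass_le:
 assumes M: "M : models X" and L: "L : bmb" "\<And>th. 0 <= L th"
 and b: "(NI (plaw M) (%th. enn (L th))) <= enn B" "0 <= B"
 shows "mass L M UNIV <= B"
proof -
 have "(NI (plaw M) (%th. enn \<bar>L th - 0\<bar>)) <= enn B" using b L(2) by simp
 from mass_close(2)[OF M L(1) _ _ _ this b(2), of UNIV] show ?thesis by (simp add: mass_def)
qed

lemma mass_ge:
 assumes M: "M : models X" and L: "L : bmb" "\<And>th. 0 <= L th"
 and g: "g : bmb" "integrable (plaw M) g" "\<And>th. 0 <= g th"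
 and d: "(NI (plaw M) (%th. enn \<bar>L th - g th\<bar>)) <= enn b" "0 <= b"
 and v: "enn v <= (NI (plaw M) (%th. enn (g th)))"
 shows "v - b <= mass L M UNIV"
proof -
 have "(NI (plaw M) (%th. enn (g th))) = enn (mass g M UNIV)"
 unfolding mass_def using g by (subst nn_integral_eq_integral) auto
 then have "enn v <= enn (mass g M UNIV)" using v by simp
 then have "v <= mass g M UNIV" using mass_nonneg[of g M UNIV] g(3) by (simp add: ennreal_le_iff)
 then show ?thesis using mass_close(2)[OF M L(1) g(1,2) _ d, of UNIV] by (simp add: abs_le_iff)
qed

text \<open>Every wrong model misses a relevant coordinate, so B bounds its mass.\<close>

lemma wrong_posterior_full:
 assumes full: "Tm = full_model X" and L: "L : bmb" "\<And>th. 0 <= L th"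
 and B: "\<And>M. M : models X ==> \<not> Tm <= M ==> (NI (plaw M) (%th. enn (L th))) <= enn B" "0 <= B"
 and v: "0 < v" "v / s ^ p <= mass L (full_model X) UNIV"
 shows "(\<Sum>M\<in>models X - {Tm}. wm M * mass L M UNIV) / (\<Sum>M\<in>models X. wm M * mass L M UNIV) <= 2 ^ N0 * rr * (B * s ^ p / v)"
proof -
 let ?F = "full_model X"
 have w: "0 < wm ?F" using model_pos full_in_models by simp
 have m: "mass L M UNIV <= B" if "M : models X - {Tm}" for M
 proof (rule mass_le[OF _ L B(1) B(2)])
 show "M : models X" using that by simp
 show "\<not> Tm <= M" using that full by (auto simp: models_def full_model_def)
 qed (use that in auto)
 have S: "(\<Sum>M\<in>models X - {Tm}. wm M * mass L M UNIV) <= 2 ^ N0 * rr * (wm ?F * B)"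
 by (rule sum_models_le[OF _ full_in_models mult_left_mono[OF m less_imp_le[OF model_pos]]]) (use B(2) in auto)
 have "wm ?F * (v / s ^ p) <= wm ?F * mass L ?F UNIV" using v w by (intro mult_left_mono) auto
 also have "... <= (\<Sum>M\<in>models X. wm M * mass L M UNIV)"
 using full_in_models finite_models mass_nonneg[OF L(2)]
 by (intro member_le_sum) (auto intro!: mult_nonneg_nonneg less_imp_le[OF model_pos])
 finally have E: "wm ?F * (v / s ^ p) <= (\<Sum>M\<in>models X. wm M * mass L M UNIV)" .
 have "(\<Sum>M\<in>models X - {Tm}. wm M * mass L M UNIV) / (\<Sum>M\<in>models X. wm M * mass L M UNIV) <=
 (2 ^ N0 * rr * (wm ?F * B)) / (wm ?F * (v / s ^ p))"
 using S E w v s B(2) rr_ge_1 by (intro frac_le) auto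
 also have "... = 2 ^ N0 * rr * (B * s ^ p / v)" using w v s(1) by (simp add: field_simps)
 finally show ?thesis .
qed

end

lemma eventually_divide_less: "0 < (e::real) ==> \<forall>\<^sub>F C in at_top. a / C < e"
proof -
 assume "0 < e"
 have "((%C::real. a / C) \<longlongrightarrow> 0) at_top"
 by (rule tendsto_divide_0[OF tendsto_const filterlim_at_top_imp_at_infinity[OF filterlim_ident]])
 then show ?thesis using \<open>0 < e\<close> by (rule order_tendstoD(2))
qed

lemma ex_small_multiple: "0 < (e::real) ==> \<exists>x>0. x <= 1 & b * x < e"
proof -
 assume e: "0 < e"
 define x where "x = min 1 (e / (2 * (\<bar>b\<bar> + 1)))"
 have x: "0 < x" "x <= 1" "x <= e / (2 * (\<bar>b\<bar> + 1))" using e by (auto simp: x_def)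
 have "b * x <= (\<bar>b\<bar> + 1) * (e / (2 * (\<bar>b\<bar> + 1)))" using x by (intro mult_mono) auto
 also have "... = e / 2"
 proof -
 have "c * (e / (2 * c)) = e / 2" if "0 < c" for c :: real using that by simp
 from this[of "\<bar>b\<bar> + 1"] show ?thesis by simp
 qed
 also have "... < e" using e by simp
 finally show ?thesis using x by blast
qed

lemma inverse_sqrt_tendsto_0: "(%n. 1 / sqrt (real n)) \<longlonglongrightarrow> 0" by real_asymp

lemma div_sqrt_powr_tendsto_0:
 assumes "0 < \<alpha>" "0 <= C" shows "(%n. (C / sqrt (real n)) powr \<alpha>) \<longlonglongrightarrow> 0"
proof -
 have "(%n. C / sqrt (real n)) \<longlonglongrightarrow> 0" using tendsto_mult[OF tendsto_const[of C] inverse_sqrt_tendsto_0] by simp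
 from tendsto_powr'[OF this tendsto_const[of \<alpha>]] assms show ?thesis by simp
qed

lemma eventually_less_sqrt: "0 < r ==> EV n. C < r * sqrt (real n)"
proof -
 assume r: "0 < r"
 have "filterlim (%n. sqrt (real n)) at_top sequentially" by real_asymp
 then have "EV n. C / r < sqrt (real n)" by (simp add: filterlim_at_top_dense)
 then show ?thesis by eventually_elim (use r in \<open>simp add: pos_divide_less_eq mult.commute\<close>)
qed

text \<open>Exponentially small terms are negligible at every polynomial rate that occurs.\<close>

lemma exp_beats_power:
 assumes c: "0 < c" and ep: "0 < ep"
 shows "EV n. ALL k<=N. a * exp (- c * real n) <= ep / sqrt (real n) ^ k"
proof -
 have "((%x. x ^ N / exp x) \<longlongrightarrow> 0) (at_top :: real filter)" by (rule tendsto_power_div_exp_0)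
 moreover have "filterlim (%n. c * real n) at_top sequentially"
 using c by (intro filterlim_tendsto_pos_mult_at_top[OF tendsto_const] filterlim_real_sequentially)
 ultimately have "(%n. (c * real n) ^ N / exp (c * real n)) \<longlonglongrightarrow> 0" by (rule filterlim_compose)
 from tendsto_mult[OF tendsto_const[of "\<bar>a\<bar> / c ^ N"] this]
 have "(%n. \<bar>a\<bar> / c ^ N * ((c * real n) ^ N / exp (c * real n))) \<longlonglongrightarrow> 0" by simp
 then have "EV n. \<bar>a\<bar> / c ^ N * ((c * real n) ^ N / exp (c * real n)) < ep" using ep by (rule order_tendstoD(2))
 then show ?thesis using eventually_gt_at_top[of 0]
 proof eventually_elim
 case (elim n)
 have n1: "1 <= real n" using elim by simp
 have e: "\<bar>a\<bar> * real n ^ N * exp (- c * real n) < ep"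
 using elim(1) c by (simp add: power_mult_distrib exp_minus field_simps)
 show ?case
 proof (intro allI impI)
 fix k assume k: "k <= N"
 have s1: "1 <= sqrt (real n)" "0 < sqrt (real n)" using n1 elim by auto
 have "sqrt (real n) ^ k <= sqrt (real n) ^ N" using k s1 by (intro power_increasing) auto
 also have "... <= real n ^ N" using s1 n1 real_le_lsqrt[of "real n" "real n"]
 by (intro power_mono) (auto simp: power2_eq_square real_sqrt_le_iff intro!: real_le_lsqrt)
 finally have sk: "sqrt (real n) ^ k <= real n ^ N" .
 have "a * exp (- c * real n) * sqrt (real n) ^ k <= \<bar>a\<bar> * exp (- c * real n) * real n ^ N"
 using sk s1 by (intro mult_mono) auto
 also have "... <= ep" using e by (simp add: mult_ac)
 finally show "a * exp (- c * real n) <= ep / sqrt (real n) ^ k" using s1 by (simp add: pos_le_divide_eq)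
 qed
 qed
qed

section \<open>Sequences of models\<close>

locale gmm_sequence =
 fixes X :: "nat => 'd gmm" and N0 :: nat and env :: "nat => 'd => real"
 and l u R r0 c1 K4 \<alpha> KF cpi c0 tmin rr :: real and \<tau> :: "nat => real"
 assumes reg: "EV n. rg n (X n) N0 (env n) l u R r0 c1 K4 \<alpha> KF cpi c0 tmin rr (\<tau> n)"
 and \<tau>: "\<tau> \<longlonglongrightarrow> 0"
 and weights: "\<And>dl. 0 < dl ==> wpa1 (%n. sample_law n (X n)) (%n D. rg.good_weight (X n) l u dl D)"
 and est: "\<And>dl. 0 < dl ==> wpa1 (%n. sample_law n (X n)) (%n D. rg.est_close n (X n) dl D)"
 and tay: "\<And>C. 0 < C ==> \<exists>KT. EV n. rg.taylor (X n) (C / sqrt (real n)) KT"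
 and lprior: "\<And>C. 0 < C ==> EV n. rg.local_prior n (X n) N0 c0 C"
begin

abbreviation "S n == rg n (X n) N0 (env n) l u R r0 c1 K4 \<alpha> KF cpi c0 tmin rr (\<tau> n)"
abbreviation "Om n == sample_law n (X n)"
abbreviation "tightn n == rg.tight n (X n) (env n)"
abbreviation "Lqn n == rg.Lq n (X n)"
abbreviation "Ptn n == rg.Pt n (X n)"
abbreviation "Lpn n == rg.Lp n (X n)"
abbreviation "psin n == rg.psi n (X n)"
abbreviation "psitn n == rg.psit n (X n)"
abbreviation "prior n == rg.plaw (X n)"
abbreviation "approxn n == rg.approx n (X n)"
abbreviation "cA == rg.cA l u c1 tmin"
abbreviation "cB == rg.cB N0 c1 KF tmin"
abbreviation "lA == rg.lA l u"
abbreviation "CH == rg.CH l u"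
abbreviation "rhomax == rg.rhomax N0 l u"
abbreviation "kmiss == rg.kmiss N0 l u tmin"

abbreviation "rt n == sqrt (real n)"
abbreviation "pg n == prob_ge (Om n)"
abbreviation "sp n == space (Om n)"
abbreviation "Tr n == true_model (X n)"
abbreviation "Fu n == full_model (X n)"
abbreviation "Mo n == models (X n)"
abbreviation "dp n == pdim (X n)"
abbreviation "mp n == model_prior (X n)"
abbreviation "GW n == rg.good_weight (X n) l u"
abbreviation "EC n == rg.est_close n (X n)"
abbreviation "Ma n == rg.mass (X n)"
abbreviation "PR n == rg.psi_range n (X n)"
abbreviation "Ph n D == Ptn n (theta_hat (X n) D)"
abbreviation "Pbd n D == rg.Pbound n (X n) (\<tau> n) (theta_hat (X n) D)"

abbreviation "dq n D M == (NI (prior n M) (%th. enn \<bar>Lqn n D th - psin n D th\<bar>))"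
abbreviation "nearq b n D == ALL M:Mo n. Tr n <= M --> dq n D M <= enn (b / rt n ^ card M)"
abbreviation "missq n D == ALL M:Mo n. \<not> Tr n <= M -->
 (NI (prior n M) (%th. enn (Lqn n D th))) <= enn (exp (- cA * real n) + exp (- cB * real n))"
abbreviation "Ptlim T b x n == ALL D:sp n. ALL M:Mo n. Tr n <= M --> tightn n D <= T\<^sup>2 --> EC n x D -->
 (AE th in prior n M. Pbd n D th) -->
 (NI (prior n M) (%th. enn \<bar>Ph n D th - psitn n D th\<bar>)) <= enn (b / rt n ^ card M)"
abbreviation "pm n L A == (\<Sum>M\<in>Mo n. mp n M * Ma n L M A) / (\<Sum>M\<in>Mo n. mp n M * Ma n L M UNIV)"

lemma ex_S: "\<exists>n. S n" using eventually_happens'[OF sequentially_bot reg] .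

lemma ev_prob: "EV n. prob_space (Om n)"
 using reg by eventually_elim (rule rg.prob_OM)

text \<open>Markov for the statistic that bounds both the score and the envelope in the sample.\<close>

lemma tightness:
 assumes dl: "0 < dl"
 obtains T where "0 < T" "EV n. pg n (%D. tightn n D <= T\<^sup>2) (1 - dl)"
proof
 obtain n1 where S1: "S n1" using ex_S by blast
 define B where "B = real N0 * u + KF + 1"
 have B: "0 < B" using rg.u_pos[OF S1] rg.KF_nonneg[OF S1] by (simp add: B_def add_nonneg_pos)
 let ?T = "sqrt (B / dl)"
 show "0 < ?T" using B dl by simp
 have T2: "?T\<^sup>2 = B / dl" using B dl by simp
 show "EV n. pg n (%D. tightn n D <= ?T\<^sup>2) (1 - dl)"
 using reg
 proof eventually_elim
 case (elim n)
 have "pg n (%D. enn (tightn n D) <= enn (B / dl)) (1 - dl)"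
 proof (rule prob_ge_Markov[OF rg.prob_OM[OF elim]])
 show "(%D. enn (tightn n D)) : borel_measurable (Om n)"
 by (rule mcomp[OF rg.measurable_tight[OF elim] measurable_ennreal])
 have "(NI (Om n) (%D. enn (tightn n D))) <= enn (real N0 * u + KF)" by (rule rg.nn_integral_tight[OF elim])
 also have "... <= enn (dl * (B / dl))" using dl by (intro ennreal_leI) (simp add: B_def)
 finally show "(NI (Om n) (%D. enn (tightn n D))) <= enn (dl * (B / dl))" .
 qed (use B dl in auto)
 then show ?case unfolding T2
 by (rule prob_ge_mono) (use B dl in \<open>auto simp: ennreal_le_iff\<close>)
 qed
qed

text \<open>Constants may depend on the bound T for the score, since T has to be chosen only after the target
 probability.\<close>

lemma wpa1_on_tight:
 assumes "\<And>T. 0 < T ==> wpa1 Om (%n D. tightn n D <= T\<^sup>2 --> E n D)"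
 shows "wpa1 Om E"
 unfolding wpa1_def
proof (intro allI impI)
 fix dl :: real assume dl: "dl > 0"
 obtain T where T: "0 < T" "EV n. pg n (%D. tightn n D <= T\<^sup>2) (1 - dl / 2)"
 using tightness[of "dl / 2"] dl by auto
 have "EV n. pg n (%D. tightn n D <= T\<^sup>2 --> E n D) (1 - dl / 2)"
 using assms[OF T(1)] dl by (simp add: wpa1_def)
 with T(2) ev_prob show "EV n. pg n (E n) (1 - dl)"
 proof eventually_elim
 case (elim n)
 show ?case by (rule prob_ge_mono[OF prob_ge_conj[OF elim(2,1,3)]]) auto
 qed
qed

lemma wpa1_prob_1:
 assumes "EV n. AE D in Om n. E n D" shows "wpa1 Om E"
 unfolding wpa1_def
proof (intro allI impI)
 fix dl :: real assume dl: "dl > 0"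
 show "EV n. pg n (E n) (1 - dl)"
 using assms ev_prob
 proof eventually_elim
 case (elim n)
 show ?case by (rule prob_ge_mono[OF prob_ge_AE[OF elim(2,1)]]) (use dl in auto)
 qed
qed

subsection \<open>The quasi-likelihood\<close>

text \<open>Order of the choices: the cut-off C from T and the target probability, then the Taylor constant,
 then the tolerances, then n.\<close>

lemma Lq_limit:
 assumes T: "0 < T" and ep: "0 < ep"
 shows "wpa1 Om (%n D. tightn n D <= T\<^sup>2 --> nearq ep n D)"
 unfolding wpa1_def
proof (intro allI impI)
 fix dl :: real assume dl: "dl > 0"
 obtain n1 where S1: "S n1" using ex_S by blast
 have lu: "0 < l" "0 < u" using rg.lu[OF S1] by auto
 note par = rg.c1[OF S1] rg.\<alpha>[OF S1]
 define et where "et = dl / (4 * 2 ^ N0)"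
 have et: "0 < et" "2 ^ N0 * (2 * et) = dl / 2" using dl by (auto simp: et_def)
 define a1 where "a1 = 2 * exp (rg.cq l u c1) * cpi * rg.tail_const N0 (rg.cq l u c1)"
 define e2 where "e2 = 2 * real N0 * exp (KF / (4 * T\<^sup>2)) * cpi * rg.tail_const N0 (rg.c2 N0 c1 / (2 * T))"
 have "\<forall>\<^sub>F C in at_top. 1 <= C & 2 * T / sqrt l <= C & 4 * (T + real N0 * KF / T) / c1 <= C & a1 / C < ep / 4 & e2 / C < ep * et / 4"
 using ep et by (intro eventually_conj eventually_ge_at_top eventually_divide_less) auto
 then obtain C where C: "1 <= C" "2 * T / sqrt l <= C" "4 * (T + real N0 * KF / T) / c1 <= C" "a1 / C < ep / 4" "e2 / C < ep * et / 4"
 using eventually_happens'[OF trivial_limit_at_top_linorder] by blast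
 have C2: "2 * T <= sqrt l * C" "4 * (T + real N0 * KF / T) <= c1 * C"
 using C(2,3) lu par by (simp_all add: pos_divide_le_eq mult.commute)
 obtain KT where KT: "EV n. rg.taylor (X n) ((C + 1) / rt n) KT"
 using tay[of "C + 1"] C by auto
 define K where "K = rg.KQ N0 l u T C KT"
 define a where "a = cpi * (2 * C) ^ N0"
 obtain x where x: "0 < x" "x <= 1" "(K * (1 + real N0) * a) * x < ep / 4" using ex_small_multiple[of "ep/4"] ep by auto
 let ?f = "%n. K * (x + real N0 * x + 1 / rt n) * a +
 K / x * ((real N0 * (K4 * (C / rt n) powr \<alpha>)\<^sup>2 * a + 1 / rt n) / et) + a1 / C + (e2 / C + 1 / rt n) / et"
 have "?f \<longlonglongrightarrow> K * (x + real N0 * x + 0) * a + K / x * ((real N0 * (K4 * 0)\<^sup>2 * a + 0) / et) + a1 / C + (e2 / C + 0) / et"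
 using et x C par by (intro tendsto_intros div_sqrt_powr_tendsto_0 inverse_sqrt_tendsto_0) auto
 moreover have "K * (x + real N0 * x + 0) * a + K / x * ((real N0 * (K4 * 0)\<^sup>2 * a + 0) / et) + a1 / C + (e2 / C + 0) / et < ep"
 proof -
 have "K * (x + real N0 * x + 0) * a = (K * (1 + real N0) * a) * x" by (simp add: algebra_simps)
 then have 1: "K * (x + real N0 * x + 0) * a < ep / 4" using x(3) by (simp only:)
 have 2: "(e2 / C + 0) / et < ep / 4" using divide_strict_right_mono[OF C(5) et(1)] et(1) by simp
 have 3: "K / x * ((real N0 * (K4 * 0)\<^sup>2 * a + 0) / et) = 0" by simp
 show ?thesis using 1 2 C(4) ep unfolding 3 by linarith
 qed
 ultimately have f: "EV n. ?f n < ep" by (rule order_tendstoD(2))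
 have gw: "EV n. pg n (%D. GW n x D) (1 - dl / 2)"
 using weights[OF x(1)] dl by (simp add: wpa1_def)
 show "EV n. pg n (%D. tightn n D <= T\<^sup>2 --> nearq ep n D) (1 - dl)"
 using reg KT f gw
 proof eventually_elim
 case (elim n)
 have n: "0 < n" by (rule rg.n_pos[OF elim(1)])
 have q: "rg.qval n N0 l u c1 K4 \<alpha> KF cpi T C KT x x et <= ep"
 using elim(3) unfolding rg.qval_def[OF elim(1)] rg.E1_def[OF elim(1)] rg.E2_def[OF elim(1)]
 by (simp add: K_def a_def a1_def e2_def mult_ac)
 have cs: "C < (C + 1) / rt n * rt n" using n by simp
 note pr = rg.Lq_psi_prob[OF elim(1,2) less_imp_le[OF x(1)] T x(1) et(1) C(1) cs C2]
 have pr2: "1 - dl <= 1 - (dl / 2 + 2 ^ N0 * (2 * et))" unfolding et(2) by simp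
 show ?case
 proof (rule prob_ge_mono[OF prob_ge_conj[OF rg.prob_OM[OF elim(1)] elim(4) pr] _ pr2], intro impI ballI)
 fix D M
 assume h: "GW n x D & (GW n x D & tightn n D <= T\<^sup>2 -->
 (ALL M:Mo n. Tr n <= M --> dq n D M <=
 enn (rg.qval n N0 l u c1 K4 \<alpha> KF cpi T C KT x x et / rt n ^ card M)))"
 "tightn n D <= T\<^sup>2" "M : Mo n" "Tr n <= M"
 then have "dq n D M <=
 enn (rg.qval n N0 l u c1 K4 \<alpha> KF cpi T C KT x x et / rt n ^ card M)" by blast
 also have "... <= enn (ep / rt n ^ card M)" using q by (intro ennreal_leI divide_right_mono) auto
 finally show "dq n D M <= enn (ep / rt n ^ card M)" .
 qed
 qed
qed

lemma Lq_missing_limit: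
 assumes T: "0 < T"
 shows "wpa1 Om (%n D. tightn n D <= T\<^sup>2 --> missq n D)"
 unfolding wpa1_def
proof (intro allI impI)
 fix dl :: real assume dl: "dl > 0"
 obtain n1 where S1: "S n1" using ex_S by blast
 note gp = rg.gm_pos[OF S1]
 let ?e0 = "rg.et0 N0 c1 tmin"
 have "(%n. KF / (real n * ?e0\<^sup>2)) \<longlonglongrightarrow> 0"
 proof -
 have "(%n. KF / ?e0\<^sup>2 * (1 / real n)) \<longlonglongrightarrow> KF / ?e0\<^sup>2 * 0" by (intro tendsto_intros lim_1_over_n)
 then show ?thesis by (simp add: mult.commute)
 qed
 moreover have "(%n. exp (- cB * real n)) \<longlonglongrightarrow> 0" using gp(5) by real_asymp
 ultimately have "(%n. KF / (real n * ?e0\<^sup>2) + 2 ^ N0 * (2 * real N0 * exp (- cB * real n))) \<longlonglongrightarrow> 0 + 2 ^ N0 * (2 * real N0 * 0)"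
 by (intro tendsto_intros)
 then have "(%n. KF / (real n * ?e0\<^sup>2) + 2 ^ N0 * (2 * real N0 * exp (- cB * real n))) \<longlonglongrightarrow> 0" by simp
 then have small: "EV n. KF / (real n * ?e0\<^sup>2) + 2 ^ N0 * (2 * real N0 * exp (- cB * real n)) < dl / 2"
 by (rule order_tendstoD(2)) (use dl in simp)
 have big: "EV n. T < rg.gm c1 tmin / 4 * rt n"
 using gp(1) by (intro eventually_less_sqrt) simp
 have gw: "EV n. pg n (%D. GW n 1 D) (1 - dl / 2)"
 using weights[of 1] dl by (simp add: wpa1_def)
 show "EV n. pg n (%D. tightn n D <= T\<^sup>2 --> missq n D) (1 - dl)"
 using reg small big gw
 proof eventually_elim
 case (elim n)
 have t: "T <= rt n * rg.gm c1 tmin / 4" using elim(3) by (simp add: mult.commute)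
 note pr = rg.Lq_missing_prob[OF elim(1) T t]
 show ?case
 by (rule prob_ge_mono[OF prob_ge_conj[OF rg.prob_OM[OF elim(1)] elim(4) pr]])
 (use elim(2) in \<open>auto simp: rg.good_weight_def[OF elim(1)]\<close>)
 qed
qed

lemma Lq_approx:
 assumes ep: "0 < ep"
 shows "wpa1 Om (%n D. approxn n (Lqn n D) D ep)"
proof (rule wpa1_on_tight)
 fix T :: real assume T: "0 < T"
 obtain n1 where S1: "S n1" using ex_S by blast
 have e: "EV n. ALL k<=N0 + 1. 1 * exp (- cA * real n) <= (ep / 2) / rt n ^ k"
 "EV n. ALL k<=N0 + 1. 1 * exp (- cB * real n) <= (ep / 2) / rt n ^ k"
 using rg.gm_pos(4,5)[OF S1] ep by (intro exp_beats_power; simp)+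
 show "wpa1 Om (%n D. tightn n D <= T\<^sup>2 --> approxn n (Lqn n D) D ep)"
 proof (rule wpa1_mono[OF wpa1_conj[OF ev_prob Lq_limit[OF T ep] Lq_missing_limit[OF T]]])
 show "EV n. ALL D:sp n.
 (tightn n D <= T\<^sup>2 --> nearq ep n D) &
 (tightn n D <= T\<^sup>2 --> missq n D) -->
 tightn n D <= T\<^sup>2 --> approxn n (Lqn n D) D ep"
 using reg e
 proof eventually_elim
 case (elim n)
 have "dp n + 1 <= N0 + 1" using rg.p_le[OF elim(1)] by simp
 then have "exp (- cA * real n) + exp (- cB * real n) <= ep / 2 / rt n ^ (dp n + 1) + ep / 2 / rt n ^ (dp n + 1)"
 using elim(2,3) by (intro add_mono) fastforce+
 then have le: "enn (exp (- cA * real n) + exp (- cB * real n)) <= enn (ep / rt n ^ (dp n + 1))"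
 by (intro ennreal_leI) (simp add: add_divide_distrib[symmetric])
 show ?case unfolding rg.approx_def[OF elim(1)] using le by (meson order_trans)
 qed
 qed
qed

subsection \<open>The likelihood of the estimator\<close>

lemma information_difference_tendsto_0:
 assumes C: "0 <= C"
 shows "(%n. rg.dA n N0 l u K4 \<alpha> C KT) \<longlonglongrightarrow> 0"
proof -
 obtain n1 where S1: "S n1" using ex_S by blast
 have a: "0 < \<alpha>" by (rule rg.\<alpha>[OF S1])
 let ?sg = "%n. K4 * (C / rt n) powr \<alpha> + 1 / rt n"
 let ?f = "%n. real N0 * real N0 * (?sg n * (1 + u) + ?sg n * (1 + (?sg n)\<^sup>2) / 2) * u / l\<^sup>2 +
 real N0 * real N0 * KT * (C * (1 / rt n)) * 2 * sqrt u / l"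
 have sg: "?sg \<longlonglongrightarrow> K4 * 0 + 0" by (intro tendsto_intros div_sqrt_powr_tendsto_0 inverse_sqrt_tendsto_0 a C)
 have "?f \<longlonglongrightarrow> real N0 * real N0 * ((K4 * 0 + 0) * (1 + u) + (K4 * 0 + 0) * (1 + (K4 * 0 + 0)\<^sup>2) / 2) * u / l\<^sup>2 +
 real N0 * real N0 * KT * (C * 0) * 2 * sqrt u / l"
 using rg.lu[OF S1] by (intro tendsto_add tendsto_mult tendsto_divide tendsto_power tendsto_const sg inverse_sqrt_tendsto_0) auto
 then have f: "?f \<longlonglongrightarrow> 0" by simp
 have eq: "EV n. ?f n = rg.dA n N0 l u K4 \<alpha> C KT"
 using reg
 proof eventually_elim
 case (elim n)
 show ?case unfolding rg.dA_def[OF elim] rg.dV_def[OF elim] rg.sg_def[OF elim] by simp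
 qed
 show ?thesis by (rule Lim_transform_eventually[OF f eq])
qed

text \<open>The tolerance x for the estimator is chosen after the cut-off C, which depends on T only.\<close>

lemma Pt_limit:
 assumes T: "0 < T" and ep: "0 < ep"
 obtains x where "0 < x" "x <= 1" "EV n. Ptlim T (ep) x n"
proof -
 obtain n1 where S1: "S n1" using ex_S by blast
 note lu = rg.lu[OF S1]
 have lA: "0 < lA" by (rule rg.lA_pos[OF S1])
 let ?b = "(rhomax + 1) * exp (lA / 8) * cpi * rg.tail_const N0 (lA / 8)"
 have "\<forall>\<^sub>F C in at_top. 1 <= C & 2 * (CH * T + 1) <= C & ?b / C < ep / 4"
 using ep by (intro eventually_conj eventually_ge_at_top eventually_divide_less) auto
 then obtain C where C: "1 <= C" "2 * (CH * T + 1) <= C" "?b / C < ep / 4"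
 using eventually_happens'[OF trivial_limit_at_top_linorder] by blast
 obtain KT where KT: "EV n. rg.taylor (X n) ((C + 1) / rt n) KT"
 using tay[of "C + 1"] C by auto
 let ?B = "CH * T + 1 + C" and ?a = "cpi * (2 * C) ^ N0"
 let ?uA = "rg.uA l u"
 have "\<exists>x>0. x <= 1 & (2 * ?uA * ?B * ?a) * x < ep / 4" by (rule ex_small_multiple) (use ep in simp)
 then obtain x where x: "0 < x" "x <= 1" "(2 * ?uA * ?B * ?a) * x < ep / 4" by blast
 let ?d = "%n. rg.dA n N0 l u K4 \<alpha> C KT"
 let ?k = "rhomax * (1 / rg.kap0 N0) * rg.kk N0 l u * (2 * C) ^ (N0 + 1) * (cpi * 2 ^ (2 * N0 + 2))"
 let ?f = "%n. (real N0 * 2 ^ N0 * (?d n / lA) + ?d n * ?B\<^sup>2 + 2 * ?uA * x * ?B) * ?a + ?b / C + ?k * \<tau> n"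
 have d: "?d \<longlonglongrightarrow> 0" using C by (intro information_difference_tendsto_0) simp
 have "?f \<longlonglongrightarrow> (real N0 * 2 ^ N0 * (0 / lA) + 0 * ?B\<^sup>2 + 2 * ?uA * x * ?B) * ?a + ?b / C + ?k * 0"
 using lA by (intro tendsto_add tendsto_mult tendsto_divide tendsto_const d \<tau>) auto
 moreover have "(real N0 * 2 ^ N0 * (0 / lA) + 0 * ?B\<^sup>2 + 2 * ?uA * x * ?B) * ?a + ?b / C + ?k * 0 < ep"
 proof -
 have "(real N0 * 2 ^ N0 * (0 / lA) + 0 * ?B\<^sup>2 + 2 * ?uA * x * ?B) * ?a = (2 * ?uA * ?B * ?a) * x" by simp
 then show ?thesis using x(3) C(3) ep by linarith
 qed
 ultimately have f: "EV n. ?f n < ep" by (rule order_tendstoD(2))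
 have sm: "EV n. ?d n < lA" using d lA by (rule order_tendstoD(2))
 have "EV n. Ptlim T (ep) x n"
 using reg KT f sm
 proof eventually_elim
 case (elim n)
 have n: "0 < n" by (rule rg.n_pos[OF elim(1)])
 have cs: "C < (C + 1) / rt n * rt n" using n by simp
 have q: "rg.pval n N0 l u K4 \<alpha> cpi (\<tau> n) T C KT x <= ep"
 proof -
 have "rg.pval n N0 l u K4 \<alpha> cpi (\<tau> n) T C KT x = ?f n"
 unfolding rg.pval_def[OF elim(1)] rg.eP_def[OF elim(1)] rg.BB_def[OF elim(1)] by simp
 then show ?thesis using elim(3) by simp
 qed
 show ?case
 proof (intro ballI impI)
 fix D M assume h: "D : sp n" "M : Mo n" "Tr n <= M" "tightn n D <= T\<^sup>2"
 "EC n x D" "AE th in prior n M. Pbd n D th"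
 have "(NI (prior n M) (%th. enn \<bar>Ph n D th - psitn n D th\<bar>)) <=
 enn (rg.pval n N0 l u K4 \<alpha> cpi (\<tau> n) T C KT x / rt n ^ card M)"
 by (rule rg.Pt_psit_integral[OF elim(1) h(2,3,1,4) T h(5) less_imp_le[OF x(1)] x(2) elim(2) C(1) cs C(2) less_imp_le[OF elim(4)] h(6)])
 also have "... <= enn (ep / rt n ^ card M)" using q by (intro ennreal_leI divide_right_mono) auto
 finally show "(NI (prior n M) (%th. enn \<bar>Ph n D th - psitn n D th\<bar>)) <= enn (ep / rt n ^ card M)" .
 qed
 qed
 then show ?thesis using that x by blast
qed

abbreviation "Pb n D == ALL M:Mo n. AE th in prior n M. Pbd n D th"

lemma Pbound_wpa1: "wpa1 Om Pb"
 by (rule wpa1_prob_1) (use reg in eventually_elim, erule rg.Pbound_sample_AE)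

definition pmissing :: "nat => real" where
 "pmissing n = rhomax * exp (- (lA / 8 * tmin\<^sup>2) * real n) + kmiss * \<tau> n / rt n ^ (dp n + 1)"

abbreviation "missp n D == ALL M:Mo n. \<not> Tr n <= M -->
 (NI (prior n M) (%th. enn (Ph n D th))) <= enn (pmissing n)"

lemma Pt_missing_limit:
 assumes T: "0 < T"
 shows "wpa1 Om (%n D. tightn n D <= T\<^sup>2 --> missp n D)"
proof (rule wpa1_mono[OF wpa1_conj[OF ev_prob est[of 1] Pbound_wpa1]])
 obtain n1 where S1: "S n1" using ex_S by blast
 have thr: "0 < tmin" by (rule rg.tmin[OF S1])
 show "EV n. ALL D:sp n. EC n 1 D & Pb n D -->
 tightn n D <= T\<^sup>2 --> missp n D"
 using reg eventually_less_sqrt[OF thr, of "2 * (CH * T + 1)"]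
 proof eventually_elim
 case (elim n)
 have b: "2 * (CH * T + 1) <= rt n * tmin" using elim(2) by (simp add: mult.commute)
 show ?case
 proof (intro ballI impI)
 fix D M assume h: "D : sp n" "EC n 1 D & Pb n D" "tightn n D <= T\<^sup>2"
 "M : Mo n" "\<not> Tr n <= M"
 have pb: "AE th in prior n M. Pbd n D th" using h by blast
 show "(NI (prior n M) (%th. enn (Ph n D th))) <= enn (pmissing n)"
 unfolding pmissing_def
 by (rule rg.Pt_missing_integral[OF elim(1) h(4,5,1,3) T conjunct1[OF h(2)] order_refl b pb])
 qed
 qed
qed simp

lemma pmissing_small:
 assumes ep: "0 < ep"
 shows "EV n. pmissing n <= ep / rt n ^ (dp n + 1)"
proof -
 obtain n1 where S1: "S n1" using ex_S by blast
 have c: "0 < lA / 8 * tmin\<^sup>2" using rg.lA_pos[OF S1] rg.tmin[OF S1] by simp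
 have e2: "0 < ep / 2" using ep by simp
 have "(%n. kmiss * \<tau> n) \<longlonglongrightarrow> kmiss * 0" by (intro tendsto_intros \<tau>)
 then have "EV n. kmiss * \<tau> n < ep / 2" by (rule order_tendstoD(2)) (use ep in simp)
 then show ?thesis using reg exp_beats_power[OF c e2, of "N0 + 1" rhomax]
 proof eventually_elim
 case (elim n)
 have "dp n + 1 <= N0 + 1" using rg.p_le[OF elim(2)] by simp
 then have "rhomax * exp (- (lA / 8 * tmin\<^sup>2) * real n) <= ep / 2 / rt n ^ (dp n + 1)" using elim(3) by blast
 moreover have "kmiss * \<tau> n / rt n ^ (dp n + 1) <= ep / 2 / rt n ^ (dp n + 1)"
 using elim(1) by (intro divide_right_mono) auto
 moreover have "ep / 2 / y + ep / 2 / y = ep / y" for y by (simp add: add_divide_distrib[symmetric])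
 ultimately show ?case unfolding pmissing_def by (metis add_mono)
 qed
qed

lemma Lp_approx:
 assumes ep: "0 < ep"
 shows "wpa1 Om (%n D. approxn n (Lpn n D) D ep)"
proof (rule wpa1_on_tight)
 fix T :: real assume T: "0 < T"
 obtain x where x: "0 < x" "x <= 1" and lim: "EV n. Ptlim T (ep) x n"
 by (rule Pt_limit[OF T ep]) blast
 show "wpa1 Om (%n D. tightn n D <= T\<^sup>2 --> approxn n (Lpn n D) D ep)"
 proof (rule wpa1_mono[OF wpa1_conj[OF ev_prob wpa1_conj[OF ev_prob est[OF x(1)] Pbound_wpa1] Pt_missing_limit[OF T]]])
 show "EV n. ALL D:sp n. (EC n x D & Pb n D) &
 (tightn n D <= T\<^sup>2 --> missp n D) -->
 tightn n D <= T\<^sup>2 --> approxn n (Lpn n D) D ep"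
 using reg lim pmissing_small[OF ep]
 proof eventually_elim
 case (elim n)
 note le1 = nn_integral_mono[OF ennreal_leI[OF rg.Lp_psi_le[OF elim(1)]]]
 note le2 = nn_integral_mono[OF ennreal_leI[OF rg.Lp_le_Pt[OF elim(1)]]]
 show ?case unfolding rg.approx_def[OF elim(1)]
 proof (intro ballI impI conjI)
 fix D M assume h: "D : sp n" "(EC n x D & Pb n D) &
 (tightn n D <= T\<^sup>2 --> missp n D)" "tightn n D <= T\<^sup>2" "M : Mo n"
 { assume "Tr n <= M"
 then show "(NI (prior n M) (%th. enn \<bar>Lpn n D th - psin n D th\<bar>)) <= enn (ep / rt n ^ card M)"
 using h elim(2) by (intro order_trans[OF le1]) blast }
 { assume "\<not> Tr n <= M"
 then have "(NI (prior n M) (%th. enn (Lpn n D th))) <= enn (pmissing n)"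
 using h by (intro order_trans[OF le2]) blast
 then show "(NI (prior n M) (%th. enn (Lpn n D th))) <= enn (ep / rt n ^ (dp n + 1))"
 using ennreal_leI[OF elim(3)] by (rule order_trans) }
 qed
 qed
 qed
qed

subsection \<open>The common approximating event\<close>

lemma psi_range_prob:
 assumes dl: "0 < dl"
 obtains c U where "0 < c" "0 < U" "EV n. pg n (%D. PR n c U D) (1 - dl)"
proof -
 obtain n1 where S1: "S n1" using ex_S by blast
 note lu = rg.lu[OF S1]
 obtain T where T: "0 < T" and ti: "EV n. pg n (%D. tightn n D <= T\<^sup>2) (1 - dl)"
 using tightness[OF dl] by blast
 define C where "C = max 1 (2 * T / sqrt l)"
 have C0: "1 <= C" "2 * T / sqrt l <= C" by (simp_all add: C_def)
 then have C: "1 <= C" "2 * T <= sqrt l * C" using lu by (simp_all add: pos_divide_le_eq mult.commute)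
 have Cp: "0 < C" using C(1) by simp
 let ?c = "rg.clo N0 l u c0 T" and ?U = "\<bar>rg.cup N0 l u cpi C\<bar> + 1"
 have "EV n. pg n (%D. PR n ?c ?U D) (1 - dl)"
 using reg ti lprior[OF Cp] eventually_less_sqrt[OF rg.r0[OF S1], of C]
 proof eventually_elim
 case (elim n)
 note lp = elim(3)
 show ?case
 proof (rule prob_ge_mono[OF elim(2)])
 fix D assume D: "D : sp n" "tightn n D <= T\<^sup>2"
 show "PR n ?c ?U D"
 unfolding rg.psi_range_def[OF elim(1)]
 proof (intro ballI impI conjI)
 fix M assume M: "M : Mo n" "Tr n <= M"
 show "enn (?c / rt n ^ card M) <= (NI (prior n M) (%th. enn (psin n D th)))"
 by (rule rg.psi_lower[OF elim(1) M D T C(1) elim(4) lp])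
 have "(NI (prior n M) (%th. enn (psin n D th))) <= enn (rg.cup N0 l u cpi C / rt n ^ card M)"
 by (rule rg.psi_upper[OF elim(1) M D T C])
 also have "... <= enn (?U / rt n ^ card M)" by (intro ennreal_leI divide_right_mono) auto
 finally show "(NI (prior n M) (%th. enn (psin n D th))) <= enn (?U / rt n ^ card M)" .
 qed
 qed simp
 qed
 moreover have "0 < ?c" by (rule rg.clo_pos[OF S1])
 ultimately show ?thesis using that[of ?c ?U] by simp
qed

definition good :: "nat => real => real => real => (nat => 'd) => bool" where
 "good n c U ep D \<longleftrightarrow> PR n c U D & approxn n (Lqn n D) D ep & approxn n (Lpn n D) D ep &
 GW n 1 D"

text \<open>c and U depend on the probability level only, so the tolerance can be taken small relative to c.\<close>

lemma good_prob:
 assumes dl: "0 < dl"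
 obtains c U where "0 < c" "0 < U" "\<And>ep. 0 < ep ==> EV n. pg n (good n c U ep) (1 - dl)"
proof -
 have d2: "0 < dl / 2" using dl by simp
 obtain c U where cU: "0 < c" "0 < U" and r: "EV n. pg n (%D. PR n c U D) (1 - dl / 2)"
 using psi_range_prob[OF d2] by blast
 have "EV n. pg n (good n c U ep) (1 - dl)" if ep: "0 < ep" for ep
 proof -
 have "EV n. pg n (%D. approxn n (Lqn n D) D ep & approxn n (Lpn n D) D ep &
 GW n 1 D) (1 - dl / 2)"
 using wpa1_conj[OF ev_prob Lq_approx[OF ep] wpa1_conj[OF ev_prob Lp_approx[OF ep] weights[of 1]]] d2
 by (simp add: wpa1_def)
 with ev_prob r show ?thesis
 proof eventually_elim
 case (elim n)
 show ?case by (rule prob_ge_mono[OF prob_ge_conj[OF elim(1,2,3)]]) (auto simp: good_def)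
 qed
 qed
 then show ?thesis using that cU by blast
qed

definition ratio :: "nat => ((nat => real) => real) => real" where
 "ratio n L = (\<Sum>M\<in>Mo n - {Tr n}. mp n M * Ma n L M UNIV) /
 (\<Sum>M\<in>Mo n. mp n M * Ma n L M UNIV)"

lemma q_posterior:
 assumes S: "S n" and D: "D : sp n" and w: "GW n 1 D"
 shows "wrong_model_post (X n) (q_lik n (X n) D) = ratio n (Lqn n D)"
 "A : sets borel ==> post_measure (X n) (q_lik n (X n) D) A =
 pm n (Lqn n D) A"
proof -
 have V: "coercive (mdim (X n)) l u (Vn (X n) D)" using w by (simp add: rg.good_weight_def[OF S])
 obtain k where k: "k > 0" "\<And>th. th : Theta (X n) ==> q_lik n (X n) D th = k * Lqn n D th"
 using rg.q_lik_eq[OF S V] by blast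
 have k0: "k ~= 0" using k by simp
 note p = rg.posterior_scaled[OF S rg.measurable_Lq[OF S D V] k0 k(2)]
 show "wrong_model_post (X n) (q_lik n (X n) D) = ratio n (Lqn n D)" unfolding ratio_def by (rule p(1))
 show "A : sets borel ==> post_measure (X n) (q_lik n (X n) D) A =
 pm n (Lqn n D) A" by (rule p(2))
qed

lemma p_posterior:
 assumes S: "S n"
 shows "wrong_model_post (X n) (p_lik (X n) D) = ratio n (Lpn n D)"
 "A : sets borel ==> post_measure (X n) (p_lik (X n) D) A =
 pm n (Lpn n D) A"
 "wrong_model_post (X n) (p_lik (X n) D) = ratio n (Ph n D)"
proof -
 obtain k where k: "k > 0" "\<And>th. th : Theta (X n) ==> p_lik (X n) D th = k * Lpn n D th"
 using rg.p_lik_eq[OF S] by blast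
 have k0: "k ~= 0" using k by simp
 note p = rg.posterior_scaled[OF S rg.measurable_Lp[OF S] k0 k(2)]
 show "wrong_model_post (X n) (p_lik (X n) D) = ratio n (Lpn n D)" unfolding ratio_def by (rule p(1))
 show "A : sets borel ==> post_measure (X n) (p_lik (X n) D) A =
 pm n (Lpn n D) A" by (rule p(2))
 let ?k = "k * exp (- rg.kp n (X n) D / 2)"
 have e: "p_lik (X n) D th = ?k * Ph n D th" if "th : Theta (X n)" for th
 using k(2)[OF that] by (simp add: rg.Lp_def[OF S])
 have k1: "?k ~= 0" using k0 by simp
 show "wrong_model_post (X n) (p_lik (X n) D) = ratio n (Ph n D)"
 unfolding ratio_def by (rule rg.posterior_scaled(1)[OF S rg.measurable_Pt_1[OF S] k1 e])
qed

abbreviation "qw n D == wrong_model_post (X n) (q_lik n (X n) D)"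
abbreviation "pw n D == wrong_model_post (X n) (p_lik (X n) D)"

lemma rr_ge_1: "1 <= rr" using ex_S rg.rr_ge_1 by blast

definition tol :: "real => real => real" where "tol e c = e * c / (1 + 2 ^ N0 * rr)"

lemma tol: "0 < e ==> 0 < c ==> 0 < tol e c" "S n ==> 0 < c ==> rg.closeness N0 rr (tol e c) c = e"
proof -
 have d: "0 < 1 + 2 ^ N0 * rr" using rr_ge_1 by (intro add_pos_nonneg) auto
 show "0 < e ==> 0 < c ==> 0 < tol e c" using d by (simp add: tol_def)
 show "S n ==> 0 < c ==> rg.closeness N0 rr (tol e c) c = e"
 using d by (simp add: rg.closeness_def tol_def)
qed

lemma good_wrong_posterior:
 assumes S: "S n" and D: "D : sp n" and g: "good n c U (tol e c) D" and c: "0 < c" "0 < U" and e: "0 < e" "e <= 1/4"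
 and nf: "Tr n ~= Fu n"
 shows "\<bar>qw n D / pw n D - 1\<bar> <= 8 * e" "0 < pw n D"
 "c / (2 * (2 ^ N0 * rr * U)) / rt n <= pw n D" "pw n D <= 2 * (2 ^ N0 * rr * U) / c / rt n"
proof -
 have gg: "PR n c U D" "approxn n (Lqn n D) D (tol e c)" "approxn n (Lpn n D) D (tol e c)"
 "GW n 1 D" using g by (auto simp: good_def)
 have V: "coercive (mdim (X n)) l u (Vn (X n) D)" using gg(4) by (simp add: rg.good_weight_def[OF S])
 have cl: "rg.closeness N0 rr (tol e c) c <= 1/4" using tol(2)[OF S c(1)] e by simp
 note R = rg.wrong_posterior_rate[OF S rg.measurable_Lq[OF S D V] less_imp_le[OF rg.Lq_pos[OF S]] gg(2)
 rg.measurable_Lp[OF S] rg.Lp_nonneg[OF S] gg(3) gg(1) c less_imp_le[OF tol(1)[OF e(1) c(1)]] cl nf]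
 note eqs = q_posterior(1)[OF S D gg(4)] p_posterior(1)[OF S]
 show "\<bar>qw n D / pw n D - 1\<bar> <= 8 * e" using R(1) unfolding eqs ratio_def tol(2)[OF S c(1)] .
 show "0 < pw n D" using R(2) unfolding eqs ratio_def .
 show "c / (2 * (2 ^ N0 * rr * U)) / rt n <= pw n D" using R(3) unfolding eqs ratio_def .
 show "pw n D <= 2 * (2 ^ N0 * rr * U) / c / rt n" using R(4) unfolding eqs ratio_def .
qed

lemma powr_neg_half: "real n powr (- 1 / 2) = 1 / rt n"
proof -
 have "real n powr (- 1 / 2) = inverse (real n powr (1/2))" using powr_minus[of "real n" "1/2"] by simp
 then show ?thesis by (simp add: powr_half_sqrt inverse_eq_divide)
qed

lemma wrong_posterior_nonfull:
 assumes nf: "EV n. Tr n ~= Fu n"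
 shows "conv_in_prob Om (%n D. qw n D / pw n D) 1" "same_order_prob Om qw pw"
 "same_order_prob Om pw (%n D. real n powr (- 1 / 2))"
proof -
 show "conv_in_prob Om (%n D. qw n D / pw n D) 1"
 unfolding conv_in_prob_def wpa1_def
 proof (intro allI impI)
 fix e0 dl :: real assume h: "0 < e0" "0 < dl"
 obtain c U where cU: "0 < c" "0 < U" and g: "\<And>ep. 0 < ep ==> EV n. pg n (good n c U ep) (1 - dl)"
 using good_prob[OF h(2)] by blast
 define e where "e = min (1/4) (e0 / 16)"
 have e: "0 < e" "e <= 1/4" "8 * e < e0" using h by (auto simp: e_def min_def)
 show "EV n. pg n (%D. \<bar>qw n D / pw n D - 1\<bar> < e0) (1 - dl)"
 using reg nf g[OF tol(1)[OF e(1) cU(1)]]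
 proof eventually_elim
 case (elim n)
 show ?case
 by (rule prob_ge_mono[OF elim(3)]) (use good_wrong_posterior(1)[OF elim(1) _ _ cU e(1,2) elim(2)] e(3) in fastforce)+
 qed
 qed
 show "same_order_prob Om qw pw"
 unfolding same_order_prob_def
 proof (intro allI impI)
 fix dl :: real assume h: "0 < dl"
 obtain c U where cU: "0 < c" "0 < U" and g: "\<And>ep. 0 < ep ==> EV n. pg n (good n c U ep) (1 - dl)"
 using good_prob[OF h] by blast
 define e :: real where "e = 1/16"
 have e: "0 < e" "e <= 1/4" "8 * e = 1/2" by (auto simp: e_def)
 have two: "1/2 * y <= x & x <= 2 * y" if "\<bar>x / y - 1\<bar> <= 8 * e" "0 < y" for x y :: real
 proof -
 have "1/2 <= x / y" "x / y <= 2" using that(1) unfolding e(3) by linarith+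
 then show ?thesis using that(2) by (simp add: pos_le_divide_eq pos_divide_le_eq)
 qed
 have "EV n. pg n (%D. 1/2 * pw n D <= qw n D & qw n D <= 2 * pw n D) (1 - dl)"
 using reg nf g[OF tol(1)[OF e(1) cU(1)]]
 proof eventually_elim
 case (elim n)
 show ?case
 proof (rule prob_ge_mono[OF elim(3)])
 fix D assume D: "D : sp n" "good n c U (tol e c) D"
 show "1/2 * pw n D <= qw n D & qw n D <= 2 * pw n D"
 by (rule two[OF good_wrong_posterior(1,2)[OF elim(1) D cU e(1,2) elim(2)]])
 qed simp
 qed
 then show "\<exists>c>0. \<exists>C. EV n. pg n (%D. c * pw n D <= qw n D & qw n D <= C * pw n D) (1 - dl)"
 by (intro exI[of _ "1/2"] conjI exI[of _ 2]) simp
 qed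
 show "same_order_prob Om pw (%n D. real n powr (- 1 / 2))"
 unfolding same_order_prob_def
 proof (intro allI impI)
 fix dl :: real assume h: "0 < dl"
 obtain c U where cU: "0 < c" "0 < U" and g: "\<And>ep. 0 < ep ==> EV n. pg n (good n c U ep) (1 - dl)"
 using good_prob[OF h] by blast
 have e: "0 < (1/4::real)" "(1/4::real) <= 1/4" by auto
 let ?a = "c / (2 * (2 ^ N0 * rr * U))" and ?b = "2 * (2 ^ N0 * rr * U) / c"
 have a: "0 < ?a" using cU rr_ge_1 by simp
 have "EV n. pg n (%D. ?a * real n powr (- 1 / 2) <= pw n D & pw n D <= ?b * real n powr (- 1 / 2)) (1 - dl)"
 using reg nf g[OF tol(1)[OF e(1) cU(1)]]
 proof eventually_elim
 case (elim n)
 have m: "x * (1 / y) = x / y" for x y :: real by simp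
 show ?case unfolding powr_neg_half m
 proof (rule prob_ge_mono[OF elim(3)])
 fix D assume D: "D : sp n" "good n c U (tol (1/4) c) D"
 show "?a / rt n <= pw n D & pw n D <= ?b / rt n"
 using good_wrong_posterior(3,4)[OF elim(1) D cU e elim(2)] by blast
 qed simp
 qed
 then show "\<exists>c>0. \<exists>C. EV n. pg n (%D. c * real n powr (- 1 / 2) <= pw n D & pw n D <= C * real n powr (- 1 / 2)) (1 - dl)"
 using a by blast
 qed
qed

lemma posterior_total_variation:
 "conv_in_prob Om (%n D. SUP A\<in>{A : sets borel. A <= Theta (X n)}.
 \<bar>post_measure (X n) (q_lik n (X n) D) A - post_measure (X n) (p_lik (X n) D) A\<bar>) 0"
 unfolding conv_in_prob_def wpa1_def
proof (intro allI impI)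
 fix e0 dl :: real assume h: "0 < e0" "0 < dl"
 obtain c U where cU: "0 < c" "0 < U" and g: "\<And>ep. 0 < ep ==> EV n. pg n (good n c U ep) (1 - dl)"
 using good_prob[OF h(2)] by blast
 define e where "e = min (1/4) (e0 / 16)"
 have e: "0 < e" "e <= 1/4" "8 * e < e0" using h by (auto simp: e_def min_def)
 show "EV n. pg n (%D. \<bar>(SUP A\<in>{A : sets borel. A <= Theta (X n)}.
 \<bar>post_measure (X n) (q_lik n (X n) D) A - post_measure (X n) (p_lik (X n) D) A\<bar>) - 0\<bar> < e0) (1 - dl)"
 using reg g[OF tol(1)[OF e(1) cU(1)]]
 proof eventually_elim
 case (elim n)
 note S = elim(1)
 show ?case
 proof (rule prob_ge_mono[OF elim(2)])
 fix D assume D: "D : sp n" "good n c U (tol e c) D"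
 have gg: "PR n c U D" "approxn n (Lqn n D) D (tol e c)" "approxn n (Lpn n D) D (tol e c)"
 "GW n 1 D" using D by (auto simp: good_def)
 have V: "coercive (mdim (X n)) l u (Vn (X n) D)" using gg(4) by (simp add: rg.good_weight_def[OF S])
 have cl: "rg.closeness N0 rr (tol e c) c <= 1/4" using tol(2)[OF S cU(1)] e by simp
 have b: "\<bar>post_measure (X n) (q_lik n (X n) D) A - post_measure (X n) (p_lik (X n) D) A\<bar> <= 8 * e" if A: "A : sets borel" for A
 using rg.posterior_distance[OF S rg.measurable_Lq[OF S D(1) V] less_imp_le[OF rg.Lq_pos[OF S]] gg(2)
 rg.measurable_Lp[OF S] rg.Lp_nonneg[OF S] gg(3) gg(1) cU(1) less_imp_le[OF cU(2)] less_imp_le[OF tol(1)[OF e(1) cU(1)]] cl A]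
 unfolding q_posterior(2)[OF S D(1) gg(4) A] p_posterior(2)[OF S A] tol(2)[OF S cU(1)] .
 let ?Z = "(%A. \<bar>post_measure (X n) (q_lik n (X n) D) A - post_measure (X n) (p_lik (X n) D) A\<bar>) ` {A : sets borel. A <= Theta (X n)}"
 have ne: "?Z ~= {}" by blast
 have "\<bar>Sup ?Z\<bar> <= 8 * e"
 by (rule cSup_abs_le[OF ne]) (use b in auto)
 then show "\<bar>Sup ?Z - 0\<bar> < e0" using e(3) by simp
 qed simp
 qed
qed

subsection \<open>The full model\<close>

lemma wrong_q_posterior_full:
 assumes full: "EV n. Tr n = Fu n" and k: "0 < k" "k < cA" "k < cB"
 shows "wpa1 Om (%n D. qw n D <= exp (- k * real n))"
 unfolding wpa1_def
proof (intro allI impI)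
 fix dl :: real assume "0 < dl"
 then have d2: "0 < dl / 2" by simp
 obtain c U where cU: "0 < c" "0 < U" and g: "\<And>ep. 0 < ep ==> EV n. pg n (good n c U ep) (1 - dl / 2)"
 using good_prob[OF d2] by blast
 have c2: "0 < c / 2" using cU by simp
 have miss: "wpa1 Om (%n D. missq n D)"
 by (rule wpa1_on_tight[OF Lq_missing_limit])
 have m2: "EV n. pg n (%D. missq n D) (1 - dl / 2)"
 using miss d2 by (simp add: wpa1_def)
 let ?K = "2 ^ N0 * rr / (c / 2)"
 have half: "0 < (1/2::real)" by simp
 have kk: "0 < cA - k" "0 < cB - k" using k by auto
 show "EV n. pg n (%D. qw n D <= exp (- k * real n)) (1 - dl)"
 using reg full g[OF c2] m2 exp_beats_power[OF kk(1) half, of N0 ?K] exp_beats_power[OF kk(2) half, of N0 ?K]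
 proof eventually_elim
 case (elim n)
 note S = elim(1)
 let ?s = "rt n" and ?q = "rt n ^ dp n" and ?B = "exp (- cA * real n) + exp (- cB * real n)" and ?p = "dp n"
 have s: "0 < ?s" using rg.s(1)[OF S] .
 have pN: "?p <= N0" by (rule rg.p_le[OF S])
 have bound: "2 ^ N0 * rr * (?B * ?q / (c / 2)) <= exp (- k * real n)"
 proof -
 have f: "?K * exp (- (a - k) * real n) * ?q <= 1/2" if "?K * exp (- (a - k) * real n) <= 1/2 / ?q" for a
 using that s by (simp add: pos_le_divide_eq)
 have h: "?K * exp (- a * real n) * ?q <= 1/2 * exp (- k * real n)" if "?K * exp (- (a - k) * real n) <= 1/2 / ?q" for a
 proof -
 have "exp (- a * real n) = exp (- (a - k) * real n) * exp (- k * real n)" by (simp add: exp_add[symmetric] algebra_simps)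
 then have "?K * exp (- a * real n) * ?q = (?K * exp (- (a - k) * real n) * ?q) * exp (- k * real n)" by (simp only: mult_ac)
 also have "... <= 1/2 * exp (- k * real n)" using f[OF that] by (intro mult_right_mono) auto
 finally show ?thesis .
 qed
 have e1: "?K * exp (- (cA - k) * real n) <= 1/2 / ?q" and e2: "?K * exp (- (cB - k) * real n) <= 1/2 / ?q"
 using elim(5,6) pN by blast+
 have "2 ^ N0 * rr * (?B * ?q / (c / 2)) = ?K * exp (- cA * real n) * ?q + ?K * exp (- cB * real n) * ?q"
 by (simp add: distrib_left distrib_right add_divide_distrib mult_ac)
 also have "... <= 1/2 * exp (- k * real n) + 1/2 * exp (- k * real n)" by (intro add_mono h e1 e2)
 finally show ?thesis by simp
 qed
 have pr: "1 - dl <= 1 - (dl / 2 + dl / 2)" by simp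
 show ?case
 proof (rule prob_ge_mono[OF prob_ge_conj[OF rg.prob_OM[OF S] elim(3,4)] _ pr])
 fix D assume D: "D : sp n" and h: "good n c U (c / 2) D & (ALL M:Mo n. \<not> Tr n <= M -->
 (NI (prior n M) (%th. enn (Lqn n D th))) <= ennreal ?B)"
 have gg: "PR n c U D" "approxn n (Lqn n D) D (c / 2)" "GW n 1 D" using h by (auto simp: good_def)
 have V: "coercive (mdim (X n)) l u (Vn (X n) D)" using gg(3) by (simp add: rg.good_weight_def[OF S])
 note F = rg.full_in_models[OF S]
 have T: "Tr n <= Fu n" using elim(2) by simp
 have cF: "card (Fu n) = ?p" by (simp add: full_model_def)
 have L: "Lqn n D : bmb" "\<And>th. 0 <= Lqn n D th"
 using rg.measurable_Lq[OF S D V] rg.Lq_pos[OF S] by (auto intro: less_imp_le)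
 have "c / ?q - c / 2 / ?q <= Ma n (Lqn n D) (Fu n) UNIV"
 proof (rule rg.mass_ge[OF S F L rg.measurable_psi[OF S] rg.integrable_psi[OF S F] less_imp_le[OF rg.psi_pos[OF S]]])
 show "(NI (prior n (Fu n)) (%th. enn \<bar>Lqn n D th - psin n D th\<bar>)) <= enn (c / 2 / ?q)"
 using gg(2) F T unfolding rg.approx_def[OF S] cF[symmetric] by blast
 show "enn (c / ?q) <= (NI (prior n (Fu n)) (%th. enn (psin n D th)))"
 using gg(1) F T unfolding rg.psi_range_def[OF S] cF[symmetric] by blast
 qed (use cU s in simp)
 moreover have "c / ?q - c / 2 / ?q = c / 2 / ?q" by (simp add: field_simps)
 ultimately have v: "c / 2 / ?q <= Ma n (Lqn n D) (Fu n) UNIV" by simp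
 have B: "(NI (prior n M) (%th. enn (Lqn n D th))) <= ennreal ?B" if "M : Mo n" "\<not> Tr n <= M" for M
 using h that by blast
 have "ratio n (Lqn n D) <= 2 ^ N0 * rr * (?B * ?q / (c / 2))"
 unfolding ratio_def by (rule rg.wrong_posterior_full[OF S elim(2) L B _ c2 v]) auto
 then show "qw n D <= exp (- k * real n)" unfolding q_posterior(1)[OF S D gg(3)] using bound by linarith
 qed
 qed
qed

text \<open>K must not depend on the probability level; it comes from psit_lower, whose constant does not
 involve T.\<close>

lemma wrong_p_posterior_full:
 assumes full: "EV n. Tr n = Fu n" and k: "0 < k" "k < lA / 8 * tmin\<^sup>2"
 shows "\<exists>K>0. wpa1 Om (%n D. pw n D <= max (exp (- k * real n)) (K * (\<tau> n * (1 / rt n))))"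
proof -
 obtain n1 where S1: "S n1" using ex_S by blast
 define v where "v = exp (- rg.uA l u / 2) * rg.mlo N0 c0 / 2"
 have v: "0 < v" using rg.mlo_pos[OF S1] by (simp add: v_def)
 define Q where "Q = 2 ^ N0 * rr / v"
 have Q: "0 < Q" using rr_ge_1 v by (simp add: Q_def)
 have km: "0 < kmiss"
 using rg.rhomax_pos[OF S1] rg.kap0_pos[OF S1] rg.kk_pos[OF S1] rg.tmin[OF S1]
 by (simp add: rg.kmiss_def[OF S1] add_pos_pos)
 define K where "K = 2 * (Q * kmiss)"
 have K: "0 < K" using Q km by (simp add: K_def)
 let ?E = "%n D. missp n D &
 v / rt n ^ dp n <= Ma n (Ph n D) (Fu n) UNIV"
 have "wpa1 Om ?E"
 proof (rule wpa1_on_tight)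
 fix T :: real assume T: "0 < T"
 obtain x where x: "0 < x" "x <= 1" and lim: "EV n. Ptlim T (v) x n"
 by (rule Pt_limit[OF T v]) blast
 define C where "C = CH * T + 1"
 have C: "CH * T + 1 <= C" "0 < C" using rg.CH_pos[OF S1] T by (auto simp: C_def intro: add_pos_pos)
 show "wpa1 Om (%n D. tightn n D <= T\<^sup>2 --> ?E n D)"
 proof (rule wpa1_mono[OF wpa1_conj[OF ev_prob wpa1_conj[OF ev_prob est[OF x(1)] Pbound_wpa1] Pt_missing_limit[OF T]]])
 show "EV n. ALL D:sp n. (EC n x D & Pb n D) &
 (tightn n D <= T\<^sup>2 --> missp n D) -->
 tightn n D <= T\<^sup>2 --> ?E n D"
 using reg full lim lprior[OF C(2)] eventually_less_sqrt[OF rg.r0[OF S1], of C]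
 proof eventually_elim
 case (elim n)
 note S = elim(1)
 let ?s = "rt n" and ?q = "rt n ^ dp n" and ?p = "dp n"
 have s: "0 < ?s" using rg.s(1)[OF S] .
 note F = rg.full_in_models[OF S]
 have Tr: "Tr n <= Fu n" using elim(2) by simp
 have cF: "card (Fu n) = ?p" by (simp add: full_model_def)
 interpret Qp: prob_space "prior n (Fu n)" by (rule rg.prob_plaw[OF S F])
 have "v / ?q <= Ma n (Ph n D) (Fu n) UNIV"
 if D: "D : sp n" and h: "EC n x D" "Pb n D" "tightn n D <= T\<^sup>2" for D
 proof -
 have psim: "psitn n D : bmb" by (rule rg.measurable_psit[OF S])
 have psi0: "0 <= psitn n D th" "psitn n D th <= 1" for th
 using rg.psit_pos[OF S, of D th] rg.psit_le_1[OF S, of D th] by auto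
 have psii: "integrable (prior n (Fu n)) (psitn n D)"
 by (rule Qp.integrable_const_bound[of _ 1]) (use psi0 psim in \<open>auto simp: rg.measurable_plaw_eq[OF S]\<close>)
 have "2 * v / ?q - v / ?q <= Ma n (Ph n D) (Fu n) UNIV"
 proof (rule rg.mass_ge[OF S F rg.measurable_Pt_1[OF S] rg.Pt_nonneg[OF S] psim psii psi0(1)])
 have "AE th in prior n (Fu n). Pbd n D th" using h(2) F by blast
 then show "(NI (prior n (Fu n)) (%th. enn \<bar>Ph n D th - psitn n D th\<bar>)) <= enn (v / ?q)"
 using elim(3)[rule_format, OF D F Tr h(3) h(1)] unfolding cF by simp
 show "enn (2 * v / ?q) <= (NI (prior n (Fu n)) (%th. enn (psitn n D th)))"
 using rg.psit_lower[OF S elim(2) D h(3) T C(1) elim(5,4)] by (simp add: v_def)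
 qed (use v s in simp)
 moreover have "2 * v / ?q - v / ?q = v / ?q" by (simp add: diff_divide_distrib[symmetric])
 ultimately show ?thesis by simp
 qed
 then show ?case by blast
 qed
 qed
 qed
 note E = this
 have kk: "0 < lA / 8 * tmin\<^sup>2 - k" using k by simp
 have half: "0 < (1/2::real)" by simp
 have "wpa1 Om (%n D. pw n D <= max (exp (- k * real n)) (K * (\<tau> n * (1 / rt n))))"
 proof (rule wpa1_mono[OF E])
 show "EV n. ALL D:sp n. ?E n D --> pw n D <= max (exp (- k * real n)) (K * (\<tau> n * (1 / rt n)))"
 using reg full exp_beats_power[OF kk half, of N0 "Q * rhomax"]
 proof eventually_elim
 case (elim n)
 note S = elim(1)
 let ?s = "rt n" and ?q = "rt n ^ dp n" and ?p = "dp n" and ?a = "lA / 8 * tmin\<^sup>2"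
 have s: "0 < ?s" using rg.s(1)[OF S] .
 have \<tau>0: "0 <= \<tau> n" by (rule rg.\<tau>_nonneg[OF S])
 have pm0: "0 <= pmissing n" using km \<tau>0 rg.rhomax_pos[OF S1] s by (simp add: pmissing_def)
 have bound: "2 ^ N0 * rr * (pmissing n * ?q / v) <= max (exp (- k * real n)) (K * (\<tau> n * (1 / ?s)))"
 proof -
 have "Q * rhomax * exp (- (?a - k) * real n) <= 1/2 / ?q" using elim(3) rg.p_le[OF S] by blast
 then have f: "Q * rhomax * exp (- (?a - k) * real n) * ?q <= 1/2" using s by (simp add: pos_le_divide_eq)
 have "exp (- ?a * real n) = exp (- (?a - k) * real n) * exp (- k * real n)" by (simp add: exp_add[symmetric] algebra_simps)
 then have "Q * rhomax * exp (- ?a * real n) * ?q = (Q * rhomax * exp (- (?a - k) * real n) * ?q) * exp (- k * real n)" by (simp only: mult_ac)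
 also have "... <= 1/2 * exp (- k * real n)" using f by (intro mult_right_mono) auto
 finally have 1: "Q * rhomax * exp (- ?a * real n) * ?q <= 1/2 * exp (- k * real n)" .
 have 2: "Q * (kmiss * \<tau> n / ?s ^ (?p + 1)) * ?q = 1/2 * (K * (\<tau> n * (1 / ?s)))" using s by (simp add: K_def)
 have "2 ^ N0 * rr * (pmissing n * ?q / v) = Q * pmissing n * ?q" by (simp add: Q_def)
 also have "... = Q * rhomax * exp (- ?a * real n) * ?q + Q * (kmiss * \<tau> n / ?s ^ (?p + 1)) * ?q"
 unfolding pmissing_def by (simp only: distrib_left distrib_right mult.assoc)
 finally have "2 ^ N0 * rr * (pmissing n * ?q / v) <= 1/2 * exp (- k * real n) + 1/2 * (K * (\<tau> n * (1 / ?s)))"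
 unfolding 2 using 1 by linarith
 also have "... <= max (exp (- k * real n)) (K * (\<tau> n * (1 / ?s)))" by (simp add: max_def)
 finally show ?thesis .
 qed
 show ?case
 proof (intro ballI impI)
 fix D assume D: "D : sp n" and h: "?E n D"
 have B: "(NI (prior n M) (%th. enn (Ph n D th))) <= enn (pmissing n)" if "M : Mo n" "\<not> Tr n <= M" for M
 using h that by blast
 have "ratio n (Ph n D) <= 2 ^ N0 * rr * (pmissing n * ?q / v)"
 unfolding ratio_def
 by (rule rg.wrong_posterior_full[OF S elim(2) rg.measurable_Pt_1[OF S] rg.Pt_nonneg[OF S] B pm0 v conjunct2[OF h]])
 then show "pw n D <= max (exp (- k * real n)) (K * (\<tau> n * (1 / ?s)))"
 unfolding p_posterior(3)[OF S] using bound by linarith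
 qed
 qed
 qed
 then show ?thesis using K by blast
qed

lemma posterior_full:
 assumes full: "EV n. Tr n = Fu n"
 shows "\<exists>C>0. \<exists>K>0.
 wpa1 Om (%n D. qw n D <= exp (- C * real n * tmin\<^sup>2)) &
 (%n. exp (- C * real n * tmin\<^sup>2)) \<longlonglongrightarrow> 0 &
 wpa1 Om (%n D. pw n D <= max (exp (- C * real n * tmin\<^sup>2))
 (K * (\<tau> n * real n powr (- (real (dp n) - real (card (Tr n)) + 1) / 2)))) &
 (%n. max (exp (- C * real n * tmin\<^sup>2))
 (K * (\<tau> n * real n powr (- (real (dp n) - real (card (Tr n)) + 1) / 2)))) \<longlonglongrightarrow> 0"
proof -
 obtain n1 where S1: "S n1" using ex_S by blast
 have thr: "0 < tmin\<^sup>2" using rg.tmin[OF S1] by simp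
 define k where "k = min (min cA cB) (lA / 8 * tmin\<^sup>2) / 2"
 have pos: "0 < cA" "0 < cB" "0 < lA / 8 * tmin\<^sup>2" using rg.gm_pos[OF S1] rg.lA_pos[OF S1] thr by auto
 have k: "0 < k" "k < cA" "k < cB" "k < lA / 8 * tmin\<^sup>2" using pos by (auto simp: k_def min_def)
 define C where "C = k / tmin\<^sup>2"
 have C: "0 < C" using k thr by (simp add: C_def)
 have ek: "exp (- C * real n * tmin\<^sup>2) = exp (- k * real n)" for n using thr by (simp add: C_def)
 obtain K where K: "0 < K" and pK: "wpa1 Om (%n D. pw n D <= max (exp (- k * real n)) (K * (\<tau> n * (1 / rt n))))"
 using wrong_p_posterior_full[OF full k(1,4)] by blast
 have lim: "(%n. exp (- k * real n)) \<longlonglongrightarrow> 0" using k(1) by real_asymp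
 have pe: "EV n. real n powr (- (real (dp n) - real (card (Tr n)) + 1) / 2) = 1 / rt n"
 using full
 proof eventually_elim
 case (elim n)
 have "real n powr (- (real (dp n) - real (card (Tr n)) + 1) / 2) = real n powr (- 1 / 2)"
 unfolding elim by (simp add: full_model_def)
 then show ?case by (simp only: powr_neg_half)
 qed
 have "(%n. max (exp (- k * real n)) (K * (\<tau> n * (1 / rt n)))) \<longlonglongrightarrow> max 0 (K * (0 * 0))"
 by (intro tendsto_max lim tendsto_mult tendsto_const \<tau> inverse_sqrt_tendsto_0)
 then have l2: "(%n. max (exp (- k * real n)) (K * (\<tau> n * (1 / rt n)))) \<longlonglongrightarrow> 0" by simp
 show ?thesis
 proof (intro exI conjI)
 show "0 < C" "0 < K" by (fact C, fact K)
 show "wpa1 Om (%n D. qw n D <= exp (- C * real n * tmin\<^sup>2))" unfolding ek by (rule wrong_q_posterior_full[OF full k(1,2,3)])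
 show "(%n. exp (- C * real n * tmin\<^sup>2)) \<longlonglongrightarrow> 0" unfolding ek by (rule lim)
 show "wpa1 Om (%n D. pw n D <= max (exp (- C * real n * tmin\<^sup>2))
 (K * (\<tau> n * real n powr (- (real (dp n) - real (card (Tr n)) + 1) / 2))))"
 unfolding ek
 by (rule wpa1_mono[OF pK]) (use pe in eventually_elim, simp only:, blast)
 show "(%n. max (exp (- C * real n * tmin\<^sup>2))
 (K * (\<tau> n * real n powr (- (real (dp n) - real (card (Tr n)) + 1) / 2)))) \<longlonglongrightarrow> 0"
 unfolding ek by (rule Lim_transform_eventually[OF l2]) (use pe in eventually_elim, simp only:)
 qed
qed

end

section \<open>From the conditions to regular sequences\<close>

lemma eigenvalues_in_mono: "eigenvalues_in A l u ==> l' <= l ==> u <= u' ==> eigenvalues_in A l' u'"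
 unfolding eigenvalues_in_def by (meson order_trans)

lemma compact_nrm_bdd_above: "compact S ==> bdd_above (nrm p ` S)"
proof -
 assume S: "compact S"
 have "continuous_on S (%x. sqrt (\<Sum>j<p. (x j)\<^sup>2))"
 by (intro continuous_on_real_sqrt continuous_on_sum continuous_on_power)
 (rule continuous_on_subset[OF continuous_on_product_coordinates], simp)
 then have "compact (nrm p ` S)" unfolding nrm_eq[abs_def] using S by (rule compact_continuous_image)
 then show ?thesis by (rule bounded_imp_bdd_above[OF compact_imp_bounded])
qed

text \<open>The number of parameters is bounded and of the same order as the number of moments.\<close>

lemma dimension_bound:
 assumes A2: "cond_A2 \<alpha> X" and A9: "cond_A9 tmin X"
 obtains N0 where "EV n. 1 <= pdim (X n) & pdim (X n) <= mdim (X n) & mdim (X n) <= N0"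
proof -
 obtain pb where pb: "EV n. 1 <= pdim (X n) & pdim (X n) <= pb" using A9 by (auto simp: cond_A9_def)
 have pm: "EV n. pdim (X n) <= mdim (X n)" using A2 by (simp add: cond_A2_def)
 have "(%n. real (pdim (X n))) : \<Theta>(%n. real (mdim (X n)))" using A2 by (simp add: cond_A2_def)
 then have "(%n. real (mdim (X n))) : O(%n. real (pdim (X n)))" by (subst (asm) bigtheta_sym) (rule bigthetaD1)
 then obtain c where c: "0 < c" "EV n. norm (real (mdim (X n))) <= c * norm (real (pdim (X n)))"
 by (rule landau_o.bigE)
 let ?N = "nat \<lceil>c * real pb\<rceil>"
 have "EV n. 1 <= pdim (X n) & pdim (X n) <= mdim (X n) & mdim (X n) <= ?N"
 using pb pm c(2)
 proof eventually_elim
 case (elim n)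
 have "c * real (pdim (X n)) <= c * real pb" using elim(1) c(1) by (intro mult_left_mono) auto
 then have "real (mdim (X n)) <= c * real pb" using elim(3) by simp
 also have "... <= real ?N" by (rule real_nat_ceiling_ge)
 finally have "real (mdim (X n)) <= real ?N" .
 then show ?case using elim by simp
 qed
 then show ?thesis using that by blast
qed

lemma pow_root_bound:
 assumes "0 <= K" "p <= N0" "0 < (\<alpha>::real)" "0 <= e"
 shows "K * (sqrt (real p) * e) powr \<alpha> <= K * sqrt (real N0) powr \<alpha> * e powr \<alpha>"
proof -
 have "(sqrt (real p) * e) powr \<alpha> = sqrt (real p) powr \<alpha> * e powr \<alpha>" by (rule powr_mult)
 also have "... <= sqrt (real N0) powr \<alpha> * e powr \<alpha>"
 using assms by (intro mult_right_mono powr_mono2) auto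
 finally have "K * (sqrt (real p) * e) powr \<alpha> <= K * (sqrt (real N0) powr \<alpha> * e powr \<alpha>)" using assms(1) by (rule mult_left_mono)
 then show ?thesis by (simp add: mult.assoc)
qed

text \<open>A single pair l, u serves all eigenvalue conditions. On the bounded parameter space the separation
 condition becomes linear in the distance.\<close>

lemma regular_constants:
 fixes X :: "nat => 'd gmm"
 assumes set: "gmm_setting X" and A1: "cond_A1 X" and A2: "cond_A2 \<alpha> X" and A4: "cond_A4 \<alpha> X" and A5: "cond_A5 X"
 and A6: "cond_A6 X" and A7: "cond_A7 X" and A9: "cond_A9 tmin X" and A10: "cond_A10 \<tau> X"
 obtains N0 env l u R r0 c1 K4 KF cpi c0 rr where
 "EV n. rg n (X n) N0 (env n) l u R r0 c1 K4 \<alpha> KF cpi c0 tmin rr (\<tau> n)"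
 "wpa1 (%n. sample_law n (X n)) (%n D. eigenvalues_in (Vn (X n) D) l u)"
proof -
 obtain N0 where N0: "EV n. 1 <= pdim (X n) & pdim (X n) <= mdim (X n) & mdim (X n) <= N0"
 using dimension_bound[OF A2 A9] by blast
 have valid: "EV n. valid_moments (X n) & valid_weights n (X n) & valid_prior (X n) & valid_estimator n (X n)"
 using set by (simp add: gmm_setting_def)
 have a1: "EV n. mean_mom (X n) (theta0 (X n)) = 0\<^sub>v (mdim (X n)) & compact (Theta (X n)) & connected (Theta (X n))"
 using A1 by (simp add: cond_A1_def)
 obtain R where R: "0 < R" "EV n. (SUP th\<in>Theta (X n). vnorm (vec (pdim (X n)) th)) = R"
 using A1 unfolding cond_A1_def by blast
 obtain r0 where r0: "0 < r0" "EV n. {th : euclid (pdim (X n)). edist (pdim (X n)) th (theta0 (X n)) < r0} <= Theta (X n)"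
 using A1 unfolding cond_A1_def by blast
 have \<alpha>: "0 < \<alpha>" using A4 by (simp add: cond_A4_def)
 obtain K where K: "EV n. ALL th:Theta (X n). ALL et:cvec (mdim (X n)). vnorm et = 1 -->
 L2_norm_of (data_law (X n)) (%d. et .* (mom (X n) d th - mom (X n) d (theta0 (X n))))
 <= K * (sqrt (real (pdim (X n))) * edist (pdim (X n)) th (theta0 (X n))) powr \<alpha>"
 using A4 unfolding cond_A4_def by blast
 obtain env where env: "EV n. env n : square_integrable (data_law (X n)) &
 (ALL f:moment_class (X n). ALL d:space (data_law (X n)). \<bar>f d\<bar> <= env n d)"
 and envO: "(%n. L2_norm_of (data_law (X n)) (env n)) : O(%n. sqrt (real (pdim (X n))))"
 using A4 unfolding cond_A4_def by blast
 obtain ce where ce: "0 < ce" "EV n. norm (L2_norm_of (data_law (X n)) (env n)) <= ce * norm (sqrt (real (pdim (X n))))"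
 using envO by (rule landau_o.bigE)
 obtain dl0 dl1 where sep0: "0 < dl0" "0 < dl1" and sep: "EV n. ALL th:Theta (X n).
 min dl0 (dl1 * edist (pdim (X n)) th (theta0 (X n))) <= vnorm (mean_mom (X n) th)"
 using A5 unfolding cond_A5_def by blast
 obtain l6 u6 where l6: "0 < l6" and eig6: "wpa1 (%n. sample_law n (X n))
 (%n D. eigenvalues_in (Vn (X n) D) l6 u6 & eigenvalues_in (V0 (X n)) l6 u6)"
 using A6 unfolding cond_A6_def by blast
 obtain cpi where cpi: "EV n. ALL M:models (X n). ALL th:Theta_of (X n) M. cond_prior (X n) M th <= cpi"
 using A7 unfolding cond_A7_def by blast
 obtain c0 where c0: "0 < c0" and pr0: "EV n. ALL M:models (X n). true_model (X n) <= M -->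
 exp (- c0 * real (card M)) <= cond_prior (X n) M (theta0 (X n))"
 proof -
 obtain c0 c1 where "0 < c0" and h: "EV n. ALL M:models (X n). true_model (X n) <= M -->
 exp (- c0 * real (card M)) <= cond_prior (X n) M (theta0 (X n)) &
 \<bar>ln (cond_prior (X n) M (theta0 (X n))) - ln (cond_prior (X n) (true_model (X n)) (theta0 (X n)))\<bar>
 <= c1 * (real (card M) - real (card (true_model (X n))))"
 using A7 unfolding cond_A7_def by blast
 moreover have "EV n. ALL M:models (X n). true_model (X n) <= M -->
 exp (- c0 * real (card M)) <= cond_prior (X n) M (theta0 (X n))" using h by eventually_elim blast
 ultimately show ?thesis using that by blast
 qed
 have thr: "0 < tmin" and sig: "EV n. ALL j:true_model (X n). tmin <= \<bar>theta0 (X n) j\<bar>"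
 using A9 by (simp_all add: cond_A9_def)
 have a9: "\<forall>\<^sub>F n in sequentially.
 (ALL th:Theta (X n). has_jacobian (pdim (X n)) (Theta (X n)) (mean_mom (X n)) (Jac (X n) th) th) &
 (ALL i<mdim (X n). ALL j<mdim (X n). continuous_on (Theta (X n)) (%th. var_mom (X n) th $$ (i, j))) &
 (ALL i<mdim (X n). ALL j<pdim (X n). continuous_on (Theta (X n)) (%th. Jac (X n) th $$ (i, j)))"
 using A9 by (simp add: cond_A9_def)
 obtain l9 u9 where l9: "0 < l9" and eig9: "EV n. ALL th:Theta (X n).
 eigenvalues_in (transpose_mat (Jac (X n) th) * Jac (X n) th) l9 u9 & eigenvalues_in (var_mom (X n) th) l9 u9"
 using A9 unfolding cond_A9_def by blast
 obtain rr where rr: "EV n. (ALL M:models (X n). 0 < model_prior (X n) M) &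
 (ALL M1:models (X n). ALL M2:models (X n). model_prior (X n) M2 / model_prior (X n) M1 <= rr)"
 using A9 unfolding cond_A9_def by blast
 have fm: "EV n. ALL th:Theta (X n).
 Fmat (X n) th : cmat (pdim (X n)) (pdim (X n)) &
 transpose_mat (Fmat (X n) th) * Fmat (X n) th =
 transpose_mat (Jac (X n) th) * minv (var_mom (X n) th) * Jac (X n) th &
 (ALL z. 0 <= Z_dens (X n) z th) &
 distributed (sample_law_at n (X n) th) (cleb {..<pdim (X n)})
 (Z_stat n (X n) th) (%z. enn (Z_dens (X n) z th))"
 and zn: "\<forall>\<^sub>F n in sequentially.
 (SUP th\<in>Theta (X n). SUP z\<in>euclid (pdim (X n)).
 ereal ((1 + vnorm (vec (pdim (X n)) z) ^ (pdim (X n) + 1)) *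
 \<bar>Z_dens (X n) z th -
 normal_dens (pdim (X n)) (0\<^sub>v (pdim (X n))) (1\<^sub>m (pdim (X n))) (vec (pdim (X n)) z)\<bar>))
 = ereal (\<tau> n)"
 using A10 by (simp_all add: cond_A10_def)
 define l where "l = min l6 l9"
 define u where "u = max l (max u6 u9)"
 have lu: "0 < l" "l <= u" "l <= l6" "l <= l9" "u6 <= u" "u9 <= u" using l6 l9 by (auto simp: l_def u_def)
 define c1 where "c1 = min dl1 (dl0 / (2 * R))"
 have c1: "0 < c1" using sep0 R by (simp add: c1_def)
 define K4 where "K4 = \<bar>K\<bar> * sqrt (real N0) powr \<alpha>"
 define KF where "KF = (ce * sqrt (real N0))\<^sup>2"
 have "EV n. rg n (X n) N0 (env n) l u R r0 c1 K4 \<alpha> KF (max cpi 0) c0 tmin rr (\<tau> n)"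
 using N0 valid a1 R(2) r0(2) K env ce(2) sep cpi pr0 sig a9 eig9 rr fm zn eventually_gt_at_top[of 0]
 proof eventually_elim
 case (elim n)
 note N0 = elim(1) and valid = elim(2) and a1 = elim(3) and SR = elim(4) and bl = elim(5) and hK = elim(6) and env = elim(7)
 and hce = elim(8) and hsep = elim(9) and hcpi = elim(10) and hpr = elim(11) and hsig = elim(12) and h9 = elim(13)
 and heig = elim(14) and hrr = elim(15) and hfm = elim(16) and hzn = elim(17) and n = elim(18)
 have ed: "0 <= edist q x y" for q x y by (simp add: edist_def vnorm_nonneg)
 have tle: "nrm (pdim (X n)) th <= R" if "th : Theta (X n)" for th
 unfolding SR[symmetric] nrm_def[symmetric] using that a1 by (intro cSUP_upper compact_nrm_bdd_above) auto
 have t0: "theta0 (X n) : Theta (X n)" using valid by (simp add: valid_moments_def)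
 show ?case
 proof (rule rg.intro)
 show "0 < n" by (rule n)
 show "valid_moments (X n)" "valid_weights n (X n)" "valid_prior (X n)" "valid_estimator n (X n)" using valid by auto
 show "mean_mom (X n) (theta0 (X n)) = 0\<^sub>v (mdim (X n))" "compact (Theta (X n))" using a1 by auto
 show "nrm (pdim (X n)) th <= R" if "th : Theta (X n)" for th by (rule tle[OF that])
 show "0 < r0" "{th : euclid (pdim (X n)). edist (pdim (X n)) th (theta0 (X n)) < r0} <= Theta (X n)" by (fact r0(1), fact bl)
 show "1 <= pdim (X n)" "pdim (X n) <= mdim (X n)" "mdim (X n) <= N0" using N0 by auto
 show "L2_norm_of (data_law (X n)) (%d. et .* (mom (X n) d th - mom (X n) d (theta0 (X n)))) <= K4 * edist (pdim (X n)) th (theta0 (X n)) powr \<alpha>"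
 if "th : Theta (X n)" "et : cvec (mdim (X n))" "vnorm et = 1" for th et
 proof -
 let ?e = "edist (pdim (X n)) th (theta0 (X n))"
 have "L2_norm_of (data_law (X n)) (%d. et .* (mom (X n) d th - mom (X n) d (theta0 (X n)))) <= K * (sqrt (real (pdim (X n))) * ?e) powr \<alpha>"
 using hK that by blast
 also have "... <= \<bar>K\<bar> * (sqrt (real (pdim (X n))) * ?e) powr \<alpha>" by (intro mult_right_mono) auto
 also have "... <= K4 * ?e powr \<alpha>" unfolding K4_def using N0 \<alpha> ed by (intro pow_root_bound) auto
 finally show ?thesis .
 qed
 show "0 < \<alpha>" by (rule \<alpha>)
 show "0 <= K4" by (simp add: K4_def)
 show "env n : square_integrable (data_law (X n))" using env by blast
 show "\<bar>f d\<bar> <= env n d" if "f : moment_class (X n)" "d : space (data_law (X n))" for f d using env that by blast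
 show "(LINT d|data_law (X n). (env n d)\<^sup>2) <= KF"
 proof -
 have i0: "0 <= (LINT d|data_law (X n). (env n d)\<^sup>2)" by simp
 have "sqrt (LINT d|data_law (X n). (env n d)\<^sup>2) <= ce * sqrt (real (pdim (X n)))"
 using hce i0 by (simp add: L2_norm_of_def)
 also have "... <= ce * sqrt (real N0)" using N0 ce(1) by (intro mult_left_mono) auto
 finally have "(sqrt (LINT d|data_law (X n). (env n d)\<^sup>2))\<^sup>2 <= KF" unfolding KF_def by (rule power_mono) (use i0 in simp)
 then show ?thesis using i0 by simp
 qed
 show "c1 * edist (pdim (X n)) th (theta0 (X n)) <= vnorm (mean_mom (X n) th)" if "th : Theta (X n)" for th
 proof -
 let ?e = "edist (pdim (X n)) th (theta0 (X n))"
 have e2: "?e <= 2 * R"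
 using tle[OF that] tle[OF t0] vnorm_diff_triangle[of "vec (pdim (X n)) th" "pdim (X n)" "vec (pdim (X n)) (theta0 (X n))"]
 by (simp add: nrm_def edist_def)
 have "c1 * ?e <= dl1 * ?e" using ed by (intro mult_right_mono) (auto simp: c1_def)
 moreover have "c1 * ?e <= dl0 / (2 * R) * (2 * R)" using e2 ed c1 sep0 R by (intro mult_mono) (auto simp: c1_def)
 ultimately have "c1 * ?e <= min dl0 (dl1 * ?e)" using R by simp
 then show ?thesis using hsep that by (meson order_trans)
 qed
 show "0 < c1" by (rule c1)
 show "has_jacobian (pdim (X n)) (Theta (X n)) (mean_mom (X n)) (Jac (X n) th) th" if "th : Theta (X n)" for th using h9 that by blast
 show "0 < l" "l <= u" by (fact lu(1), fact lu(2))
 show "eigenvalues_in (transpose_mat (Jac (X n) th) * Jac (X n) th) l u" if "th : Theta (X n)" for th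
 by (rule eigenvalues_in_mono[OF _ lu(4,6)]) (use heig that in blast)
 show "eigenvalues_in (var_mom (X n) th) l u" if "th : Theta (X n)" for th
 by (rule eigenvalues_in_mono[OF _ lu(4,6)]) (use heig that in blast)
 show "continuous_on (Theta (X n)) (%th. var_mom (X n) th $$ (i, j))" if "i < mdim (X n)" "j < mdim (X n)" for i j using h9 that by blast
 show "continuous_on (Theta (X n)) (%th. Jac (X n) th $$ (i, j))" if "i < mdim (X n)" "j < pdim (X n)" for i j using h9 that by blast
 show "cond_prior (X n) M th <= max cpi 0" if "M : models (X n)" "th : Theta_of (X n) M" for M th
 using hcpi that by (meson max.coboundedI1)
 show "0 <= max cpi 0" by simp
 show "exp (- c0 * real (card M)) <= cond_prior (X n) M (theta0 (X n))" if "M : models (X n)" "true_model (X n) <= M" for M using hpr that by blast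
 show "0 < c0" by (rule c0)
 show "tmin <= \<bar>theta0 (X n) j\<bar>" if "j : true_model (X n)" for j using hsig that by blast
 show "0 < tmin" by (rule thr)
 show "0 < model_prior (X n) M" if "M : models (X n)" for M using hrr that by blast
 show "model_prior (X n) M' / model_prior (X n) M <= rr" if "M : models (X n)" "M' : models (X n)" for M M' using hrr that by blast
 show "Fmat (X n) th : cmat (pdim (X n)) (pdim (X n))" if "th : Theta (X n)" for th using hfm that by blast
 show "transpose_mat (Fmat (X n) th) * Fmat (X n) th = sandwich (Jac (X n) th) (var_mom (X n) th)" if "th : Theta (X n)" for th
 unfolding sandwich_def using hfm that by blast
 show "0 <= Z_dens (X n) z th" if "th : Theta (X n)" for th z using hfm that by blast
 show "distributed (sample_law_at n (X n) th) (cleb {..<pdim (X n)}) (Z_stat n (X n) th) (%z. enn (Z_dens (X n) z th))"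
 if "th : Theta (X n)" for th using hfm that by blast
 show "(1 + nrm (pdim (X n)) z ^ (pdim (X n) + 1)) * \<bar>Z_dens (X n) z th -
 normal_dens (pdim (X n)) (0\<^sub>v (pdim (X n))) (1\<^sub>m (pdim (X n))) (vec (pdim (X n)) z)\<bar> <= \<tau> n"
 if "th : Theta (X n)" "z : euclid (pdim (X n))" for th z
 proof -
 let ?f = "%th z. ereal ((1 + vnorm (vec (pdim (X n)) z) ^ (pdim (X n) + 1)) *
 \<bar>Z_dens (X n) z th - normal_dens (pdim (X n)) (0\<^sub>v (pdim (X n))) (1\<^sub>m (pdim (X n))) (vec (pdim (X n)) z)\<bar>)"
 have "?f th z <= (SUP z\<in>euclid (pdim (X n)). ?f th z)" by (rule SUP_upper[OF that(2)])
 also have "... <= (SUP th\<in>Theta (X n). SUP z\<in>euclid (pdim (X n)). ?f th z)" by (rule SUP_upper[OF that(1)])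
 also have "... = ereal (\<tau> n)" by (rule hzn)
 finally show ?thesis by (simp only: ereal_less_eq nrm_def)
 qed
 qed
 qed
 moreover have "wpa1 (%n. sample_law n (X n)) (%n D. eigenvalues_in (Vn (X n) D) l u)"
 by (rule wpa1_mono[OF eig6]) (intro always_eventually allI ballI impI, use eigenvalues_in_mono[OF _ lu(3,5)] in blast)
 ultimately show ?thesis using that by blast
qed

text \<open>The neighbourhoods of the conditions have radius C sqrt (p/n), which exceeds C / sqrt n.\<close>

lemma gmm_sequence_of_conditions:
 fixes X :: "nat => 'd gmm"
 assumes set: "gmm_setting X" and A1: "cond_A1 X" and A2: "cond_A2 \<alpha> X" and A4: "cond_A4 \<alpha> X" and A5: "cond_A5 X"
 and A6: "cond_A6 X" and A7: "cond_A7 X" and A9: "cond_A9 tmin X" and A10: "cond_A10 \<tau> X"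
 obtains N0 env l u R r0 c1 K4 KF cpi c0 rr where "gmm_sequence X N0 env l u R r0 c1 K4 \<alpha> KF cpi c0 tmin rr \<tau>"
proof -
 let ?Om = "%n. sample_law n (X n)"
 obtain N0 env l u R r0 c1 K4 KF cpi c0 rr where
 reg: "EV n. rg n (X n) N0 (env n) l u R r0 c1 K4 \<alpha> KF cpi c0 tmin rr (\<tau> n)"
 and eig: "wpa1 ?Om (%n D. eigenvalues_in (Vn (X n) D) l u)"
 by (rule regular_constants[OF set A1 A2 A4 A5 A6 A7 A9 A10])
 obtain n1 where S1: "rg n1 (X n1) N0 (env n1) l u R r0 c1 K4 \<alpha> KF cpi c0 tmin rr (\<tau> n1)"
 using eventually_happens'[OF sequentially_bot reg] by blast
 note l = rg.lu(1)[OF S1] and r0 = rg.r0[OF S1] and c0 = rg.c0[OF S1]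
 have prob: "EV n. prob_space (?Om n)" using reg by eventually_elim (rule rg.prob_OM)
 \<comment> \<open>the rate of the neighbourhoods in the conditions dominates the root n rate\<close>
 have rate: "x / sqrt (real n) <= x * eps n (X n)" if "0 <= x" "1 <= pdim (X n)" "0 < n" for x n
 proof -
 have "1 / sqrt (real n) <= sqrt (real (pdim (X n))) / sqrt (real n)" using that by (intro divide_right_mono) auto
 also have "... = eps n (X n)" by (simp add: eps_def real_sqrt_divide)
 finally have "x * (1 / sqrt (real n)) <= x * eps n (X n)" using that(1) by (rule mult_left_mono)
 then show ?thesis by simp
 qed
 have "gmm_sequence X N0 env l u R r0 c1 K4 \<alpha> KF cpi c0 tmin rr \<tau>"
 proof (rule gmm_sequence.intro)
 show "EV n. rg n (X n) N0 (env n) l u R r0 c1 K4 \<alpha> KF cpi c0 tmin rr (\<tau> n)" by (rule reg)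
 show "\<tau> \<longlonglongrightarrow> 0" using A10 by (simp add: cond_A10_def)
 fix dl :: real assume dl: "0 < dl"
 have op: "wpa1 ?Om (%n D. \<bar>op_norm (Vn (X n) D - V0 (X n)) - 0\<bar> < dl)"
 using A6 dl unfolding cond_A6_def conv_in_prob_def by blast
 have pd: "EV n. ALL D:space (?Om n). pos_def_mat (Vn (X n) D)" using A6 by (simp add: cond_A6_def)
 show "wpa1 ?Om (%n D. rg.good_weight (X n) l u dl D)"
 proof (rule wpa1_mono[OF wpa1_conj[OF prob op eig]])
 show "EV n. ALL D:space (?Om n). \<bar>op_norm (Vn (X n) D - V0 (X n)) - 0\<bar> < dl & eigenvalues_in (Vn (X n) D) l u -->
 rg.good_weight (X n) l u dl D"
 using reg pd
 proof eventually_elim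
 case (elim n)
 let ?m = "mdim (X n)"
 have vw: "valid_weights n (X n)" by (rule rg.vw[OF elim(1)])
 show ?case
 proof (intro ballI impI)
 fix D assume D: "D : space (?Om n)" and h: "\<bar>op_norm (Vn (X n) D - V0 (X n)) - 0\<bar> < dl & eigenvalues_in (Vn (X n) D) l u"
 have V: "Vn (X n) D : cmat ?m ?m" using vw D by (simp add: valid_weights_def)
 have V0: "V0 (X n) : cmat ?m ?m" by (simp add: var_mom_def)
 have "transpose_mat (Vn (X n) D) = Vn (X n) D" using elim(2) D by (simp add: pos_def_mat_def)
 then have "coercive ?m l u (Vn (X n) D)" using V h l by (intro eigenvalues_in_coercive) auto
 moreover have "vnorm ((Vn (X n) D - V0 (X n)) *. v) <= dl * vnorm v" if "v : cvec ?m" for v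
 proof -
 have "vnorm ((Vn (X n) D - V0 (X n)) *. v) <= op_norm (Vn (X n) D - V0 (X n)) * vnorm v"
 by (rule vnorm_mult_mat_vec_le_op_norm[OF minus_carrier_mat[OF V0] that])
 also have "... <= dl * vnorm v" using h by (intro mult_right_mono) (auto simp: vnorm_nonneg)
 finally show ?thesis .
 qed
 ultimately show "rg.good_weight (X n) l u dl D" by (simp add: rg.good_weight_def[OF elim(1)])
 qed
 qed
 qed
 show "wpa1 ?Om (%n D. rg.est_close n (X n) dl D)"
 unfolding wpa1_def
 proof (intro allI impI)
 fix e :: real assume "0 < e"
 then obtain C where C: "EV n. prob_ge (?Om n)
 (%D. \<bar>vnorm (vec (pdim (X n)) (theta_hat (X n) D) - theta_bar n (X n) D)\<bar> <= C * (1 / real n)) (1 - e)"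
 using A9 unfolding cond_A9_def bigO_prob_def by blast
 show "EV n. prob_ge (?Om n) (%D. rg.est_close n (X n) dl D) (1 - e)"
 using reg C eventually_less_sqrt[OF dl, of C]
 proof eventually_elim
 case (elim n)
 have s: "0 < sqrt (real n)" "sqrt (real n) * sqrt (real n) = real n" using rg.s[OF elim(1)] by auto
 show ?case
 proof (rule prob_ge_mono[OF elim(2)])
 fix D assume h: "\<bar>vnorm (vec (pdim (X n)) (theta_hat (X n) D) - theta_bar n (X n) D)\<bar> <= C * (1 / real n)"
 have "sqrt (real n) * vnorm (vec (pdim (X n)) (theta_hat (X n) D) - theta_bar n (X n) D) <= sqrt (real n) * (C * (1 / real n))"
 using h by (intro mult_left_mono) auto
 also have "... = C / sqrt (real n)"
 proof -
 have "x * (C * (1 / (x * x))) = C / x" if "0 < x" for x :: real using that by simp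
 from this[OF s(1)] show ?thesis by (simp only: s(2))
 qed
 also have "... <= dl" using elim(3) s(1) by (simp add: pos_divide_le_eq)
 finally show "rg.est_close n (X n) dl D" by (simp add: rg.est_close_def[OF elim(1)])
 qed simp
 qed
 qed
 next
 fix C :: real assume C: "0 < C"
 obtain K where K: "EV n. ALL th:B0 (X n) (C * eps n (X n)).
 has_jacobian (pdim (X n)) (Theta (X n)) (mean_mom (X n)) (Jac (X n) th) th &
 (ALL i<mdim (X n). has_jacobian (pdim (X n)) (Theta (X n))
 (%th'. row (Jac (X n) th') i) (Hess (X n) th i) th) &
 (ALL u:cvec (pdim (X n)). ALL v:cvec (pdim (X n)). vnorm u = 1 & vnorm v = 1 -->
 vnorm (vec (mdim (X n)) (%i. u .* (Hess (X n) th i *. v)))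
 <= K * sqrt (real (pdim (X n))))"
 using A5[unfolded cond_A5_def, THEN conjunct2, THEN conjunct2, THEN conjunct2, THEN spec, THEN mp, OF C] by (rule exE)
 let ?K = "\<bar>K\<bar> * sqrt (real N0)"
 have "EV n. rg.taylor (X n) (C / sqrt (real n)) ?K"
 using reg K eventually_less_sqrt[OF r0, of C]
 proof eventually_elim
 case (elim n)
 note S = elim(1)
 let ?p = "pdim (X n)" and ?t0 = "theta0 (X n)"
 note d = rg.dims[OF S] and t0 = rg.t0_in[OF S]
 have s: "0 < sqrt (real n)" using rg.s(1)[OF S] .
 have B: "th : B0 (X n) (C * eps n (X n))" if "th : Theta (X n)" "edist ?p th ?t0 < C / sqrt (real n)" for th
 using that rate[of C n] C d rg.n_pos[OF S] by (simp add: B0_def)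
 have sub: "{th : euclid ?p. edist ?p th ?t0 < C / sqrt (real n)} <= Theta (X n)"
 proof -
 have "C / sqrt (real n) < r0" using elim(3) s by (simp add: pos_divide_less_eq)
 then have "{th : euclid ?p. edist ?p th ?t0 < C / sqrt (real n)} <= {th : euclid ?p. edist ?p th ?t0 < r0}" by auto
 then show ?thesis using rg.ball[OF S] by (rule order_trans)
 qed
 have H3: "vnorm (vec (mdim (X n)) (%i. u .* (Hess (X n) th i *. v))) <= ?K"
 if "th : Theta (X n)" "edist ?p th ?t0 < C / sqrt (real n)" "u : cvec ?p" "v : cvec ?p" "vnorm u = 1" "vnorm v = 1" for th u v
 proof -
 have "vnorm (vec (mdim (X n)) (%i. u .* (Hess (X n) th i *. v))) <= K * sqrt (real ?p)"
 using elim(2) B[OF that(1,2)] that by blast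
 also have "... <= ?K" using d by (intro mult_mono) auto
 finally show ?thesis .
 qed
 note TB = taylor_bounds[of "Theta (X n)" ?p ?t0 "C / sqrt (real n)" "mean_mom (X n)" "Jac (X n)" "mdim (X n)" "Hess (X n)" ?K]
 have mz: "mean_mom (X n) ?t0 $ i = 0" if "i < mdim (X n)" for i using rg.mean0[OF S] that by simp
 have b1: "\<bar>mean_mom (X n) th $ i - mean_mom (X n) ?t0 $ i - (G0 (X n) *. (vec ?p th - vec ?p ?t0)) $ i\<bar> <= ?K * (edist ?p th ?t0)\<^sup>2"
 if "th : Theta (X n)" "edist ?p th ?t0 < C / sqrt (real n)" "i < mdim (X n)" for th i
 by (rule TB(1)[OF _ _ H3 sub rg.Theta_euclid[OF S] t0 rg.mean_mom_carrier[OF S] rg.Jac_carrier[OF S] that])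
 (use elim(2) B in blast)+
 have b2: "\<bar>Jac (X n) th $$ (i,j) - G0 (X n) $$ (i,j)\<bar> <= ?K * edist ?p th ?t0"
 if "th : Theta (X n)" "edist ?p th ?t0 < C / sqrt (real n)" "i < mdim (X n)" "j < ?p" for th i j
 by (rule TB(2)[OF _ _ H3 sub rg.Theta_euclid[OF S] t0 rg.mean_mom_carrier[OF S] rg.Jac_carrier[OF S] that])
 (use elim(2) B in blast)+
 show ?case unfolding rg.taylor_def[OF S] using b1 b2 mz by simp
 qed
 then show "\<exists>KT. EV n. rg.taylor (X n) (C / sqrt (real n)) KT" by blast
 have C1: "0 < C + 1" and one: "0 < (1::real)" using C by simp_all
 have "EV n. ALL M:models (X n). true_model (X n) <= M -->
 (ALL th:Theta_of (X n) M \<inter> B0 (X n) ((C + 1) * eps n (X n)).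
 0 < cond_prior (X n) M th &
 \<bar>ln (cond_prior (X n) M th) - ln (cond_prior (X n) M (theta0 (X n)))\<bar> < 1)"
 by (rule A7[unfolded cond_A7_def, THEN conjunct2, THEN conjunct1, THEN spec, THEN mp, OF C1, THEN spec, THEN mp, OF one])
 with reg show "EV n. rg.local_prior n (X n) N0 c0 C"
 proof eventually_elim
 case (elim n)
 note S = elim(1)
 let ?p = "pdim (X n)" and ?t0 = "theta0 (X n)"
 have s: "0 < sqrt (real n)" using rg.s(1)[OF S] .
 show ?case unfolding rg.local_prior_def[OF S]
 proof (intro ballI impI)
 fix M th assume M: "M : models (X n)" "true_model (X n) <= M" and th: "th : Theta_of (X n) M" and h: "nrm ?p (rg.hsc n (X n) th) <= C"
 have "edist ?p th ?t0 <= C / sqrt (real n)" by (rule rg.edist_local[OF S h])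
 also have "... < (C + 1) / sqrt (real n)" using s by (intro divide_strict_right_mono) auto
 also have "... <= (C + 1) * eps n (X n)" using C1 rg.dims(1)[OF S] rg.n_pos[OF S] by (intro rate) auto
 finally have "th : B0 (X n) ((C + 1) * eps n (X n))" using th by (simp add: B0_def Theta_of_def)
 then have pr: "0 < cond_prior (X n) M th" "\<bar>ln (cond_prior (X n) M th) - ln (cond_prior (X n) M ?t0)\<bar> < 1"
 using elim(2) M th by blast+
 have p0: "exp (- c0 * real (card M)) <= cond_prior (X n) M ?t0" by (rule rg.prior_ge[OF S M])
 then have "ln (exp (- c0 * real (card M))) <= ln (cond_prior (X n) M ?t0)" by (subst ln_le_cancel_iff) (auto intro: less_le_trans[OF exp_gt_zero])
 moreover have "c0 * real (card M) <= c0 * real N0"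
 using rg.models_finite(3)[OF S M(1)] rg.p_le[OF S] c0 by (intro mult_left_mono) auto
 ultimately have "- 1 - c0 * real N0 <= ln (cond_prior (X n) M th)" using pr(2) by simp
 then show "exp (- 1 - c0 * real N0) <= cond_prior (X n) M th" using pr(1) by (simp add: ln_ge_iff)
 qed
 qed
 qed
 then show ?thesis using that by blast
qed

theorem theorem3:
  fixes X :: "nat \<Rightarrow> 'd gmm" and \<alpha> \<theta>min :: real and \<tau> :: "nat \<Rightarrow> real"
  assumes "gmm_setting X"
    and "cond_A1 X"
    and "cond_A2 \<alpha> X"
    and "cond_A3 X"
    and "cond_A4 \<alpha> X"
    and "cond_A5 X"
    and "cond_A6 X"
    and "cond_A7 X"
    and "cond_A8 X"
    and "cond_A9 \<theta>min X"
    and "cond_A10 \<tau> X"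
  defines "P \<equiv> \<lambda>n. sample_law n (X n)"
    and "qwrong \<equiv> \<lambda>n D. wrong_model_post (X n) (q_lik n (X n) D)"
    and "pwrong \<equiv> \<lambda>n D. wrong_model_post (X n) (p_lik (X n) D)"
  shows
    "((\<forall>\<^sub>F n in sequentially. true_model (X n) \<noteq> full_model (X n)) \<longrightarrow>
        conv_in_prob P (\<lambda>n D. qwrong n D / pwrong n D) 1 \<and>
        same_order_prob P qwrong pwrong \<and>
        same_order_prob P pwrong (\<lambda>n D. real n powr (- 1 / 2)) \<and>
        (\<lambda>n. real n powr (- 1 / 2)) \<longlonglongrightarrow> 0) \<and>
     ((\<forall>\<^sub>F n in sequentially. true_model (X n) = full_model (X n)) \<longrightarrow>
        (\<exists>C>0. \<exists>K>0.
           wpa1 P (\<lambda>n D. qwrong n D \<le> exp (- C * real n * \<theta>min\<^sup>2)) \<and>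
           (\<lambda>n. exp (- C * real n * \<theta>min\<^sup>2)) \<longlonglongrightarrow> 0 \<and>
           wpa1 P (\<lambda>n D. pwrong n D \<le>
             max (exp (- C * real n * \<theta>min\<^sup>2))
               (K * (\<tau> n * real n powr
                 (- (real (pdim (X n)) - real (card (true_model (X n))) + 1) / 2)))) \<and>
           (\<lambda>n. max (exp (- C * real n * \<theta>min\<^sup>2))
               (K * (\<tau> n * real n powr
                 (- (real (pdim (X n)) - real (card (true_model (X n))) + 1) / 2)))) \<longlonglongrightarrow> 0)) \<and>
     conv_in_prob P
       (\<lambda>n D. SUP A\<in>{A \<in> sets borel. A \<subseteq> Theta (X n)}.
          \<bar>post_measure (X n) (q_lik n (X n) D) A - post_measure (X n) (p_lik (X n) D) A\<bar>) 0"
proof -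
 obtain N0 env l u R r0 c1 K4 KF cpi c0 rr where "gmm_sequence X N0 env l u R r0 c1 K4 \<alpha> KF cpi c0 \<theta>min rr \<tau>"
 by (rule gmm_sequence_of_conditions[OF assms(1,2,3,5,6,7,8,10,11)])
 then interpret gmm_sequence X N0 env l u R r0 c1 K4 \<alpha> KF cpi c0 \<theta>min rr \<tau> .
 have half: "(%n. real n powr (- 1 / 2)) \<longlonglongrightarrow> 0" by real_asymp
 show ?thesis unfolding P_def qwrong_def pwrong_def
 using wrong_posterior_nonfull half posterior_full posterior_total_variation by blast
qed

end
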